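(* Let $\mathcal{L}\subseteq \mathsf{Mod}(R)$ and $\mathcal{A}\subseteq\mathsf{Mod}(R^{\rm o})$ be classes of modules and $\nu={}^{\perp}\mathcal{A}\cap\mathcal{A}$. Suppose $\mathcal{L}$ is a relative generator in $\mathsf{Mod}(R)$ closed under extensions, and that either $\mathcal{L}$ is closed under epikernels or $\mathcal{L}^+\subseteq\mathcal{A}$. If $\mathcal{GF}_{(\mathcal{L},\nu)}$ is closed under extensions, then $$l.\mathrm{GF}_{(\mathcal{L},\nu)}\text{-}\mathrm{findim}(R)\leq l.\mathcal{L}\text{-}\mathrm{findim}(R).$$ Furthermore, equality holds in the case where $(\mathcal{L},\mathcal{A})$ is a product closed bicomplete duality pair.
   Context: $R$ is an associative ring with identity; $\mathsf{Mod}(R)$ and $\mathsf{Mod}(R^{\rm o})$ are the categories of left and right $R$-modules; $M^+=\mathrm{Hom}_{\mathbb{Z}}(M,\mathbb{Q}/\mathbb{Z})$, $\mathcal{L}^+=\{L^+ : L\in\mathcal{L}\}$; ${}^{\perp}\mathcal{A}=\{N : \mathrm{Ext}^i_{R^{\rm o}}(N,A)=0\ \forall A\in\mathcal{A},\ i\geq1\}$. $\mathcal{GF}_{(\mathcal{L},\nu)}$: the class of left $R$-modules isomorphic to $Z_0(L_\bullet)$ for an exact complex $L_\bullet$ with components in $\mathcal{L}$ such that $A\otimes_R L_\bullet$ is exact for every $A\in\nu$. For a class $\mathcal{X}\subseteq\mathsf{Mod}(R)$, $\mathrm{resdim}_{\mathcal{X}}(M)$ is the smallest $m\geq0$ for which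 there is an exact sequence $0\to X_m\to\cdots\to X_0\to M\to0$ with all $X_k\in\mathcal{X}$ ($\infty$ if none exists); $\mathcal{X}^{\wedge}$ is the class of $M$ with $\mathrm{resdim}_{\mathcal{X}}(M)<\infty$; $l.\mathcal{X}\text{-}\mathrm{findim}(R)=\sup\{\mathrm{resdim}_{\mathcal{X}}(M) : M\in\mathcal{X}^{\wedge}\}$. $l.\mathrm{GF}_{(\mathcal{L},\nu)}\text{-}\mathrm{findim}(R)$ is this number for $\mathcal{X}=\mathcal{GF}_{(\mathcal{L},\nu)}$. $\mathcal{L}$ is a relative generator in $\mathsf{Mod}(R)$ if every left $R$-module is a quotient of an object of $\mathcal{L}$. Closed under epikernels means closed under kernels of epimorphisms between objects of the class. A pair $(\mathcal{L},\mathcal{A})$ is a duality pair if $L\in\mathcal{L}\Leftrightarrow L^+\in\mathcal{A}$ and $\mathcal{A}$ is closed under direct summands and finite direct sums (similarly with the sides exchanged). It is product closed if $\mathcal{L}$ is closed under products; symmetric if $(\mathcal{A},\mathcal{L})$ is also a duality pair; perfect if $\mathcal{L}$ is closed under coproducts and extensions and $R\in\mathcal{L}$; complete if symmetric and perfect; bicomplete if it is complete and $({}^{\perp}\mathcal{A},\mathcal{A})$ is a hereditary complete cotorsion pair in $\mathsf{Mod}(R^{\rm o})$. *)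

theory Defs
  imports
    "HOL-Algebra.AbelCoset"
    "HOL-Algebra.Module"
    "HOL-Algebra.Free_Abelian_Groups"
    "HOL-Algebra.Elementary_Groups"
    "HOL-Library.Equipollence"
    "HOL-Library.Extended_Nat"
begin

section \<open>The universe\<close>

text \<open>
  A class of modules is rendered as a set of modules carried by subsets of one type \<open>'u\<close>, which
  plays the role of a Grothendieck universe: a set is small if it has fewer elements than \<open>'u\<close>,
  and the cardinality of \<open>'u\<close> is strongly inaccessible. Up to isomorphism the modules with small
  carrier are then all modules of the universe, and products, coproducts and character modules
  of small modules are again (isomorphic to) small modules. The type of all ZF sets, with
  smallness meaning being a set, is an instance.
\<close>

definition small :: "'u set \<Rightarrow> bool" where
  "small A \<longleftrightarrow> A \<prec> (UNIV :: 'u set)"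

definition universe :: "'u itself \<Rightarrow> bool" where
  "universe (_ :: 'u itself) \<longleftrightarrow>
     (UNIV :: nat set) \<prec> (UNIV :: 'u set) \<and>
     (\<forall>A :: 'u set. small A \<longrightarrow> Pow A \<prec> (UNIV :: 'u set)) \<and>
     (\<forall>(I :: 'u set) (X :: 'u \<Rightarrow> 'u set).
        small I \<and> (\<forall>i\<in>I. small (X i)) \<longrightarrow> small (\<Union>i\<in>I. X i))"


section \<open>Modules over a not necessarily commutative ring\<close>

text \<open>
  The locale \<^locale>\<open>module\<close> requires a commutative ring, so its axioms are restated here over a
  ring. The record \<^typ>\<open>('r, 'm) module\<close> extends rings; its fields \<^const>\<open>monoid.mult\<close> and
  \<^const>\<open>monoid.one\<close> play no role.
\<close>

locale left_module = R?: ring R + M?: abelian_group M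
  for R :: "('r, 'c) ring_scheme" (structure) and M :: "('r, 'm, 'd) module_scheme" (structure) +
  assumes smult_closed:
      "\<lbrakk>a \<in> carrier R; x \<in> carrier M\<rbrakk> \<Longrightarrow> a \<odot>\<^bsub>M\<^esub> x \<in> carrier M"
    and smult_l_distr:
      "\<lbrakk>a \<in> carrier R; b \<in> carrier R; x \<in> carrier M\<rbrakk> \<Longrightarrow>
        (a \<oplus> b) \<odot>\<^bsub>M\<^esub> x = a \<odot>\<^bsub>M\<^esub> x \<oplus>\<^bsub>M\<^esub> b \<odot>\<^bsub>M\<^esub> x"
    and smult_r_distr:
      "\<lbrakk>a \<in> carrier R; x \<in> carrier M; y \<in> carrier M\<rbrakk> \<Longrightarrow>
        a \<odot>\<^bsub>M\<^esub> (x \<oplus>\<^bsub>M\<^esub> y) = a \<odot>\<^bsub>M\<^esub> x \<oplus>\<^bsub>M\<^esub> a \<odot>\<^bsub>M\<^esub> y"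
    and smult_assoc1:
      "\<lbrakk>a \<in> carrier R; b \<in> carrier R; x \<in> carrier M\<rbrakk> \<Longrightarrow>
        (a \<otimes> b) \<odot>\<^bsub>M\<^esub> x = a \<odot>\<^bsub>M\<^esub> (b \<odot>\<^bsub>M\<^esub> x)"
    and smult_one:
      "x \<in> carrier M \<Longrightarrow> \<one> \<odot>\<^bsub>M\<^esub> x = x"

text \<open>
  Right \<open>R\<close>-modules are left modules over the opposite ring, \<open>x\<close> acted on by \<open>r\<close> from the right
  being \<open>r \<odot> x\<close>. All notions below are for left modules over a ring \<open>S\<close>, to be used with
  \<open>S = R\<close> and with \<open>S = op_ring R\<close>.
\<close>

definition op_ring :: "('r, 'c) ring_scheme \<Rightarrow> ('r, 'c) ring_scheme" where
  "op_ring R = R\<lparr>monoid.mult := \<lambda>x y. y \<otimes>\<^bsub>R\<^esub> x\<rparr>"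

definition modules :: "'u ring \<Rightarrow> ('u, 'u) module set" where
  "modules S = {M. left_module S M \<and> small (carrier M)}"

definition regular_module :: "'r ring \<Rightarrow> ('r, 'r) module" where
  "regular_module S =
     \<lparr>carrier = carrier S, monoid.mult = undefined, one = undefined,
      ring.zero = \<zero>\<^bsub>S\<^esub>, ring.add = (\<oplus>\<^bsub>S\<^esub>), smult = (\<otimes>\<^bsub>S\<^esub>)\<rparr>"

definition mod_hom :: "'r ring \<Rightarrow> ('r, 'a) module \<Rightarrow> ('r, 'b) module \<Rightarrow> ('a \<Rightarrow> 'b) set" where
  "mod_hom S M N = {f \<in> carrier M \<rightarrow> carrier N.
     (\<forall>x\<in>carrier M. \<forall>y\<in>carrier M. f (x \<oplus>\<^bsub>M\<^esub> y) = f x \<oplus>\<^bsub>N\<^esub> f y) \<and>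
     (\<forall>r\<in>carrier S. \<forall>x\<in>carrier M. f (r \<odot>\<^bsub>M\<^esub> x) = r \<odot>\<^bsub>N\<^esub> f x)}"

definition isomorphic :: "'r ring \<Rightarrow> ('r, 'a) module \<Rightarrow> ('r, 'b) module \<Rightarrow> bool" where
  "isomorphic S M N \<longleftrightarrow> (\<exists>f\<in>mod_hom S M N. bij_betw f (carrier M) (carrier N))"

definition module_class :: "'u ring \<Rightarrow> ('u, 'u) module set \<Rightarrow> bool" where
  "module_class S \<X> \<longleftrightarrow> \<X> \<subseteq> modules S \<and>
     (\<forall>M\<in>\<X>. \<forall>N\<in>modules S. isomorphic S M N \<longrightarrow> N \<in> \<X>)"

text \<open>
  Constructions such as products produce modules on other carrier types; these belong to a class
  if a copy of them inside \<open>'u\<close> does.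
\<close>

definition belongs :: "'u ring \<Rightarrow> ('u, 'b) module \<Rightarrow> ('u, 'u) module set \<Rightarrow> bool" where
  "belongs S M \<X> \<longleftrightarrow> (\<exists>N\<in>\<X>. isomorphic S M N)"


section \<open>Products, coproducts, direct sums\<close>

definition prod_module :: "'i set \<Rightarrow> ('i \<Rightarrow> ('r, 'a) module) \<Rightarrow> ('r, 'i \<Rightarrow> 'a) module" where
  "prod_module I M =
     \<lparr>carrier = (\<Pi>\<^sub>E i\<in>I. carrier (M i)), monoid.mult = undefined, one = undefined,
      ring.zero = (\<lambda>i\<in>I. \<zero>\<^bsub>M i\<^esub>), ring.add = (\<lambda>f g. \<lambda>i\<in>I. f i \<oplus>\<^bsub>M i\<^esub> g i),
      smult = (\<lambda>r f. \<lambda>i\<in>I. r \<odot>\<^bsub>M i\<^esub> f i)\<rparr>"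

definition coprod_module :: "'i set \<Rightarrow> ('i \<Rightarrow> ('r, 'a) module) \<Rightarrow> ('r, 'i \<Rightarrow> 'a) module" where
  "coprod_module I M = (prod_module I M)
     \<lparr>carrier := {f \<in> \<Pi>\<^sub>E i\<in>I. carrier (M i). finite {i \<in> I. f i \<noteq> \<zero>\<^bsub>M i\<^esub>}}\<rparr>"

definition dirsum :: "('r, 'a) module \<Rightarrow> ('r, 'b) module \<Rightarrow> ('r, 'a \<times> 'b) module" where
  "dirsum M N =
     \<lparr>carrier = carrier M \<times> carrier N, monoid.mult = undefined, one = undefined,
      ring.zero = (\<zero>\<^bsub>M\<^esub>, \<zero>\<^bsub>N\<^esub>),
      ring.add = (\<lambda>(x, y) (x', y'). (x \<oplus>\<^bsub>M\<^esub> x', y \<oplus>\<^bsub>N\<^esub> y')),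
      smult = (\<lambda>r (x, y). (r \<odot>\<^bsub>M\<^esub> x, r \<odot>\<^bsub>N\<^esub> y))\<rparr>"

definition closed_products :: "'u ring \<Rightarrow> ('u, 'u) module set \<Rightarrow> bool" where
  "closed_products S \<X> \<longleftrightarrow>
     (\<forall>(I :: 'u set) M. small I \<and> (\<forall>i\<in>I. M i \<in> \<X>) \<longrightarrow> belongs S (prod_module I M) \<X>)"

definition closed_coproducts :: "'u ring \<Rightarrow> ('u, 'u) module set \<Rightarrow> bool" where
  "closed_coproducts S \<X> \<longleftrightarrow>
     (\<forall>(I :: 'u set) M. small I \<and> (\<forall>i\<in>I. M i \<in> \<X>) \<longrightarrow> belongs S (coprod_module I M) \<X>)"

definition closed_finite_sums :: "'u ring \<Rightarrow> ('u, 'u) module set \<Rightarrow> bool" where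
  "closed_finite_sums S \<X> \<longleftrightarrow> (\<forall>M\<in>\<X>. \<forall>N\<in>\<X>. belongs S (dirsum M N) \<X>)"

definition closed_summands :: "'u ring \<Rightarrow> ('u, 'u) module set \<Rightarrow> bool" where
  "closed_summands S \<X> \<longleftrightarrow>
     (\<forall>M\<in>modules S. \<forall>N\<in>modules S. belongs S (dirsum M N) \<X> \<longrightarrow> M \<in> \<X>)"


section \<open>Short exact sequences\<close>

definition short_exact ::
  "'r ring \<Rightarrow> ('r, 'a) module \<Rightarrow> ('a \<Rightarrow> 'b) \<Rightarrow> ('r, 'b) module \<Rightarrow> ('b \<Rightarrow> 'c) \<Rightarrow> ('r, 'c) module \<Rightarrow> bool"
where
  "short_exact S A f B g C \<longleftrightarrow> f \<in> mod_hom S A B \<and> g \<in> mod_hom S B C \<and>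
     inj_on f (carrier A) \<and> f ` carrier A = a_kernel B C g \<and> g ` carrier B = carrier C"

definition closed_extensions :: "'u ring \<Rightarrow> ('u, 'u) module set \<Rightarrow> bool" where
  "closed_extensions S \<X> \<longleftrightarrow>
     (\<forall>A\<in>\<X>. \<forall>C\<in>\<X>. \<forall>B\<in>modules S. \<forall>f g. short_exact S A f B g C \<longrightarrow> B \<in> \<X>)"

definition closed_epikernels :: "'u ring \<Rightarrow> ('u, 'u) module set \<Rightarrow> bool" where
  "closed_epikernels S \<X> \<longleftrightarrow>
     (\<forall>B\<in>\<X>. \<forall>C\<in>\<X>. \<forall>A\<in>modules S. \<forall>f g. short_exact S A f B g C \<longrightarrow> A \<in> \<X>)"

definition relative_generator :: "'u ring \<Rightarrow> ('u, 'u) module set \<Rightarrow> bool" where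
  "relative_generator S \<X> \<longleftrightarrow>
     (\<forall>M\<in>modules S. \<exists>X\<in>\<X>. \<exists>f\<in>mod_hom S X M. f ` carrier X = carrier M)"


section \<open>Character modules\<close>

definition rat_group :: "rat monoid" where
  "rat_group = \<lparr>carrier = UNIV, monoid.mult = (+), one = 0\<rparr>"

definition QZ :: "rat set monoid" where
  "QZ = rat_group Mod \<int>"

definition char_module :: "'r ring \<Rightarrow> ('r, 'a) module \<Rightarrow> ('r, 'a \<Rightarrow> rat set) module" where
  "char_module S M =
     \<lparr>carrier = hom (add_monoid M) QZ \<inter> extensional (carrier M),
      monoid.mult = undefined, one = undefined,
      ring.zero = (\<lambda>x\<in>carrier M. \<one>\<^bsub>QZ\<^esub>),
      ring.add = (\<lambda>f g. \<lambda>x\<in>carrier M. f x \<otimes>\<^bsub>QZ\<^esub> g x),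
      smult = (\<lambda>r f. \<lambda>x\<in>carrier M. f (r \<odot>\<^bsub>M\<^esub> x))\<rparr>"


section \<open>Resolutions and dimensions\<close>

text \<open>\<open>0 \<rightarrow> X m \<rightarrow> \<dots> \<rightarrow> X 0 \<rightarrow> M \<rightarrow> 0\<close>, where \<open>d 0 : X 0 \<rightarrow> M\<close> and \<open>d (Suc k) : X (Suc k) \<rightarrow> X k\<close>.\<close>

definition exact_augmented ::
  "'r ring \<Rightarrow> (nat \<Rightarrow> ('r, 'u) module) \<Rightarrow> (nat \<Rightarrow> 'u \<Rightarrow> 'u) \<Rightarrow> ('r, 'u) module \<Rightarrow> enat \<Rightarrow> bool"
where
  "exact_augmented S X d M m \<longleftrightarrow>
     d 0 \<in> mod_hom S (X 0) M \<and> d 0 ` carrier (X 0) = carrier M \<and>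
     (\<forall>k. enat (Suc k) \<le> m \<longrightarrow> d (Suc k) \<in> mod_hom S (X (Suc k)) (X k) \<and>
        d (Suc k) ` carrier (X (Suc k)) = a_kernel (X k) (if k = 0 then M else X (k - 1)) (d k)) \<and>
     (\<forall>k. m = enat k \<longrightarrow> inj_on (d k) (carrier (X k)))"

definition resdim :: "'u ring \<Rightarrow> ('u, 'u) module set \<Rightarrow> ('u, 'u) module \<Rightarrow> enat" where
  "resdim S \<X> M = Inf {enat m | m. \<exists>X d. (\<forall>k\<le>m. X k \<in> \<X>) \<and> exact_augmented S X d M (enat m)}"

definition finite_resdim_class :: "'u ring \<Rightarrow> ('u, 'u) module set \<Rightarrow> ('u, 'u) module set" where
  "finite_resdim_class S \<X> = {M \<in> modules S. resdim S \<X> M < \<infinity>}"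

definition findim :: "'u ring \<Rightarrow> ('u, 'u) module set \<Rightarrow> enat" where
  "findim S \<X> = (SUP M\<in>finite_resdim_class S \<X>. resdim S \<X> M)"


section \<open>Ext and orthogonal classes\<close>

definition projective :: "'u ring \<Rightarrow> ('u, 'u) module \<Rightarrow> bool" where
  "projective S P \<longleftrightarrow> P \<in> modules S \<and>
     (\<forall>B\<in>modules S. \<forall>C\<in>modules S. \<forall>g\<in>mod_hom S B C. \<forall>f\<in>mod_hom S P C.
        g ` carrier B = carrier C \<longrightarrow>
        (\<exists>h\<in>mod_hom S P B. \<forall>x\<in>carrier P. g (h x) = f x))"

definition projective_resolution ::
  "'u ring \<Rightarrow> (nat \<Rightarrow> ('u, 'u) module) \<Rightarrow> (nat \<Rightarrow> 'u \<Rightarrow> 'u) \<Rightarrow> ('u, 'u) module \<Rightarrow> bool"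
where
  "projective_resolution S P d N \<longleftrightarrow> (\<forall>k. projective S (P k)) \<and> exact_augmented S P d N \<infinity>"

definition hom_group :: "'r ring \<Rightarrow> ('r, 'a) module \<Rightarrow> ('r, 'b) module \<Rightarrow> ('a \<Rightarrow> 'b) monoid" where
  "hom_group S M N =
     \<lparr>carrier = mod_hom S M N \<inter> extensional (carrier M),
      monoid.mult = (\<lambda>f g. \<lambda>x\<in>carrier M. f x \<oplus>\<^bsub>N\<^esub> g x),
      one = (\<lambda>x\<in>carrier M. \<zero>\<^bsub>N\<^esub>)\<rparr>"

text \<open>The \<open>i\<close>-th cohomology group of \<open>Hom(P, A)\<close>; the augmentation \<open>d 0\<close> is deleted.\<close>

definition ext_cocycles ::
  "'r ring \<Rightarrow> (nat \<Rightarrow> ('r, 'a) module) \<Rightarrow> (nat \<Rightarrow> 'a \<Rightarrow> 'a) \<Rightarrow> nat \<Rightarrow> ('r, 'b) module \<Rightarrow> ('a \<Rightarrow> 'b) set"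
where
  "ext_cocycles S P d i A = {f \<in> carrier (hom_group S (P i) A).
     compose (carrier (P (Suc i))) f (d (Suc i)) = \<one>\<^bsub>hom_group S (P (Suc i)) A\<^esub>}"

definition ext_coboundaries ::
  "'r ring \<Rightarrow> (nat \<Rightarrow> ('r, 'a) module) \<Rightarrow> (nat \<Rightarrow> 'a \<Rightarrow> 'a) \<Rightarrow> nat \<Rightarrow> ('r, 'b) module \<Rightarrow> ('a \<Rightarrow> 'b) set"
where
  "ext_coboundaries S P d i A = (if i = 0 then {\<one>\<^bsub>hom_group S (P 0) A\<^esub>}
     else (\<lambda>f. compose (carrier (P i)) f (d i)) ` carrier (hom_group S (P (i - 1)) A))"

definition ext_group ::
  "'r ring \<Rightarrow> (nat \<Rightarrow> ('r, 'a) module) \<Rightarrow> (nat \<Rightarrow> 'a \<Rightarrow> 'a) \<Rightarrow> nat \<Rightarrow> ('r, 'b) module \<Rightarrow> ('a \<Rightarrow> 'b) set monoid"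
where
  "ext_group S P d i A =
     (hom_group S (P i) A)\<lparr>carrier := ext_cocycles S P d i A\<rparr> Mod ext_coboundaries S P d i A"

text \<open>
  \<open>Ext\<^sup>i\<^sub>S(N, A) = 0\<close>. Every module of the universe has a projective resolution, and the groups
  computed from two of them are isomorphic.
\<close>

definition ext_zero :: "'u ring \<Rightarrow> nat \<Rightarrow> ('u, 'u) module \<Rightarrow> ('u, 'u) module \<Rightarrow> bool" where
  "ext_zero S i N A \<longleftrightarrow>
     (\<forall>P d. projective_resolution S P d N \<longrightarrow> trivial_group (ext_group S P d i A))"

definition left_perp :: "'u ring \<Rightarrow> ('u, 'u) module set \<Rightarrow> ('u, 'u) module set" where
  "left_perp S \<A> = {N \<in> modules S. \<forall>A\<in>\<A>. \<forall>i\<ge>1. ext_zero S i N A}"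

definition cotorsion_pair :: "'u ring \<Rightarrow> ('u, 'u) module set \<Rightarrow> ('u, 'u) module set \<Rightarrow> bool" where
  "cotorsion_pair S \<X> \<Y> \<longleftrightarrow>
     \<X> = {N \<in> modules S. \<forall>Y\<in>\<Y>. ext_zero S 1 N Y} \<and>
     \<Y> = {N \<in> modules S. \<forall>X\<in>\<X>. ext_zero S 1 X N}"

definition hereditary_pair :: "'u ring \<Rightarrow> ('u, 'u) module set \<Rightarrow> ('u, 'u) module set \<Rightarrow> bool" where
  "hereditary_pair S \<X> \<Y> \<longleftrightarrow> (\<forall>X\<in>\<X>. \<forall>Y\<in>\<Y>. \<forall>i\<ge>1. ext_zero S i X Y)"

definition complete_pair :: "'u ring \<Rightarrow> ('u, 'u) module set \<Rightarrow> ('u, 'u) module set \<Rightarrow> bool" where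
  "complete_pair S \<X> \<Y> \<longleftrightarrow> (\<forall>M\<in>modules S.
     (\<exists>X\<in>\<X>. \<exists>Y\<in>\<Y>. \<exists>f g. short_exact S Y f X g M) \<and>
     (\<exists>X\<in>\<X>. \<exists>Y\<in>\<Y>. \<exists>f g. short_exact S M f Y g X))"


section \<open>Tensor products\<close>

text \<open>\<open>A \<otimes>\<^sub>R L\<close> for \<open>A\<close> over \<open>op_ring R\<close> and \<open>L\<close> over \<open>R\<close>, as a quotient of a free abelian group.\<close>

definition tensor_relations ::
  "'r ring \<Rightarrow> ('r, 'a) module \<Rightarrow> ('r, 'b) module \<Rightarrow> ('a \<times> 'b \<Rightarrow>\<^sub>0 int) set"
where
  "tensor_relations R A L =
     {frag_of (a \<oplus>\<^bsub>A\<^esub> a', x) - frag_of (a, x) - frag_of (a', x) | a a' x.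
        a \<in> carrier A \<and> a' \<in> carrier A \<and> x \<in> carrier L} \<union>
     {frag_of (a, x \<oplus>\<^bsub>L\<^esub> x') - frag_of (a, x) - frag_of (a, x') | a x x'.
        a \<in> carrier A \<and> x \<in> carrier L \<and> x' \<in> carrier L} \<union>
     {frag_of (r \<odot>\<^bsub>A\<^esub> a, x) - frag_of (a, r \<odot>\<^bsub>L\<^esub> x) | r a x.
        r \<in> carrier R \<and> a \<in> carrier A \<and> x \<in> carrier L}"

definition tensor_subgroup ::
  "'r ring \<Rightarrow> ('r, 'a) module \<Rightarrow> ('r, 'b) module \<Rightarrow> ('a \<times> 'b \<Rightarrow>\<^sub>0 int) set"
where
  "tensor_subgroup R A L =
     generate (free_Abelian_group (carrier A \<times> carrier L)) (tensor_relations R A L)"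

definition tensor ::
  "'r ring \<Rightarrow> ('r, 'a) module \<Rightarrow> ('r, 'b) module \<Rightarrow> ('a \<times> 'b \<Rightarrow>\<^sub>0 int) set monoid"
where
  "tensor R A L = free_Abelian_group (carrier A \<times> carrier L) Mod tensor_subgroup R A L"

text \<open>
  \<open>id\<^sub>A \<otimes> f : A \<otimes>\<^sub>R L \<rightarrow> A \<otimes>\<^sub>R L'\<close> on cosets: the image of a representative does not depend, modulo
  the relations, on the representative.
\<close>

definition tensor_map ::
  "'r ring \<Rightarrow> ('r, 'a) module \<Rightarrow> ('r, 'c) module \<Rightarrow> ('b \<Rightarrow> 'c) \<Rightarrow>
   ('a \<times> 'b \<Rightarrow>\<^sub>0 int) set \<Rightarrow> ('a \<times> 'c \<Rightarrow>\<^sub>0 int) set"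
where
  "tensor_map R A L' f T = the_elem
     ((\<lambda>t. tensor_subgroup R A L' #>\<^bsub>free_Abelian_group (carrier A \<times> carrier L')\<^esub>
        frag_extend (\<lambda>(a, x). frag_of (a, f x)) t) ` T)"


section \<open>Gorenstein modules relative to a class and a test class\<close>

definition exact_complex :: "'r ring \<Rightarrow> (int \<Rightarrow> ('r, 'a) module) \<Rightarrow> (int \<Rightarrow> 'a \<Rightarrow> 'a) \<Rightarrow> bool" where
  "exact_complex R L d \<longleftrightarrow> (\<forall>n. d n \<in> mod_hom R (L n) (L (n - 1)) \<and>
     d (n + 1) ` carrier (L (n + 1)) = a_kernel (L n) (L (n - 1)) (d n))"

definition tensor_exact ::
  "'r ring \<Rightarrow> ('r, 'b) module \<Rightarrow> (int \<Rightarrow> ('r, 'a) module) \<Rightarrow> (int \<Rightarrow> 'a \<Rightarrow> 'a) \<Rightarrow> bool"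
where
  "tensor_exact R A L d \<longleftrightarrow> (\<forall>n.
     tensor_map R A (L n) (d (n + 1)) ` carrier (tensor R A (L (n + 1))) =
     kernel (tensor R A (L n)) (tensor R A (L (n - 1))) (tensor_map R A (L (n - 1)) (d n)))"

definition GF :: "'u ring \<Rightarrow> ('u, 'u) module set \<Rightarrow> ('u, 'u) module set \<Rightarrow> ('u, 'u) module set" where
  "GF R \<L> \<nu> = {M \<in> modules R. \<exists>L d. (\<forall>n. L n \<in> \<L>) \<and> exact_complex R L d \<and>
     (\<forall>A\<in>\<nu>. tensor_exact R A L d) \<and>
     isomorphic R M ((L 0)\<lparr>carrier := a_kernel (L 0) (L (- 1)) (d 0)\<rparr>)}"


section \<open>Duality pairs\<close>

text \<open>
  \<open>duality_pair R \<L> \<A>\<close> is for classes \<open>\<L>\<close> of left and \<open>\<A>\<close> of right \<open>R\<close>-modules; since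
  \<open>op_ring (op_ring R) = R\<close>, the version with the sides exchanged is
  \<open>duality_pair (op_ring R) \<A> \<L>\<close>.
\<close>

definition duality_pair :: "'u ring \<Rightarrow> ('u, 'u) module set \<Rightarrow> ('u, 'u) module set \<Rightarrow> bool" where
  "duality_pair S \<X> \<Y> \<longleftrightarrow>
     (\<forall>M\<in>modules S. M \<in> \<X> \<longleftrightarrow> belongs (op_ring S) (char_module S M) \<Y>) \<and>
     closed_summands (op_ring S) \<Y> \<and> closed_finite_sums (op_ring S) \<Y>"

definition product_closed_duality_pair ::
  "'u ring \<Rightarrow> ('u, 'u) module set \<Rightarrow> ('u, 'u) module set \<Rightarrow> bool"
where
  "product_closed_duality_pair R \<L> \<A> \<longleftrightarrow> duality_pair R \<L> \<A> \<and> closed_products R \<L>"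

definition symmetric_duality_pair ::
  "'u ring \<Rightarrow> ('u, 'u) module set \<Rightarrow> ('u, 'u) module set \<Rightarrow> bool"
where
  "symmetric_duality_pair R \<L> \<A> \<longleftrightarrow> duality_pair R \<L> \<A> \<and> duality_pair (op_ring R) \<A> \<L>"

definition perfect_duality_pair ::
  "'u ring \<Rightarrow> ('u, 'u) module set \<Rightarrow> ('u, 'u) module set \<Rightarrow> bool"
where
  "perfect_duality_pair R \<L> \<A> \<longleftrightarrow> duality_pair R \<L> \<A> \<and>
     closed_coproducts R \<L> \<and> closed_extensions R \<L> \<and> belongs R (regular_module R) \<L>"

definition complete_duality_pair ::
  "'u ring \<Rightarrow> ('u, 'u) module set \<Rightarrow> ('u, 'u) module set \<Rightarrow> bool"
where
  "complete_duality_pair R \<L> \<A> \<longleftrightarrow> symmetric_duality_pair R \<L> \<A> \<and> perfect_duality_pair R \<L> \<A>"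

definition bicomplete_duality_pair ::
  "'u ring \<Rightarrow> ('u, 'u) module set \<Rightarrow> ('u, 'u) module set \<Rightarrow> bool"
where
  "bicomplete_duality_pair R \<L> \<A> \<longleftrightarrow> complete_duality_pair R \<L> \<A> \<and>
     cotorsion_pair (op_ring R) (left_perp (op_ring R) \<A>) \<A> \<and>
     hereditary_pair (op_ring R) (left_perp (op_ring R) \<A>) \<A> \<and>
     complete_pair (op_ring R) (left_perp (op_ring R) \<A>) \<A>"

end

theory Submission
  imports Defs
begin

text \<open>
  Write \<open>\<G>\<close> for the Gorenstein class. Every module in \<open>\<G>\<close> embeds into an object of \<open>\<L>\<close> with cokernel
  in \<open>\<G>\<close>, so for \<open>M\<close> of \<open>\<G>\<close>-resolution dimension at most \<open>n \<ge> 1\<close> the Auslander--Buchweitz argument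
  gives \<open>0 \<rightarrow> K \<rightarrow> G \<rightarrow> M \<rightarrow> 0\<close> with \<open>G \<in> \<G>\<close> and \<open>K\<close> of \<open>\<L>\<close>-dimension at most \<open>n - 1\<close>, and, after pushing out
  along an embedding \<open>G \<rightarrow> L\<close> taken from a complex defining \<open>G\<close>, an exact sequence
  \<open>0 \<rightarrow> M \<rightarrow> Q \<rightarrow> H \<rightarrow> 0\<close> with \<open>H \<in> \<G>\<close> and \<open>Q = L/K\<close> of \<open>\<L>\<close>-dimension at most \<open>n\<close>, which stays exact
  under \<open>A \<otimes> -\<close> for \<open>A \<in> \<nu>\<close>. It remains to bound the \<open>\<G>\<close>-dimension of \<open>M\<close> by the \<open>\<L>\<close>-dimension of \<open>Q\<close>.
  If \<open>\<L>\<^sup>+ \<subseteq> \<A>\<close> then \<open>Tor(\<nu>, \<G>)\<close> vanishes, hence \<open>\<G>\<close> is closed under epikernels, and this follows from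
  the sequence for \<open>M\<close>, \<open>Q\<close>, \<open>H\<close>. If \<open>\<L>\<close> is closed under epikernels, then \<open>K\<close> has smaller
  \<open>\<L>\<close>-dimension than \<open>Q\<close> unless \<open>Q \<in> \<L>\<close>, and in the latter case the purity of \<open>M \<rightarrow> Q\<close> yields \<open>M \<in> \<G>\<close>.

  For a bicomplete duality pair the equality reduces to the claim that the cokernel \<open>M\<close> of a monomorphism
  \<open>L\<^sub>1 \<rightarrow> L\<^sub>0\<close> in \<open>\<L>\<close> belongs to \<open>\<L>\<close> as soon as \<open>Tor\<^sub>1(\<nu>, M) = 0\<close>, that is,
  \<open>Ext\<^sup>1(X, M\<^sup>+) = 0\<close> for \<open>X\<close> left orthogonal to \<open>\<A>\<close>: a homomorphism \<open>X \<rightarrow> L\<^sub>1\<^sup>+\<close> is extended to some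
  \<open>Y \<in> \<nu>\<close> containing \<open>X\<close>, lifted to \<open>Y \<rightarrow> L\<^sub>0\<^sup>+\<close>, and restricted to \<open>X\<close>.
\<close>

section \<open>The group \<open>\<rat>/\<int>\<close> is an injective cogenerator\<close>

text \<open>Neither Tor nor its long exact sequences are constructed. The characters of
  \<open>A \<otimes> M\<close> are the balanced maps
  \<open>A \<times> M \<rightarrow> \<rat>/\<int>\<close>, and as \<open>\<rat>/\<int>\<close> is an
  injective cogenerator, injectivity of \<open>A \<otimes> f\<close> becomes the extension property
  \<open>bal_ext\<close> along f. For a presentation by a projective, the same property says that
  Tor vanishes in degree one, and by adjunction it is the vanishing of Ext into a character module.
  So one predicate links the tensor-exactness in \<open>GF\<close>, the orthogonality in
  \<open>\<nu>\<close> and membership of character modules in \<open>\<A>\<close>.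

  Two obstacles shape the development. Modules of a class are carried by the single type
  \<open>'u\<close>, so each quotient, pullback or character module is replaced by a copy on
  \<open>'u\<close>, whose smallness has to be checked. And \<open>\<L>\<close> may lack the zero
  module, so resolutions cannot be padded by zeros and an object of \<open>\<L>\<close> is not
  obviously in \<open>\<G>\<close>; split sequences
  \<open>L \<rightarrow> L \<oplus> L \<rightarrow> L\<close> take the place of zeros.\<close>

lemma comm_group_rat_group: "comm_group rat_group"
  by (rule comm_groupI) (auto simp: rat_group_def intro: exI[of _ "- _"])

lemma int_pow_rat_group: "x [^]\<^bsub>rat_group\<^esub> (k :: int) = of_int k * x"
proof -
  interpret comm_group rat_group by (rule comm_group_rat_group)
  have nat: "x [^]\<^bsub>rat_group\<^esub> (n :: nat) = of_nat n * x" for n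
    by (induction n) (simp_all add: rat_group_def algebra_simps)
  have inv: "inv\<^bsub>rat_group\<^esub> y = - y" for y
    by (rule inv_equality) (auto simp: rat_group_def)
  show ?thesis
  proof (cases "k \<ge> 0")
    case True
    then have "x [^]\<^bsub>rat_group\<^esub> k = x [^]\<^bsub>rat_group\<^esub> nat k"
      by (simp only: int_pow_def2 not_less[symmetric] if_False)
    then show ?thesis using True by (simp add: nat)
  next
    case False
    then have "x [^]\<^bsub>rat_group\<^esub> k = inv\<^bsub>rat_group\<^esub> (x [^]\<^bsub>rat_group\<^esub> nat (- k))"
      by (simp only: int_pow_def2 not_le if_True)
    then show ?thesis using False by (simp add: nat inv)
  qed
qed

lemma subgroup_Ints: "subgroup \<int> rat_group"
proof -
  interpret comm_group rat_group by (rule comm_group_rat_group)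
  have inv: "inv\<^bsub>rat_group\<^esub> y = - y" for y
    by (rule inv_equality) (auto simp: rat_group_def)
  show ?thesis
    by unfold_locales (use inv in \<open>auto simp: rat_group_def\<close>)
qed

lemma comm_group_QZ: "comm_group QZ"
  unfolding QZ_def by (rule comm_group.abelian_FactGroup[OF comm_group_rat_group subgroup_Ints])

interpretation QZ: comm_group QZ
  by (rule comm_group_QZ)

text \<open>The root can be taken nontrivial: over the trivial class, \<open>1/n\<close> is not an
  integer because \<open>n \<ge> 2\<close>, and over a nontrivial class no root is trivial.
  Divisibility will give injectivity of \<open>\<rat>/\<int>\<close>, the nontrivial root its
  cogenerator property.\<close>

lemma QZ_divisible:
  assumes "q \<in> carrier QZ" "n \<ge> 2"
  shows "\<exists>r\<in>carrier QZ. r \<noteq> \<one>\<^bsub>QZ\<^esub> \<and> r [^]\<^bsub>QZ\<^esub> int n = q"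
proof -
  interpret rat: comm_group rat_group by (rule comm_group_rat_group)
  interpret rat: normal \<int> rat_group
    by (rule rat.normal_iff_subgroup[THEN iffD2, OF subgroup_Ints])
  define c where "c x = \<int> #>\<^bsub>rat_group\<^esub> x" for x
  have hom: "group_hom rat_group QZ c"
    unfolding QZ_def c_def group_hom_def group_hom_axioms_def
    using rat.r_coset_hom_Mod rat.factorgroup_is_group rat.group_axioms by auto
  have one: "c x = \<one>\<^bsub>QZ\<^esub> \<longleftrightarrow> x \<in> \<int>" for x
    using rat.coset_join1[of \<int> x] rat.coset_join2[of x \<int>] subgroup_Ints
    unfolding QZ_def c_def by (auto simp: rat_group_def dest: subgroup.subset)
  have pow: "c x [^]\<^bsub>QZ\<^esub> k = c (of_int k * x)" for x and k :: int
    using group_hom.hom_int_pow[OF hom, of x k] int_pow_rat_group[of x k] by (simp add: rat_group_def)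
  obtain x where x: "q = c x"
    using assms(1) unfolding QZ_def c_def carrier_FactGroup by auto
  have c_car: "c y \<in> carrier QZ" for y
    by (rule group_hom.hom_closed[OF hom]) (simp add: rat_group_def)
  show ?thesis
  proof (cases "x \<in> \<int>")
    case True
    have "(1 :: rat) / of_nat n \<notin> \<int>"
    proof
      assume "(1 :: rat) / of_nat n \<in> \<int>"
      then obtain z where "(1 :: rat) / of_nat n = of_int z"
        by (auto elim: Ints_cases)
      then have "(1 :: rat) = of_int (z * int n)"
        using assms(2) by (simp add: field_simps)
      then have "1 = z * int n" by (metis of_int_eq_1_iff)
      then have "int n dvd 1" by (metis dvd_triv_right)
      then show False using assms(2) by auto
    qed
    moreover have "c (1 / of_nat n) [^]\<^bsub>QZ\<^esub> int n = q"
      using assms(2) True x one[of 1] one[of x] by (simp add: pow)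
    ultimately show ?thesis using one c_car by blast
  next
    case False
    have "c (x / of_nat n) [^]\<^bsub>QZ\<^esub> int n = q"
      using assms(2) x by (simp add: pow)
    moreover have "c (x / of_nat n) \<noteq> \<one>\<^bsub>QZ\<^esub>"
      using calculation False one x by (metis QZ.int_pow_one)
    ultimately show ?thesis using c_car by blast
  qed
qed

text \<open>Keeps the character modules of small modules inside the universe.\<close>

lemma countable_QZ: "countable (carrier QZ)"
  unfolding QZ_def carrier_FactGroup by simp

text \<open>The graph of a homomorphism from a subgroup of \<open>G\<close> to \<open>\<rat>/\<int>\<close>.\<close>

definition partial_character :: "('g, 'x) monoid_scheme \<Rightarrow> ('g \<times> rat set) set \<Rightarrow> bool" where
  "partial_character G \<Gamma> \<longleftrightarrow> subgroup \<Gamma> (G \<times>\<times> QZ) \<and> (\<forall>q. (\<one>\<^bsub>G\<^esub>, q) \<in> \<Gamma> \<longrightarrow> q = \<one>\<^bsub>QZ\<^esub>)"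

lemma partial_characterI:
  fixes G :: "('g, 'x) monoid_scheme"
  assumes "comm_group G" "\<Gamma> \<subseteq> carrier G \<times> carrier QZ" "(\<one>\<^bsub>G\<^esub>, \<one>\<^bsub>QZ\<^esub>) \<in> \<Gamma>"
    and "\<And>a q. (a, q) \<in> \<Gamma> \<Longrightarrow> (inv\<^bsub>G\<^esub> a, inv\<^bsub>QZ\<^esub> q) \<in> \<Gamma>"
    and "\<And>a q a' q'. (a, q) \<in> \<Gamma> \<Longrightarrow> (a', q') \<in> \<Gamma> \<Longrightarrow> (a \<otimes>\<^bsub>G\<^esub> a', q \<otimes>\<^bsub>QZ\<^esub> q') \<in> \<Gamma>"
    and "\<And>q. (\<one>\<^bsub>G\<^esub>, q) \<in> \<Gamma> \<Longrightarrow> q = \<one>\<^bsub>QZ\<^esub>"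
  shows "partial_character G \<Gamma>"
proof -
  interpret G: comm_group G by fact
  interpret D: group "G \<times>\<times> QZ" by (rule DirProd_group[OF G.group_axioms QZ.group_axioms])
  have inv: "inv\<^bsub>G \<times>\<times> QZ\<^esub> (a, q) = (inv\<^bsub>G\<^esub> a, inv\<^bsub>QZ\<^esub> q)" if "(a, q) \<in> \<Gamma>" for a q
    using that assms(2) by (intro inv_DirProd G.group_axioms QZ.group_axioms) auto
  have "subgroup \<Gamma> (G \<times>\<times> QZ)"
  proof (rule D.subgroupI)
    show "\<Gamma> \<noteq> {}" using assms(3) by auto
  next
    fix p assume "p \<in> \<Gamma>" then show "inv\<^bsub>G \<times>\<times> QZ\<^esub> p \<in> \<Gamma>"
      using assms(4) inv by (cases p) auto
  next
    fix p p' assume "p \<in> \<Gamma>" "p' \<in> \<Gamma>" then show "p \<otimes>\<^bsub>G \<times>\<times> QZ\<^esub> p' \<in> \<Gamma>"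
      using assms(5) by (cases p; cases p') auto
  qed (use assms(2) in auto)
  then show ?thesis unfolding partial_character_def using assms(6) by blast
qed

lemma partial_characterD:
  fixes G :: "('g, 'x) monoid_scheme"
  assumes "comm_group G" "partial_character G \<Gamma>"
  shows "\<And>a q. (a, q) \<in> \<Gamma> \<Longrightarrow> a \<in> carrier G" "\<And>a q. (a, q) \<in> \<Gamma> \<Longrightarrow> q \<in> carrier QZ"
    "(\<one>\<^bsub>G\<^esub>, \<one>\<^bsub>QZ\<^esub>) \<in> \<Gamma>"
    "\<And>a q. (a, q) \<in> \<Gamma> \<Longrightarrow> (inv\<^bsub>G\<^esub> a, inv\<^bsub>QZ\<^esub> q) \<in> \<Gamma>"
    "\<And>a q a' q'. (a, q) \<in> \<Gamma> \<Longrightarrow> (a', q') \<in> \<Gamma> \<Longrightarrow> (a \<otimes>\<^bsub>G\<^esub> a', q \<otimes>\<^bsub>QZ\<^esub> q') \<in> \<Gamma>"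
    "\<And>a q (k :: int). (a, q) \<in> \<Gamma> \<Longrightarrow> (a [^]\<^bsub>G\<^esub> k, q [^]\<^bsub>QZ\<^esub> k) \<in> \<Gamma>"
    "\<And>q. (\<one>\<^bsub>G\<^esub>, q) \<in> \<Gamma> \<Longrightarrow> q = \<one>\<^bsub>QZ\<^esub>"
    "\<And>a q q'. (a, q) \<in> \<Gamma> \<Longrightarrow> (a, q') \<in> \<Gamma> \<Longrightarrow> q = q'"
proof -
  interpret G: comm_group G by fact
  have sg: "subgroup \<Gamma> (G \<times>\<times> QZ)" and fn: "\<And>q. (\<one>\<^bsub>G\<^esub>, q) \<in> \<Gamma> \<Longrightarrow> q = \<one>\<^bsub>QZ\<^esub>"
    using assms(2) unfolding partial_character_def by auto
  show c1: "\<And>a q. (a, q) \<in> \<Gamma> \<Longrightarrow> a \<in> carrier G" and c2: "\<And>a q. (a, q) \<in> \<Gamma> \<Longrightarrow> q \<in> carrier QZ"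
    using subgroup.subset[OF sg] by auto
  show one: "(\<one>\<^bsub>G\<^esub>, \<one>\<^bsub>QZ\<^esub>) \<in> \<Gamma>"
    using subgroup.one_closed[OF sg] by simp
  show i: "(inv\<^bsub>G\<^esub> a, inv\<^bsub>QZ\<^esub> q) \<in> \<Gamma>" if "(a, q) \<in> \<Gamma>" for a q
    using subgroup.m_inv_closed[OF sg that] that c1 c2
    by (simp add: inv_DirProd[OF G.group_axioms QZ.group_axioms])
  show m: "(a \<otimes>\<^bsub>G\<^esub> a', q \<otimes>\<^bsub>QZ\<^esub> q') \<in> \<Gamma>" if "(a, q) \<in> \<Gamma>" "(a', q') \<in> \<Gamma>" for a q a' q'
    using subgroup.m_closed[OF sg that] by simp
  have n: "(a [^]\<^bsub>G\<^esub> k, q [^]\<^bsub>QZ\<^esub> k) \<in> \<Gamma>" if "(a, q) \<in> \<Gamma>" for a q and k :: nat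
    using that by (induction k) (auto intro: m one)
  show "(a [^]\<^bsub>G\<^esub> k, q [^]\<^bsub>QZ\<^esub> k) \<in> \<Gamma>" if "(a, q) \<in> \<Gamma>" for a q and k :: int
  proof (cases "k \<ge> 0")
    case True
    then have "a [^]\<^bsub>G\<^esub> k = a [^]\<^bsub>G\<^esub> nat k" "q [^]\<^bsub>QZ\<^esub> k = q [^]\<^bsub>QZ\<^esub> nat k"
      by (simp_all only: int_pow_def2 not_less[symmetric] if_False)
    then show ?thesis using n[OF that, of "nat k"] by (simp only:)
  next
    case False
    then have "a [^]\<^bsub>G\<^esub> k = inv\<^bsub>G\<^esub> (a [^]\<^bsub>G\<^esub> nat (- k))"
        "q [^]\<^bsub>QZ\<^esub> k = inv\<^bsub>QZ\<^esub> (q [^]\<^bsub>QZ\<^esub> nat (- k))"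
      by (simp_all only: int_pow_def2 not_le if_True)
    then show ?thesis using i[OF n[OF that, of "nat (- k)"]] by (simp only:)
  qed
  show "\<And>q. (\<one>\<^bsub>G\<^esub>, q) \<in> \<Gamma> \<Longrightarrow> q = \<one>\<^bsub>QZ\<^esub>" by (rule fn)
  show "q = q'" if "(a, q) \<in> \<Gamma>" "(a, q') \<in> \<Gamma>" for a q q'
  proof -
    have "(a \<otimes>\<^bsub>G\<^esub> inv\<^bsub>G\<^esub> a, q \<otimes>\<^bsub>QZ\<^esub> inv\<^bsub>QZ\<^esub> q') \<in> \<Gamma>" using m i that by blast
    then have "q \<otimes>\<^bsub>QZ\<^esub> inv\<^bsub>QZ\<^esub> q' = \<one>\<^bsub>QZ\<^esub>" using fn c1 that by auto
    then show ?thesis using c2 that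
      by (metis QZ.inv_closed QZ.inv_equality QZ.inv_inv)
  qed
qed

text \<open>Baer's argument for one new element g. The exponents k with g^k in the domain of
  \<open>\<Gamma>\<close> form a subgroup of the integers. If it is generated by n > 0, the value r
  at g must be an n-th root of the value at g^n; if it is zero, r is free. When g is outside the
  domain, n is at least 2, so r can be nontrivial in either case.\<close>

lemma partial_character_extend_step:
  fixes G :: "('g, 'x) monoid_scheme"
  assumes G: "comm_group G" and pc: "partial_character G \<Gamma>" and g: "g \<in> carrier G"
  shows "\<exists>\<Gamma>' r. partial_character G \<Gamma>' \<and> \<Gamma> \<subseteq> \<Gamma>' \<and> (g, r) \<in> \<Gamma>' \<and> (g \<notin> Domain \<Gamma> \<longrightarrow> r \<noteq> \<one>\<^bsub>QZ\<^esub>)"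
proof (cases "g \<in> Domain \<Gamma>")
  case True
  then show ?thesis using pc by blast
next
  case False
  interpret G: comm_group G by fact
  note D = partial_characterD[OF G pc]
  have "\<exists>r\<in>carrier QZ. r \<noteq> \<one>\<^bsub>QZ\<^esub> \<and> (\<forall>k::int. g [^]\<^bsub>G\<^esub> k \<in> Domain \<Gamma> \<longrightarrow> (g [^]\<^bsub>G\<^esub> k, r [^]\<^bsub>QZ\<^esub> k) \<in> \<Gamma>)"
  proof (cases "\<exists>n>0. g [^]\<^bsub>G\<^esub> int n \<in> Domain \<Gamma>")
    case True
    define n where "n = (LEAST n. n > 0 \<and> g [^]\<^bsub>G\<^esub> int n \<in> Domain \<Gamma>)"
    have n: "n > 0" "g [^]\<^bsub>G\<^esub> int n \<in> Domain \<Gamma>"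
      using LeastI_ex[OF True] unfolding n_def by auto
    have "n \<noteq> 1" using n False g by auto
    then have "n \<ge> 2" using n by simp
    obtain q where q: "(g [^]\<^bsub>G\<^esub> int n, q) \<in> \<Gamma>" using n by auto
    then obtain r where r: "r \<in> carrier QZ" "r \<noteq> \<one>\<^bsub>QZ\<^esub>" "r [^]\<^bsub>QZ\<^esub> int n = q"
      using QZ_divisible[OF D(2)[OF q] \<open>n \<ge> 2\<close>] by blast
    have "(g [^]\<^bsub>G\<^esub> k, r [^]\<^bsub>QZ\<^esub> k) \<in> \<Gamma>" if k: "g [^]\<^bsub>G\<^esub> k \<in> Domain \<Gamma>" for k :: int
    proof -
      obtain s where s: "(g [^]\<^bsub>G\<^esub> k, s) \<in> \<Gamma>" using k by blast
      \<comment> \<open>Dividing g^k by a power of g^n stays in the domain and leaves the exponent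
        \<open>k mod n\<close>, which minimality of n forces to be 0.\<close>
      have qd: "((g [^]\<^bsub>G\<^esub> int n) [^]\<^bsub>G\<^esub> (- (k div int n)), q [^]\<^bsub>QZ\<^esub> (- (k div int n))) \<in> \<Gamma>"
        by (rule D(6)[OF q])
      have "g [^]\<^bsub>G\<^esub> k \<otimes>\<^bsub>G\<^esub> (g [^]\<^bsub>G\<^esub> int n) [^]\<^bsub>G\<^esub> (- (k div int n)) = g [^]\<^bsub>G\<^esub> (k mod int n)"
      proof -
        have "g [^]\<^bsub>G\<^esub> k \<otimes>\<^bsub>G\<^esub> (g [^]\<^bsub>G\<^esub> int n) [^]\<^bsub>G\<^esub> (- (k div int n))
            = g [^]\<^bsub>G\<^esub> (k + int n * (- (k div int n)))"
          using g by (simp only: G.int_pow_pow G.int_pow_mult)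
        also have "k + int n * (- (k div int n)) = k mod int n"
          by (simp add: minus_mult_div_eq_mod)
        finally show ?thesis .
      qed
      then have "g [^]\<^bsub>G\<^esub> (k mod int n) \<in> Domain \<Gamma>"
        using DomainI[OF D(5)[OF s qd]] by (simp only:)
      moreover have k0: "k mod int n \<ge> 0" using n by simp
      ultimately have "g [^]\<^bsub>G\<^esub> (int (nat (k mod int n))) \<in> Domain \<Gamma>"
        by (simp only: int_nat_eq if_True)
      moreover have "nat (k mod int n) < n" using n by (simp add: nat_less_iff)
      ultimately have "\<not> nat (k mod int n) > 0"
        using not_less_Least[of "nat (k mod int n)" "\<lambda>n. n > 0 \<and> g [^]\<^bsub>G\<^esub> int n \<in> Domain \<Gamma>"]
        unfolding n_def[symmetric] by simp
      then have "k mod int n = 0" using k0 by simp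
      then have "k = int n * (k div int n)" by (metis minus_mod_eq_mult_div diff_zero)
      moreover have "((g [^]\<^bsub>G\<^esub> int n) [^]\<^bsub>G\<^esub> (k div int n), q [^]\<^bsub>QZ\<^esub> (k div int n)) \<in> \<Gamma>"
        by (rule D(6)[OF q])
      ultimately show ?thesis using r g by (metis G.int_pow_pow QZ.int_pow_pow)
    qed
    then show ?thesis using r by blast
  next
    case F: False
    obtain r where r: "r \<in> carrier QZ" "r \<noteq> \<one>\<^bsub>QZ\<^esub>" using QZ_divisible[of "\<one>\<^bsub>QZ\<^esub>" 2] by auto
    have "(g [^]\<^bsub>G\<^esub> k, r [^]\<^bsub>QZ\<^esub> k) \<in> \<Gamma>" if k: "g [^]\<^bsub>G\<^esub> k \<in> Domain \<Gamma>" for k :: int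
    proof -
      obtain s where s: "(g [^]\<^bsub>G\<^esub> k, s) \<in> \<Gamma>" using k by blast
      \<comment> \<open>The domain is closed under inverses, so the sign of k may be dropped; a
        nonzero k would then give a positive exponent.\<close>
      have "(g [^]\<^bsub>G\<^esub> (- k), inv\<^bsub>QZ\<^esub> s) \<in> \<Gamma>" using D(4)[OF s] g by (simp add: G.int_pow_neg)
      then have "g [^]\<^bsub>G\<^esub> int (nat \<bar>k\<bar>) \<in> Domain \<Gamma>" using k by (cases "k \<ge> 0") auto
      then have "k = 0" using F by (metis abs_0_eq nat_0_iff not_gr0 zero_less_nat_eq zero_less_abs_iff)
      then show ?thesis using D(3) by simp
    qed
    then show ?thesis using r by blast
  qed
  then obtain r where r: "r \<in> carrier QZ" "r \<noteq> \<one>\<^bsub>QZ\<^esub>"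
    and rk: "\<And>k::int. g [^]\<^bsub>G\<^esub> k \<in> Domain \<Gamma> \<Longrightarrow> (g [^]\<^bsub>G\<^esub> k, r [^]\<^bsub>QZ\<^esub> k) \<in> \<Gamma>"
    by blast
  \<comment> \<open>The subgroup generated by \<open>\<Gamma>\<close> and \<open>(g, r)\<close>.
    Over the identity, g^k is the inverse of an element of the domain, and \<open>rk\<close> makes
    its value there r^k; hence \<open>\<Gamma>'\<close> is still single valued.\<close>
  define \<Gamma>' where "\<Gamma>' = {(a \<otimes>\<^bsub>G\<^esub> g [^]\<^bsub>G\<^esub> k, b \<otimes>\<^bsub>QZ\<^esub> r [^]\<^bsub>QZ\<^esub> k) | a b (k :: int). (a, b) \<in> \<Gamma>}"
  have I: "(a \<otimes>\<^bsub>G\<^esub> g [^]\<^bsub>G\<^esub> k, b \<otimes>\<^bsub>QZ\<^esub> r [^]\<^bsub>QZ\<^esub> k) \<in> \<Gamma>'" if "(a, b) \<in> \<Gamma>" for a b and k :: int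
    unfolding \<Gamma>'_def using that by blast
  have sub: "\<Gamma> \<subseteq> \<Gamma>'"
    using I[of _ _ 0] D(1,2) by auto
  have gr: "(g, r) \<in> \<Gamma>'" using I[OF D(3), of 1] g r by auto
  have "partial_character G \<Gamma>'"
  proof (rule partial_characterI[OF G])
    show "\<Gamma>' \<subseteq> carrier G \<times> carrier QZ" unfolding \<Gamma>'_def using D(1,2) g r by auto
    show "(\<one>\<^bsub>G\<^esub>, \<one>\<^bsub>QZ\<^esub>) \<in> \<Gamma>'" using sub D(3) by blast
  next
    fix x q assume "(x, q) \<in> \<Gamma>'"
    then obtain a b and k :: int where ab: "(a, b) \<in> \<Gamma>" "x = a \<otimes>\<^bsub>G\<^esub> g [^]\<^bsub>G\<^esub> k" "q = b \<otimes>\<^bsub>QZ\<^esub> r [^]\<^bsub>QZ\<^esub> k"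
      unfolding \<Gamma>'_def by auto
    have "inv\<^bsub>G\<^esub> x = inv\<^bsub>G\<^esub> a \<otimes>\<^bsub>G\<^esub> g [^]\<^bsub>G\<^esub> (- k)" "inv\<^bsub>QZ\<^esub> q = inv\<^bsub>QZ\<^esub> b \<otimes>\<^bsub>QZ\<^esub> r [^]\<^bsub>QZ\<^esub> (- k)"
      using ab D(1,2)[OF ab(1)] g r by (auto simp: G.int_pow_neg QZ.int_pow_neg G.inv_mult QZ.inv_mult)
    then show "(inv\<^bsub>G\<^esub> x, inv\<^bsub>QZ\<^esub> q) \<in> \<Gamma>'" using I[OF D(4)[OF ab(1)]] by simp
  next
    fix x q x' q' assume "(x, q) \<in> \<Gamma>'" "(x', q') \<in> \<Gamma>'"
    then obtain a b a' b' and k k' :: int where ab: "(a, b) \<in> \<Gamma>" "x = a \<otimes>\<^bsub>G\<^esub> g [^]\<^bsub>G\<^esub> k" "q = b \<otimes>\<^bsub>QZ\<^esub> r [^]\<^bsub>QZ\<^esub> k"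
      and ab': "(a', b') \<in> \<Gamma>" "x' = a' \<otimes>\<^bsub>G\<^esub> g [^]\<^bsub>G\<^esub> k'" "q' = b' \<otimes>\<^bsub>QZ\<^esub> r [^]\<^bsub>QZ\<^esub> k'"
      unfolding \<Gamma>'_def by auto
    have "x \<otimes>\<^bsub>G\<^esub> x' = (a \<otimes>\<^bsub>G\<^esub> a') \<otimes>\<^bsub>G\<^esub> g [^]\<^bsub>G\<^esub> (k + k')" "q \<otimes>\<^bsub>QZ\<^esub> q' = (b \<otimes>\<^bsub>QZ\<^esub> b') \<otimes>\<^bsub>QZ\<^esub> r [^]\<^bsub>QZ\<^esub> (k + k')"
      using ab ab' D(1,2)[OF ab(1)] D(1,2)[OF ab'(1)] g r
      by (auto simp: G.int_pow_mult QZ.int_pow_mult G.m_ac QZ.m_ac)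
    then show "(x \<otimes>\<^bsub>G\<^esub> x', q \<otimes>\<^bsub>QZ\<^esub> q') \<in> \<Gamma>'" using I[OF D(5)[OF ab(1) ab'(1)]] by simp
  next
    fix q assume "(\<one>\<^bsub>G\<^esub>, q) \<in> \<Gamma>'"
    then obtain a b and k :: int where ab: "(a, b) \<in> \<Gamma>" "\<one>\<^bsub>G\<^esub> = a \<otimes>\<^bsub>G\<^esub> g [^]\<^bsub>G\<^esub> k" "q = b \<otimes>\<^bsub>QZ\<^esub> r [^]\<^bsub>QZ\<^esub> k"
      unfolding \<Gamma>'_def by auto
    have "g [^]\<^bsub>G\<^esub> k = inv\<^bsub>G\<^esub> a" using ab D(1)[OF ab(1)] g
      by (metis G.int_pow_closed G.inv_comm G.inv_equality)
    then have "(g [^]\<^bsub>G\<^esub> k, r [^]\<^bsub>QZ\<^esub> k) \<in> \<Gamma>" using rk[of k] DomainI[OF D(4)[OF ab(1)]] by simp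
    then have "(\<one>\<^bsub>G\<^esub>, q) \<in> \<Gamma>" using D(5)[OF ab(1)] ab(2,3) by simp
    then show "q = \<one>\<^bsub>QZ\<^esub>" by (rule D(7))
  qed
  then show ?thesis using sub gr r by blast
qed

text \<open>Injectivity of \<open>\<rat>/\<int>\<close>. Graphs are ordered by inclusion, unions of
  chains are again partial characters, and by the one-element extension a maximal graph has the
  whole group as its domain.\<close>

lemma partial_character_extend:
  fixes G :: "('g, 'x) monoid_scheme"
  assumes G: "comm_group G" and pc: "partial_character G \<Gamma>"
  shows "\<exists>\<phi>\<in>hom G QZ. \<forall>(g, q)\<in>\<Gamma>. \<phi> g = q"
proof -
  interpret G: comm_group G by fact
  define S where "S = {\<Delta>. partial_character G \<Delta> \<and> \<Gamma> \<subseteq> \<Delta>}"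
  have "\<exists>M\<in>S. \<forall>X\<in>S. M \<subseteq> X \<longrightarrow> X = M"
  proof (rule subset_Zorn_nonempty)
    show "S \<noteq> {}" unfolding S_def using pc by auto
    fix C assume "C \<noteq> {}" and ch: "subset.chain S C"
    then have C: "\<And>\<Delta>. \<Delta> \<in> C \<Longrightarrow> partial_character G \<Delta> \<and> \<Gamma> \<subseteq> \<Delta>"
      unfolding S_def subset.chain_def by auto
    note D = partial_characterD[OF G C[THEN conjunct1]]
    have "partial_character G (\<Union>C)"
    proof (rule partial_characterI[OF G])
      show "\<Union>C \<subseteq> carrier G \<times> carrier QZ" using D(1,2) by auto
      show "(\<one>\<^bsub>G\<^esub>, \<one>\<^bsub>QZ\<^esub>) \<in> \<Union>C" using \<open>C \<noteq> {}\<close> D(3) by blast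
    next
      fix a q assume "(a, q) \<in> \<Union>C" then show "(inv\<^bsub>G\<^esub> a, inv\<^bsub>QZ\<^esub> q) \<in> \<Union>C"
        using D(4) by blast
    next
      fix a q a' q' assume "(a, q) \<in> \<Union>C" "(a', q') \<in> \<Union>C"
      then obtain \<Delta> \<Delta>' where d: "\<Delta> \<in> C" "(a, q) \<in> \<Delta>" "\<Delta>' \<in> C" "(a', q') \<in> \<Delta>'" by blast
      then have "\<Delta> \<subseteq> \<Delta>' \<or> \<Delta>' \<subseteq> \<Delta>" using ch unfolding subset.chain_def by blast
      then obtain \<Delta>'' where "\<Delta>'' \<in> C" "(a, q) \<in> \<Delta>''" "(a', q') \<in> \<Delta>''" using d by blast
      then show "(a \<otimes>\<^bsub>G\<^esub> a', q \<otimes>\<^bsub>QZ\<^esub> q') \<in> \<Union>C" using D(5) by blast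
    next
      fix q assume "(\<one>\<^bsub>G\<^esub>, q) \<in> \<Union>C" then show "q = \<one>\<^bsub>QZ\<^esub>" using D(7) by blast
    qed
    then show "\<Union>C \<in> S" using \<open>C \<noteq> {}\<close> C unfolding S_def by blast
  qed
  then obtain M where "M \<in> S" and maxS: "\<And>X. X \<in> S \<Longrightarrow> M \<subseteq> X \<Longrightarrow> X = M"
    by metis
  then have M: "partial_character G M" "\<Gamma> \<subseteq> M" unfolding S_def by auto
  have max: "X = M" if "partial_character G X" "M \<subseteq> X" for X
  proof (rule maxS)
    show "X \<in> S" using that M(2) unfolding S_def by auto
  qed (rule that(2))
  note D = partial_characterD[OF G M(1)]
  have "\<exists>q. (g, q) \<in> M" if g: "g \<in> carrier G" for g
  proof -
    obtain M' r where M': "partial_character G M'" "M \<subseteq> M'" "(g, r) \<in> M'"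
      using partial_character_extend_step[OF G M(1) g] by blast
    then show ?thesis using max[OF M'(1,2)] by metis
  qed
  then obtain \<phi> where \<phi>: "\<And>g. g \<in> carrier G \<Longrightarrow> (g, \<phi> g) \<in> M" by metis
  have "\<phi> \<in> hom G QZ"
  proof (rule homI)
    show "\<phi> g \<in> carrier QZ" if "g \<in> carrier G" for g using D(2)[OF \<phi>[OF that]] .
    show "\<phi> (g \<otimes>\<^bsub>G\<^esub> h) = \<phi> g \<otimes>\<^bsub>QZ\<^esub> \<phi> h" if "g \<in> carrier G" "h \<in> carrier G" for g h
      using D(8)[OF \<phi>[OF G.m_closed[OF that]] D(5)[OF \<phi>[OF that(1)] \<phi>[OF that(2)]]] .
  qed
  moreover have "\<forall>(g, q)\<in>\<Gamma>. \<phi> g = q"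
    using \<phi> D(1,8) M(2) by blast
  ultimately show ?thesis by blast
qed

text \<open>The cogenerator property: the trivial character of H receives a nontrivial value at t
  before it is extended to all of G.\<close>

lemma character_separates:
  fixes G :: "('g, 'x) monoid_scheme"
  assumes G: "comm_group G" and H: "subgroup H G" and t: "t \<in> carrier G" "t \<notin> H"
  shows "\<exists>\<phi>\<in>hom G QZ. (\<forall>h\<in>H. \<phi> h = \<one>\<^bsub>QZ\<^esub>) \<and> \<phi> t \<noteq> \<one>\<^bsub>QZ\<^esub>"
proof -
  interpret G: comm_group G by fact
  have pc: "partial_character G (H \<times> {\<one>\<^bsub>QZ\<^esub>})"
    by (rule partial_characterI[OF G])
      (use subgroup.subset[OF H] H in \<open>auto intro: subgroup.one_closed subgroup.m_closed subgroup.m_inv_closed\<close>)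
  obtain \<Gamma> r where \<Gamma>: "partial_character G \<Gamma>" "H \<times> {\<one>\<^bsub>QZ\<^esub>} \<subseteq> \<Gamma>" "(t, r) \<in> \<Gamma>" "r \<noteq> \<one>\<^bsub>QZ\<^esub>"
    using partial_character_extend_step[OF G pc t(1)] t(2) by auto
  obtain \<phi> where \<phi>: "\<phi> \<in> hom G QZ" "\<And>g q. (g, q) \<in> \<Gamma> \<Longrightarrow> \<phi> g = q"
    using partial_character_extend[OF G \<Gamma>(1)] by blast
  then show ?thesis using \<Gamma> by (intro bexI[of _ \<phi>]) auto
qed

section \<open>Cardinalities in the universe\<close>

lemma universe_infinite: "universe TYPE('u) \<Longrightarrow> infinite (UNIV :: 'u set)"
  unfolding universe_def
  by (meson infinite_UNIV_nat lepoll_iff_finite_card lepoll_trans lesspoll_imp_lepoll finite_lepoll_infinite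
      infinite_le_lepoll)

lemma small_UN:
  fixes I :: "'u set" and X :: "'u \<Rightarrow> 'u set"
  assumes "universe TYPE('u)" "small I" "\<And>i. i \<in> I \<Longrightarrow> small (X i)"
  shows "small (\<Union>i\<in>I. X i)"
proof -
  have "\<forall>(I :: 'u set) (X :: 'u \<Rightarrow> 'u set). small I \<and> (\<forall>i\<in>I. small (X i)) \<longrightarrow> small (\<Union>i\<in>I. X i)"
    using assms(1) unfolding universe_def by (elim conjE)
  then show ?thesis using assms(2,3) by simp
qed

text \<open>The closure clauses of \<open>universe\<close> speak only of subsets of
  \<open>'u\<close>; this brings sets of other types into their range.\<close>

lemma lesspoll_small_copy:
  assumes "A \<prec> (UNIV :: 'u set)"
  obtains e where "inj_on e A" "small (e ` A :: 'u set)"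
proof -
  obtain e :: "_ \<Rightarrow> 'u" where "inj_on e A"
    using assms unfolding lesspoll_def lepoll_def by auto
  then show ?thesis
    using that[of e] assms inj_on_image_lesspoll_1 unfolding small_def by blast
qed

text \<open>The type \<open>'u\<close> carries no pairing, but being infinite it is equipollent to
  its square. Along the injection \<open>p\<close> the product becomes a union, over a small index
  set, of small copies of B, to which the union clause of \<open>universe\<close> applies.\<close>

lemma lesspoll_Times:
  assumes "universe TYPE('u)" "A \<prec> (UNIV :: 'u set)" "B \<prec> (UNIV :: 'u set)"
  shows "A \<times> B \<prec> (UNIV :: 'u set)"
proof -
  obtain e f :: "_ \<Rightarrow> 'u" where e: "inj_on e A" "small (e ` A)" and f: "inj_on f B" "small (f ` B)"
    using lesspoll_small_copy assms(2,3) by metis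
  have "(UNIV :: 'u set) \<times> (UNIV :: 'u set) \<approx> (UNIV :: 'u set)"
    using universe_infinite[OF assms(1)]
    unfolding eqpoll_iff_card_of_ordIso by (rule card_of_Times_same_infinite)
  then obtain p :: "'u \<times> 'u \<Rightarrow> 'u" where p: "inj p"
    unfolding eqpoll_def bij_betw_def UNIV_Times_UNIV by blast
  have "small (\<Union>x\<in>e ` A. (\<lambda>y. p (x, y)) ` f ` B)"
  proof -
    have "small ((\<lambda>y. p (x, y)) ` f ` B)" for x
    proof -
      have "inj_on (\<lambda>y. p (x, y)) (f ` B)" by (rule inj_onI) (use injD[OF p] in blast)
      then show ?thesis using f(2) inj_on_image_lesspoll_1 unfolding small_def by metis
    qed
    then show ?thesis by (intro small_UN[OF assms(1) e(2)])
  qed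
  moreover have "A \<times> B \<lesssim> (\<Union>x\<in>e ` A. (\<lambda>y. p (x, y)) ` f ` B)"
    unfolding lepoll_def
  proof (intro exI conjI)
    show "inj_on (\<lambda>(x, y). p (e x, f y)) (A \<times> B)"
    proof (rule inj_onI, clarify)
      fix a b a' b' assume "a \<in> A" "b \<in> B" "a' \<in> A" "b' \<in> B" and "p (e a, f b) = p (e a', f b')"
      then show "a = a' \<and> b = b'"
        using injD[OF p, of "(e a, f b)" "(e a', f b')"] inj_onD[OF e(1), of a a'] inj_onD[OF f(1), of b b']
        by simp
    qed
  qed auto
  ultimately show ?thesis unfolding small_def by (rule lesspoll_trans1[rotated])
qed

lemma lesspoll_Pow:
  assumes "universe TYPE('u)" "A \<prec> (UNIV :: 'u set)"
  shows "Pow A \<prec> (UNIV :: 'u set)"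
proof -
  obtain e :: "_ \<Rightarrow> 'u" where e: "inj_on e A" "small (e ` A)"
    using lesspoll_small_copy assms(2) by metis
  have "Pow A \<lesssim> Pow (e ` A)"
    unfolding lepoll_def
    by (intro exI[of _ "(`) e"] conjI inj_on_image_Pow e) auto
  then show ?thesis
    using e(2) assms(1) unfolding universe_def by (meson lesspoll_trans1)
qed

text \<open>Graphs embed the function space into the power set of the product.\<close>

lemma lesspoll_PiE:
  assumes "universe TYPE('u)" "A \<prec> (UNIV :: 'u set)" "B \<prec> (UNIV :: 'u set)"
  shows "A \<rightarrow>\<^sub>E B \<prec> (UNIV :: 'u set)"
proof -
  have "A \<rightarrow>\<^sub>E B \<lesssim> Pow (A \<times> B)"
    unfolding lepoll_def
  proof (intro exI conjI)
    show "inj_on (\<lambda>f. (\<lambda>x. (x, f x)) ` A) (A \<rightarrow>\<^sub>E B)"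
    proof (rule inj_onI)
      fix f g assume fg: "f \<in> A \<rightarrow>\<^sub>E B" "g \<in> A \<rightarrow>\<^sub>E B"
        and eq: "(\<lambda>x. (x, f x)) ` A = (\<lambda>x. (x, g x)) ` A"
      show "f = g"
      proof (rule PiE_ext[OF fg])
        fix x assume "x \<in> A"
        then have "(x, f x) \<in> (\<lambda>x. (x, g x)) ` A" using eq by blast
        then show "f x = g x" by auto
      qed
    qed
  qed auto
  then show ?thesis
    using lesspoll_Pow[OF assms(1) lesspoll_Times[OF assms]] by (rule lesspoll_trans1)
qed

lemma lesspoll_countable:
  assumes "universe TYPE('u)" "countable A"
  shows "A \<prec> (UNIV :: 'u set)"
proof -
  have "A \<lesssim> (UNIV :: nat set)"
    using assms(2) unfolding countable_def lepoll_def by auto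
  then show ?thesis
    using assms(1) unfolding universe_def by (meson lesspoll_trans1)
qed

section \<open>Modules and homomorphisms\<close>

lemma left_module_abelian_group: "left_module S M \<Longrightarrow> abelian_group M"
  by (rule left_module.axioms(2))

lemma modulesD:
  assumes "M \<in> modules S"
  shows "left_module S M" "abelian_group M" "small (carrier M)"
  using assms left_module_abelian_group unfolding modules_def by auto

lemma left_moduleI:
  assumes "ring S"
    and "\<zero>\<^bsub>M\<^esub> \<in> carrier M"
    and "\<And>x y. x \<in> carrier M \<Longrightarrow> y \<in> carrier M \<Longrightarrow> x \<oplus>\<^bsub>M\<^esub> y \<in> carrier M"
    and "\<And>x y z. x \<in> carrier M \<Longrightarrow> y \<in> carrier M \<Longrightarrow> z \<in> carrier M \<Longrightarrow> (x \<oplus>\<^bsub>M\<^esub> y) \<oplus>\<^bsub>M\<^esub> z = x \<oplus>\<^bsub>M\<^esub> (y \<oplus>\<^bsub>M\<^esub> z)"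
    and "\<And>x y. x \<in> carrier M \<Longrightarrow> y \<in> carrier M \<Longrightarrow> x \<oplus>\<^bsub>M\<^esub> y = y \<oplus>\<^bsub>M\<^esub> x"
    and "\<And>x. x \<in> carrier M \<Longrightarrow> \<zero>\<^bsub>M\<^esub> \<oplus>\<^bsub>M\<^esub> x = x"
    and "\<And>x. x \<in> carrier M \<Longrightarrow> \<exists>y\<in>carrier M. y \<oplus>\<^bsub>M\<^esub> x = \<zero>\<^bsub>M\<^esub>"
    and "\<And>a x. a \<in> carrier S \<Longrightarrow> x \<in> carrier M \<Longrightarrow> a \<odot>\<^bsub>M\<^esub> x \<in> carrier M"
    and "\<And>a b x. a \<in> carrier S \<Longrightarrow> b \<in> carrier S \<Longrightarrow> x \<in> carrier M \<Longrightarrow>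
      (a \<oplus>\<^bsub>S\<^esub> b) \<odot>\<^bsub>M\<^esub> x = a \<odot>\<^bsub>M\<^esub> x \<oplus>\<^bsub>M\<^esub> b \<odot>\<^bsub>M\<^esub> x"
    and "\<And>a x y. a \<in> carrier S \<Longrightarrow> x \<in> carrier M \<Longrightarrow> y \<in> carrier M \<Longrightarrow>
      a \<odot>\<^bsub>M\<^esub> (x \<oplus>\<^bsub>M\<^esub> y) = a \<odot>\<^bsub>M\<^esub> x \<oplus>\<^bsub>M\<^esub> a \<odot>\<^bsub>M\<^esub> y"
    and "\<And>a b x. a \<in> carrier S \<Longrightarrow> b \<in> carrier S \<Longrightarrow> x \<in> carrier M \<Longrightarrow>
      (a \<otimes>\<^bsub>S\<^esub> b) \<odot>\<^bsub>M\<^esub> x = a \<odot>\<^bsub>M\<^esub> (b \<odot>\<^bsub>M\<^esub> x)"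
    and "\<And>x. x \<in> carrier M \<Longrightarrow> \<one>\<^bsub>S\<^esub> \<odot>\<^bsub>M\<^esub> x = x"
  shows "left_module S M"
proof -
  have "abelian_group M"
    by (rule abelian_groupI) (use assms in auto)
  then show ?thesis
    unfolding left_module_def left_module_axioms_def using assms by blast
qed

lemma double_eq_self:
  assumes "abelian_group M" "x \<in> carrier M" "x \<oplus>\<^bsub>M\<^esub> x = x"
  shows "x = \<zero>\<^bsub>M\<^esub>"
proof -
  interpret M: abelian_group M by fact
  have "\<ominus>\<^bsub>M\<^esub> x \<oplus>\<^bsub>M\<^esub> (x \<oplus>\<^bsub>M\<^esub> x) = x"
    using assms(2) by (simp add: M.a_assoc[symmetric] M.l_neg)
  then show ?thesis using assms(2,3) by (simp add: M.l_neg)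
qed

lemma minus_eq_zero_iff:
  assumes "abelian_group M" "x \<in> carrier M" "y \<in> carrier M"
  shows "x \<ominus>\<^bsub>M\<^esub> y = \<zero>\<^bsub>M\<^esub> \<longleftrightarrow> x = y"
proof -
  interpret M: abelian_group M by fact
  have "x = x \<ominus>\<^bsub>M\<^esub> y \<oplus>\<^bsub>M\<^esub> y"
    using assms(2,3) by (simp add: a_minus_def M.a_assoc M.l_neg)
  moreover have "y \<ominus>\<^bsub>M\<^esub> y = \<zero>\<^bsub>M\<^esub>"
    using assms(3) by (simp add: a_minus_def M.r_neg)
  ultimately show ?thesis using assms(3) by (metis M.l_zero)
qed

lemma smult_zero:
  assumes "left_module S M" "r \<in> carrier S"
  shows "r \<odot>\<^bsub>M\<^esub> \<zero>\<^bsub>M\<^esub> = \<zero>\<^bsub>M\<^esub>"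
proof -
  interpret M: left_module S M by fact
  have "r \<odot>\<^bsub>M\<^esub> \<zero>\<^bsub>M\<^esub> \<oplus>\<^bsub>M\<^esub> r \<odot>\<^bsub>M\<^esub> \<zero>\<^bsub>M\<^esub> = r \<odot>\<^bsub>M\<^esub> \<zero>\<^bsub>M\<^esub>"
    using M.smult_r_distr[OF assms(2), of "\<zero>\<^bsub>M\<^esub>" "\<zero>\<^bsub>M\<^esub>"] by simp
  then show ?thesis by (intro double_eq_self M.abelian_group_axioms) (simp_all add: M.smult_closed assms(2))
qed

lemma zero_smult:
  assumes "left_module S M" "x \<in> carrier M"
  shows "\<zero>\<^bsub>S\<^esub> \<odot>\<^bsub>M\<^esub> x = \<zero>\<^bsub>M\<^esub>"
proof -
  interpret M: left_module S M by fact
  have "\<zero>\<^bsub>S\<^esub> \<odot>\<^bsub>M\<^esub> x \<oplus>\<^bsub>M\<^esub> \<zero>\<^bsub>S\<^esub> \<odot>\<^bsub>M\<^esub> x = \<zero>\<^bsub>S\<^esub> \<odot>\<^bsub>M\<^esub> x"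
    using M.smult_l_distr[of "\<zero>\<^bsub>S\<^esub>" "\<zero>\<^bsub>S\<^esub>" x] assms(2) by simp
  then show ?thesis by (intro double_eq_self M.abelian_group_axioms) (simp_all add: M.smult_closed assms(2))
qed

lemma smult_minus:
  assumes "left_module S M" "r \<in> carrier S" "x \<in> carrier M" "y \<in> carrier M"
  shows "r \<odot>\<^bsub>M\<^esub> (x \<ominus>\<^bsub>M\<^esub> y) = r \<odot>\<^bsub>M\<^esub> x \<ominus>\<^bsub>M\<^esub> r \<odot>\<^bsub>M\<^esub> y"
proof -
  interpret M: left_module S M by fact
  have "r \<odot>\<^bsub>M\<^esub> (\<ominus>\<^bsub>M\<^esub> y) \<oplus>\<^bsub>M\<^esub> r \<odot>\<^bsub>M\<^esub> y = \<zero>\<^bsub>M\<^esub>"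
    using M.smult_r_distr[of r "\<ominus>\<^bsub>M\<^esub> y" y] assms smult_zero[OF assms(1,2)] by (simp add: M.l_neg)
  then have "r \<odot>\<^bsub>M\<^esub> (\<ominus>\<^bsub>M\<^esub> y) = \<ominus>\<^bsub>M\<^esub> (r \<odot>\<^bsub>M\<^esub> y)"
    using assms M.smult_closed by (metis M.M.minus_equality M.a_inv_closed)
  then show ?thesis
    using M.smult_r_distr[of r x "\<ominus>\<^bsub>M\<^esub> y"] assms by (simp add: a_minus_def)
qed

lemma mod_homI:
  assumes "\<And>x. x \<in> carrier M \<Longrightarrow> f x \<in> carrier N"
    and "\<And>x y. x \<in> carrier M \<Longrightarrow> y \<in> carrier M \<Longrightarrow> f (x \<oplus>\<^bsub>M\<^esub> y) = f x \<oplus>\<^bsub>N\<^esub> f y"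
    and "\<And>r x. r \<in> carrier S \<Longrightarrow> x \<in> carrier M \<Longrightarrow> f (r \<odot>\<^bsub>M\<^esub> x) = r \<odot>\<^bsub>N\<^esub> f x"
  shows "f \<in> mod_hom S M N"
  using assms unfolding mod_hom_def by blast

lemma mod_homD:
  assumes "f \<in> mod_hom S M N"
  shows "\<And>x. x \<in> carrier M \<Longrightarrow> f x \<in> carrier N"
    and "\<And>x y. x \<in> carrier M \<Longrightarrow> y \<in> carrier M \<Longrightarrow> f (x \<oplus>\<^bsub>M\<^esub> y) = f x \<oplus>\<^bsub>N\<^esub> f y"
    and "\<And>r x. r \<in> carrier S \<Longrightarrow> x \<in> carrier M \<Longrightarrow> f (r \<odot>\<^bsub>M\<^esub> x) = r \<odot>\<^bsub>N\<^esub> f x"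
  using assms unfolding mod_hom_def by blast+

lemma mod_hom_zero:
  assumes "f \<in> mod_hom S M N" "abelian_group M" "abelian_group N"
  shows "f \<zero>\<^bsub>M\<^esub> = \<zero>\<^bsub>N\<^esub>"
proof -
  interpret M: abelian_group M by fact
  interpret N: abelian_group N by fact
  have "f \<zero>\<^bsub>M\<^esub> \<oplus>\<^bsub>N\<^esub> f \<zero>\<^bsub>M\<^esub> = f \<zero>\<^bsub>M\<^esub>"
    using mod_homD(2)[OF assms(1), of "\<zero>\<^bsub>M\<^esub>" "\<zero>\<^bsub>M\<^esub>"] by simp
  then show ?thesis by (intro double_eq_self assms(3)) (simp_all add: mod_homD(1)[OF assms(1)])
qed

lemma mod_hom_uminus:
  assumes "f \<in> mod_hom S M N" "abelian_group M" "abelian_group N" "x \<in> carrier M"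
  shows "f (\<ominus>\<^bsub>M\<^esub> x) = \<ominus>\<^bsub>N\<^esub> f x"
proof -
  interpret M: abelian_group M by fact
  interpret N: abelian_group N by fact
  have "f (\<ominus>\<^bsub>M\<^esub> x) \<oplus>\<^bsub>N\<^esub> f x = \<zero>\<^bsub>N\<^esub>"
    using mod_homD(2)[OF assms(1), of "\<ominus>\<^bsub>M\<^esub> x" x] assms(4) mod_hom_zero[OF assms(1-3)]
    by (simp add: M.l_neg)
  then show ?thesis
    using mod_homD(1)[OF assms(1)] assms(4) by (metis N.minus_equality M.a_inv_closed)
qed

lemma mod_hom_minus:
  assumes "f \<in> mod_hom S M N" "abelian_group M" "abelian_group N" "x \<in> carrier M" "y \<in> carrier M"
  shows "f (x \<ominus>\<^bsub>M\<^esub> y) = f x \<ominus>\<^bsub>N\<^esub> f y"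
proof -
  interpret M: abelian_group M by fact
  show ?thesis
    using mod_homD(2)[OF assms(1), of x "\<ominus>\<^bsub>M\<^esub> y"] mod_hom_uminus[OF assms(1-3)] assms(4,5)
    by (simp add: a_minus_def)
qed

lemma mod_hom_comp:
  assumes "f \<in> mod_hom S M N" "g \<in> mod_hom S N P"
  shows "g \<circ> f \<in> mod_hom S M P"
  using assms unfolding mod_hom_def by (auto simp: Pi_iff)

lemma mod_hom_id: "id \<in> mod_hom S M M"
  unfolding mod_hom_def by auto

lemma mod_hom_restrict:
  assumes "left_module S M" "f \<in> mod_hom S M N"
  shows "restrict f (carrier M) \<in> mod_hom S M N"
proof -
  interpret M: left_module S M by fact
  show ?thesis using assms(2) M.smult_closed unfolding mod_hom_def by auto
qed

lemma mod_hom_op_ring [simp]: "mod_hom (op_ring S) M N = mod_hom S M N"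
  unfolding mod_hom_def op_ring_def by simp

lemma short_exact_op_ring [simp]: "short_exact (op_ring S) A f B g C = short_exact S A f B g C"
  unfolding short_exact_def by simp

lemma isomorphic_op_ring [simp]: "isomorphic (op_ring S) M N = isomorphic S M N"
  unfolding isomorphic_def by simp

lemma carrier_op_ring [simp]: "carrier (op_ring S) = carrier S"
  unfolding op_ring_def by simp

lemma ring_op_ring: "ring S \<Longrightarrow> ring (op_ring S)"
proof -
  assume "ring S"
  then interpret S: ring S .
  show "ring (op_ring S)"
  proof (rule ringI)
    show "abelian_group (op_ring S)"
      by (rule abelian_groupI)
        (auto simp: op_ring_def S.a_assoc intro: S.a_comm S.add.l_inv_ex)
    show "monoid (op_ring S)"
      by (rule monoidI) (auto simp: op_ring_def S.m_assoc)
  qed (auto simp: op_ring_def S.l_distr S.r_distr)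
qed

lemma inv_mod_hom:
  assumes "left_module S M" "left_module S N" "f \<in> mod_hom S M N" "bij_betw f (carrier M) (carrier N)"
  shows "inv_into (carrier M) f \<in> mod_hom S N M"
proof -
  interpret M: left_module S M by fact
  interpret N: left_module S N by fact
  let ?g = "inv_into (carrier M) f"
  have img: "f ` carrier M = carrier N" and inj: "inj_on f (carrier M)"
    using assms(4) unfolding bij_betw_def by auto
  have c: "?g x \<in> carrier M" and fg: "f (?g x) = x" if "x \<in> carrier N" for x
    using that img by (auto intro: inv_into_into f_inv_into_f)
  have gf: "?g (f x) = x" if "x \<in> carrier M" for x
    using that inj by simp
  show ?thesis
  proof (rule mod_homI)
    fix x y assume "x \<in> carrier N" "y \<in> carrier N"
    then show "?g (x \<oplus>\<^bsub>N\<^esub> y) = ?g x \<oplus>\<^bsub>M\<^esub> ?g y"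
      using gf[of "?g x \<oplus>\<^bsub>M\<^esub> ?g y"] mod_homD(2)[OF assms(3)] c fg by simp
  next
    fix r x assume "r \<in> carrier S" "x \<in> carrier N"
    then show "?g (r \<odot>\<^bsub>N\<^esub> x) = r \<odot>\<^bsub>M\<^esub> ?g x"
      using gf[of "r \<odot>\<^bsub>M\<^esub> ?g x"] mod_homD(3)[OF assms(3)] c fg M.smult_closed by simp
  qed (rule c)
qed

lemma inverse_mod_homE:
  assumes "left_module S M" "left_module S N" "f \<in> mod_hom S M N" "bij_betw f (carrier M) (carrier N)"
  obtains g where "g \<in> mod_hom S N M" "\<And>x. x \<in> carrier M \<Longrightarrow> g (f x) = x" "\<And>y. y \<in> carrier N \<Longrightarrow> f (g y) = y"
  using that[OF inv_mod_hom[OF assms]] bij_betw_inv_into_left[OF assms(4)] bij_betw_inv_into_right[OF assms(4)]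
  by blast

lemma isomorphic_sym:
  assumes "left_module S M" "left_module S N" "isomorphic S M N"
  shows "isomorphic S N M"
  using assms inv_mod_hom bij_betw_inv_into unfolding isomorphic_def by metis

lemma isomorphic_trans:
  assumes "isomorphic S M N" "isomorphic S N P"
  shows "isomorphic S M P"
  using assms mod_hom_comp bij_betw_trans unfolding isomorphic_def by metis

section \<open>Short exact sequences\<close>

lemma short_exactI:
  assumes "f \<in> mod_hom S A B" "g \<in> mod_hom S B C" "inj_on f (carrier A)"
    and "\<And>x. x \<in> carrier A \<Longrightarrow> g (f x) = \<zero>\<^bsub>C\<^esub>"
    and "\<And>y. y \<in> carrier B \<Longrightarrow> g y = \<zero>\<^bsub>C\<^esub> \<Longrightarrow> \<exists>x\<in>carrier A. y = f x"
    and "\<And>z. z \<in> carrier C \<Longrightarrow> \<exists>y\<in>carrier B. z = g y"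
  shows "short_exact S A f B g C"
  unfolding short_exact_def a_kernel_def' image_def
  using assms mod_homD(1)[OF assms(1)] mod_homD(1)[OF assms(2)] by blast

lemma short_exactD:
  assumes "short_exact S A f B g C"
  shows "f \<in> mod_hom S A B" "g \<in> mod_hom S B C" "inj_on f (carrier A)"
    and "\<And>x. x \<in> carrier A \<Longrightarrow> f x \<in> carrier B"
    and "\<And>x. x \<in> carrier B \<Longrightarrow> g x \<in> carrier C"
    and "\<And>x. x \<in> carrier A \<Longrightarrow> g (f x) = \<zero>\<^bsub>C\<^esub>"
    and "\<And>y. y \<in> carrier B \<Longrightarrow> g y = \<zero>\<^bsub>C\<^esub> \<Longrightarrow> \<exists>x\<in>carrier A. y = f x"
    and "\<And>z. z \<in> carrier C \<Longrightarrow> \<exists>y\<in>carrier B. z = g y"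
    and "\<And>x y. x \<in> carrier A \<Longrightarrow> y \<in> carrier A \<Longrightarrow> f x = f y \<Longrightarrow> x = y"
proof -
  show fh: "f \<in> mod_hom S A B" and gh: "g \<in> mod_hom S B C" and "inj_on f (carrier A)"
    using assms unfolding short_exact_def by auto
  then show "\<And>x y. x \<in> carrier A \<Longrightarrow> y \<in> carrier A \<Longrightarrow> f x = f y \<Longrightarrow> x = y"
    by (auto dest: inj_onD)
  show "\<And>x. x \<in> carrier A \<Longrightarrow> f x \<in> carrier B" "\<And>x. x \<in> carrier B \<Longrightarrow> g x \<in> carrier C"
    using fh gh by (auto dest: mod_homD(1))
  have "f ` carrier A = {x \<in> carrier B. g x = \<zero>\<^bsub>C\<^esub>}" "g ` carrier B = carrier C"
    using assms unfolding short_exact_def a_kernel_def' by auto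
  then show "\<And>x. x \<in> carrier A \<Longrightarrow> g (f x) = \<zero>\<^bsub>C\<^esub>"
    "\<And>y. y \<in> carrier B \<Longrightarrow> g y = \<zero>\<^bsub>C\<^esub> \<Longrightarrow> \<exists>x\<in>carrier A. y = f x"
    "\<And>z. z \<in> carrier C \<Longrightarrow> \<exists>y\<in>carrier B. z = g y"
    by blast+
qed

lemma short_exact_factor:
  assumes "short_exact S A f B g C" "left_module S A" "left_module S B" "left_module S X"
    and "h \<in> mod_hom S X B" "\<And>x. x \<in> carrier X \<Longrightarrow> g (h x) = \<zero>\<^bsub>C\<^esub>"
  shows "\<exists>k\<in>mod_hom S X A. \<forall>x\<in>carrier X. f (k x) = h x"
proof -
  note E = short_exactD[OF assms(1)]
  interpret A: left_module S A by fact
  interpret X: left_module S X by fact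
  have "\<exists>a. a \<in> carrier A \<and> f a = h x" if "x \<in> carrier X" for x
    using E(7)[OF mod_homD(1)[OF assms(5) that] assms(6)[OF that]] by auto
  then obtain k where k: "\<And>x. x \<in> carrier X \<Longrightarrow> k x \<in> carrier A \<and> f (k x) = h x"
    by metis
  have "k \<in> mod_hom S X A"
  proof (rule mod_homI)
    fix x y assume xy: "x \<in> carrier X" "y \<in> carrier X"
    show "k (x \<oplus>\<^bsub>X\<^esub> y) = k x \<oplus>\<^bsub>A\<^esub> k y"
      by (rule E(9)) (use xy k mod_homD(2)[OF assms(5)] mod_homD(2)[OF E(1)] in auto)
  next
    fix r x assume rx: "r \<in> carrier S" "x \<in> carrier X"
    show "k (r \<odot>\<^bsub>X\<^esub> x) = r \<odot>\<^bsub>A\<^esub> k x"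
      by (rule E(9)) (use rx k A.smult_closed X.smult_closed mod_homD(3)[OF assms(5)] mod_homD(3)[OF E(1)] in auto)
  qed (use k in auto)
  then show ?thesis using k by blast
qed

text \<open>The universal property of a cokernel, for an arbitrary surjection g, because quotients
  appear here only as copies on \<open>'u\<close>.\<close>

lemma mod_hom_descend:
  assumes "left_module S B" "left_module S C" "left_module S D"
    and g: "g \<in> mod_hom S B C" "\<And>z. z \<in> carrier C \<Longrightarrow> \<exists>y\<in>carrier B. z = g y"
    and h: "h \<in> mod_hom S B D" "\<And>y. y \<in> carrier B \<Longrightarrow> g y = \<zero>\<^bsub>C\<^esub> \<Longrightarrow> h y = \<zero>\<^bsub>D\<^esub>"
  shows "\<exists>k\<in>mod_hom S C D. \<forall>y\<in>carrier B. k (g y) = h y"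
proof -
  interpret B: left_module S B by fact
  interpret C: left_module S C by fact
  interpret D: left_module S D by fact
  obtain s where s: "\<And>z. z \<in> carrier C \<Longrightarrow> s z \<in> carrier B \<and> g (s z) = z"
    using g(2) by metis
  have eq: "h y = h y'" if "y \<in> carrier B" "y' \<in> carrier B" "g y = g y'" for y y'
  proof -
    have "g (y \<ominus>\<^bsub>B\<^esub> y') = \<zero>\<^bsub>C\<^esub>"
      using that mod_hom_minus[OF g(1) B.abelian_group_axioms C.abelian_group_axioms]
        mod_homD(1)[OF g(1)] minus_eq_zero_iff[OF C.abelian_group_axioms] by simp
    then have "h y \<ominus>\<^bsub>D\<^esub> h y' = \<zero>\<^bsub>D\<^esub>"
      using that h(2)[of "y \<ominus>\<^bsub>B\<^esub> y'"] mod_hom_minus[OF h(1) B.abelian_group_axioms D.abelian_group_axioms]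
      by auto
    then show ?thesis using that mod_homD(1)[OF h(1)] minus_eq_zero_iff[OF D.abelian_group_axioms] by auto
  qed
  have k: "h (s (g y)) = h y" if "y \<in> carrier B" for y
    using eq s mod_homD(1)[OF g(1)] that by metis
  have "h \<circ> s \<in> mod_hom S C D"
  proof (rule mod_homI)
    fix x y assume xy: "x \<in> carrier C" "y \<in> carrier C"
    have "h (s (x \<oplus>\<^bsub>C\<^esub> y)) = h (s x \<oplus>\<^bsub>B\<^esub> s y)"
      by (rule eq) (use xy s mod_homD(2)[OF g(1)] in auto)
    then show "(h \<circ> s) (x \<oplus>\<^bsub>C\<^esub> y) = (h \<circ> s) x \<oplus>\<^bsub>D\<^esub> (h \<circ> s) y"
      using xy s mod_homD(2)[OF h(1)] by auto
  next
    fix r x assume rx: "r \<in> carrier S" "x \<in> carrier C"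
    have "h (s (r \<odot>\<^bsub>C\<^esub> x)) = h (r \<odot>\<^bsub>B\<^esub> s x)"
      by (rule eq) (use rx s mod_homD(3)[OF g(1)] B.smult_closed C.smult_closed in auto)
    then show "(h \<circ> s) (r \<odot>\<^bsub>C\<^esub> x) = r \<odot>\<^bsub>D\<^esub> (h \<circ> s) x"
      using rx s mod_homD(3)[OF h(1)] by auto
  qed (use s mod_homD(1)[OF h(1)] in auto)
  then show ?thesis using k by (intro bexI[of _ "h \<circ> s"]) auto
qed

section \<open>Submodules, quotients and direct sums\<close>

text \<open>Closure under negatives comes from the action of -1, see
  \<open>submod_uminus\<close>.\<close>

definition submod :: "'r ring \<Rightarrow> ('r, 'a) module \<Rightarrow> 'a set \<Rightarrow> bool" where
  "submod S M K \<longleftrightarrow> K \<subseteq> carrier M \<and> \<zero>\<^bsub>M\<^esub> \<in> K \<and> (\<forall>x\<in>K. \<forall>y\<in>K. x \<oplus>\<^bsub>M\<^esub> y \<in> K) \<and>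
     (\<forall>r\<in>carrier S. \<forall>x\<in>K. r \<odot>\<^bsub>M\<^esub> x \<in> K)"

lemma submod_uminus:
  assumes "left_module S M" "submod S M K" "x \<in> K"
  shows "\<ominus>\<^bsub>M\<^esub> x \<in> K"
proof -
  interpret M: left_module S M by fact
  have x: "x \<in> carrier M" and K: "(\<ominus>\<^bsub>S\<^esub> \<one>\<^bsub>S\<^esub>) \<odot>\<^bsub>M\<^esub> x \<in> K"
    using assms(2,3) unfolding submod_def by auto
  have "(\<ominus>\<^bsub>S\<^esub> \<one>\<^bsub>S\<^esub>) \<odot>\<^bsub>M\<^esub> x \<oplus>\<^bsub>M\<^esub> x = (\<ominus>\<^bsub>S\<^esub> \<one>\<^bsub>S\<^esub> \<oplus>\<^bsub>S\<^esub> \<one>\<^bsub>S\<^esub>) \<odot>\<^bsub>M\<^esub> x"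
    using x M.smult_l_distr[of "\<ominus>\<^bsub>S\<^esub> \<one>\<^bsub>S\<^esub>" "\<one>\<^bsub>S\<^esub>" x] M.smult_one by simp
  then have "(\<ominus>\<^bsub>S\<^esub> \<one>\<^bsub>S\<^esub>) \<odot>\<^bsub>M\<^esub> x = \<ominus>\<^bsub>M\<^esub> x"
    using x M.smult_closed zero_smult[OF assms(1)] by (simp add: M.R.l_neg M.M.minus_equality)
  then show ?thesis using K by simp
qed

lemma submod_minus:
  assumes "left_module S M" "submod S M K" "x \<in> K" "y \<in> K"
  shows "x \<ominus>\<^bsub>M\<^esub> y \<in> K"
  using submod_uminus[OF assms(1,2,4)] assms(2,3) unfolding submod_def a_minus_def by auto

lemma left_module_submod:
  assumes "left_module S M" "submod S M K"
  shows "left_module S (M\<lparr>carrier := K\<rparr>)"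
proof -
  interpret M: left_module S M by fact
  have K: "K \<subseteq> carrier M" using assms(2) unfolding submod_def by auto
  show ?thesis
  proof (rule left_moduleI)
    fix x assume "x \<in> carrier (M\<lparr>carrier := K\<rparr>)"
    then show "\<exists>y\<in>carrier (M\<lparr>carrier := K\<rparr>). y \<oplus>\<^bsub>M\<lparr>carrier := K\<rparr>\<^esub> x = \<zero>\<^bsub>M\<lparr>carrier := K\<rparr>\<^esub>"
      using submod_uminus[OF assms] K by (auto intro!: bexI[of _ "\<ominus>\<^bsub>M\<^esub> x"] simp: M.l_neg)
  qed (use assms(2) K M.R.ring_axioms in \<open>auto simp: submod_def M.M.a_assoc M.smult_r_distr M.smult_l_distr
      M.smult_assoc1 M.smult_one subset_iff intro: M.M.a_comm\<close>)
qed

lemma submod_kernel: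
  assumes "left_module S M" "left_module S N" "f \<in> mod_hom S M N"
  shows "submod S M (a_kernel M N f)"
proof -
  interpret M: left_module S M by fact
  interpret N: left_module S N by fact
  show ?thesis
    using mod_homD[OF assms(3)] mod_hom_zero[OF assms(3) M.abelian_group_axioms N.abelian_group_axioms]
      smult_zero[OF assms(2)] M.smult_closed
    unfolding submod_def a_kernel_def' by auto
qed

lemma submod_image:
  assumes "left_module S M" "left_module S N" "f \<in> mod_hom S M N"
  shows "submod S N (f ` carrier M)"
proof -
  interpret M: left_module S M by fact
  interpret N: left_module S N by fact
  have "\<zero>\<^bsub>N\<^esub> \<in> f ` carrier M"
    using mod_hom_zero[OF assms(3) M.abelian_group_axioms N.abelian_group_axioms]
    by (metis M.M.zero_closed image_eqI)
  then show ?thesis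
    unfolding submod_def
  proof (intro conjI ballI)
    fix x y assume "x \<in> f ` carrier M" "y \<in> f ` carrier M"
    then obtain a b where "a \<in> carrier M" "b \<in> carrier M" "x = f a" "y = f b" by blast
    then show "x \<oplus>\<^bsub>N\<^esub> y \<in> f ` carrier M"
      by (intro image_eqI[of _ _ "a \<oplus>\<^bsub>M\<^esub> b"]) (simp_all add: mod_homD(2)[OF assms(3)])
  next
    fix r x assume "r \<in> carrier S" "x \<in> f ` carrier M"
    then obtain a where "a \<in> carrier M" "x = f a" "r \<in> carrier S" by blast
    then show "r \<odot>\<^bsub>N\<^esub> x \<in> f ` carrier M"
      by (intro image_eqI[of _ _ "r \<odot>\<^bsub>M\<^esub> a"]) (simp_all add: mod_homD(3)[OF assms(3)] M.smult_closed)
  qed (use mod_homD(1)[OF assms(3)] in auto)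
qed

text \<open>Meaningful when the fibres of \<open>\<phi>\<close> form a congruence; covers copies on another type as well as quotients.\<close>

definition image_module :: "('a \<Rightarrow> 'b) \<Rightarrow> ('r, 'a) module \<Rightarrow> ('r, 'b) module" where
  "image_module \<phi> M = (let s = inv_into (carrier M) \<phi> in
     \<lparr>carrier = \<phi> ` carrier M, monoid.mult = undefined, one = undefined, ring.zero = \<phi> \<zero>\<^bsub>M\<^esub>,
      ring.add = (\<lambda>a b. \<phi> (s a \<oplus>\<^bsub>M\<^esub> s b)), smult = (\<lambda>r a. \<phi> (r \<odot>\<^bsub>M\<^esub> s a))\<rparr>)"

lemma image_module:
  assumes "left_module S M"
    and add: "\<And>x x' y y'. \<lbrakk>x \<in> carrier M; x' \<in> carrier M; y \<in> carrier M; y' \<in> carrier M;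
        \<phi> x = \<phi> x'; \<phi> y = \<phi> y'\<rbrakk> \<Longrightarrow> \<phi> (x \<oplus>\<^bsub>M\<^esub> y) = \<phi> (x' \<oplus>\<^bsub>M\<^esub> y')"
    and smult: "\<And>r x x'. \<lbrakk>r \<in> carrier S; x \<in> carrier M; x' \<in> carrier M; \<phi> x = \<phi> x'\<rbrakk> \<Longrightarrow>
        \<phi> (r \<odot>\<^bsub>M\<^esub> x) = \<phi> (r \<odot>\<^bsub>M\<^esub> x')"
  shows "left_module S (image_module \<phi> M)" "\<phi> \<in> mod_hom S M (image_module \<phi> M)"
proof -
  interpret M: left_module S M by fact
  let ?s = "inv_into (carrier M) \<phi>" and ?N = "image_module \<phi> M"
  have c: "carrier ?N = \<phi> ` carrier M" and z: "\<zero>\<^bsub>?N\<^esub> = \<phi> \<zero>\<^bsub>M\<^esub>"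
    unfolding image_module_def by (simp_all add: Let_def)
  have s: "?s (\<phi> x) \<in> carrier M" "\<phi> (?s (\<phi> x)) = \<phi> x" if "x \<in> carrier M" for x
    using that by (auto intro: inv_into_into f_inv_into_f)
  have a: "\<phi> x \<oplus>\<^bsub>?N\<^esub> \<phi> y = \<phi> (x \<oplus>\<^bsub>M\<^esub> y)" if "x \<in> carrier M" "y \<in> carrier M" for x y
    using add[OF s(1)[OF that(1)] that(1) s(1)[OF that(2)] that(2) s(2)[OF that(1)] s(2)[OF that(2)]]
    unfolding image_module_def by (simp add: Let_def)
  have m: "r \<odot>\<^bsub>?N\<^esub> \<phi> x = \<phi> (r \<odot>\<^bsub>M\<^esub> x)" if "r \<in> carrier S" "x \<in> carrier M" for r x
    using smult[OF that(1) s(1)[OF that(2)] that(2) s(2)[OF that(2)]]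
    unfolding image_module_def by (simp add: Let_def)
  show "left_module S ?N"
  proof (rule left_moduleI)
    fix x assume "x \<in> carrier ?N"
    then obtain y where y: "y \<in> carrier M" "x = \<phi> y" using c by auto
    then show "\<exists>y\<in>carrier ?N. y \<oplus>\<^bsub>?N\<^esub> x = \<zero>\<^bsub>?N\<^esub>"
      using c z a by (intro bexI[of _ "\<phi> (\<ominus>\<^bsub>M\<^esub> y)"]) (auto simp: M.l_neg)
  qed (use M.R.ring_axioms in \<open>auto simp: c z a m M.smult_closed M.M.a_assoc M.smult_r_distr M.smult_l_distr
      M.smult_assoc1 M.smult_one intro!: arg_cong[where f = \<phi>] M.M.a_comm\<close>)
  show "\<phi> \<in> mod_hom S M ?N"
    by (rule mod_homI) (auto simp: c a m)
qed

text \<open>Cosets would live on the type of sets. Instead each coset is represented by a chosen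
  element \<open>rep\<close>, and the representatives are moved into \<open>'u\<close> by an
  injection, so that the quotient is a member of \<open>modules S\<close> itself.\<close>

lemma quotient_exists:
  fixes M :: "('u, 'b) module"
  assumes M: "left_module S M" "carrier M \<prec> (UNIV :: 'u set)" and K: "submod S M K"
  obtains C g where "C \<in> modules (S :: 'u ring)" "g \<in> mod_hom S M C" "g ` carrier M = carrier C"
    "\<And>x. x \<in> carrier M \<Longrightarrow> g x = \<zero>\<^bsub>C\<^esub> \<longleftrightarrow> x \<in> K"
proof -
  interpret M: left_module S M by fact
  have Kc: "K \<subseteq> carrier M" using K unfolding submod_def by auto
  have K1: "x \<oplus>\<^bsub>M\<^esub> y \<in> K" if "x \<in> K" "y \<in> K" for x y using K that unfolding submod_def by auto
  have K2: "r \<odot>\<^bsub>M\<^esub> x \<in> K" if "r \<in> carrier S" "x \<in> K" for x r using K that unfolding submod_def by auto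
  obtain e :: "'b \<Rightarrow> 'u" where e: "inj_on e (carrier M)" using lesspoll_small_copy[OF M(2)] by metis
  define rep where "rep x = (SOME y. y \<in> carrier M \<and> x \<ominus>\<^bsub>M\<^esub> y \<in> K)" for x
  have rep: "rep x \<in> carrier M \<and> x \<ominus>\<^bsub>M\<^esub> rep x \<in> K" if "x \<in> carrier M" for x
  proof -
    have "x \<ominus>\<^bsub>M\<^esub> x \<in> K" using that K minus_eq_zero_iff[OF M.abelian_group_axioms, of x x]
      unfolding submod_def by simp
    then show ?thesis unfolding rep_def using that by (metis (mono_tags, lifting) someI)
  qed
  have rep_eq: "rep x = rep y \<longleftrightarrow> x \<ominus>\<^bsub>M\<^esub> y \<in> K" if xy: "x \<in> carrier M" "y \<in> carrier M" for x y
  proof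
    assume "rep x = rep y"
    moreover have "x \<ominus>\<^bsub>M\<^esub> rep x \<ominus>\<^bsub>M\<^esub> (y \<ominus>\<^bsub>M\<^esub> rep y) \<in> K"
      using submod_minus[OF M(1) K] rep xy by blast
    moreover have "x \<ominus>\<^bsub>M\<^esub> a \<ominus>\<^bsub>M\<^esub> (y \<ominus>\<^bsub>M\<^esub> a) = x \<ominus>\<^bsub>M\<^esub> y" if "a \<in> carrier M" for a
      using that xy M.M.a_lcomm[of a x "\<ominus>\<^bsub>M\<^esub> a \<oplus>\<^bsub>M\<^esub> \<ominus>\<^bsub>M\<^esub> y"]
      by (simp add: a_minus_def M.M.minus_add M.M.a_ac M.M.r_neg2)
    ultimately show "x \<ominus>\<^bsub>M\<^esub> y \<in> K" using rep xy by metis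
  next
    assume xyK: "x \<ominus>\<^bsub>M\<^esub> y \<in> K"
    \<comment> \<open>For congruent x and y the predicates under the choice operator are equivalent,
      so the very same representative is chosen.\<close>
    have "x \<ominus>\<^bsub>M\<^esub> z \<in> K \<longleftrightarrow> y \<ominus>\<^bsub>M\<^esub> z \<in> K" if z: "z \<in> carrier M" for z
    proof -
      have "x \<ominus>\<^bsub>M\<^esub> z = (x \<ominus>\<^bsub>M\<^esub> y) \<oplus>\<^bsub>M\<^esub> (y \<ominus>\<^bsub>M\<^esub> z)"
        using xy z by (simp add: a_minus_def M.M.a_ac M.M.r_neg1 M.M.r_neg2)
      moreover have "y \<ominus>\<^bsub>M\<^esub> z = (x \<ominus>\<^bsub>M\<^esub> z) \<ominus>\<^bsub>M\<^esub> (x \<ominus>\<^bsub>M\<^esub> y)"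
        using xy z by (simp add: a_minus_def M.M.minus_add M.M.a_ac M.M.r_neg1 M.M.r_neg2)
      ultimately show ?thesis using K1 xyK submod_minus[OF M(1) K] by metis
    qed
    then show "rep x = rep y" unfolding rep_def by metis
  qed
  define \<phi> where "\<phi> = e \<circ> rep"
  have \<phi>: "\<phi> x = \<phi> y \<longleftrightarrow> x \<ominus>\<^bsub>M\<^esub> y \<in> K" if "x \<in> carrier M" "y \<in> carrier M" for x y
    using rep_eq[OF that] inj_on_eq_iff[OF e, of "rep x" "rep y"] rep that unfolding \<phi>_def by simp
  have add: "\<phi> (x \<oplus>\<^bsub>M\<^esub> y) = \<phi> (x' \<oplus>\<^bsub>M\<^esub> y')"
    if c: "x \<in> carrier M" "x' \<in> carrier M" "y \<in> carrier M" "y' \<in> carrier M"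
      and eq: "\<phi> x = \<phi> x'" "\<phi> y = \<phi> y'" for x x' y y'
  proof -
    have "(x \<ominus>\<^bsub>M\<^esub> x') \<oplus>\<^bsub>M\<^esub> (y \<ominus>\<^bsub>M\<^esub> y') = (x \<oplus>\<^bsub>M\<^esub> y) \<ominus>\<^bsub>M\<^esub> (x' \<oplus>\<^bsub>M\<^esub> y')"
      using c by (simp add: a_minus_def M.M.minus_add M.M.a_ac)
    then have "(x \<oplus>\<^bsub>M\<^esub> y) \<ominus>\<^bsub>M\<^esub> (x' \<oplus>\<^bsub>M\<^esub> y') \<in> K"
      using K1 \<phi>[OF c(1,2)] \<phi>[OF c(3,4)] eq by metis
    then show ?thesis using \<phi>[of "x \<oplus>\<^bsub>M\<^esub> y" "x' \<oplus>\<^bsub>M\<^esub> y'"] c by simp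
  qed
  have smult: "\<phi> (r \<odot>\<^bsub>M\<^esub> x) = \<phi> (r \<odot>\<^bsub>M\<^esub> x')"
    if "r \<in> carrier S" "x \<in> carrier M" "x' \<in> carrier M" "\<phi> x = \<phi> x'" for r x x'
    using K2[OF that(1), of "x \<ominus>\<^bsub>M\<^esub> x'"] \<phi>[OF that(2,3)] that(4) smult_minus[OF M(1) that(1-3)]
      \<phi>[OF M.smult_closed[OF that(1,2)] M.smult_closed[OF that(1,3)]] by simp
  have C: "left_module S (image_module \<phi> M)" "\<phi> \<in> mod_hom S M (image_module \<phi> M)"
    by (rule image_module[OF M(1)], fact add, fact smult)+
  have im: "carrier (image_module \<phi> M) = \<phi> ` carrier M"
    unfolding image_module_def by (simp add: Let_def)
  have "small (\<phi> ` carrier M)"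
    unfolding small_def using image_lepoll M(2) by (rule lesspoll_trans1)
  then have "image_module \<phi> M \<in> modules S" using C(1) by (simp add: modules_def im)
  moreover have "\<phi> x = \<zero>\<^bsub>image_module \<phi> M\<^esub> \<longleftrightarrow> x \<in> K" if "x \<in> carrier M" for x
  proof -
    have "\<zero>\<^bsub>image_module \<phi> M\<^esub> = \<phi> \<zero>\<^bsub>M\<^esub>" unfolding image_module_def by (simp add: Let_def)
    moreover have "x \<ominus>\<^bsub>M\<^esub> \<zero>\<^bsub>M\<^esub> = x" using that by (simp add: a_minus_def)
    ultimately show ?thesis using \<phi>[of x "\<zero>\<^bsub>M\<^esub>"] that by simp
  qed
  ultimately show ?thesis using that[of "image_module \<phi> M" \<phi>] C(2) im by blast
qed

text \<open>A copy is the quotient by the zero submodule, which \<open>quotient_exists\<close>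
  already places on \<open>'u\<close>.\<close>

lemma copy_exists:
  fixes M :: "('u, 'b) module"
  assumes M: "left_module S M" "carrier M \<prec> (UNIV :: 'u set)"
  obtains N \<phi> where "N \<in> modules (S :: 'u ring)" "\<phi> \<in> mod_hom S M N" "bij_betw \<phi> (carrier M) (carrier N)"
proof -
  interpret M: left_module S M by fact
  have "submod S M {\<zero>\<^bsub>M\<^esub>}" unfolding submod_def using smult_zero[OF M(1)] by auto
  then obtain N \<phi> where N: "N \<in> modules S" "\<phi> \<in> mod_hom S M N" "\<phi> ` carrier M = carrier N"
    "\<And>x. x \<in> carrier M \<Longrightarrow> \<phi> x = \<zero>\<^bsub>N\<^esub> \<longleftrightarrow> x \<in> {\<zero>\<^bsub>M\<^esub>}"
    using quotient_exists[OF M] by metis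
  have "inj_on \<phi> (carrier M)"
  proof (rule inj_onI)
    fix x y assume xy: "x \<in> carrier M" "y \<in> carrier M" "\<phi> x = \<phi> y"
    interpret N: abelian_group N using modulesD[OF N(1)] by simp
    have "\<phi> (x \<ominus>\<^bsub>M\<^esub> y) = \<zero>\<^bsub>N\<^esub>"
      using xy mod_hom_minus[OF N(2) M.abelian_group_axioms N.abelian_group_axioms] mod_homD(1)[OF N(2)]
        minus_eq_zero_iff[OF N.abelian_group_axioms] by simp
    then show "x = y" using N(4)[of "x \<ominus>\<^bsub>M\<^esub> y"] xy minus_eq_zero_iff[OF M.abelian_group_axioms] by simp
  qed
  then show ?thesis using that[OF N(1,2)] N(3) unfolding bij_betw_def by blast
qed

lemma left_module_dirsum:
  assumes "left_module S M" "left_module S N"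
  shows "left_module S (dirsum M N)"
proof -
  interpret M: left_module S M by fact
  interpret N: left_module S N by fact
  show ?thesis
  proof (rule left_moduleI)
    fix x assume "x \<in> carrier (dirsum M N)"
    then show "\<exists>y\<in>carrier (dirsum M N). y \<oplus>\<^bsub>dirsum M N\<^esub> x = \<zero>\<^bsub>dirsum M N\<^esub>"
      by (intro bexI[of _ "(\<ominus>\<^bsub>M\<^esub> fst x, \<ominus>\<^bsub>N\<^esub> snd x)"]) (auto simp: dirsum_def M.M.l_neg N.M.l_neg)
  qed (auto simp: dirsum_def M.M.a_assoc M.smult_closed M.smult_r_distr M.smult_l_distr
      M.smult_assoc1 M.smult_one N.M.a_assoc N.smult_closed N.smult_r_distr N.smult_l_distr
      N.smult_assoc1 N.smult_one M.R.ring_axioms intro: M.M.a_comm N.M.a_comm)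
qed

section \<open>Constructions with short exact sequences\<close>

lemma small_subset: "A \<subseteq> B \<Longrightarrow> small B \<Longrightarrow> small A"
  unfolding small_def by (meson lesspoll_trans1 subset_imp_lepoll)

lemma submod_modules:
  assumes "M \<in> modules S" "submod S M K"
  shows "M\<lparr>carrier := K\<rparr> \<in> modules S"
  using left_module_submod[OF modulesD(1)[OF assms(1)] assms(2)] modulesD(3)[OF assms(1)] assms(2) small_subset
  unfolding modules_def submod_def by auto

lemma kernel_exists:
  assumes "B \<in> modules S" "C \<in> modules S" "g \<in> mod_hom S B C" "g ` carrier B = carrier C"
  obtains K where "K \<in> modules S" "short_exact S K id B g C"
proof
  let ?K = "B\<lparr>carrier := a_kernel B C g\<rparr>"
  show "?K \<in> modules S"
    using submod_modules submod_kernel modulesD assms by metis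
  show "short_exact S ?K id B g C"
    by (rule short_exactI) (use assms in \<open>auto simp: a_kernel_def' mod_hom_def\<close>)
qed

lemma cokernel_exists:
  fixes S :: "'u ring"
  assumes "A \<in> modules S" "B \<in> modules S" "f \<in> mod_hom S A B" "inj_on f (carrier A)"
  obtains C g where "C \<in> modules S" "short_exact S A f B g C"
proof -
  have "carrier B \<prec> (UNIV :: 'u set)" using modulesD(3)[OF assms(2)] unfolding small_def .
  then obtain C g where C: "C \<in> modules S" "g \<in> mod_hom S B C" "g ` carrier B = carrier C"
    "\<And>x. x \<in> carrier B \<Longrightarrow> g x = \<zero>\<^bsub>C\<^esub> \<longleftrightarrow> x \<in> f ` carrier A"
    by (rule quotient_exists[OF modulesD(1)[OF assms(2)] _ submod_image[OF modulesD(1)[OF assms(1)] modulesD(1)[OF assms(2)] assms(3)]])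
      blast
  have "short_exact S A f B g C"
    by (rule short_exactI) (use assms C mod_homD(1)[OF assms(3)] in auto)
  then show ?thesis using that C(1) by blast
qed

lemma modules_dirsum_small:
  assumes "universe TYPE('u)" "M \<in> modules (S :: 'u ring)" "N \<in> modules S"
  shows "carrier (dirsum M N) \<prec> (UNIV :: 'u set)"
  using lesspoll_Times[OF assms(1)] modulesD(3)[OF assms(2)] modulesD(3)[OF assms(3)]
  unfolding dirsum_def small_def by simp

text \<open>The fibre product inside the direct sum, copied to \<open>'u\<close>. The kernel of each
  projection is the kernel of the opposite map, which gives both exact rows; the last three clauses
  record the commuting squares.\<close>

lemma pullback_exists:
  fixes S :: "'u ring"
  assumes U: "universe TYPE('u)" and mods: "A \<in> modules S" "B \<in> modules S" "A' \<in> modules S" "B' \<in> modules S" "C \<in> modules S"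
    and ex: "short_exact S A f B g C" "short_exact S A' f' B' g' C"
  obtains Q i i' p p' where "Q \<in> modules S" "short_exact S A i Q p' B'" "short_exact S A' i' Q p B"
    "\<And>x. x \<in> carrier Q \<Longrightarrow> g (p x) = g' (p' x)" "\<And>x. x \<in> carrier A \<Longrightarrow> p (i x) = f x"
    "\<And>x. x \<in> carrier A' \<Longrightarrow> p' (i' x) = f' x"
proof -
  note E = short_exactD[OF ex(1)] and E' = short_exactD[OF ex(2)]
  interpret A: left_module S A using modulesD(1)[OF mods(1)] .
  interpret B: left_module S B using modulesD(1)[OF mods(2)] .
  interpret A': left_module S A' using modulesD(1)[OF mods(3)] .
  interpret B': left_module S B' using modulesD(1)[OF mods(4)] .
  interpret C: left_module S C using modulesD(1)[OF mods(5)] .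
  note g0 = mod_hom_zero[OF E(2) B.abelian_group_axioms C.abelian_group_axioms]
    mod_hom_zero[OF E'(2) B'.abelian_group_axioms C.abelian_group_axioms]
    mod_hom_zero[OF E(1) A.abelian_group_axioms B.abelian_group_axioms]
    mod_hom_zero[OF E'(1) A'.abelian_group_axioms B'.abelian_group_axioms]
  define K where "K = {(x, y). x \<in> carrier B \<and> y \<in> carrier B' \<and> g x = g' y}"
  let ?D = "dirsum B B'"
  let ?P = "?D\<lparr>carrier := K\<rparr>"
  have D: "left_module S ?D" by (rule left_module_dirsum) (rule B.left_module_axioms, rule B'.left_module_axioms)
  have KD: "K \<subseteq> carrier ?D" unfolding K_def dirsum_def by auto
  have sub: "submod S ?D K"
    unfolding submod_def using KD
    by (auto simp: K_def dirsum_def g0 mod_homD(2,3)[OF E(2)] mod_homD(2,3)[OF E'(2)] B.smult_closed B'.smult_closed)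
  have P: "left_module S ?P" by (rule left_module_submod[OF D sub])
  have "carrier ?P \<prec> (UNIV :: 'u set)"
    using modules_dirsum_small[OF U mods(2,4)] KD by (auto intro: lesspoll_trans1 subset_imp_lepoll)
  then obtain Q \<phi> where Q: "Q \<in> modules S" "\<phi> \<in> mod_hom S ?P Q" "bij_betw \<phi> (carrier ?P) (carrier Q)"
    by (rule copy_exists[OF P])
  obtain \<psi> where \<psi>: "\<psi> \<in> mod_hom S Q ?P" and \<psi>\<phi>: "\<And>x. x \<in> K \<Longrightarrow> \<psi> (\<phi> x) = x"
      and \<phi>\<psi>: "\<And>x. x \<in> carrier Q \<Longrightarrow> \<phi> (\<psi> x) = x"
    by (rule inverse_mod_homE[OF P modulesD(1)[OF Q(1)] Q(2,3)]) (simp | blast)+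
  have \<psi>K: "\<psi> x \<in> K" if "x \<in> carrier Q" for x using mod_homD(1)[OF \<psi> that] by simp
  have \<phi>K: "\<phi> x \<in> carrier Q" if "x \<in> K" for x using mod_homD(1)[OF Q(2)] that by simp
  have fst: "fst \<in> mod_hom S ?P B" and snd: "snd \<in> mod_hom S ?P B'"
    unfolding mod_hom_def K_def dirsum_def by auto
  have i: "(\<lambda>x. (f x, \<zero>\<^bsub>B'\<^esub>)) \<in> mod_hom S A ?P"
    by (rule mod_homI) (auto simp: K_def dirsum_def E(4,6) g0 mod_homD[OF E(1)] smult_zero[OF B'.left_module_axioms])
  have i': "(\<lambda>x. (\<zero>\<^bsub>B\<^esub>, f' x)) \<in> mod_hom S A' ?P"
    by (rule mod_homI) (auto simp: K_def dirsum_def E'(4,6) g0 mod_homD[OF E'(1)] smult_zero[OF B.left_module_axioms])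
  have iK: "(f x, \<zero>\<^bsub>B'\<^esub>) \<in> K" if "x \<in> carrier A" for x using mod_homD(1)[OF i that] by simp
  have iK': "(\<zero>\<^bsub>B\<^esub>, f' x) \<in> K" if "x \<in> carrier A'" for x using mod_homD(1)[OF i' that] by simp
  show ?thesis
  proof (rule that[of Q "\<phi> \<circ> (\<lambda>x. (f x, \<zero>\<^bsub>B'\<^esub>))" "snd \<circ> \<psi>" "\<phi> \<circ> (\<lambda>x. (\<zero>\<^bsub>B\<^esub>, f' x))" "fst \<circ> \<psi>"])
    show "Q \<in> modules S" by (rule Q(1))
    show "short_exact S A (\<phi> \<circ> (\<lambda>x. (f x, \<zero>\<^bsub>B'\<^esub>))) Q (snd \<circ> \<psi>) B'"
    proof (rule short_exactI)
      show "inj_on (\<phi> \<circ> (\<lambda>x. (f x, \<zero>\<^bsub>B'\<^esub>))) (carrier A)"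
      proof (rule inj_onI)
        fix x y assume xy: "x \<in> carrier A" "y \<in> carrier A"
          "(\<phi> \<circ> (\<lambda>x. (f x, \<zero>\<^bsub>B'\<^esub>))) x = (\<phi> \<circ> (\<lambda>x. (f x, \<zero>\<^bsub>B'\<^esub>))) y"
        then have "\<psi> (\<phi> (f x, \<zero>\<^bsub>B'\<^esub>)) = \<psi> (\<phi> (f y, \<zero>\<^bsub>B'\<^esub>))" by simp
        then have "f x = f y" using \<psi>\<phi> iK xy by auto
        then show "x = y" using E(9) xy by blast
      qed
    next
      fix y assume y: "y \<in> carrier Q" "(snd \<circ> \<psi>) y = \<zero>\<^bsub>B'\<^esub>"
      have yK: "fst (\<psi> y) \<in> carrier B" "g (fst (\<psi> y)) = \<zero>\<^bsub>C\<^esub>"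
        using \<psi>K[OF y(1)] y(2) g0 by (auto simp: K_def)
      then obtain x where x: "x \<in> carrier A" "fst (\<psi> y) = f x" using E(7) by blast
      then have "\<psi> y = (f x, \<zero>\<^bsub>B'\<^esub>)" using y(2) by (cases "\<psi> y") auto
      then show "\<exists>x\<in>carrier A. y = (\<phi> \<circ> (\<lambda>x. (f x, \<zero>\<^bsub>B'\<^esub>))) x"
        using x(1) \<phi>\<psi>[OF y(1)] by auto
    next
      fix z assume z: "z \<in> carrier B'"
      then obtain b where "b \<in> carrier B" "g' z = g b" using E(8) E'(5) by metis
      then have "(b, z) \<in> K" using z by (simp add: K_def)
      then show "\<exists>y\<in>carrier Q. z = (snd \<circ> \<psi>) y"
        by (intro bexI[of _ "\<phi> (b, z)"]) (auto simp: \<psi>\<phi> \<phi>K)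
    qed (use mod_hom_comp[OF i Q(2)] mod_hom_comp[OF \<psi> snd] in \<open>auto simp: \<psi>\<phi> iK\<close>)
    show "short_exact S A' (\<phi> \<circ> (\<lambda>x. (\<zero>\<^bsub>B\<^esub>, f' x))) Q (fst \<circ> \<psi>) B"
    proof (rule short_exactI)
      show "inj_on (\<phi> \<circ> (\<lambda>x. (\<zero>\<^bsub>B\<^esub>, f' x))) (carrier A')"
      proof (rule inj_onI)
        fix x y assume xy: "x \<in> carrier A'" "y \<in> carrier A'"
          "(\<phi> \<circ> (\<lambda>x. (\<zero>\<^bsub>B\<^esub>, f' x))) x = (\<phi> \<circ> (\<lambda>x. (\<zero>\<^bsub>B\<^esub>, f' x))) y"
        then have "\<psi> (\<phi> (\<zero>\<^bsub>B\<^esub>, f' x)) = \<psi> (\<phi> (\<zero>\<^bsub>B\<^esub>, f' y))" by simp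
        then have "f' x = f' y" using \<psi>\<phi> iK' xy by auto
        then show "x = y" using E'(9) xy by blast
      qed
    next
      fix y assume y: "y \<in> carrier Q" "(fst \<circ> \<psi>) y = \<zero>\<^bsub>B\<^esub>"
      have yK: "snd (\<psi> y) \<in> carrier B'" "g' (snd (\<psi> y)) = \<zero>\<^bsub>C\<^esub>"
        using \<psi>K[OF y(1)] y(2) g0 by (auto simp: K_def)
      then obtain x where x: "x \<in> carrier A'" "snd (\<psi> y) = f' x" using E'(7) by blast
      then have "\<psi> y = (\<zero>\<^bsub>B\<^esub>, f' x)" using y(2) by (cases "\<psi> y") auto
      then show "\<exists>x\<in>carrier A'. y = (\<phi> \<circ> (\<lambda>x. (\<zero>\<^bsub>B\<^esub>, f' x))) x"
        using x(1) \<phi>\<psi>[OF y(1)] by auto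
    next
      fix z assume z: "z \<in> carrier B"
      then obtain b where "b \<in> carrier B'" "g z = g' b" using E'(8) E(5) by metis
      then have "(z, b) \<in> K" using z by (simp add: K_def)
      then show "\<exists>y\<in>carrier Q. z = (fst \<circ> \<psi>) y"
        by (intro bexI[of _ "\<phi> (z, b)"]) (auto simp: \<psi>\<phi> \<phi>K)
    qed (use mod_hom_comp[OF i' Q(2)] mod_hom_comp[OF \<psi> fst] in \<open>auto simp: \<psi>\<phi> iK'\<close>)
    show "\<And>x. x \<in> carrier Q \<Longrightarrow> g ((fst \<circ> \<psi>) x) = g' ((snd \<circ> \<psi>) x)"
      using \<psi>K by (force simp: K_def)
  qed (auto simp: \<psi>\<phi> iK iK')
qed

text \<open>The quotient of the direct sum by the antidiagonal image of A. Each leg is injective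
  because the map opposite to it is, and has the same cokernel as that map.\<close>

lemma pushout_exists:
  fixes S :: "'u ring"
  assumes U: "universe TYPE('u)" and mods: "A \<in> modules S" "B \<in> modules S" "C \<in> modules S" "B' \<in> modules S" "C' \<in> modules S"
    and ex: "short_exact S A f B g C" "short_exact S A f' B' g' C'"
  obtains P i i' p p' where "P \<in> modules S" "short_exact S B' i P p C" "short_exact S B i' P p' C'"
proof -
  note E = short_exactD[OF ex(1)] and E' = short_exactD[OF ex(2)]
  interpret A: left_module S A using modulesD(1)[OF mods(1)] .
  interpret B: left_module S B using modulesD(1)[OF mods(2)] .
  interpret C: left_module S C using modulesD(1)[OF mods(3)] .
  interpret B': left_module S B' using modulesD(1)[OF mods(4)] .
  interpret C': left_module S C' using modulesD(1)[OF mods(5)] .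
  note fA = mod_hom_zero[OF E(1) A.abelian_group_axioms B.abelian_group_axioms]
    mod_hom_zero[OF E'(1) A.abelian_group_axioms B'.abelian_group_axioms]
  note gB = mod_hom_zero[OF E(2) B.abelian_group_axioms C.abelian_group_axioms]
    mod_hom_zero[OF E'(2) B'.abelian_group_axioms C'.abelian_group_axioms]
  let ?D = "dirsum B B'"
  let ?d = "\<lambda>x. (f x, \<ominus>\<^bsub>B'\<^esub> f' x)"
  have D: "left_module S ?D" by (rule left_module_dirsum) (rule B.left_module_axioms, rule B'.left_module_axioms)
  interpret D: left_module S ?D by (rule D)
  have d: "?d \<in> mod_hom S A ?D"
  proof (rule mod_homI)
    fix r x assume rx: "r \<in> carrier S" "x \<in> carrier A"
    have "f' (r \<odot>\<^bsub>A\<^esub> (\<ominus>\<^bsub>A\<^esub> x)) = r \<odot>\<^bsub>B'\<^esub> (\<ominus>\<^bsub>B'\<^esub> f' x)"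
      using rx mod_homD(3)[OF E'(1)] mod_hom_uminus[OF E'(1) A.abelian_group_axioms B'.abelian_group_axioms] by simp
    moreover have "r \<odot>\<^bsub>A\<^esub> (\<ominus>\<^bsub>A\<^esub> x) = \<ominus>\<^bsub>A\<^esub> (r \<odot>\<^bsub>A\<^esub> x)"
      using smult_minus[OF A.left_module_axioms rx(1), of "\<zero>\<^bsub>A\<^esub>" x] rx smult_zero[OF A.left_module_axioms]
      by (simp add: a_minus_def A.smult_closed)
    ultimately show "?d (r \<odot>\<^bsub>A\<^esub> x) = r \<odot>\<^bsub>?D\<^esub> ?d x"
      using rx mod_homD(3)[OF E(1)] mod_hom_uminus[OF E'(1) A.abelian_group_axioms B'.abelian_group_axioms]
      by (auto simp: dirsum_def A.smult_closed)
  qed (auto simp: dirsum_def E(4) E'(4) mod_homD(2)[OF E(1)] mod_homD(2)[OF E'(1)] B'.M.minus_add)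
  obtain P q where P: "P \<in> modules S" "q \<in> mod_hom S ?D P" "q ` carrier ?D = carrier P"
    and q0: "\<And>x. x \<in> carrier ?D \<Longrightarrow> q x = \<zero>\<^bsub>P\<^esub> \<longleftrightarrow> x \<in> ?d ` carrier A"
    by (rule quotient_exists[OF D modules_dirsum_small[OF U mods(2,4)] submod_image[OF A.left_module_axioms D d]])
      blast
  interpret P: left_module S P using modulesD(1)[OF P(1)] .
  have onto: "\<exists>y\<in>carrier ?D. z = q y" if "z \<in> carrier P" for z using P(3) that by blast
  have iB: "(\<lambda>x. (x, \<zero>\<^bsub>B'\<^esub>)) \<in> mod_hom S B ?D"
    by (rule mod_homI) (auto simp: dirsum_def smult_zero[OF B'.left_module_axioms])
  have iB': "(\<lambda>x. (\<zero>\<^bsub>B\<^esub>, x)) \<in> mod_hom S B' ?D"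
    by (rule mod_homI) (auto simp: dirsum_def smult_zero[OF B.left_module_axioms])
  have gf: "g \<circ> fst \<in> mod_hom S ?D C" and gf': "g' \<circ> snd \<in> mod_hom S ?D C'"
    by (rule_tac [!] mod_hom_comp[OF _ E(2)] mod_hom_comp[OF _ E'(2)]) (auto simp: mod_hom_def dirsum_def)
  have "\<exists>p\<in>mod_hom S P C. \<forall>y\<in>carrier ?D. p (q y) = (g \<circ> fst) y"
    by (rule mod_hom_descend[OF D P.left_module_axioms C.left_module_axioms P(2) onto gf])
      (use q0 E(6) in auto)
  then obtain p where p: "p \<in> mod_hom S P C" "\<And>x y. x \<in> carrier B \<Longrightarrow> y \<in> carrier B' \<Longrightarrow> p (q (x, y)) = g x"
    by (auto simp: dirsum_def)
  have "\<exists>p\<in>mod_hom S P C'. \<forall>y\<in>carrier ?D. p (q y) = (g' \<circ> snd) y"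
    by (rule mod_hom_descend[OF D P.left_module_axioms C'.left_module_axioms P(2) onto gf'])
      (use q0 E'(4,6) mod_hom_uminus[OF E'(2) B'.abelian_group_axioms C'.abelian_group_axioms]
        in \<open>auto simp: C'.M.add.inv_one\<close>)
  then obtain p' where p': "p' \<in> mod_hom S P C'" "\<And>x y. x \<in> carrier B \<Longrightarrow> y \<in> carrier B' \<Longrightarrow> p' (q (x, y)) = g' y"
    by (auto simp: dirsum_def)
  \<comment> \<open>Classes do not change along the antidiagonal, so a component of a representative
    can be cleared as soon as it lies in the image of A.\<close>
  have shift: "q (x, y) = q (x \<oplus>\<^bsub>B\<^esub> f a, y \<ominus>\<^bsub>B'\<^esub> f' a)"
    if "x \<in> carrier B" "y \<in> carrier B'" "a \<in> carrier A" for x y a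
  proof -
    have "?d a \<in> carrier ?D" by (rule mod_homD(1)[OF d that(3)])
    then have "q (?d a) = \<zero>\<^bsub>P\<^esub>" using q0 that(3) by blast
    moreover have "(x, y) \<in> carrier ?D" using that by (simp add: dirsum_def)
    ultimately have "q ((x, y) \<oplus>\<^bsub>?D\<^esub> ?d a) = q (x, y)"
      using mod_homD(1,2)[OF P(2)] \<open>?d a \<in> carrier ?D\<close> by simp
    then show ?thesis by (simp add: dirsum_def a_minus_def)
  qed
  show ?thesis
  proof (rule that[OF P(1)])
    show "short_exact S B' (q \<circ> (\<lambda>x. (\<zero>\<^bsub>B\<^esub>, x))) P p C"
    proof (rule short_exactI)
      show "inj_on (q \<circ> (\<lambda>x. (\<zero>\<^bsub>B\<^esub>, x))) (carrier B')"
      proof (rule inj_onI)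
        fix x y assume xy: "x \<in> carrier B'" "y \<in> carrier B'"
          "(q \<circ> (\<lambda>x. (\<zero>\<^bsub>B\<^esub>, x))) x = (q \<circ> (\<lambda>x. (\<zero>\<^bsub>B\<^esub>, x))) y"
        let ?h = "q \<circ> (\<lambda>x. (\<zero>\<^bsub>B\<^esub>, x))"
        have h: "?h \<in> mod_hom S B' P" by (rule mod_hom_comp[OF iB' P(2)])
        have "?h (x \<ominus>\<^bsub>B'\<^esub> y) = \<zero>\<^bsub>P\<^esub>"
          using mod_hom_minus[OF h B'.abelian_group_axioms P.abelian_group_axioms xy(1,2)] xy
            minus_eq_zero_iff[OF P.abelian_group_axioms] mod_homD(1)[OF h] by simp
        then have "(\<zero>\<^bsub>B\<^esub>, x \<ominus>\<^bsub>B'\<^esub> y) \<in> ?d ` carrier A"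
          using q0[of "(\<zero>\<^bsub>B\<^esub>, x \<ominus>\<^bsub>B'\<^esub> y)"] xy by (simp add: dirsum_def)
        then obtain a where a: "a \<in> carrier A" "\<zero>\<^bsub>B\<^esub> = f a" "x \<ominus>\<^bsub>B'\<^esub> y = \<ominus>\<^bsub>B'\<^esub> f' a" by auto
        then have "a = \<zero>\<^bsub>A\<^esub>" using E(9)[of a "\<zero>\<^bsub>A\<^esub>"] fA by simp
        then have "x \<ominus>\<^bsub>B'\<^esub> y = \<zero>\<^bsub>B'\<^esub>" using a fA by (simp add: B'.M.add.inv_one)
        then show "x = y" using xy minus_eq_zero_iff[OF B'.abelian_group_axioms] by simp
      qed
    next
      fix z assume z: "z \<in> carrier P" "p z = \<zero>\<^bsub>C\<^esub>"
      then obtain x y where xy: "x \<in> carrier B" "y \<in> carrier B'" "z = q (x, y)"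
        using onto[OF z(1)] by (auto simp: dirsum_def)
      then have "g x = \<zero>\<^bsub>C\<^esub>" using z(2) p(2) by simp
      then obtain a where a: "a \<in> carrier A" "x = f a" using E(7) xy by blast
      have "z = q (x \<oplus>\<^bsub>B\<^esub> f (\<ominus>\<^bsub>A\<^esub> a), y \<ominus>\<^bsub>B'\<^esub> f' (\<ominus>\<^bsub>A\<^esub> a))"
        using shift[of x y "\<ominus>\<^bsub>A\<^esub> a"] xy a by simp
      also have "x \<oplus>\<^bsub>B\<^esub> f (\<ominus>\<^bsub>A\<^esub> a) = \<zero>\<^bsub>B\<^esub>"
        using a E(4) mod_hom_uminus[OF E(1) A.abelian_group_axioms B.abelian_group_axioms] by (simp add: B.M.r_neg)
      finally show "\<exists>x\<in>carrier B'. z = (q \<circ> (\<lambda>x. (\<zero>\<^bsub>B\<^esub>, x))) x"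
        using xy a E'(4) by (intro bexI[of _ "y \<ominus>\<^bsub>B'\<^esub> f' (\<ominus>\<^bsub>A\<^esub> a)"]) auto
    next
      fix z assume "z \<in> carrier C"
      then obtain x where "x \<in> carrier B" "z = g x" using E(8) by blast
      then show "\<exists>y\<in>carrier P. z = p y"
        using p(2)[of x "\<zero>\<^bsub>B'\<^esub>"] mod_homD(1)[OF P(2), of "(x, \<zero>\<^bsub>B'\<^esub>)"]
        by (intro bexI[of _ "q (x, \<zero>\<^bsub>B'\<^esub>)"]) (auto simp: dirsum_def)
    qed (use mod_hom_comp[OF iB' P(2)] p gB in auto)
    show "short_exact S B (q \<circ> (\<lambda>x. (x, \<zero>\<^bsub>B'\<^esub>))) P p' C'"
    proof (rule short_exactI)
      show "inj_on (q \<circ> (\<lambda>x. (x, \<zero>\<^bsub>B'\<^esub>))) (carrier B)"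
      proof (rule inj_onI)
        fix x y assume xy: "x \<in> carrier B" "y \<in> carrier B"
          "(q \<circ> (\<lambda>x. (x, \<zero>\<^bsub>B'\<^esub>))) x = (q \<circ> (\<lambda>x. (x, \<zero>\<^bsub>B'\<^esub>))) y"
        let ?h = "q \<circ> (\<lambda>x. (x, \<zero>\<^bsub>B'\<^esub>))"
        have h: "?h \<in> mod_hom S B P" by (rule mod_hom_comp[OF iB P(2)])
        have "?h (x \<ominus>\<^bsub>B\<^esub> y) = \<zero>\<^bsub>P\<^esub>"
          using mod_hom_minus[OF h B.abelian_group_axioms P.abelian_group_axioms xy(1,2)] xy
            minus_eq_zero_iff[OF P.abelian_group_axioms] mod_homD(1)[OF h] by simp
        then have "(x \<ominus>\<^bsub>B\<^esub> y, \<zero>\<^bsub>B'\<^esub>) \<in> ?d ` carrier A"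
          using q0[of "(x \<ominus>\<^bsub>B\<^esub> y, \<zero>\<^bsub>B'\<^esub>)"] xy by (simp add: dirsum_def)
        then obtain a where a: "a \<in> carrier A" "x \<ominus>\<^bsub>B\<^esub> y = f a" "\<zero>\<^bsub>B'\<^esub> = \<ominus>\<^bsub>B'\<^esub> f' a" by auto
        then have "f' a = \<ominus>\<^bsub>B'\<^esub> \<zero>\<^bsub>B'\<^esub>" using B'.M.minus_minus[OF E'(4)[OF a(1)]] by simp
        then have "f' a = \<zero>\<^bsub>B'\<^esub>" by (simp add: B'.M.add.inv_one)
        then have "a = \<zero>\<^bsub>A\<^esub>" using a E'(9)[of a "\<zero>\<^bsub>A\<^esub>"] fA by simp
        then have "x \<ominus>\<^bsub>B\<^esub> y = \<zero>\<^bsub>B\<^esub>" using a fA by simp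
        then show "x = y" using xy minus_eq_zero_iff[OF B.abelian_group_axioms] by simp
      qed
    next
      fix z assume z: "z \<in> carrier P" "p' z = \<zero>\<^bsub>C'\<^esub>"
      then obtain x y where xy: "x \<in> carrier B" "y \<in> carrier B'" "z = q (x, y)"
        using onto[OF z(1)] by (auto simp: dirsum_def)
      then have "g' y = \<zero>\<^bsub>C'\<^esub>" using z(2) p'(2) by simp
      then obtain a where a: "a \<in> carrier A" "y = f' a" using E'(7) xy by blast
      have "z = q (x \<oplus>\<^bsub>B\<^esub> f a, y \<ominus>\<^bsub>B'\<^esub> f' a)"
        using shift[of x y a] xy a by simp
      also have "y \<ominus>\<^bsub>B'\<^esub> f' a = \<zero>\<^bsub>B'\<^esub>"
        using a E'(4) minus_eq_zero_iff[OF B'.abelian_group_axioms] by simp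
      finally show "\<exists>y\<in>carrier B. z = (q \<circ> (\<lambda>x. (x, \<zero>\<^bsub>B'\<^esub>))) y"
        using xy a E(4) by (intro bexI[of _ "x \<oplus>\<^bsub>B\<^esub> f a"]) auto
    next
      fix z assume "z \<in> carrier C'"
      then obtain y where "y \<in> carrier B'" "z = g' y" using E'(8) by blast
      then show "\<exists>y\<in>carrier P. z = p' y"
        using p'(2)[of "\<zero>\<^bsub>B\<^esub>" y] mod_homD(1)[OF P(2), of "(\<zero>\<^bsub>B\<^esub>, y)"]
        by (intro bexI[of _ "q (\<zero>\<^bsub>B\<^esub>, y)"]) (auto simp: dirsum_def)
    qed (use mod_hom_comp[OF iB P(2)] p' gB in auto)
  qed
qed

text \<open>W is the preimage of K under b, and b maps it onto K with the old kernel N. Applied to a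
  cover C of Q, this yields a cover of the submodule K with the same syzygy.\<close>

lemma kernel_comp_exists:
  assumes mods: "N \<in> modules S" "C \<in> modules S" "Q \<in> modules S" "K \<in> modules S" "X \<in> modules S"
    and ex: "short_exact S N a C b Q" "short_exact S K c Q d X"
  obtains W n v where "W \<in> modules S" "short_exact S W id C (d \<circ> b) X" "short_exact S N n W v K"
    "\<And>x. x \<in> carrier N \<Longrightarrow> n x = a x" "\<And>x. x \<in> carrier W \<Longrightarrow> c (v x) = b x"
proof -
  note E = short_exactD[OF ex(1)] and F = short_exactD[OF ex(2)]
  have db: "d \<circ> b \<in> mod_hom S C X" by (rule mod_hom_comp[OF E(2) F(2)])
  have "(d \<circ> b) ` carrier C = carrier X"
    using ex unfolding short_exact_def by (simp only: image_comp[symmetric])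
  then obtain W where W: "W \<in> modules S" "short_exact S W id C (d \<circ> b) X"
    by (rule kernel_exists[OF mods(2,5) db])
  note G = short_exactD[OF W(2)]
  interpret Q: left_module S Q using modulesD(1)[OF mods(3)] .
  interpret X: left_module S X using modulesD(1)[OF mods(5)] .
  have bW: "b \<in> mod_hom S W Q" using mod_hom_comp[OF G(1) E(2)] by simp
  obtain v where v: "v \<in> mod_hom S W K" "\<And>x. x \<in> carrier W \<Longrightarrow> c (v x) = b x"
    using short_exact_factor[OF ex(2) modulesD(1)[OF mods(4)] modulesD(1)[OF mods(3)] modulesD(1)[OF W(1)] bW]
      G(6) by auto
  have da0: "(d \<circ> b) (a x) = \<zero>\<^bsub>X\<^esub>" if "x \<in> carrier N" for x
    using E(6)[OF that] mod_hom_zero[OF F(2) Q.abelian_group_axioms X.abelian_group_axioms] by simp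
  obtain n where n: "n \<in> mod_hom S N W" "\<And>x. x \<in> carrier N \<Longrightarrow> n x = a x"
    using short_exact_factor[OF W(2) modulesD(1)[OF W(1)] modulesD(1)[OF mods(2)] modulesD(1)[OF mods(1)] E(1) da0]
    by auto
  have "short_exact S N n W v K"
  proof (rule short_exactI)
    show "inj_on n (carrier N)" using n(2) E(9) by (auto intro!: inj_onI)
    fix x assume x: "x \<in> carrier N"
    have "c (v (n x)) = c \<zero>\<^bsub>K\<^esub>"
      using v(2)[OF mod_homD(1)[OF n(1) x]] n(2)[OF x] E(6)[OF x]
        mod_hom_zero[OF F(1) modulesD(2)[OF mods(4)] Q.abelian_group_axioms] by simp
    then show "v (n x) = \<zero>\<^bsub>K\<^esub>"
      using F(9) mod_homD(1)[OF v(1) mod_homD(1)[OF n(1) x]]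
        abelian_groupE(2)[OF modulesD(2)[OF mods(4)]] by blast
  next
    fix y assume y: "y \<in> carrier W" "v y = \<zero>\<^bsub>K\<^esub>"
    then have "b y = \<zero>\<^bsub>Q\<^esub>"
      using v(2)[OF y(1)] mod_hom_zero[OF F(1) modulesD(2)[OF mods(4)] Q.abelian_group_axioms] by simp
    then show "\<exists>x\<in>carrier N. y = n x" using E(7)[of y] G(4)[OF y(1)] n(2) by auto
  next
    fix z assume z: "z \<in> carrier K"
    then obtain y where y: "y \<in> carrier C" "c z = b y" using E(8) F(4) by blast
    then have "(d \<circ> b) y = \<zero>\<^bsub>X\<^esub>" using F(6)[OF z] by simp
    then obtain w where "w \<in> carrier W" "y = id w" using G(7)[OF y(1)] by blast
    then show "\<exists>y\<in>carrier W. z = v y"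
      using v y(2) F(9)[OF z mod_homD(1)[OF v(1)]] by auto
  qed (use n v in auto)
  then show ?thesis using that W n(2) v(2) by blast
qed

text \<open>The third isomorphism theorem with Q = L/K: M = G/K embeds into it with quotient L/G =
  H. The square in the last clause makes m the pushout of j along g, from which purity will be
  inherited.\<close>

lemma cokernel_comp_exists:
  fixes S :: "'u ring"
  assumes mods: "K \<in> modules S" "G \<in> modules S" "M \<in> modules S" "L \<in> modules S" "H \<in> modules S"
    and ex: "short_exact S K f G g M" "short_exact S G j L q H"
  obtains Q r m s where "Q \<in> modules S" "short_exact S K (j \<circ> f) L r Q" "short_exact S M m Q s H"
    "\<And>x. x \<in> carrier G \<Longrightarrow> m (g x) = r (j x)"
proof -
  note E = short_exactD[OF ex(1)] and F = short_exactD[OF ex(2)]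
  have jf: "j \<circ> f \<in> mod_hom S K L" by (rule mod_hom_comp[OF E(1) F(1)])
  have "inj_on (j \<circ> f) (carrier K)" using E(4,9) F(9) by (auto intro!: inj_onI)
  then obtain Q r where Q: "Q \<in> modules S" "short_exact S K (j \<circ> f) L r Q"
    by (rule cokernel_exists[OF mods(1,4) jf])
  note Z = short_exactD[OF Q(2)]
  have rj: "r \<circ> j \<in> mod_hom S G Q" by (rule mod_hom_comp[OF F(1) Z(2)])
  have "\<exists>m\<in>mod_hom S M Q. \<forall>y\<in>carrier G. m (g y) = (r \<circ> j) y"
  proof (rule mod_hom_descend[OF modulesD(1)[OF mods(2)] modulesD(1)[OF mods(3)] modulesD(1)[OF Q(1)] E(2) E(8) rj])
    fix y assume "y \<in> carrier G" "g y = \<zero>\<^bsub>M\<^esub>"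
    then show "(r \<circ> j) y = \<zero>\<^bsub>Q\<^esub>" using E(7)[of y] Z(6) by auto
  qed
  then obtain m where m: "m \<in> mod_hom S M Q" "\<And>y. y \<in> carrier G \<Longrightarrow> m (g y) = r (j y)" by auto
  have "\<exists>s\<in>mod_hom S Q H. \<forall>y\<in>carrier L. s (r y) = q y"
  proof (rule mod_hom_descend[OF modulesD(1)[OF mods(4)] modulesD(1)[OF Q(1)] modulesD(1)[OF mods(5)] Z(2) Z(8) F(2)])
    fix y assume "y \<in> carrier L" "r y = \<zero>\<^bsub>Q\<^esub>"
    then show "q y = \<zero>\<^bsub>H\<^esub>" using Z(7)[of y] E(4) F(6) by auto
  qed
  then obtain s where s: "s \<in> mod_hom S Q H" "\<And>y. y \<in> carrier L \<Longrightarrow> s (r y) = q y" by auto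
  have kernel: "x = \<zero>\<^bsub>M\<^esub>" if x: "x \<in> carrier M" "m x = \<zero>\<^bsub>Q\<^esub>" for x
  proof -
    obtain y where y: "y \<in> carrier G" "x = g y" using E(8)[OF x(1)] by blast
    then have "r (j y) = \<zero>\<^bsub>Q\<^esub>" using m(2) x(2) by simp
    then obtain k where k: "k \<in> carrier K" "j y = j (f k)" using Z(7)[OF F(4)[OF y(1)]] by auto
    then have "y = f k" using F(9) y E(4) by blast
    then show ?thesis using E(6) k y by simp
  qed
  have "short_exact S M m Q s H"
  proof (rule short_exactI)
    show "inj_on m (carrier M)"
    proof (rule inj_onI)
      fix x y assume xy: "x \<in> carrier M" "y \<in> carrier M" "m x = m y"
      have "m (x \<ominus>\<^bsub>M\<^esub> y) = \<zero>\<^bsub>Q\<^esub>"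
        using mod_hom_minus[OF m(1) modulesD(2)[OF mods(3)] modulesD(2)[OF Q(1)] xy(1,2)] xy
          minus_eq_zero_iff[OF modulesD(2)[OF Q(1)]] mod_homD(1)[OF m(1)] by simp
      then have "x \<ominus>\<^bsub>M\<^esub> y = \<zero>\<^bsub>M\<^esub>"
        using kernel xy abelian_group.minus_closed[OF modulesD(2)[OF mods(3)]] by blast
      then show "x = y" using xy minus_eq_zero_iff[OF modulesD(2)[OF mods(3)]] by blast
    qed
  next
    fix x assume "x \<in> carrier M"
    then obtain y where "y \<in> carrier G" "x = g y" using E(8) by blast
    then show "s (m x) = \<zero>\<^bsub>H\<^esub>" using m(2) s(2) F(4,6) by simp
  next
    fix y assume y: "y \<in> carrier Q" "s y = \<zero>\<^bsub>H\<^esub>"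
    then obtain l where l: "l \<in> carrier L" "y = r l" using Z(8) by blast
    then have "q l = \<zero>\<^bsub>H\<^esub>" using s(2) y(2) by simp
    then obtain x where "x \<in> carrier G" "l = j x" using F(7)[OF l(1)] by blast
    then show "\<exists>x\<in>carrier M. y = m x" using m(2) l E(5) by (intro bexI[of _ "g x"]) auto
  next
    fix z assume "z \<in> carrier H"
    then obtain l where "l \<in> carrier L" "z = q l" using F(8) by blast
    then show "\<exists>y\<in>carrier Q. z = s y" using s(2) Z(5) by (intro bexI[of _ "r l"]) auto
  qed (use m s in auto)
  then show ?thesis using that Q m(2) by blast
qed

text \<open>The retraction r is recorded because it keeps i injective under every tensor
  product.\<close>

lemma dirsum_copy_exists:
  fixes S :: "'u ring"
  assumes U: "universe TYPE('u)" and mods: "M \<in> modules S" "N \<in> modules S"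
  obtains Q i p r where "Q \<in> modules S" "short_exact S M i Q p N" "r \<in> mod_hom S Q M"
    "\<And>x. x \<in> carrier M \<Longrightarrow> r (i x) = x"
proof -
  interpret M: left_module S M using modulesD(1)[OF mods(1)] .
  interpret N: left_module S N using modulesD(1)[OF mods(2)] .
  let ?D = "dirsum M N"
  have D: "left_module S ?D" by (rule left_module_dirsum) (rule M.left_module_axioms, rule N.left_module_axioms)
  obtain Q \<phi> where Q: "Q \<in> modules S" "\<phi> \<in> mod_hom S ?D Q" "bij_betw \<phi> (carrier ?D) (carrier Q)"
    by (rule copy_exists[OF D modules_dirsum_small[OF U mods]])
  obtain \<psi> where \<psi>: "\<psi> \<in> mod_hom S Q ?D" and \<psi>\<phi>: "\<And>x. x \<in> carrier ?D \<Longrightarrow> \<psi> (\<phi> x) = x"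
      and \<phi>\<psi>: "\<And>x. x \<in> carrier Q \<Longrightarrow> \<phi> (\<psi> x) = x"
    by (rule inverse_mod_homE[OF D modulesD(1)[OF Q(1)] Q(2,3)]) (simp | blast)+
  have i: "(\<lambda>x. (x, \<zero>\<^bsub>N\<^esub>)) \<in> mod_hom S M ?D"
    by (rule mod_homI) (auto simp: dirsum_def smult_zero[OF N.left_module_axioms])
  have fst: "fst \<in> mod_hom S ?D M" and snd: "snd \<in> mod_hom S ?D N"
    unfolding mod_hom_def dirsum_def by auto
  have c: "(x, y) \<in> carrier ?D \<longleftrightarrow> x \<in> carrier M \<and> y \<in> carrier N" for x y by (simp add: dirsum_def)
  show ?thesis
  proof (rule that[OF Q(1)])
    show "short_exact S M (\<phi> \<circ> (\<lambda>x. (x, \<zero>\<^bsub>N\<^esub>))) Q (snd \<circ> \<psi>) N"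
    proof (rule short_exactI)
      show "inj_on (\<phi> \<circ> (\<lambda>x. (x, \<zero>\<^bsub>N\<^esub>))) (carrier M)"
      proof (rule inj_onI)
        fix x y assume xy: "x \<in> carrier M" "y \<in> carrier M" "(\<phi> \<circ> (\<lambda>x. (x, \<zero>\<^bsub>N\<^esub>))) x = (\<phi> \<circ> (\<lambda>x. (x, \<zero>\<^bsub>N\<^esub>))) y"
        then have "\<psi> (\<phi> (x, \<zero>\<^bsub>N\<^esub>)) = \<psi> (\<phi> (y, \<zero>\<^bsub>N\<^esub>))" by simp
        then show "x = y" using \<psi>\<phi> xy by (simp add: c)
      qed
    next
      fix y assume y: "y \<in> carrier Q" "(snd \<circ> \<psi>) y = \<zero>\<^bsub>N\<^esub>"
      then show "\<exists>x\<in>carrier M. y = (\<phi> \<circ> (\<lambda>x. (x, \<zero>\<^bsub>N\<^esub>))) x"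
        using mod_homD(1)[OF \<psi> y(1)] \<phi>\<psi>[OF y(1)]
        by (intro bexI[of _ "fst (\<psi> y)"]) (cases "\<psi> y"; auto simp: c)+
    next
      fix z assume "z \<in> carrier N"
      then show "\<exists>y\<in>carrier Q. z = (snd \<circ> \<psi>) y"
        using mod_homD(1)[OF Q(2), of "(\<zero>\<^bsub>M\<^esub>, z)"]
        by (intro bexI[of _ "\<phi> (\<zero>\<^bsub>M\<^esub>, z)"]) (auto simp: \<psi>\<phi> c)
    qed (use mod_hom_comp[OF i Q(2)] mod_hom_comp[OF \<psi> snd] in \<open>auto simp: \<psi>\<phi> c\<close>)
    show "fst \<circ> \<psi> \<in> mod_hom S Q M" by (rule mod_hom_comp[OF \<psi> fst])
  qed (auto simp: \<psi>\<phi> c)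
qed

section \<open>Balanced maps into \<open>\<rat>/\<int>\<close>\<close>

text \<open>
  Balanced maps \<open>A \<times> M \<rightarrow> \<rat>/\<int>\<close> stand for the characters of \<open>A \<otimes> M\<close>. The scalars act
  symmetrically, so the roles of \<open>A\<close> and \<open>M\<close> can be exchanged.
\<close>

definition balanced :: "'r ring \<Rightarrow> ('r, 'a) module \<Rightarrow> ('r, 'b) module \<Rightarrow> ('a \<Rightarrow> 'b \<Rightarrow> rat set) set" where
  "balanced S A M = {\<beta>.
     (\<forall>a\<in>carrier A. \<forall>x\<in>carrier M. \<beta> a x \<in> carrier QZ) \<and>
     (\<forall>a\<in>carrier A. \<forall>a'\<in>carrier A. \<forall>x\<in>carrier M. \<beta> (a \<oplus>\<^bsub>A\<^esub> a') x = \<beta> a x \<otimes>\<^bsub>QZ\<^esub> \<beta> a' x) \<and>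
     (\<forall>a\<in>carrier A. \<forall>x\<in>carrier M. \<forall>x'\<in>carrier M. \<beta> a (x \<oplus>\<^bsub>M\<^esub> x') = \<beta> a x \<otimes>\<^bsub>QZ\<^esub> \<beta> a x') \<and>
     (\<forall>r\<in>carrier S. \<forall>a\<in>carrier A. \<forall>x\<in>carrier M. \<beta> (r \<odot>\<^bsub>A\<^esub> a) x = \<beta> a (r \<odot>\<^bsub>M\<^esub> x))}"

text \<open>The dual form of injectivity of
  \<open>X \<otimes> N \<rightarrow> Y \<otimes> N\<close>: every character of the source extends to
  the target. That this is equivalent to injectivity is the injective cogenerator property of
  \<open>\<rat>/\<int>\<close>.\<close>

definition bal_ext ::
  "'r ring \<Rightarrow> ('a \<Rightarrow> 'b) \<Rightarrow> ('r, 'a) module \<Rightarrow> ('r, 'b) module \<Rightarrow> ('r, 'c) module \<Rightarrow> bool"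
where
  "bal_ext S f X Y N \<longleftrightarrow> (\<forall>\<beta>\<in>balanced S X N. \<exists>\<gamma>\<in>balanced S Y N.
     \<forall>x\<in>carrier X. \<forall>n\<in>carrier N. \<gamma> (f x) n = \<beta> x n)"

lemma balancedI:
  assumes "\<And>a x. a \<in> carrier A \<Longrightarrow> x \<in> carrier M \<Longrightarrow> \<beta> a x \<in> carrier QZ"
    and "\<And>a a' x. a \<in> carrier A \<Longrightarrow> a' \<in> carrier A \<Longrightarrow> x \<in> carrier M \<Longrightarrow> \<beta> (a \<oplus>\<^bsub>A\<^esub> a') x = \<beta> a x \<otimes>\<^bsub>QZ\<^esub> \<beta> a' x"
    and "\<And>a x x'. a \<in> carrier A \<Longrightarrow> x \<in> carrier M \<Longrightarrow> x' \<in> carrier M \<Longrightarrow> \<beta> a (x \<oplus>\<^bsub>M\<^esub> x') = \<beta> a x \<otimes>\<^bsub>QZ\<^esub> \<beta> a x'"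
    and "\<And>r a x. r \<in> carrier S \<Longrightarrow> a \<in> carrier A \<Longrightarrow> x \<in> carrier M \<Longrightarrow> \<beta> (r \<odot>\<^bsub>A\<^esub> a) x = \<beta> a (r \<odot>\<^bsub>M\<^esub> x)"
  shows "\<beta> \<in> balanced S A M"
  unfolding balanced_def mem_Collect_eq by (intro conjI ballI assms)

lemma balancedD:
  assumes "\<beta> \<in> balanced S A M"
  shows "\<And>a x. a \<in> carrier A \<Longrightarrow> x \<in> carrier M \<Longrightarrow> \<beta> a x \<in> carrier QZ"
    and "\<And>a a' x. a \<in> carrier A \<Longrightarrow> a' \<in> carrier A \<Longrightarrow> x \<in> carrier M \<Longrightarrow> \<beta> (a \<oplus>\<^bsub>A\<^esub> a') x = \<beta> a x \<otimes>\<^bsub>QZ\<^esub> \<beta> a' x"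
    and "\<And>a x x'. a \<in> carrier A \<Longrightarrow> x \<in> carrier M \<Longrightarrow> x' \<in> carrier M \<Longrightarrow> \<beta> a (x \<oplus>\<^bsub>M\<^esub> x') = \<beta> a x \<otimes>\<^bsub>QZ\<^esub> \<beta> a x'"
    and "\<And>r a x. r \<in> carrier S \<Longrightarrow> a \<in> carrier A \<Longrightarrow> x \<in> carrier M \<Longrightarrow> \<beta> (r \<odot>\<^bsub>A\<^esub> a) x = \<beta> a (r \<odot>\<^bsub>M\<^esub> x)"
  using assms unfolding balanced_def by auto

lemma balanced_op_ring [simp]: "balanced (op_ring S) A M = balanced S A M"
  unfolding balanced_def by simp

lemma balanced_swap: "\<beta> \<in> balanced S A M \<Longrightarrow> (\<lambda>x a. \<beta> a x) \<in> balanced S M A"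
  by (rule balancedI) (auto simp: balancedD)

lemma balanced_comp:
  assumes "\<beta> \<in> balanced S A M" "f \<in> mod_hom S A' A" "g \<in> mod_hom S M' M"
  shows "(\<lambda>a x. \<beta> (f a) (g x)) \<in> balanced S A' M'"
  by (rule balancedI) (simp_all add: balancedD[OF assms(1)] mod_homD[OF assms(2)] mod_homD[OF assms(3)])

lemma balanced_zero_left:
  assumes "\<beta> \<in> balanced S A M" "abelian_group A" "x \<in> carrier M"
  shows "\<beta> \<zero>\<^bsub>A\<^esub> x = \<one>\<^bsub>QZ\<^esub>"
proof -
  interpret A: abelian_group A by fact
  have "\<beta> \<zero>\<^bsub>A\<^esub> x \<in> carrier QZ" using balancedD(1)[OF assms(1)] assms(3) by simp
  moreover have "\<beta> \<zero>\<^bsub>A\<^esub> x \<otimes>\<^bsub>QZ\<^esub> \<beta> \<zero>\<^bsub>A\<^esub> x = \<beta> \<zero>\<^bsub>A\<^esub> x"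
    using balancedD(2)[OF assms(1), of "\<zero>\<^bsub>A\<^esub>" "\<zero>\<^bsub>A\<^esub>" x] assms(3) by simp
  ultimately show ?thesis by simp
qed

lemma balanced_zero_right:
  assumes "\<beta> \<in> balanced S A M" "abelian_group M" "a \<in> carrier A"
  shows "\<beta> a \<zero>\<^bsub>M\<^esub> = \<one>\<^bsub>QZ\<^esub>"
  using balanced_zero_left[OF balanced_swap[OF assms(1)] assms(2,3)] .

text \<open>The structure shared by left and right modules, which is all that balanced maps depend on.\<close>

definition acted :: "'r ring \<Rightarrow> ('r, 'a) module \<Rightarrow> bool" where
  "acted S M \<longleftrightarrow> abelian_group M \<and> (\<forall>r\<in>carrier S. \<forall>x\<in>carrier M. r \<odot>\<^bsub>M\<^esub> x \<in> carrier M)"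

lemma left_module_acted: "left_module S M \<Longrightarrow> acted S M"
  unfolding acted_def by (simp add: left_module_abelian_group left_module.smult_closed)

lemma left_module_op_acted: "left_module (op_ring S) M \<Longrightarrow> acted S M"
  using left_module_acted[of "op_ring S" M] unfolding acted_def by simp

lemma modules_acted: "M \<in> modules S \<Longrightarrow> acted S M" "M \<in> modules (op_ring S) \<Longrightarrow> acted S M"
  using modulesD(1) left_module_acted left_module_op_acted by blast+

lemma balanced_quotient:
  assumes "\<beta> \<in> balanced S A M" "\<gamma> \<in> balanced S A M" "acted S A" "acted S M"
  shows "(\<lambda>a x. \<beta> a x \<otimes>\<^bsub>QZ\<^esub> inv\<^bsub>QZ\<^esub> \<gamma> a x) \<in> balanced S A M"
proof -
  interpret A: abelian_group A using assms(3) unfolding acted_def by simp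
  interpret M: abelian_group M using assms(4) unfolding acted_def by simp
  have c: "\<And>r x. r \<in> carrier S \<Longrightarrow> x \<in> carrier A \<Longrightarrow> r \<odot>\<^bsub>A\<^esub> x \<in> carrier A"
    "\<And>r x. r \<in> carrier S \<Longrightarrow> x \<in> carrier M \<Longrightarrow> r \<odot>\<^bsub>M\<^esub> x \<in> carrier M"
    using assms(3,4) unfolding acted_def by auto
  show ?thesis
    by (rule balancedI)
      (simp_all add: balancedD[OF assms(1)] balancedD[OF assms(2)] c QZ.inv_mult QZ.m_ac)
qed

text \<open>Right exactness of the tensor product in dual form: a character of
  \<open>P \<otimes> M\<close> that kills the kernel of \<pi> comes from
  \<open>A \<otimes> M\<close>.\<close>

lemma balanced_descend:
  assumes acted: "acted S P" "acted S A" "acted S M"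
    and \<pi>: "\<pi> \<in> mod_hom S P A" "\<And>a. a \<in> carrier A \<Longrightarrow> \<exists>p\<in>carrier P. a = \<pi> p"
    and \<beta>: "\<beta> \<in> balanced S P M"
    and van: "\<And>p m. p \<in> carrier P \<Longrightarrow> m \<in> carrier M \<Longrightarrow> \<pi> p = \<zero>\<^bsub>A\<^esub> \<Longrightarrow> \<beta> p m = \<one>\<^bsub>QZ\<^esub>"
  obtains \<eta> where "\<eta> \<in> balanced S A M"
    "\<And>p m. p \<in> carrier P \<Longrightarrow> m \<in> carrier M \<Longrightarrow> \<eta> (\<pi> p) m = \<beta> p m"
proof -
  interpret P: abelian_group P using acted(1) unfolding acted_def by simp
  interpret A: abelian_group A using acted(2) unfolding acted_def by simp
  interpret M: abelian_group M using acted(3) unfolding acted_def by simp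
  have c: "\<And>r x. r \<in> carrier S \<Longrightarrow> x \<in> carrier P \<Longrightarrow> r \<odot>\<^bsub>P\<^esub> x \<in> carrier P"
    "\<And>r x. r \<in> carrier S \<Longrightarrow> x \<in> carrier A \<Longrightarrow> r \<odot>\<^bsub>A\<^esub> x \<in> carrier A"
    "\<And>r x. r \<in> carrier S \<Longrightarrow> x \<in> carrier M \<Longrightarrow> r \<odot>\<^bsub>M\<^esub> x \<in> carrier M"
    using acted unfolding acted_def by auto
  note B = balancedD[OF \<beta>] and H = mod_homD[OF \<pi>(1)]
  define s where "s a = (SOME p. p \<in> carrier P \<and> \<pi> p = a)" for a
  have s: "s a \<in> carrier P" "\<pi> (s a) = a" if "a \<in> carrier A" for a
  proof -
    have "\<exists>p. p \<in> carrier P \<and> \<pi> p = a" using \<pi>(2)[OF that] by blast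
    from someI_ex[OF this] show "s a \<in> carrier P" "\<pi> (s a) = a" unfolding s_def by auto
  qed
  have eq: "\<beta> p m = \<beta> p' m" if p: "p \<in> carrier P" "p' \<in> carrier P" "m \<in> carrier M" "\<pi> p = \<pi> p'" for p p' m
  proof -
    have "\<pi> (p \<ominus>\<^bsub>P\<^esub> p') = \<zero>\<^bsub>A\<^esub>"
      using p mod_hom_minus[OF \<pi>(1) P.abelian_group_axioms A.abelian_group_axioms] H(1)
        minus_eq_zero_iff[OF A.abelian_group_axioms] by simp
    then have "\<beta> (p \<ominus>\<^bsub>P\<^esub> p') m = \<one>\<^bsub>QZ\<^esub>" using van p by simp
    moreover have "(p \<ominus>\<^bsub>P\<^esub> p') \<oplus>\<^bsub>P\<^esub> p' = p" using p by (simp add: a_minus_def P.a_assoc P.l_neg)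
    moreover have "\<beta> ((p \<ominus>\<^bsub>P\<^esub> p') \<oplus>\<^bsub>P\<^esub> p') m = \<beta> (p \<ominus>\<^bsub>P\<^esub> p') m \<otimes>\<^bsub>QZ\<^esub> \<beta> p' m"
      using B(2) p by simp
    ultimately show ?thesis using B(1) p by simp
  qed
  define \<eta> where "\<eta> a m = \<beta> (s a) m" for a m
  have \<eta>: "\<eta> (\<pi> p) m = \<beta> p m" if "p \<in> carrier P" "m \<in> carrier M" for p m
    unfolding \<eta>_def by (rule eq) (use that s H(1) in auto)
  have "\<eta> \<in> balanced S A M"
  proof (rule balancedI)
    fix a a' m assume a: "a \<in> carrier A" "a' \<in> carrier A" "m \<in> carrier M"
    have "\<beta> (s (a \<oplus>\<^bsub>A\<^esub> a')) m = \<beta> (s a \<oplus>\<^bsub>P\<^esub> s a') m"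
      by (rule eq) (use a s H in auto)
    then show "\<eta> (a \<oplus>\<^bsub>A\<^esub> a') m = \<eta> a m \<otimes>\<^bsub>QZ\<^esub> \<eta> a' m" unfolding \<eta>_def using B(2) a s by simp
  next
    fix r a m assume a: "r \<in> carrier S" "a \<in> carrier A" "m \<in> carrier M"
    have "\<beta> (s (r \<odot>\<^bsub>A\<^esub> a)) m = \<beta> (r \<odot>\<^bsub>P\<^esub> s a) m"
      by (rule eq) (use a s H c in auto)
    then show "\<eta> (r \<odot>\<^bsub>A\<^esub> a) m = \<eta> a (r \<odot>\<^bsub>M\<^esub> m)" unfolding \<eta>_def using B(4) a s by simp
  qed (use B s in \<open>auto simp: \<eta>_def\<close>)
  then show ?thesis using that \<eta> by blast
qed

lemma balanced_descend_right:
  assumes "acted S P" "acted S A" "acted S M"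
    and "\<pi> \<in> mod_hom S P A" "\<And>a. a \<in> carrier A \<Longrightarrow> \<exists>p\<in>carrier P. a = \<pi> p"
    and "\<beta> \<in> balanced S M P"
    and "\<And>p m. p \<in> carrier P \<Longrightarrow> m \<in> carrier M \<Longrightarrow> \<pi> p = \<zero>\<^bsub>A\<^esub> \<Longrightarrow> \<beta> m p = \<one>\<^bsub>QZ\<^esub>"
  obtains \<eta> where "\<eta> \<in> balanced S M A"
    "\<And>p m. p \<in> carrier P \<Longrightarrow> m \<in> carrier M \<Longrightarrow> \<eta> m (\<pi> p) = \<beta> m p"
proof (rule balanced_descend[OF assms(1-5) balanced_swap[OF assms(6)] assms(7)])
  fix \<eta> assume "\<eta> \<in> balanced S A M"
    "\<And>p m. p \<in> carrier P \<Longrightarrow> m \<in> carrier M \<Longrightarrow> \<eta> (\<pi> p) m = \<beta> m p"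
  then show ?thesis using that[of "\<lambda>m a. \<eta> a m"] balanced_swap by blast
qed

lemma bal_extD:
  assumes "bal_ext S f X Y N" "\<beta> \<in> balanced S X N"
  obtains \<gamma> where "\<gamma> \<in> balanced S Y N"
    "\<And>x n. x \<in> carrier X \<Longrightarrow> n \<in> carrier N \<Longrightarrow> \<gamma> (f x) n = \<beta> x n"
  using bspec[OF assms(1)[unfolded bal_ext_def] assms(2)] by (elim bexE) simp

section \<open>Diagram chases replacing long exact Tor sequences\<close>

text \<open>
  In the next lemmas \<open>0 \<rightarrow> A\<^sub>1 \<rightarrow> P \<rightarrow> A \<rightarrow> 0\<close> and \<open>0 \<rightarrow> M' \<rightarrow> M \<rightarrow> M'' \<rightarrow> 0\<close> are exact. If \<open>P\<close> is
  projective then \<open>bal_ext S \<iota> A\<^sub>1 P N\<close> means \<open>Tor\<^sub>1(A, N) = 0\<close>.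
\<close>

lemma bal_ext_connect:
  assumes acted: "acted S A1" "acted S P" "acted S A" "acted S M'" "acted S M" "acted S M''"
    and ex: "short_exact S A1 \<iota> P \<pi> A" "short_exact S M' f M g M''"
    and ext: "bal_ext S \<iota> A1 P M''" "bal_ext S f M' M P"
  shows "bal_ext S f M' M A"
  unfolding bal_ext_def
proof
  note E = short_exactD[OF ex(1)] and F = short_exactD[OF ex(2)]
  have ag: "abelian_group A1" "abelian_group P" "abelian_group A" "abelian_group M'" "abelian_group M" "abelian_group M''"
    using acted unfolding acted_def by auto
  fix \<beta> assume \<beta>: "\<beta> \<in> balanced S M' A"
  have "(\<lambda>m p. \<beta> (id m) (\<pi> p)) \<in> balanced S M' P"
    by (rule balanced_comp[OF \<beta> mod_hom_id E(2)])
  then obtain \<delta> where \<delta>: "\<delta> \<in> balanced S M P"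
    "\<And>m p. m \<in> carrier M' \<Longrightarrow> p \<in> carrier P \<Longrightarrow> \<delta> (f m) p = \<beta> m (\<pi> p)"
    using bal_extD[OF ext(2)] by auto
  \<comment> \<open>\<open>\<delta>\<close> would come from A if it were trivial on A1. Its
    restriction to A1 is trivial on M', hence a character \<open>\<epsilon>\<close> on M''. This
    extends to P by the assumption on M'', and dividing by the extension \<open>\<zeta>\<close>
    corrects \<open>\<delta>\<close> without changing it on M'.\<close>
  have \<delta>1: "(\<lambda>a m. \<delta> m (\<iota> a)) \<in> balanced S A1 M"
    using balanced_comp[OF balanced_swap[OF \<delta>(1)] E(1) mod_hom_id] by simp
  have van: "\<delta> m (\<iota> a) = \<one>\<^bsub>QZ\<^esub>" if m: "m \<in> carrier M" "g m = \<zero>\<^bsub>M''\<^esub>" and a: "a \<in> carrier A1" for m a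
  proof -
    obtain m' where m': "m' \<in> carrier M'" "m = f m'" using F(7)[OF m] by blast
    then show ?thesis using \<delta>(2)[OF m'(1) E(4)[OF a]] E(6)[OF a] balanced_zero_right[OF \<beta> ag(3) m'(1)] by simp
  qed
  obtain \<epsilon> where \<epsilon>: "\<epsilon> \<in> balanced S A1 M''"
    "\<And>m a. m \<in> carrier M \<Longrightarrow> a \<in> carrier A1 \<Longrightarrow> \<epsilon> a (g m) = \<delta> m (\<iota> a)"
    by (rule balanced_descend_right[OF acted(5,6,1) F(2,8) \<delta>1]) (use van in auto)
  obtain \<zeta> where \<zeta>: "\<zeta> \<in> balanced S P M''"
    "\<And>a m. a \<in> carrier A1 \<Longrightarrow> m \<in> carrier M'' \<Longrightarrow> \<zeta> (\<iota> a) m = \<epsilon> a m"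
    by (rule bal_extD[OF ext(1) \<epsilon>(1)]) blast
  have \<zeta>1: "(\<lambda>m p. \<zeta> p (g m)) \<in> balanced S M P"
    using balanced_comp[OF balanced_swap[OF \<zeta>(1)] F(2) mod_hom_id] by simp
  let ?\<theta> = "\<lambda>m p. \<delta> m p \<otimes>\<^bsub>QZ\<^esub> inv\<^bsub>QZ\<^esub> \<zeta> p (g m)"
  have \<theta>: "?\<theta> \<in> balanced S M P" by (rule balanced_quotient[OF \<delta>(1) \<zeta>1 acted(5,2)])
  have van2: "?\<theta> m p = \<one>\<^bsub>QZ\<^esub>" if p: "p \<in> carrier P" "\<pi> p = \<zero>\<^bsub>A\<^esub>" and m: "m \<in> carrier M" for m p
  proof -
    obtain a where a: "a \<in> carrier A1" "p = \<iota> a" using E(7)[OF p] by blast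
    then show ?thesis
      using \<zeta>(2)[OF a(1) F(5)[OF m]] \<epsilon>(2)[OF m a(1)] balancedD(1)[OF \<delta>(1) m p(1)] by simp
  qed
  obtain \<eta> where \<eta>: "\<eta> \<in> balanced S M A"
    "\<And>p m. p \<in> carrier P \<Longrightarrow> m \<in> carrier M \<Longrightarrow> \<eta> m (\<pi> p) = ?\<theta> m p"
    by (rule balanced_descend_right[OF acted(2,3,5) E(2,8) \<theta>]) (use van2 in auto)
  have "\<eta> (f m) a = \<beta> m a" if m: "m \<in> carrier M'" and a: "a \<in> carrier A" for m a
  proof -
    obtain p where p: "p \<in> carrier P" "a = \<pi> p" using E(8)[OF a] by blast
    have "\<eta> (f m) a = \<beta> m a \<otimes>\<^bsub>QZ\<^esub> inv\<^bsub>QZ\<^esub> \<one>\<^bsub>QZ\<^esub>"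
      using \<eta>(2)[OF p(1) F(4)[OF m]] \<delta>(2)[OF m p(1)] p(2) F(6)[OF m] balanced_zero_right[OF \<zeta>(1) ag(6) p(1)]
      by simp
    then show ?thesis using balancedD(1)[OF \<beta> m a] by simp
  qed
  then show "\<exists>\<gamma>\<in>balanced S M A. \<forall>x\<in>carrier M'. \<forall>n\<in>carrier A. \<gamma> (f x) n = \<beta> x n"
    using \<eta>(1) by blast
qed

text \<open>For projective P this is the exact piece Tor_1(A, M) \<rightarrow> Tor_1(A, M'')
  \<rightarrow> \<open>A \<otimes> M' \<rightarrow> A \<otimes> M\<close>: the second term vanishes
  when the first does and the last map is injective.\<close>

lemma bal_ext_cokernel:
  assumes acted: "acted S A1" "acted S P" "acted S A" "acted S M'" "acted S M" "acted S M''"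
    and ex: "short_exact S A1 \<iota> P \<pi> A" "short_exact S M' f M g M''"
    and ext: "bal_ext S f M' M A" "bal_ext S \<iota> A1 P M"
  shows "bal_ext S \<iota> A1 P M''"
  unfolding bal_ext_def
proof
  note E = short_exactD[OF ex(1)] and F = short_exactD[OF ex(2)]
  have ag: "abelian_group A1" "abelian_group P" "abelian_group A" "abelian_group M'" "abelian_group M" "abelian_group M''"
    using acted unfolding acted_def by auto
  fix \<beta> assume \<beta>: "\<beta> \<in> balanced S A1 M''"
  have "(\<lambda>a m. \<beta> (id a) (g m)) \<in> balanced S A1 M"
    by (rule balanced_comp[OF \<beta> mod_hom_id F(2)])
  then obtain \<delta> where \<delta>: "\<delta> \<in> balanced S P M"
    "\<And>a m. a \<in> carrier A1 \<Longrightarrow> m \<in> carrier M \<Longrightarrow> \<delta> (\<iota> a) m = \<beta> a (g m)"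
    using bal_extD[OF ext(2)] by auto
  \<comment> \<open>The only obstruction to descending \<open>\<delta>\<close> to M'' is its
    restriction to M', which factors through A as \<open>\<epsilon>\<close>. Extended to M as
    \<open>\<zeta>\<close> and divided out, it leaves the values on A1 unchanged.\<close>
  have \<delta>1: "(\<lambda>m p. \<delta> p (f m)) \<in> balanced S M' P"
    using balanced_comp[OF balanced_swap[OF \<delta>(1)] F(1) mod_hom_id] by simp
  have van: "\<delta> p (f m) = \<one>\<^bsub>QZ\<^esub>" if p: "p \<in> carrier P" "\<pi> p = \<zero>\<^bsub>A\<^esub>" and m: "m \<in> carrier M'" for p m
  proof -
    obtain a where a: "a \<in> carrier A1" "p = \<iota> a" using E(7)[OF p] by blast
    then show ?thesis using \<delta>(2)[OF a(1) F(4)[OF m]] F(6)[OF m] balanced_zero_right[OF \<beta> ag(6) a(1)] by simp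
  qed
  obtain \<epsilon> where \<epsilon>: "\<epsilon> \<in> balanced S M' A"
    "\<And>p m. p \<in> carrier P \<Longrightarrow> m \<in> carrier M' \<Longrightarrow> \<epsilon> m (\<pi> p) = \<delta> p (f m)"
    by (rule balanced_descend_right[OF acted(2,3,4) E(2,8) \<delta>1]) (use van in auto)
  obtain \<zeta> where \<zeta>: "\<zeta> \<in> balanced S M A"
    "\<And>m a. m \<in> carrier M' \<Longrightarrow> a \<in> carrier A \<Longrightarrow> \<zeta> (f m) a = \<epsilon> m a"
    by (rule bal_extD[OF ext(1) \<epsilon>(1)]) blast
  have \<zeta>1: "(\<lambda>p m. \<zeta> m (\<pi> p)) \<in> balanced S P M"
    using balanced_comp[OF balanced_swap[OF \<zeta>(1)] E(2) mod_hom_id] by simp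
  let ?\<theta> = "\<lambda>p m. \<delta> p m \<otimes>\<^bsub>QZ\<^esub> inv\<^bsub>QZ\<^esub> \<zeta> m (\<pi> p)"
  have \<theta>: "?\<theta> \<in> balanced S P M" by (rule balanced_quotient[OF \<delta>(1) \<zeta>1 acted(2,5)])
  have van2: "?\<theta> p m = \<one>\<^bsub>QZ\<^esub>" if m: "m \<in> carrier M" "g m = \<zero>\<^bsub>M''\<^esub>" and p: "p \<in> carrier P" for m p
  proof -
    obtain m' where m': "m' \<in> carrier M'" "m = f m'" using F(7)[OF m] by blast
    then show ?thesis
      using \<zeta>(2)[OF m'(1) E(5)[OF p]] \<epsilon>(2)[OF p m'(1)] balancedD(1)[OF \<delta>(1) p m(1)] by simp
  qed
  obtain \<eta> where \<eta>: "\<eta> \<in> balanced S P M''"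
    "\<And>m p. m \<in> carrier M \<Longrightarrow> p \<in> carrier P \<Longrightarrow> \<eta> p (g m) = ?\<theta> p m"
    by (rule balanced_descend_right[OF acted(5,6,2) F(2,8) \<theta>]) (use van2 in auto)
  have "\<eta> (\<iota> a) n = \<beta> a n" if a: "a \<in> carrier A1" and n: "n \<in> carrier M''" for a n
  proof -
    obtain m where m: "m \<in> carrier M" "n = g m" using F(8)[OF n] by blast
    have "\<eta> (\<iota> a) n = \<beta> a n \<otimes>\<^bsub>QZ\<^esub> inv\<^bsub>QZ\<^esub> \<one>\<^bsub>QZ\<^esub>"
      using \<eta>(2)[OF m(1) E(4)[OF a]] \<delta>(2)[OF a m(1)] m(2) E(6)[OF a] balanced_zero_right[OF \<zeta>(1) ag(3) m(1)]
      by simp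
    then show ?thesis using balancedD(1)[OF \<beta> a n] by simp
  qed
  then show "\<exists>\<gamma>\<in>balanced S P M''. \<forall>x\<in>carrier A1. \<forall>n\<in>carrier M''. \<gamma> (\<iota> x) n = \<beta> x n"
    using \<eta>(1) by blast
qed

text \<open>The injective composite \<open>A1 \<otimes> M' \<rightarrow> A1 \<otimes> M
  \<rightarrow> P \<otimes> M\<close> factors through \<open>P \<otimes> M'\<close>. It is applied
  with either side in the role of the resolution.\<close>

lemma bal_ext_restrict:
  assumes "f \<in> mod_hom S M' M" "bal_ext S f M' M A1" "bal_ext S \<iota> A1 P M" "\<iota> \<in> mod_hom S A1 P"
  shows "bal_ext S \<iota> A1 P M'"
  unfolding bal_ext_def
proof
  fix \<beta> assume \<beta>: "\<beta> \<in> balanced S A1 M'"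
  obtain \<gamma> where \<gamma>: "\<gamma> \<in> balanced S M A1"
    "\<And>m a. m \<in> carrier M' \<Longrightarrow> a \<in> carrier A1 \<Longrightarrow> \<gamma> (f m) a = \<beta> a m"
    by (rule bal_extD[OF assms(2) balanced_swap[OF \<beta>]]) blast
  obtain \<delta> where \<delta>: "\<delta> \<in> balanced S P M"
    "\<And>a m. a \<in> carrier A1 \<Longrightarrow> m \<in> carrier M \<Longrightarrow> \<delta> (\<iota> a) m = \<gamma> m a"
    by (rule bal_extD[OF assms(3) balanced_swap[OF \<gamma>(1)]]) blast
  have "(\<lambda>p m. \<delta> (id p) (f m)) \<in> balanced S P M'" by (rule balanced_comp[OF \<delta>(1) mod_hom_id assms(1)])
  moreover have "\<delta> (\<iota> a) (f m) = \<beta> a m" if "a \<in> carrier A1" "m \<in> carrier M'" for a m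
    using that \<delta>(2) \<gamma>(2) mod_homD(1)[OF assms(1)] by simp
  ultimately show "\<exists>\<gamma>\<in>balanced S P M'. \<forall>x\<in>carrier A1. \<forall>n\<in>carrier M'. \<gamma> (\<iota> x) n = \<beta> x n"
    by (intro bexI[of _ "\<lambda>p m. \<delta> (id p) (f m)"]) auto
qed

text \<open>A first factor of an injective map is injective; for a retraction k, the map h is the
  identity.\<close>

lemma bal_ext_factor:
  assumes "bal_ext S h X Z N" "k \<in> mod_hom S Y Z" "\<And>x. x \<in> carrier X \<Longrightarrow> k (f x) = h x"
  shows "bal_ext S f X Y N"
  unfolding bal_ext_def
proof
  fix \<beta> assume \<beta>: "\<beta> \<in> balanced S X N"
  obtain \<gamma> where \<gamma>: "\<gamma> \<in> balanced S Z N"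
    "\<And>x n. x \<in> carrier X \<Longrightarrow> n \<in> carrier N \<Longrightarrow> \<gamma> (h x) n = \<beta> x n"
    by (rule bal_extD[OF assms(1) \<beta>]) blast
  have "(\<lambda>y n. \<gamma> (k y) (id n)) \<in> balanced S Y N" by (rule balanced_comp[OF \<gamma>(1) assms(2) mod_hom_id])
  then show "\<exists>\<gamma>\<in>balanced S Y N. \<forall>x\<in>carrier X. \<forall>n\<in>carrier N. \<gamma> (f x) n = \<beta> x n"
    by (intro bexI[of _ "\<lambda>y n. \<gamma> (k y) (id n)"]) (use \<gamma>(2) assms(3) in auto)
qed

lemma bal_ext_comp:
  assumes "bal_ext S f X Y N" "bal_ext S h Y Z N" "f \<in> mod_hom S X Y"
  shows "bal_ext S (h \<circ> f) X Z N"
  unfolding bal_ext_def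
proof
  fix \<beta> assume \<beta>: "\<beta> \<in> balanced S X N"
  obtain \<gamma> where \<gamma>: "\<gamma> \<in> balanced S Y N"
    "\<And>x n. x \<in> carrier X \<Longrightarrow> n \<in> carrier N \<Longrightarrow> \<gamma> (f x) n = \<beta> x n"
    by (rule bal_extD[OF assms(1) \<beta>]) blast
  obtain \<delta> where \<delta>: "\<delta> \<in> balanced S Z N"
    "\<And>x n. x \<in> carrier Y \<Longrightarrow> n \<in> carrier N \<Longrightarrow> \<delta> (h x) n = \<gamma> x n"
    by (rule bal_extD[OF assms(2) \<gamma>(1)]) blast
  show "\<exists>\<gamma>\<in>balanced S Z N. \<forall>x\<in>carrier X. \<forall>n\<in>carrier N. \<gamma> ((h \<circ> f) x) n = \<beta> x n"
    using \<delta> \<gamma>(2) mod_homD(1)[OF assms(3)] by (intro bexI[of _ \<delta>]) auto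
qed

text \<open>Purity passes to pushouts: a character on M, pulled back to G and extended to L, kills
  the image of K and therefore descends to Q.\<close>

lemma bal_ext_pushout:
  assumes acted: "acted S G" "acted S M" "acted S L" "acted S Q" "acted S N"
    and jh: "j \<in> mod_hom S G L" and ex: "short_exact S K f G g M" "short_exact S K (j \<circ> f) L r Q"
    and j: "bal_ext S j G L N"
    and m: "\<And>x. x \<in> carrier G \<Longrightarrow> m (g x) = r (j x)"
  shows "bal_ext S m M Q N"
  unfolding bal_ext_def
proof
  note E = short_exactD[OF ex(1)] and F = short_exactD[OF ex(2)]
  fix \<beta> assume \<beta>: "\<beta> \<in> balanced S M N"
  have "(\<lambda>x n. \<beta> (g x) (id n)) \<in> balanced S G N" by (rule balanced_comp[OF \<beta> E(2) mod_hom_id])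
  then obtain \<gamma> where \<gamma>: "\<gamma> \<in> balanced S L N"
    "\<And>x n. x \<in> carrier G \<Longrightarrow> n \<in> carrier N \<Longrightarrow> \<gamma> (j x) n = \<beta> (g x) n"
    using bal_extD[OF j] by auto
  have M0: "abelian_group M" using acted(2) unfolding acted_def by simp
  have van: "\<gamma> l n = \<one>\<^bsub>QZ\<^esub>" if l: "l \<in> carrier L" "r l = \<zero>\<^bsub>Q\<^esub>" and n: "n \<in> carrier N" for l n
  proof -
    obtain k where k: "k \<in> carrier K" "l = j (f k)" using F(7)[OF l] by auto
    then show ?thesis using \<gamma>(2)[OF E(4)[OF k(1)] n] E(6)[OF k(1)] balanced_zero_left[OF \<beta> M0 n] by simp
  qed
  obtain \<eta> where \<eta>: "\<eta> \<in> balanced S Q N"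
    "\<And>l n. l \<in> carrier L \<Longrightarrow> n \<in> carrier N \<Longrightarrow> \<eta> (r l) n = \<gamma> l n"
    by (rule balanced_descend[OF acted(3,4,5) F(2,8) \<gamma>(1)]) (use van in auto)
  have "\<eta> (m x) n = \<beta> x n" if x: "x \<in> carrier M" and n: "n \<in> carrier N" for x n
  proof -
    obtain y where y: "y \<in> carrier G" "x = g y" using E(8)[OF x] by blast
    have "j y \<in> carrier L" by (rule mod_homD(1)[OF jh y(1)])
    then show ?thesis using m[OF y(1)] \<eta>(2) \<gamma>(2)[OF y(1) n] n y(2) by simp
  qed
  then show "\<exists>\<gamma>\<in>balanced S Q N. \<forall>x\<in>carrier M. \<forall>n\<in>carrier N. \<gamma> (m x) n = \<beta> x n"
    using \<eta>(1) by blast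
qed

section \<open>Character modules\<close>

lemma char_module_simps:
  "carrier (char_module S M) = hom (add_monoid M) QZ \<inter> extensional (carrier M)"
  "\<zero>\<^bsub>char_module S M\<^esub> = (\<lambda>x\<in>carrier M. \<one>\<^bsub>QZ\<^esub>)"
  "f \<oplus>\<^bsub>char_module S M\<^esub> g = (\<lambda>x\<in>carrier M. f x \<otimes>\<^bsub>QZ\<^esub> g x)"
  "r \<odot>\<^bsub>char_module S M\<^esub> f = (\<lambda>x\<in>carrier M. f (r \<odot>\<^bsub>M\<^esub> x))"
  unfolding char_module_def by simp_all

lemma char_carrierD:
  assumes "f \<in> carrier (char_module S M)"
  shows "\<And>x. x \<in> carrier M \<Longrightarrow> f x \<in> carrier QZ"
    "\<And>x y. x \<in> carrier M \<Longrightarrow> y \<in> carrier M \<Longrightarrow> f (x \<oplus>\<^bsub>M\<^esub> y) = f x \<otimes>\<^bsub>QZ\<^esub> f y"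
    "f \<in> extensional (carrier M)"
  using assms unfolding char_module_simps hom_def by auto

lemma char_carrierI:
  assumes "\<And>x. x \<in> carrier M \<Longrightarrow> f x \<in> carrier QZ"
    "\<And>x y. x \<in> carrier M \<Longrightarrow> y \<in> carrier M \<Longrightarrow> f (x \<oplus>\<^bsub>M\<^esub> y) = f x \<otimes>\<^bsub>QZ\<^esub> f y"
    "f \<in> extensional (carrier M)"
  shows "f \<in> carrier (char_module S M)"
  using assms unfolding char_module_simps hom_def by auto

lemma left_module_char:
  assumes "left_module S M"
  shows "left_module (op_ring S) (char_module S M)"
proof -
  interpret M: left_module S M by fact
  note C = char_carrierD
  have ext: "f = g" if "f \<in> extensional (carrier M)" "g \<in> extensional (carrier M)"
    "\<And>x. x \<in> carrier M \<Longrightarrow> f x = g x" for f g :: "_ \<Rightarrow> rat set"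
    using that by (rule extensionalityI)
  show ?thesis
  proof (rule left_moduleI)
    show "ring (op_ring S)" by (rule ring_op_ring[OF M.R.ring_axioms])
    show "\<zero>\<^bsub>char_module S M\<^esub> \<in> carrier (char_module S M)"
      by (rule char_carrierI) (auto simp: char_module_simps)
  next
    fix f g assume "f \<in> carrier (char_module S M)" "g \<in> carrier (char_module S M)"
    then show "f \<oplus>\<^bsub>char_module S M\<^esub> g \<in> carrier (char_module S M)"
      by (intro char_carrierI) (auto simp: char_module_simps(3) C(1,2) QZ.m_ac)
  next
    fix f g h assume "f \<in> carrier (char_module S M)" "g \<in> carrier (char_module S M)" "h \<in> carrier (char_module S M)"
    then show "f \<oplus>\<^bsub>char_module S M\<^esub> g \<oplus>\<^bsub>char_module S M\<^esub> h = f \<oplus>\<^bsub>char_module S M\<^esub> (g \<oplus>\<^bsub>char_module S M\<^esub> h)"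
      by (intro ext) (auto simp: char_module_simps(3) C(1) QZ.m_ac)
  next
    fix f g assume "f \<in> carrier (char_module S M)" "g \<in> carrier (char_module S M)"
    then show "f \<oplus>\<^bsub>char_module S M\<^esub> g = g \<oplus>\<^bsub>char_module S M\<^esub> f"
      by (intro ext) (auto simp: char_module_simps(3) C(1) QZ.m_ac)
  next
    fix f assume f: "f \<in> carrier (char_module S M)"
    then show "\<zero>\<^bsub>char_module S M\<^esub> \<oplus>\<^bsub>char_module S M\<^esub> f = f"
      by (intro ext) (auto simp: char_module_simps(2,3) C(1,3))
    have "(\<lambda>x\<in>carrier M. inv\<^bsub>QZ\<^esub> f x) \<in> carrier (char_module S M)"
      using f by (intro char_carrierI) (auto simp: C(1,2) QZ.inv_mult)
    moreover have "(\<lambda>x\<in>carrier M. inv\<^bsub>QZ\<^esub> f x) \<oplus>\<^bsub>char_module S M\<^esub> f = \<zero>\<^bsub>char_module S M\<^esub>"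
      using f by (intro ext) (auto simp: char_module_simps(2,3) C(1))
    ultimately show "\<exists>g\<in>carrier (char_module S M). g \<oplus>\<^bsub>char_module S M\<^esub> f = \<zero>\<^bsub>char_module S M\<^esub>"
      by blast
    show "\<one>\<^bsub>op_ring S\<^esub> \<odot>\<^bsub>char_module S M\<^esub> f = f"
      using f by (intro ext) (auto simp: char_module_simps(4) C(3) op_ring_def M.smult_one)
  next
    fix a f assume "a \<in> carrier (op_ring S)" "f \<in> carrier (char_module S M)"
    then show "a \<odot>\<^bsub>char_module S M\<^esub> f \<in> carrier (char_module S M)"
      by (intro char_carrierI) (auto simp: char_module_simps(4) C(1,2) M.smult_closed M.smult_r_distr)
  next
    fix a b f assume "a \<in> carrier (op_ring S)" "b \<in> carrier (op_ring S)" "f \<in> carrier (char_module S M)"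
    then show "(a \<oplus>\<^bsub>op_ring S\<^esub> b) \<odot>\<^bsub>char_module S M\<^esub> f =
        a \<odot>\<^bsub>char_module S M\<^esub> f \<oplus>\<^bsub>char_module S M\<^esub> b \<odot>\<^bsub>char_module S M\<^esub> f"
      and "(a \<otimes>\<^bsub>op_ring S\<^esub> b) \<odot>\<^bsub>char_module S M\<^esub> f = a \<odot>\<^bsub>char_module S M\<^esub> (b \<odot>\<^bsub>char_module S M\<^esub> f)"
      by (auto intro!: ext simp: char_module_simps(3,4) C(1,2) M.smult_closed M.smult_l_distr
          M.smult_assoc1 op_ring_def)
  next
    fix a f g assume "a \<in> carrier (op_ring S)" "f \<in> carrier (char_module S M)" "g \<in> carrier (char_module S M)"
    then show "a \<odot>\<^bsub>char_module S M\<^esub> (f \<oplus>\<^bsub>char_module S M\<^esub> g) =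
        a \<odot>\<^bsub>char_module S M\<^esub> f \<oplus>\<^bsub>char_module S M\<^esub> a \<odot>\<^bsub>char_module S M\<^esub> g"
      by (intro ext) (auto simp: char_module_simps(3,4) M.smult_closed)
  qed
qed

lemma char_copy_exists:
  assumes U: "universe TYPE('u)" and M: "M \<in> modules (R :: 'u ring)"
  obtains B where "B \<in> modules (op_ring R)" "isomorphic R (char_module R M) B"
proof -
  have "carrier (char_module R M) \<subseteq> carrier M \<rightarrow>\<^sub>E carrier QZ"
    by (auto simp: PiE_def dest: char_carrierD)
  moreover have "carrier M \<rightarrow>\<^sub>E carrier QZ \<prec> (UNIV :: 'u set)"
    using lesspoll_PiE[OF U] modulesD(3)[OF M] lesspoll_countable[OF U countable_QZ] unfolding small_def by blast
  ultimately have "carrier (char_module R M) \<prec> (UNIV :: 'u set)"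
    by (meson lesspoll_trans1 subset_imp_lepoll)
  then obtain N \<phi> where "N \<in> modules (op_ring R)" "\<phi> \<in> mod_hom (op_ring R) (char_module R M) N"
      "bij_betw \<phi> (carrier (char_module R M)) (carrier N)"
    by (rule copy_exists[OF left_module_char[OF modulesD(1)[OF M]]])
  then show ?thesis using that unfolding isomorphic_def by auto
qed

lemma mod_hom_char_balanced:
  assumes "h \<in> mod_hom S X (char_module S M)"
  shows "h \<in> balanced S X M"
proof -
  note H = mod_homD[OF assms]
  note C = char_carrierD[OF H(1)]
  show ?thesis
    by (rule balancedI) (simp_all add: C(1,2) H(2,3) char_module_simps(3,4))
qed

lemma balanced_mod_hom_char:
  assumes "\<beta> \<in> balanced S X M" "acted S M"
  shows "(\<lambda>x. \<lambda>m\<in>carrier M. \<beta> x m) \<in> mod_hom S X (char_module S M)"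
proof -
  interpret M: abelian_group M using assms(2) unfolding acted_def by simp
  show ?thesis
  proof (rule mod_homI)
    show "\<And>x. x \<in> carrier X \<Longrightarrow> (\<lambda>m\<in>carrier M. \<beta> x m) \<in> carrier (char_module S M)"
      by (rule char_carrierI) (auto simp: balancedD[OF assms(1)])
  qed (use assms(2) in \<open>auto simp: char_module_simps(3,4) balancedD[OF assms(1)] acted_def intro!: restrict_ext\<close>)
qed

definition hom_ext ::
  "'r ring \<Rightarrow> ('a \<Rightarrow> 'b) \<Rightarrow> ('r, 'a) module \<Rightarrow> ('r, 'b) module \<Rightarrow> ('r, 'c) module \<Rightarrow> bool"
where
  "hom_ext S f X Y B \<longleftrightarrow> (\<forall>h\<in>mod_hom S X B. \<exists>k\<in>mod_hom S Y B. \<forall>x\<in>carrier X. k (f x) = h x)"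

lemma hom_ext_op_ring [simp]: "hom_ext (op_ring S) f X Y B = hom_ext S f X Y B"
  unfolding hom_ext_def by simp

text \<open>The adjunction between tensor product and Hom: maps from X to \<open>M^+\<close> are the
  balanced maps on X and M. B stands for a copy of \<open>M^+\<close>, since classes contain only
  modules carried by \<open>'u\<close>.\<close>

lemma hom_ext_char_iff:
  assumes M: "left_module S M" and B: "left_module (op_ring S) B" "isomorphic S (char_module S M) B"
    and f: "f \<in> mod_hom S X Y"
  shows "hom_ext S f X Y B \<longleftrightarrow> bal_ext S f X Y M"
proof -
  obtain \<phi> where \<phi>: "\<phi> \<in> mod_hom S (char_module S M) B" "bij_betw \<phi> (carrier (char_module S M)) (carrier B)"
    using B(2) unfolding isomorphic_def by blast
  define \<psi> where "\<psi> = inv_into (carrier (char_module S M)) \<phi>"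
  have \<psi>: "\<psi> \<in> mod_hom S B (char_module S M)"
    using inv_mod_hom[OF left_module_char[OF M] B(1), of \<phi>] \<phi> unfolding \<psi>_def by simp
  have \<psi>\<phi>: "\<psi> (\<phi> x) = x" if "x \<in> carrier (char_module S M)" for x
    unfolding \<psi>_def using \<phi>(2) that by (simp add: bij_betw_def)
  have \<phi>\<psi>: "\<phi> (\<psi> x) = x" if "x \<in> carrier B" for x
    unfolding \<psi>_def using bij_betw_inv_into_right[OF \<phi>(2) that] .
  show ?thesis
  proof
    assume L: "hom_ext S f X Y B"
    show "bal_ext S f X Y M"
      unfolding bal_ext_def
    proof
      fix \<beta> assume "\<beta> \<in> balanced S X M"
      then have h: "(\<lambda>x. \<lambda>m\<in>carrier M. \<beta> x m) \<in> mod_hom S X (char_module S M)" (is "?h \<in> _")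
        by (rule balanced_mod_hom_char[OF _ left_module_acted[OF M]])
      then obtain k where k: "k \<in> mod_hom S Y B" "\<And>x. x \<in> carrier X \<Longrightarrow> k (f x) = \<phi> (?h x)"
        using L mod_hom_comp[OF h \<phi>(1)] unfolding hom_ext_def by force
      have "(\<psi> \<circ> k) (f x) = ?h x" if "x \<in> carrier X" for x
        using k(2)[OF that] \<psi>\<phi>[OF mod_homD(1)[OF h that]] by simp
      then show "\<exists>\<gamma>\<in>balanced S Y M. \<forall>x\<in>carrier X. \<forall>n\<in>carrier M. \<gamma> (f x) n = \<beta> x n"
        using mod_hom_char_balanced[OF mod_hom_comp[OF k(1) \<psi>]]
        by (intro bexI[of _ "\<psi> \<circ> k"]) auto
    qed
  next
    assume L: "bal_ext S f X Y M"
    show "hom_ext S f X Y B"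
      unfolding hom_ext_def
    proof
      fix h assume h: "h \<in> mod_hom S X B"
      have hp: "\<psi> \<circ> h \<in> mod_hom S X (char_module S M)" by (rule mod_hom_comp[OF h \<psi>])
      obtain \<gamma> where \<gamma>: "\<gamma> \<in> balanced S Y M"
        "\<And>x n. x \<in> carrier X \<Longrightarrow> n \<in> carrier M \<Longrightarrow> \<gamma> (f x) n = (\<psi> \<circ> h) x n"
        by (rule bal_extD[OF L mod_hom_char_balanced[OF hp]]) blast
      have k: "(\<lambda>x. \<lambda>m\<in>carrier M. \<gamma> x m) \<in> mod_hom S Y (char_module S M)" (is "?k \<in> _")
        by (rule balanced_mod_hom_char[OF \<gamma>(1) left_module_acted[OF M]])
      have "?k (f x) = \<psi> (h x)" if "x \<in> carrier X" for x
        by (rule extensionalityI[of _ "carrier M"])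
          (use char_carrierD(3)[OF mod_homD(1)[OF hp that]] \<gamma>(2)[OF that] in auto)
      then have "(\<phi> \<circ> ?k) (f x) = h x" if "x \<in> carrier X" for x
        using \<phi>\<psi>[OF mod_homD(1)[OF h that]] that by simp
      then show "\<exists>k\<in>mod_hom S Y B. \<forall>x\<in>carrier X. k (f x) = h x"
        using mod_hom_comp[OF k \<phi>(1)] by blast
    qed
  qed
qed

text \<open>As f is injective, the values prescribed on its image form a partial character, to which
  injectivity of \<open>\<rat>/\<int>\<close> applies.\<close>

lemma char_extend:
  assumes "abelian_group M'" "abelian_group M" "f \<in> mod_hom S M' M" "inj_on f (carrier M')"
    and "\<chi> \<in> carrier (char_module S M')"
  shows "\<exists>\<psi>\<in>carrier (char_module S M). \<forall>x\<in>carrier M'. \<psi> (f x) = \<chi> x"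
proof -
  interpret M': abelian_group M' by fact
  interpret M: abelian_group M by fact
  note C = char_carrierD[OF assms(5)] and H = mod_homD[OF assms(3)]
  have f0: "f \<zero>\<^bsub>M'\<^esub> = \<zero>\<^bsub>M\<^esub>" by (rule mod_hom_zero[OF assms(3,1,2)])
  have \<chi>: "group_hom (add_monoid M') QZ \<chi>"
    using C M'.a_group by (auto simp: group_hom_def group_hom_axioms_def hom_def QZ.group_axioms)
  have \<chi>0: "\<chi> \<zero>\<^bsub>M'\<^esub> = \<one>\<^bsub>QZ\<^esub>" using group_hom.hom_one[OF \<chi>] by simp
  have \<chi>i: "\<chi> (\<ominus>\<^bsub>M'\<^esub> x) = inv\<^bsub>QZ\<^esub> \<chi> x" if "x \<in> carrier M'" for x
    using group_hom.hom_inv[OF \<chi>, of x] that by (simp add: a_inv_def)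
  have "partial_character (add_monoid M) ((\<lambda>x. (f x, \<chi> x)) ` carrier M')"
  proof (rule partial_characterI)
    show "comm_group (add_monoid M)" by (rule M.a_comm_group)
    show "(\<lambda>x. (f x, \<chi> x)) ` carrier M' \<subseteq> carrier (add_monoid M) \<times> carrier QZ" using C(1) H(1) by auto
    show "(\<one>\<^bsub>add_monoid M\<^esub>, \<one>\<^bsub>QZ\<^esub>) \<in> (\<lambda>x. (f x, \<chi> x)) ` carrier M'"
      by (rule image_eqI[of _ _ "\<zero>\<^bsub>M'\<^esub>"]) (simp_all add: f0 \<chi>0)
  next
    fix a q assume "(a, q) \<in> (\<lambda>x. (f x, \<chi> x)) ` carrier M'"
    then obtain x where x: "x \<in> carrier M'" "a = f x" "q = \<chi> x" by auto
    then show "(inv\<^bsub>add_monoid M\<^esub> a, inv\<^bsub>QZ\<^esub> q) \<in> (\<lambda>x. (f x, \<chi> x)) ` carrier M'"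
      using mod_hom_uminus[OF assms(3,1,2) x(1)] \<chi>i[OF x(1)]
      by (intro image_eqI[of _ _ "\<ominus>\<^bsub>M'\<^esub> x"]) (simp_all add: a_inv_def)
  next
    fix a q a' q' assume "(a, q) \<in> (\<lambda>x. (f x, \<chi> x)) ` carrier M'" "(a', q') \<in> (\<lambda>x. (f x, \<chi> x)) ` carrier M'"
    then obtain x y where "x \<in> carrier M'" "a = f x" "q = \<chi> x" "y \<in> carrier M'" "a' = f y" "q' = \<chi> y" by auto
    then show "(a \<otimes>\<^bsub>add_monoid M\<^esub> a', q \<otimes>\<^bsub>QZ\<^esub> q') \<in> (\<lambda>x. (f x, \<chi> x)) ` carrier M'"
      by (intro image_eqI[of _ _ "x \<oplus>\<^bsub>M'\<^esub> y"]) (simp_all add: H C)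
  next
    fix q assume "(\<one>\<^bsub>add_monoid M\<^esub>, q) \<in> (\<lambda>x. (f x, \<chi> x)) ` carrier M'"
    then obtain x where x: "x \<in> carrier M'" "\<zero>\<^bsub>M\<^esub> = f x" "q = \<chi> x" by auto
    then have "x = \<zero>\<^bsub>M'\<^esub>" using inj_onD[OF assms(4), of x "\<zero>\<^bsub>M'\<^esub>"] f0 by simp
    then show "q = \<one>\<^bsub>QZ\<^esub>" using x \<chi>0 by simp
  qed
  then obtain \<phi> where \<phi>: "\<phi> \<in> hom (add_monoid M) QZ" "\<And>x. x \<in> carrier M' \<Longrightarrow> \<phi> (f x) = \<chi> x"
    using partial_character_extend[OF M.a_comm_group] by force
  have "restrict \<phi> (carrier M) \<in> carrier (char_module S M)"
    using \<phi>(1) by (intro char_carrierI) (auto simp: hom_def)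
  then show ?thesis using \<phi>(2) H(1) by (intro bexI[of _ "restrict \<phi> (carrier M)"]) auto
qed

text \<open>Projectives are flat: \<open>M^+ \<rightarrow> M'^+\<close> is onto, so a map from P to
  \<open>M'^+\<close> lifts. The lift is taken between copies B and B', because
  \<open>projective\<close> tests only against modules carried by \<open>'u\<close>.\<close>

lemma projective_bal_ext:
  assumes U: "universe TYPE('u)" and P: "projective (op_ring R) P"
    and mods: "M' \<in> modules (R :: 'u ring)" "M \<in> modules R"
    and f: "f \<in> mod_hom R M' M" "inj_on f (carrier M')"
  shows "bal_ext R f M' M P"
  unfolding bal_ext_def
proof
  fix \<beta> assume \<beta>: "\<beta> \<in> balanced R M' P"
  note lm = modulesD(1)[OF mods(1)] modulesD(1)[OF mods(2)]
  note H = mod_homD[OF f(1)]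
  obtain B' where B': "B' \<in> modules (op_ring R)" "isomorphic R (char_module R M') B'"
    by (rule char_copy_exists[OF U mods(1)])
  obtain B where B: "B \<in> modules (op_ring R)" "isomorphic R (char_module R M) B"
    by (rule char_copy_exists[OF U mods(2)])
  obtain \<phi>' where \<phi>': "\<phi>' \<in> mod_hom R (char_module R M') B'" "bij_betw \<phi>' (carrier (char_module R M')) (carrier B')"
    using B'(2) unfolding isomorphic_def by blast
  obtain \<phi> where \<phi>: "\<phi> \<in> mod_hom R (char_module R M) B" "bij_betw \<phi> (carrier (char_module R M)) (carrier B)"
    using B(2) unfolding isomorphic_def by blast
  define \<psi> where "\<psi> = inv_into (carrier (char_module R M)) \<phi>"
  have \<psi>: "\<psi> \<in> mod_hom R B (char_module R M)"
    using inv_mod_hom[OF left_module_char[OF lm(2)] modulesD(1)[OF B(1)], of \<phi>] \<phi> unfolding \<psi>_def by simp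
  have \<psi>\<phi>: "\<psi> (\<phi> x) = x" if "x \<in> carrier (char_module R M)" for x
    unfolding \<psi>_def using \<phi>(2) that by (simp add: bij_betw_def)
  \<comment> \<open>The dual map of f, which \<open>char_extend\<close> shows to be
    surjective.\<close>
  define c where "c \<chi> = (\<lambda>x\<in>carrier M'. \<chi> (f x))" for \<chi> :: "'u \<Rightarrow> rat set"
  note smul = left_module.smult_closed[OF lm(1)]
  have add: "x \<oplus>\<^bsub>M'\<^esub> y \<in> carrier M'" if "x \<in> carrier M'" "y \<in> carrier M'" for x y
    using that abelian_groupE(1)[OF modulesD(2)[OF mods(1)]] by blast
  have c: "c \<in> mod_hom R (char_module R M) (char_module R M')"
  proof (rule mod_homI)
    fix \<chi> assume "\<chi> \<in> carrier (char_module R M)"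
    then show "c \<chi> \<in> carrier (char_module R M')"
      unfolding c_def by (intro char_carrierI) (auto simp: char_carrierD H add)
  next
    fix \<chi> \<chi>' assume "\<chi> \<in> carrier (char_module R M)" "\<chi>' \<in> carrier (char_module R M)"
    then show "c (\<chi> \<oplus>\<^bsub>char_module R M\<^esub> \<chi>') = c \<chi> \<oplus>\<^bsub>char_module R M'\<^esub> c \<chi>'"
      unfolding c_def char_module_simps by (auto intro!: restrict_ext simp: H)
  next
    fix r \<chi> assume "r \<in> carrier R" "\<chi> \<in> carrier (char_module R M)"
    then show "c (r \<odot>\<^bsub>char_module R M\<^esub> \<chi>) = r \<odot>\<^bsub>char_module R M'\<^esub> c \<chi>"
      unfolding c_def char_module_simps by (auto intro!: restrict_ext simp: H smul)
  qed
  let ?g = "\<phi>' \<circ> (c \<circ> \<psi>)"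
  have g: "?g \<in> mod_hom R B B'" by (rule mod_hom_comp[OF mod_hom_comp[OF \<psi> c] \<phi>'(1)])
  have onto: "?g ` carrier B = carrier B'"
  proof
    show "?g ` carrier B \<subseteq> carrier B'" using mod_homD(1)[OF g] by blast
    show "carrier B' \<subseteq> ?g ` carrier B"
    proof
      fix b assume "b \<in> carrier B'"
      then obtain \<chi> where \<chi>: "\<chi> \<in> carrier (char_module R M')" "b = \<phi>' \<chi>"
        using \<phi>'(2) unfolding bij_betw_def by blast
      obtain \<theta> where \<theta>: "\<theta> \<in> carrier (char_module R M)" "\<And>x. x \<in> carrier M' \<Longrightarrow> \<theta> (f x) = \<chi> x"
        using char_extend[OF modulesD(2)[OF mods(1)] modulesD(2)[OF mods(2)] f \<chi>(1)] by blast
      have "c \<theta> = \<chi>"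
        by (rule extensionalityI[of _ "carrier M'"]) (use char_carrierD(3)[OF \<chi>(1)] \<theta>(2) in \<open>auto simp: c_def\<close>)
      then have "b = ?g (\<phi> \<theta>)" using \<chi>(2) \<psi>\<phi>[OF \<theta>(1)] by simp
      then show "b \<in> ?g ` carrier B" using mod_homD(1)[OF \<phi>(1) \<theta>(1)] by blast
    qed
  qed
  have h: "(\<lambda>p. \<lambda>m\<in>carrier M'. \<beta> m p) \<in> mod_hom R P (char_module R M')" (is "?h \<in> _")
    by (rule balanced_mod_hom_char[OF balanced_swap[OF \<beta>] left_module_acted[OF lm(1)]])
  have "\<forall>B\<in>modules (op_ring R). \<forall>C\<in>modules (op_ring R). \<forall>g\<in>mod_hom R B C. \<forall>f\<in>mod_hom R P C.
      g ` carrier B = carrier C \<longrightarrow> (\<exists>k\<in>mod_hom R P B. \<forall>p\<in>carrier P. g (k p) = f p)"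
    using P unfolding projective_def by simp
  note lift = mp[OF bspec[OF bspec[OF bspec[OF bspec[OF this B(1)] B'(1)] g] mod_hom_comp[OF h \<phi>'(1)]] onto]
  obtain k where k: "k \<in> mod_hom R P B" "\<And>p. p \<in> carrier P \<Longrightarrow> ?g (k p) = \<phi>' (?h p)"
    using lift by auto
  have \<psi>k: "\<psi> \<circ> k \<in> mod_hom R P (char_module R M)" by (rule mod_hom_comp[OF k(1) \<psi>])
  have "(\<psi> \<circ> k) p (f m) = \<beta> m p" if m: "m \<in> carrier M'" and p: "p \<in> carrier P" for m p
  proof -
    have "c ((\<psi> \<circ> k) p) = ?h p"
      by (rule inj_onD[OF bij_betw_imp_inj_on[OF \<phi>'(2)]])
        (use k(2)[OF p] mod_homD(1)[OF c mod_homD(1)[OF \<psi>k p]] mod_homD(1)[OF h p] in auto)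
    then have "c ((\<psi> \<circ> k) p) m = \<beta> m p" using m by simp
    then show ?thesis using m unfolding c_def by simp
  qed
  then show "\<exists>\<gamma>\<in>balanced R M P. \<forall>x\<in>carrier M'. \<forall>n\<in>carrier P. \<gamma> (f x) n = \<beta> x n"
    by (intro bexI[OF _ balanced_swap[OF mod_hom_char_balanced[OF \<psi>k]]]) simp
qed

section \<open>Exactness of tensor products in terms of balanced maps\<close>

lemma fag_hom_diff:
  assumes "\<phi> \<in> hom (free_Abelian_group S) QZ" "Poly_Mapping.keys x \<subseteq> S" "Poly_Mapping.keys y \<subseteq> S"
  shows "\<phi> (x - y) = \<phi> x \<otimes>\<^bsub>QZ\<^esub> inv\<^bsub>QZ\<^esub> \<phi> y"
proof -
  interpret group_hom "free_Abelian_group S" QZ \<phi>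
    using assms(1) by (simp add: group_hom_def group_hom_axioms_def QZ.group_axioms)
  have y: "Poly_Mapping.keys (- y) \<subseteq> S" using assms(3) by simp
  have "\<phi> (x - y) = \<phi> (x \<otimes>\<^bsub>free_Abelian_group S\<^esub> inv\<^bsub>free_Abelian_group S\<^esub> y)"
    using assms(3) by simp
  also have "\<dots> = \<phi> x \<otimes>\<^bsub>QZ\<^esub> inv\<^bsub>QZ\<^esub> \<phi> y"
    using assms(2,3) y by (simp only: hom_mult hom_inv carrier_free_Abelian_group_iff inv_free_Abelian_group)
      (metis assms(3) carrier_free_Abelian_group_iff hom_inv inv_free_Abelian_group)
  finally show ?thesis .
qed

lemma fag_hom_eq:
  assumes "\<phi> \<in> hom (free_Abelian_group S) QZ" "\<psi> \<in> hom (free_Abelian_group S) QZ"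
    and gen: "\<And>a. a \<in> S \<Longrightarrow> \<phi> (frag_of a) = \<psi> (frag_of a)" and x: "Poly_Mapping.keys x \<subseteq> S"
  shows "\<phi> x = \<psi> x"
proof (rule free_Abelian_group_induct[OF x])
  have "group_hom (free_Abelian_group S) QZ \<phi>" "group_hom (free_Abelian_group S) QZ \<psi>"
    using assms(1,2) by (simp_all add: group_hom_def group_hom_axioms_def QZ.group_axioms)
  from this[THEN group_hom.hom_one] show "\<phi> 0 = \<psi> 0" by simp
qed (simp_all add: fag_hom_diff[OF assms(1)] fag_hom_diff[OF assms(2)] gen)

abbreviation tensor_free :: "('r, 'a) module \<Rightarrow> ('r, 'b) module \<Rightarrow> ('a \<times> 'b \<Rightarrow>\<^sub>0 int) monoid" where
  "tensor_free A L \<equiv> free_Abelian_group (carrier A \<times> carrier L)"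

lemma subgroup_tensor:
  assumes "acted R A" "acted R L"
  shows "subgroup (tensor_subgroup R A L) (tensor_free A L)"
proof -
  interpret A: abelian_group A using assms(1) unfolding acted_def by simp
  interpret L: abelian_group L using assms(2) unfolding acted_def by simp
  have c: "\<And>r x. r \<in> carrier R \<Longrightarrow> x \<in> carrier A \<Longrightarrow> r \<odot>\<^bsub>A\<^esub> x \<in> carrier A"
    "\<And>r x. r \<in> carrier R \<Longrightarrow> x \<in> carrier L \<Longrightarrow> r \<odot>\<^bsub>L\<^esub> x \<in> carrier L"
    using assms unfolding acted_def by auto
  have "tensor_relations R A L \<subseteq> carrier (tensor_free A L)"
    unfolding tensor_relations_def by (auto dest!: subsetD[OF keys_diff] simp: c)
  then show ?thesis
    unfolding tensor_subgroup_def by (rule group.generate_is_subgroup[OF group_free_Abelian_group])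
qed

lemma tensor_subgroupD:
  assumes "acted R A" "acted R L"
  shows "\<And>s. s \<in> tensor_subgroup R A L \<Longrightarrow> Poly_Mapping.keys s \<subseteq> carrier A \<times> carrier L"
    "0 \<in> tensor_subgroup R A L"
    "\<And>s t. s \<in> tensor_subgroup R A L \<Longrightarrow> t \<in> tensor_subgroup R A L \<Longrightarrow> s + t \<in> tensor_subgroup R A L"
    "\<And>s. s \<in> tensor_subgroup R A L \<Longrightarrow> - s \<in> tensor_subgroup R A L"
    "\<And>s t. s \<in> tensor_subgroup R A L \<Longrightarrow> t \<in> tensor_subgroup R A L \<Longrightarrow> s - t \<in> tensor_subgroup R A L"
    "tensor_relations R A L \<subseteq> tensor_subgroup R A L"
proof -
  note sg = subgroup_tensor[OF assms]
  show k: "Poly_Mapping.keys s \<subseteq> carrier A \<times> carrier L" if "s \<in> tensor_subgroup R A L" for s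
    using subgroup.mem_carrier[OF sg that] by simp
  show "0 \<in> tensor_subgroup R A L" using subgroup.one_closed[OF sg] by simp
  show a: "s + t \<in> tensor_subgroup R A L" if "s \<in> tensor_subgroup R A L" "t \<in> tensor_subgroup R A L" for s t
    using subgroup.m_closed[OF sg that] by simp
  show m: "- s \<in> tensor_subgroup R A L" if "s \<in> tensor_subgroup R A L" for s
    using subgroup.m_inv_closed[OF sg that] k[OF that] by simp
  show "s - t \<in> tensor_subgroup R A L" if "s \<in> tensor_subgroup R A L" "t \<in> tensor_subgroup R A L" for s t
    using a[OF that(1) m[OF that(2)]] by simp
  show "tensor_relations R A L \<subseteq> tensor_subgroup R A L"
    unfolding tensor_subgroup_def by (auto intro: generate.incl)
qed

lemma hom_kills_tensor_subgroup:
  assumes "acted R A" "acted R L" "\<phi> \<in> hom (tensor_free A L) QZ"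
    and "\<And>s. s \<in> tensor_relations R A L \<Longrightarrow> \<phi> s = \<one>\<^bsub>QZ\<^esub>" and s: "s \<in> tensor_subgroup R A L"
  shows "\<phi> s = \<one>\<^bsub>QZ\<^esub>"
proof -
  have gh: "group_hom (tensor_free A L) QZ \<phi>"
    using assms(3) by (simp add: group_hom_def group_hom_axioms_def QZ.group_axioms)
  have "tensor_relations R A L \<subseteq> kernel (tensor_free A L) QZ \<phi>"
    using tensor_subgroupD(1,6)[OF assms(1,2)] assms(4) unfolding kernel_def by auto
  then have "tensor_subgroup R A L \<subseteq> kernel (tensor_free A L) QZ \<phi>"
    unfolding tensor_subgroup_def
    by (rule group.generate_subgroup_incl[OF group_free_Abelian_group _ group_hom.subgroup_kernel[OF gh]])
  then show ?thesis using s unfolding kernel_def by auto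
qed

text \<open>With \<open>balanced_of_character\<close>, this is the universal property of the tensor
  product for the target \<open>\<rat>/\<int>\<close>. It is phrased with characters of the free
  group that kill the relations, so that no quotient group enters.\<close>

lemma character_of_balanced:
  assumes "acted R A" "acted R L" "\<beta> \<in> balanced R A L"
  obtains \<phi> where "\<phi> \<in> hom (tensor_free A L) QZ"
    "\<And>a x. a \<in> carrier A \<Longrightarrow> x \<in> carrier L \<Longrightarrow> \<phi> (frag_of (a, x)) = \<beta> a x"
    "\<And>s. s \<in> tensor_subgroup R A L \<Longrightarrow> \<phi> s = \<one>\<^bsub>QZ\<^esub>"
proof -
  interpret A: abelian_group A using assms(1) unfolding acted_def by simp
  interpret L: abelian_group L using assms(2) unfolding acted_def by simp
  have c: "\<And>r x. r \<in> carrier R \<Longrightarrow> x \<in> carrier A \<Longrightarrow> r \<odot>\<^bsub>A\<^esub> x \<in> carrier A"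
    "\<And>r x. r \<in> carrier R \<Longrightarrow> x \<in> carrier L \<Longrightarrow> r \<odot>\<^bsub>L\<^esub> x \<in> carrier L"
    using assms unfolding acted_def by auto
  note B = balancedD[OF assms(3)]
  have "(\<lambda>(a, x). \<beta> a x) ` (carrier A \<times> carrier L) \<subseteq> carrier QZ" using B(1) by auto
  then obtain \<phi> where \<phi>: "\<phi> \<in> hom (tensor_free A L) QZ"
    "\<And>p. p \<in> carrier A \<times> carrier L \<Longrightarrow> \<phi> (frag_of p) = (\<lambda>(a, x). \<beta> a x) p"
    using QZ.free_Abelian_group_universal by blast
  have g: "\<phi> (frag_of (a, x)) = \<beta> a x" if "a \<in> carrier A" "x \<in> carrier L" for a x
    using \<phi>(2)[of "(a, x)"] that by simp
  have keys: "Poly_Mapping.keys (x - y) \<subseteq> S" if "Poly_Mapping.keys x \<subseteq> S" "Poly_Mapping.keys y \<subseteq> S"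
    for x y :: "'x \<Rightarrow>\<^sub>0 int" and S
    using that keys_diff[of x y] by blast
  have can: "p \<otimes>\<^bsub>QZ\<^esub> q \<otimes>\<^bsub>QZ\<^esub> inv\<^bsub>QZ\<^esub> p \<otimes>\<^bsub>QZ\<^esub> inv\<^bsub>QZ\<^esub> q = \<one>\<^bsub>QZ\<^esub>" if "p \<in> carrier QZ" "q \<in> carrier QZ" for p q
  proof -
    have "p \<otimes>\<^bsub>QZ\<^esub> q \<otimes>\<^bsub>QZ\<^esub> inv\<^bsub>QZ\<^esub> p \<otimes>\<^bsub>QZ\<^esub> inv\<^bsub>QZ\<^esub> q = (p \<otimes>\<^bsub>QZ\<^esub> q) \<otimes>\<^bsub>QZ\<^esub> inv\<^bsub>QZ\<^esub> (p \<otimes>\<^bsub>QZ\<^esub> q)"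
      using that by (simp add: QZ.inv_mult QZ.m_assoc)
    then show ?thesis using that by simp
  qed
  have "\<phi> s = \<one>\<^bsub>QZ\<^esub>" if "s \<in> tensor_relations R A L" for s
    using that unfolding tensor_relations_def
    by (auto simp: fag_hom_diff[OF \<phi>(1)] keys c g B can)
  then show ?thesis using that \<phi>(1) g hom_kills_tensor_subgroup[OF assms(1,2) \<phi>(1)] by blast
qed

lemma balanced_of_character:
  assumes "acted R A" "acted R L" "\<phi> \<in> hom (tensor_free A L) QZ"
    and "\<And>s. s \<in> tensor_subgroup R A L \<Longrightarrow> \<phi> s = \<one>\<^bsub>QZ\<^esub>"
  shows "(\<lambda>a x. \<phi> (frag_of (a, x))) \<in> balanced R A L"
proof -
  interpret A: abelian_group A using assms(1) unfolding acted_def by simp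
  interpret L: abelian_group L using assms(2) unfolding acted_def by simp
  have c: "\<And>r x. r \<in> carrier R \<Longrightarrow> x \<in> carrier A \<Longrightarrow> r \<odot>\<^bsub>A\<^esub> x \<in> carrier A"
    "\<And>r x. r \<in> carrier R \<Longrightarrow> x \<in> carrier L \<Longrightarrow> r \<odot>\<^bsub>L\<^esub> x \<in> carrier L"
    using assms unfolding acted_def by auto
  have closed: "\<phi> (frag_of (a, x)) \<in> carrier QZ" if "a \<in> carrier A" "x \<in> carrier L" for a x
    using assms(3) that by (auto simp: hom_def Pi_iff)
  have rel: "\<phi> s = \<one>\<^bsub>QZ\<^esub>" if "s \<in> tensor_relations R A L" for s
    using assms(4) tensor_subgroupD(6)[OF assms(1,2)] that by blast
  have keys: "Poly_Mapping.keys (x - y) \<subseteq> S" if "Poly_Mapping.keys x \<subseteq> S" "Poly_Mapping.keys y \<subseteq> S"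
    for x y :: "'x \<Rightarrow>\<^sub>0 int" and S
    using that keys_diff[of x y] by blast
  have eq: "x = y" if "x \<otimes>\<^bsub>QZ\<^esub> inv\<^bsub>QZ\<^esub> y = \<one>\<^bsub>QZ\<^esub>" "x \<in> carrier QZ" "y \<in> carrier QZ" for x y
    using QZ.inv_equality[OF that(1)] that(2,3) by simp
  have eq3: "x = y \<otimes>\<^bsub>QZ\<^esub> z" if "x \<otimes>\<^bsub>QZ\<^esub> inv\<^bsub>QZ\<^esub> y \<otimes>\<^bsub>QZ\<^esub> inv\<^bsub>QZ\<^esub> z = \<one>\<^bsub>QZ\<^esub>"
    "x \<in> carrier QZ" "y \<in> carrier QZ" "z \<in> carrier QZ" for x y z
    by (rule eq) (use that in \<open>simp_all add: QZ.inv_mult QZ.m_assoc\<close>)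
  show ?thesis
  proof (rule balancedI)
    fix a a' x assume a: "a \<in> carrier A" "a' \<in> carrier A" "x \<in> carrier L"
    have "\<phi> (frag_of (a \<oplus>\<^bsub>A\<^esub> a', x) - frag_of (a, x) - frag_of (a', x)) = \<one>\<^bsub>QZ\<^esub>"
      by (rule rel) (use a in \<open>auto simp: tensor_relations_def\<close>)
    then show "\<phi> (frag_of (a \<oplus>\<^bsub>A\<^esub> a', x)) = \<phi> (frag_of (a, x)) \<otimes>\<^bsub>QZ\<^esub> \<phi> (frag_of (a', x))"
      using a by (rule_tac eq3) (simp_all add: fag_hom_diff[OF assms(3)] keys closed)
  next
    fix a x x' assume a: "a \<in> carrier A" "x \<in> carrier L" "x' \<in> carrier L"
    have "\<phi> (frag_of (a, x \<oplus>\<^bsub>L\<^esub> x') - frag_of (a, x) - frag_of (a, x')) = \<one>\<^bsub>QZ\<^esub>"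
      by (rule rel) (use a in \<open>auto simp: tensor_relations_def\<close>)
    then show "\<phi> (frag_of (a, x \<oplus>\<^bsub>L\<^esub> x')) = \<phi> (frag_of (a, x)) \<otimes>\<^bsub>QZ\<^esub> \<phi> (frag_of (a, x'))"
      using a by (rule_tac eq3) (simp_all add: fag_hom_diff[OF assms(3)] keys closed)
  next
    fix r a x assume a: "r \<in> carrier R" "a \<in> carrier A" "x \<in> carrier L"
    have "\<phi> (frag_of (r \<odot>\<^bsub>A\<^esub> a, x) - frag_of (a, r \<odot>\<^bsub>L\<^esub> x)) = \<one>\<^bsub>QZ\<^esub>"
      by (rule rel) (use a in \<open>auto simp: tensor_relations_def\<close>)
    then show "\<phi> (frag_of (r \<odot>\<^bsub>A\<^esub> a, x)) = \<phi> (frag_of (a, r \<odot>\<^bsub>L\<^esub> x))"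
      using a by (rule_tac eq) (simp_all add: fag_hom_diff[OF assms(3)] c closed)
  qed (rule closed)
qed

section \<open>Maps induced on tensor products, on representatives and on cosets\<close>

abbreviation frag_lift :: "('b \<Rightarrow> 'c) \<Rightarrow> ('a \<times> 'b \<Rightarrow>\<^sub>0 int) \<Rightarrow> ('a \<times> 'c \<Rightarrow>\<^sub>0 int)" where
  "frag_lift f \<equiv> frag_extend (\<lambda>(a, x). frag_of (a, f x))"

lemma frag_lift_keys:
  assumes "f \<in> mod_hom R L L'" "Poly_Mapping.keys t \<subseteq> A \<times> carrier L"
  shows "Poly_Mapping.keys (frag_lift f t) \<subseteq> A \<times> carrier L'"
proof -
  have "Poly_Mapping.keys (frag_lift f t) \<subseteq> (\<Union>p\<in>Poly_Mapping.keys t. Poly_Mapping.keys ((\<lambda>(a, x). frag_of (a, f x)) p))"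
    by (rule keys_frag_extend)
  also have "\<dots> \<subseteq> A \<times> carrier L'" using mod_homD(1)[OF assms(1)] assms(2) by auto
  finally show ?thesis .
qed

lemma frag_lift_hom:
  assumes "f \<in> mod_hom R L L'"
  shows "frag_lift f \<in> hom (free_Abelian_group (A \<times> carrier L)) (free_Abelian_group (A \<times> carrier L'))"
  by (rule homI) (simp_all add: frag_lift_keys[OF assms] frag_extend_add)

lemma frag_lift_tensor_subgroup:
  assumes "acted R A" "acted R L" "acted R L'" "f \<in> mod_hom R L L'" "s \<in> tensor_subgroup R A L"
  shows "frag_lift f s \<in> tensor_subgroup R A L'"
proof -
  have f: "\<And>x. x \<in> carrier L \<Longrightarrow> f x \<in> carrier L'" using mod_homD(1)[OF assms(4)] .
  have gh: "group_hom (tensor_free A L) (tensor_free A L') (frag_lift f)"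
    using frag_lift_hom[OF assms(4)] by (simp add: group_hom_def group_hom_axioms_def)
  have "frag_lift f r \<in> tensor_relations R A L'" if r: "r \<in> tensor_relations R A L" for r
  proof -
    consider a a' x where "a \<in> carrier A" "a' \<in> carrier A" "x \<in> carrier L"
        "r = frag_of (a \<oplus>\<^bsub>A\<^esub> a', x) - frag_of (a, x) - frag_of (a', x)"
      | a x x' where "a \<in> carrier A" "x \<in> carrier L" "x' \<in> carrier L"
        "r = frag_of (a, x \<oplus>\<^bsub>L\<^esub> x') - frag_of (a, x) - frag_of (a, x')"
      | k a x where "k \<in> carrier R" "a \<in> carrier A" "x \<in> carrier L"
        "r = frag_of (k \<odot>\<^bsub>A\<^esub> a, x) - frag_of (a, k \<odot>\<^bsub>L\<^esub> x)"
      using r unfolding tensor_relations_def by blast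
    then show ?thesis
    proof cases
      case 1
      then have "frag_lift f r = frag_of (a \<oplus>\<^bsub>A\<^esub> a', f x) - frag_of (a, f x) - frag_of (a', f x)"
        by (simp add: frag_extend_diff)
      then show ?thesis using 1 f unfolding tensor_relations_def by blast
    next
      case 2
      then have "frag_lift f r = frag_of (a, f x \<oplus>\<^bsub>L'\<^esub> f x') - frag_of (a, f x) - frag_of (a, f x')"
        by (simp add: frag_extend_diff mod_homD(2)[OF assms(4)])
      then show ?thesis using 2 f unfolding tensor_relations_def by blast
    next
      case 3
      then have "frag_lift f r = frag_of (k \<odot>\<^bsub>A\<^esub> a, f x) - frag_of (a, k \<odot>\<^bsub>L'\<^esub> f x)"
        by (simp add: frag_extend_diff mod_homD(3)[OF assms(4)])
      then show ?thesis using 3 f unfolding tensor_relations_def by blast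
    qed
  qed
  then have sub: "frag_lift f ` tensor_relations R A L \<subseteq> tensor_subgroup R A L'"
    using tensor_subgroupD(6)[OF assms(1,3)] by blast
  have "tensor_relations R A L \<subseteq> carrier (tensor_free A L)"
    using tensor_subgroupD(1,6)[OF assms(1,2)] by auto
  then have "frag_lift f ` tensor_subgroup R A L = generate (tensor_free A L') (frag_lift f ` tensor_relations R A L)"
    unfolding tensor_subgroup_def by (rule group_hom.generate_img[OF gh, symmetric])
  also have "\<dots> \<subseteq> tensor_subgroup R A L'"
    by (rule group.generate_subgroup_incl[OF group_free_Abelian_group sub subgroup_tensor[OF assms(1,3)]])
  finally show ?thesis using assms(5) by blast
qed

lemma tensor_coset_eq_iff:
  assumes "acted R A" "acted R L" "Poly_Mapping.keys t \<subseteq> carrier A \<times> carrier L" "Poly_Mapping.keys u \<subseteq> carrier A \<times> carrier L"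
  shows "tensor_subgroup R A L #>\<^bsub>tensor_free A L\<^esub> t = tensor_subgroup R A L #>\<^bsub>tensor_free A L\<^esub> u \<longleftrightarrow>
    t - u \<in> tensor_subgroup R A L"
proof -
  note T = tensor_subgroupD[OF assms(1,2)]
  have mem: "x \<in> tensor_subgroup R A L #>\<^bsub>tensor_free A L\<^esub> y \<longleftrightarrow> x - y \<in> tensor_subgroup R A L" for x y
    unfolding r_coset_def by (auto intro!: bexI[of _ "x - y"])
  show ?thesis
  proof
    assume "tensor_subgroup R A L #>\<^bsub>tensor_free A L\<^esub> t = tensor_subgroup R A L #>\<^bsub>tensor_free A L\<^esub> u"
    then show "t - u \<in> tensor_subgroup R A L" using mem[of t t] mem[of t u] T(2) by simp
  next
    assume tu: "t - u \<in> tensor_subgroup R A L"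
    have "x - t \<in> tensor_subgroup R A L \<longleftrightarrow> x - u \<in> tensor_subgroup R A L" for x
      using T(3)[OF _ tu, of "x - t"] T(5)[OF _ tu, of "x - u"] by (auto simp: algebra_simps)
    then show "tensor_subgroup R A L #>\<^bsub>tensor_free A L\<^esub> t = tensor_subgroup R A L #>\<^bsub>tensor_free A L\<^esub> u"
      using mem by blast
  qed
qed

text \<open>All representatives of a coset are sent into one coset, so the set to which
  \<open>tensor_map\<close> applies \<open>the_elem\<close> is a singleton.\<close>

lemma tensor_map_coset:
  assumes "acted R A" "acted R L" "acted R L'" "f \<in> mod_hom R L L'"
    and t: "Poly_Mapping.keys t \<subseteq> carrier A \<times> carrier L"
  shows "tensor_map R A L' f (tensor_subgroup R A L #>\<^bsub>tensor_free A L\<^esub> t) =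
    tensor_subgroup R A L' #>\<^bsub>tensor_free A L'\<^esub> frag_lift f t"
proof -
  have f: "\<And>x. x \<in> carrier L \<Longrightarrow> f x \<in> carrier L'" using mod_homD(1)[OF assms(4)] .
  have "tensor_subgroup R A L' #>\<^bsub>tensor_free A L'\<^esub> frag_lift f u =
      tensor_subgroup R A L' #>\<^bsub>tensor_free A L'\<^esub> frag_lift f t"
    if u: "u \<in> tensor_subgroup R A L #>\<^bsub>tensor_free A L\<^esub> t" for u
  proof -
    obtain s where s: "s \<in> tensor_subgroup R A L" "u = s + t" using u unfolding r_coset_def by auto
    have uk: "Poly_Mapping.keys u \<subseteq> carrier A \<times> carrier L"
      using s(2) keys_add[of s t] tensor_subgroupD(1)[OF assms(1,2) s(1)] t by blast
    then show ?thesis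
      using tensor_coset_eq_iff[OF assms(1,3) frag_lift_keys[OF assms(4) uk] frag_lift_keys[OF assms(4) t]]
        frag_lift_tensor_subgroup[OF assms(1-4) s(1)] s(2) by (simp add: frag_extend_add)
  qed
  moreover have "t \<in> tensor_subgroup R A L #>\<^bsub>tensor_free A L\<^esub> t"
    using tensor_subgroupD(2)[OF assms(1,2)] unfolding r_coset_def by force
  ultimately have "(\<lambda>t. tensor_subgroup R A L' #>\<^bsub>tensor_free A L'\<^esub> frag_lift f t) ` (tensor_subgroup R A L #>\<^bsub>tensor_free A L\<^esub> t)
      = {tensor_subgroup R A L' #>\<^bsub>tensor_free A L'\<^esub> frag_lift f t}"
    by blast
  then show ?thesis unfolding tensor_map_def by (simp only: the_elem_eq)
qed

text \<open>Moves exactness from cosets to representatives in the free groups, where the characters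
  of the next lemma are defined.\<close>

lemma tensor_exact_at_iff:
  assumes acted: "acted R A" "acted R L1" "acted R L0" "acted R L'"
    and f: "f \<in> mod_hom R L1 L0" and g: "g \<in> mod_hom R L0 L'"
  shows "tensor_map R A L0 f ` carrier (tensor R A L1) = kernel (tensor R A L0) (tensor R A L') (tensor_map R A L' g) \<longleftrightarrow>
    (\<forall>t. Poly_Mapping.keys t \<subseteq> carrier A \<times> carrier L0 \<longrightarrow>
      (frag_lift g t \<in> tensor_subgroup R A L' \<longleftrightarrow>
        (\<exists>s. Poly_Mapping.keys s \<subseteq> carrier A \<times> carrier L1 \<and> t - frag_lift f s \<in> tensor_subgroup R A L0)))"
proof -
  let ?c1 = "\<lambda>t. tensor_subgroup R A L1 #>\<^bsub>tensor_free A L1\<^esub> t"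
  let ?c0 = "\<lambda>t. tensor_subgroup R A L0 #>\<^bsub>tensor_free A L0\<^esub> t"
  let ?c' = "\<lambda>t. tensor_subgroup R A L' #>\<^bsub>tensor_free A L'\<^esub> t"
  let ?F1 = "{t. Poly_Mapping.keys t \<subseteq> carrier A \<times> carrier L1}"
  let ?F0 = "{t. Poly_Mapping.keys t \<subseteq> carrier A \<times> carrier L0}"
  note f1 = mod_homD(1)[OF f] and g1 = mod_homD(1)[OF g]
  have car: "carrier (tensor R A L1) = ?c1 ` ?F1" "carrier (tensor R A L0) = ?c0 ` ?F0"
    unfolding tensor_def carrier_FactGroup by (auto simp: free_Abelian_group_def)
  have one: "\<one>\<^bsub>tensor R A L'\<^esub> = ?c' 0"
    unfolding tensor_def by (auto simp: r_coset_def)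
  have im: "tensor_map R A L0 f ` carrier (tensor R A L1) = (\<lambda>s. ?c0 (frag_lift f s)) ` ?F1"
    unfolding car image_image by (rule image_cong) (simp_all add: tensor_map_coset[OF acted(1-3) f])
  have ker: "?c0 t \<in> kernel (tensor R A L0) (tensor R A L') (tensor_map R A L' g) \<longleftrightarrow> frag_lift g t \<in> tensor_subgroup R A L'"
    if "t \<in> ?F0" for t
    using that tensor_map_coset[OF acted(1,3,4) g, of t]
      tensor_coset_eq_iff[OF acted(1,4), of "frag_lift g t" 0] frag_lift_keys[OF g, of t "carrier A"]
    unfolding kernel_def one by (auto simp: car)
  have ker_sub: "kernel (tensor R A L0) (tensor R A L') (tensor_map R A L' g) \<subseteq> ?c0 ` ?F0"
    unfolding kernel_def car by blast
  have im_iff: "?c0 t \<in> (\<lambda>s. ?c0 (frag_lift f s)) ` ?F1 \<longleftrightarrow>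
      (\<exists>s. Poly_Mapping.keys s \<subseteq> carrier A \<times> carrier L1 \<and> t - frag_lift f s \<in> tensor_subgroup R A L0)" if "t \<in> ?F0" for t
  proof -
    have t: "Poly_Mapping.keys t \<subseteq> carrier A \<times> carrier L0" using that by simp
    have "?c0 t = ?c0 (frag_lift f s) \<longleftrightarrow> t - frag_lift f s \<in> tensor_subgroup R A L0"
      if "Poly_Mapping.keys s \<subseteq> carrier A \<times> carrier L1" for s
      by (rule tensor_coset_eq_iff[OF acted(1,3) t frag_lift_keys[OF f that]])
    then show ?thesis unfolding image_iff by blast
  qed
  have im_sub: "(\<lambda>s. ?c0 (frag_lift f s)) ` ?F1 \<subseteq> ?c0 ` ?F0"
    using frag_lift_keys[OF f] by blast
  show ?thesis
    unfolding im
  proof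
    assume eq: "(\<lambda>s. ?c0 (frag_lift f s)) ` ?F1 = kernel (tensor R A L0) (tensor R A L') (tensor_map R A L' g)"
    show "\<forall>t. Poly_Mapping.keys t \<subseteq> carrier A \<times> carrier L0 \<longrightarrow>
      (frag_lift g t \<in> tensor_subgroup R A L' \<longleftrightarrow>
        (\<exists>s. Poly_Mapping.keys s \<subseteq> carrier A \<times> carrier L1 \<and> t - frag_lift f s \<in> tensor_subgroup R A L0))"
      using ker[unfolded eq[symmetric]] im_iff by simp
  next
    assume all: "\<forall>t. Poly_Mapping.keys t \<subseteq> carrier A \<times> carrier L0 \<longrightarrow>
      (frag_lift g t \<in> tensor_subgroup R A L' \<longleftrightarrow>
        (\<exists>s. Poly_Mapping.keys s \<subseteq> carrier A \<times> carrier L1 \<and> t - frag_lift f s \<in> tensor_subgroup R A L0))"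
    have iff: "?c0 t \<in> (\<lambda>s. ?c0 (frag_lift f s)) ` ?F1 \<longleftrightarrow>
        ?c0 t \<in> kernel (tensor R A L0) (tensor R A L') (tensor_map R A L' g)" if "t \<in> ?F0" for t
      unfolding ker[OF that] im_iff[OF that] using all that by blast
    show "(\<lambda>s. ?c0 (frag_lift f s)) ` ?F1 = kernel (tensor R A L0) (tensor R A L') (tensor_map R A L' g)"
    proof (rule subset_antisym; rule subsetI)
      fix T assume T: "T \<in> (\<lambda>s. ?c0 (frag_lift f s)) ` ?F1"
      from subsetD[OF im_sub T] obtain t where "t \<in> ?F0" "T = ?c0 t" by (rule imageE)
      then show "T \<in> kernel (tensor R A L0) (tensor R A L') (tensor_map R A L' g)" using iff T by simp
    next
      fix T assume T: "T \<in> kernel (tensor R A L0) (tensor R A L') (tensor_map R A L' g)"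
      from subsetD[OF ker_sub T] obtain t where "t \<in> ?F0" "T = ?c0 t" by (rule imageE)
      then show "T \<in> (\<lambda>s. ?c0 (frag_lift f s)) ` ?F1" using iff T by simp
    qed
  qed
qed

text \<open>
  The left-to-right direction uses that \<open>\<rat>/\<int>\<close> is injective, the converse that it is a cogenerator.
\<close>

lemma tensor_exact_at_iff_bal_ext:
  assumes acted: "acted R A" "acted R L1" "acted R L0" "acted R L'" "acted R Z"
    and f: "f \<in> mod_hom R L1 L0" and p: "p \<in> mod_hom R L0 Z" and i: "i \<in> mod_hom R Z L'"
    and g: "\<And>x. g x = i (p x)" and inj: "inj_on i (carrier Z)"
    and onto: "\<And>z. z \<in> carrier Z \<Longrightarrow> \<exists>x\<in>carrier L0. z = p x"
    and ex: "f ` carrier L1 = {x \<in> carrier L0. p x = \<zero>\<^bsub>Z\<^esub>}"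
  shows "tensor_map R A L0 f ` carrier (tensor R A L1) = kernel (tensor R A L0) (tensor R A L') (tensor_map R A L' g) \<longleftrightarrow>
    bal_ext R i Z L' A"
proof -
  have g_eq: "g = i \<circ> p" using g by auto
  have gh: "g \<in> mod_hom R L0 L'" unfolding g_eq by (rule mod_hom_comp[OF p i])
  note f1 = mod_homD(1)[OF f] and g1 = mod_homD(1)[OF gh]
  have ag: "abelian_group A" "abelian_group Z" "abelian_group L'" using acted unfolding acted_def by auto
  have pf: "p (f x) = \<zero>\<^bsub>Z\<^esub>" if "x \<in> carrier L1" for x using ex that by blast
  have i0: "i \<zero>\<^bsub>Z\<^esub> = \<zero>\<^bsub>L'\<^esub>" by (rule mod_hom_zero[OF i ag(2,3)])
  note T' = tensor_subgroupD[OF acted(1,4)] and T0 = tensor_subgroupD[OF acted(1,3)]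
  let ?F = "\<lambda>t. Poly_Mapping.keys t \<subseteq> carrier A \<times> carrier L0"
  let ?F1 = "\<lambda>t. Poly_Mapping.keys t \<subseteq> carrier A \<times> carrier L1"
  let ?P = "\<lambda>t. \<exists>s. ?F1 s \<and> t - frag_lift f s \<in> tensor_subgroup R A L0"
  have gf: "frag_lift g (frag_lift f s) \<in> tensor_subgroup R A L'" if s: "?F1 s" for s
  proof (rule free_Abelian_group_induct[OF s])
    fix q assume "q \<in> carrier A \<times> carrier L1"
    then obtain a x where q: "q = (a, x)" "a \<in> carrier A" "x \<in> carrier L1" by auto
    \<comment> \<open>The additivity relation for 0 + 0 = 0 is the negative of the generator
      \<open>(a, 0)\<close>, which therefore lies in the relation subgroup.\<close>
    have z: "\<zero>\<^bsub>L'\<^esub> \<in> carrier L'" using abelian_groupE(2)[OF ag(3)] .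
    have "\<zero>\<^bsub>L'\<^esub> \<oplus>\<^bsub>L'\<^esub> \<zero>\<^bsub>L'\<^esub> = \<zero>\<^bsub>L'\<^esub>" using abelian_groupE(5)[OF ag(3) z] .
    then have "frag_of (a, \<zero>\<^bsub>L'\<^esub>) - frag_of (a, \<zero>\<^bsub>L'\<^esub>) - frag_of (a, \<zero>\<^bsub>L'\<^esub>) \<in> tensor_relations R A L'"
      using q z unfolding tensor_relations_def by force
    then have "- (- frag_of (a, \<zero>\<^bsub>L'\<^esub>)) \<in> tensor_subgroup R A L'" using T'(4,6) by fastforce
    then show "frag_lift g (frag_lift f (frag_of q)) \<in> tensor_subgroup R A L'"
      using q pf g i0 by simp
  qed (simp_all add: frag_extend_diff T')
  show ?thesis
    unfolding tensor_exact_at_iff[OF acted(1-4) f gh]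
  proof
    assume L: "\<forall>t. ?F t \<longrightarrow> (frag_lift g t \<in> tensor_subgroup R A L' \<longleftrightarrow> ?P t)"
    show "bal_ext R i Z L' A"
      unfolding bal_ext_def
    proof
      fix \<beta> assume \<beta>: "\<beta> \<in> balanced R Z A"
      have \<beta>p: "(\<lambda>a x. \<beta> (p x) a) \<in> balanced R A L0"
        using balanced_swap[OF balanced_comp[OF \<beta> p mod_hom_id]] by simp
      obtain \<phi> where \<phi>: "\<phi> \<in> hom (tensor_free A L0) QZ"
        "\<And>a x. a \<in> carrier A \<Longrightarrow> x \<in> carrier L0 \<Longrightarrow> \<phi> (frag_of (a, x)) = \<beta> (p x) a"
        "\<And>s. s \<in> tensor_subgroup R A L0 \<Longrightarrow> \<phi> s = \<one>\<^bsub>QZ\<^esub>"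
        by (rule character_of_balanced[OF acted(1,3) \<beta>p]) blast
      have \<phi>h: "\<phi> t \<in> carrier QZ" if "?F t" for t using \<phi>(1) that by (auto simp: hom_def)
      have \<phi>a: "\<phi> (t + u) = \<phi> t \<otimes>\<^bsub>QZ\<^esub> \<phi> u" if "?F t" "?F u" for t u using \<phi>(1) that by (auto simp: hom_def)
      have \<phi>0: "\<phi> 0 = \<one>\<^bsub>QZ\<^esub>" using \<phi>(3) T0(2) by blast
      have \<phi>f: "\<phi> (frag_lift f s) = \<one>\<^bsub>QZ\<^esub>" if "?F1 s" for s
      proof -
        have "\<phi> \<circ> frag_lift f \<in> hom (tensor_free A L1) QZ"
          by (rule hom_compose[OF frag_lift_hom[OF f] \<phi>(1)])
        moreover have "(\<lambda>_. \<one>\<^bsub>QZ\<^esub>) \<in> hom (tensor_free A L1) QZ" by (rule homI) auto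
        ultimately have "(\<phi> \<circ> frag_lift f) s = (\<lambda>_. \<one>\<^bsub>QZ\<^esub>) s"
          by (rule fag_hom_eq) (use \<phi>(2) f1 pf balanced_zero_left[OF \<beta> ag(2)] that in auto)
        then show ?thesis by simp
      qed
      \<comment> \<open>The character \<open>\<phi>\<close> carried over to the image of g, extended
        by the trivial value on relations. It is single valued because, by exactness, an element
        that g sends into the relations comes from f up to relations, and \<open>\<phi>\<close> is
        trivial on both.\<close>
      define \<Gamma> where "\<Gamma> = {(frag_lift g t + s, \<phi> t) | t s. ?F t \<and> s \<in> tensor_subgroup R A L'}"
      have \<Gamma>I: "(frag_lift g t + s, \<phi> t) \<in> \<Gamma>" if "?F t" "s \<in> tensor_subgroup R A L'" for t s
        unfolding \<Gamma>_def using that by blast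
      have \<Gamma>E: thesis if "p \<in> \<Gamma>"
        "\<And>t s. p = (frag_lift g t + s, \<phi> t) \<Longrightarrow> ?F t \<Longrightarrow> s \<in> tensor_subgroup R A L' \<Longrightarrow> thesis" for p thesis
        using that unfolding \<Gamma>_def by blast
      have "partial_character (tensor_free A L') \<Gamma>"
      proof (rule partial_characterI[OF abelian_free_Abelian_group])
        have "Poly_Mapping.keys (frag_lift g t + s) \<subseteq> carrier A \<times> carrier L'"
          if "?F t" "s \<in> tensor_subgroup R A L'" for t s
          using keys_add[of "frag_lift g t" s] frag_lift_keys[OF gh that(1)] T'(1)[OF that(2)] by blast
        then show "\<Gamma> \<subseteq> carrier (tensor_free A L') \<times> carrier QZ"
          unfolding \<Gamma>_def using \<phi>h by auto
        show "(\<one>\<^bsub>tensor_free A L'\<^esub>, \<one>\<^bsub>QZ\<^esub>) \<in> \<Gamma>" using \<Gamma>I[of 0 0] T'(2) \<phi>0 by simp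
      next
        fix x q assume "(x, q) \<in> \<Gamma>"
        then obtain t s where ts: "x = frag_lift g t + s" "q = \<phi> t" "?F t" "s \<in> tensor_subgroup R A L'"
          by (rule \<Gamma>E) blast
        have "Poly_Mapping.keys x \<subseteq> carrier A \<times> carrier L'"
          unfolding ts(1) using keys_add[of "frag_lift g t" s] frag_lift_keys[OF gh ts(3)] T'(1)[OF ts(4)] by blast
        moreover have "inv\<^bsub>QZ\<^esub> q = \<phi> (- t)"
          using fag_hom_diff[OF \<phi>(1), of 0 t] ts \<phi>0 \<phi>h by simp
        ultimately show "(inv\<^bsub>tensor_free A L'\<^esub> x, inv\<^bsub>QZ\<^esub> q) \<in> \<Gamma>"
          using \<Gamma>I[of "- t" "- s"] ts T'(4) by (simp add: frag_extend_minus)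
      next
        fix x q x' q' assume "(x, q) \<in> \<Gamma>" "(x', q') \<in> \<Gamma>"
        from \<open>(x, q) \<in> \<Gamma>\<close> obtain t s where ts: "x = frag_lift g t + s" "q = \<phi> t" "?F t" "s \<in> tensor_subgroup R A L'"
          by (rule \<Gamma>E) blast
        from \<open>(x', q') \<in> \<Gamma>\<close> obtain t' s' where ts': "x' = frag_lift g t' + s'" "q' = \<phi> t'" "?F t'" "s' \<in> tensor_subgroup R A L'"
          by (rule \<Gamma>E) blast
        have "?F (t + t')" using keys_add[of t t'] ts(3) ts'(3) by blast
        then have "(frag_lift g (t + t') + (s + s'), \<phi> (t + t')) \<in> \<Gamma>"
          by (rule \<Gamma>I[OF _ T'(3)[OF ts(4) ts'(4)]])
        moreover have "frag_lift g (t + t') + (s + s') = x + x'"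
          unfolding ts(1) ts'(1) by (simp add: frag_extend_add)
        ultimately show "(x \<otimes>\<^bsub>tensor_free A L'\<^esub> x', q \<otimes>\<^bsub>QZ\<^esub> q') \<in> \<Gamma>"
          unfolding ts(2) ts'(2) by (simp only: mult_free_Abelian_group \<phi>a[OF ts(3) ts'(3)])
      next
        fix q assume "(\<one>\<^bsub>tensor_free A L'\<^esub>, q) \<in> \<Gamma>"
        then obtain t s where ts: "0 = frag_lift g t + s" "q = \<phi> t" "?F t" "s \<in> tensor_subgroup R A L'"
          by (rule \<Gamma>E) auto
        have "frag_lift g t = - s" using ts(1) by (simp add: eq_neg_iff_add_eq_0)
        then have "frag_lift g t \<in> tensor_subgroup R A L'" using T'(4)[OF ts(4)] by simp
        then obtain u where u: "?F1 u" "t - frag_lift f u \<in> tensor_subgroup R A L0" using L ts(3) by blast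
        have "\<phi> ((t - frag_lift f u) + frag_lift f u) = \<one>\<^bsub>QZ\<^esub> \<otimes>\<^bsub>QZ\<^esub> \<one>\<^bsub>QZ\<^esub>"
          using \<phi>a[OF T0(1)[OF u(2)] frag_lift_keys[OF f u(1)]] \<phi>(3)[OF u(2)] \<phi>f[OF u(1)] by simp
        then show "q = \<one>\<^bsub>QZ\<^esub>" using ts(2) by simp
      qed
      then obtain \<psi> where \<psi>: "\<psi> \<in> hom (tensor_free A L') QZ" "\<forall>(x, q)\<in>\<Gamma>. \<psi> x = q"
        using partial_character_extend[OF abelian_free_Abelian_group] by blast
      have "\<psi> s = \<one>\<^bsub>QZ\<^esub>" if "s \<in> tensor_subgroup R A L'" for s
        using \<psi>(2) \<Gamma>I[of 0 s] that \<phi>0 by auto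
      then have \<gamma>: "(\<lambda>a x. \<psi> (frag_of (a, x))) \<in> balanced R A L'"
        by (rule balanced_of_character[OF acted(1,4) \<psi>(1)])
      have "\<psi> (frag_of (a, i z)) = \<beta> z a" if z: "z \<in> carrier Z" and a: "a \<in> carrier A" for a z
      proof -
        obtain x where x: "x \<in> carrier L0" "z = p x" using onto[OF z] by blast
        have "(frag_lift g (frag_of (a, x)) + 0, \<phi> (frag_of (a, x))) \<in> \<Gamma>"
          by (rule \<Gamma>I) (use a x T'(2) in auto)
        then show ?thesis using \<psi>(2) \<phi>(2)[OF a x(1)] x(2) g by auto
      qed
      then show "\<exists>\<gamma>\<in>balanced R L' A. \<forall>x\<in>carrier Z. \<forall>n\<in>carrier A. \<gamma> (i x) n = \<beta> x n"
        by (intro bexI[OF _ balanced_swap[OF \<gamma>]]) simp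
    qed
  next
    assume L: "bal_ext R i Z L' A"
    have "?P t" if t: "?F t" and gt: "frag_lift g t \<in> tensor_subgroup R A L'" for t
    proof (rule ccontr)
      assume neg: "\<not> ?P t"
      \<comment> \<open>The preimage of the image of \<open>A \<otimes> f\<close>. A counterexample
        t is separated from H by a character \<open>\<phi>\<close>; it kills the image of f, so it
        lives on \<open>A \<otimes> Z\<close> and extends to L'. The extension pulled back along g
        agrees with \<open>\<phi>\<close>, yet is trivial at t.\<close>
      define H where "H = {u. ?F u \<and> ?P u}"
      have H: "subgroup H (tensor_free A L0)"
      proof (rule group.subgroupI[OF group_free_Abelian_group])
        show "H \<subseteq> carrier (tensor_free A L0)" unfolding H_def by auto
        have "?P 0" by (rule exI[of _ 0]) (simp add: T0(2))
        then have "0 \<in> H" unfolding H_def by simp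
        then show "H \<noteq> {}" by blast
      next
        fix u assume "u \<in> H"
        then obtain s where s: "?F u" "?F1 s" "u - frag_lift f s \<in> tensor_subgroup R A L0" unfolding H_def by blast
        have "- u - frag_lift f (- s) \<in> tensor_subgroup R A L0"
          using T0(4)[OF s(3)] by (simp add: frag_extend_minus)
        then show "inv\<^bsub>tensor_free A L0\<^esub> u \<in> H"
          using s unfolding H_def by (auto intro!: exI[of _ "- s"])
      next
        fix u v assume "u \<in> H" "v \<in> H"
        then obtain s r where s: "?F u" "?F1 s" "u - frag_lift f s \<in> tensor_subgroup R A L0"
          and r: "?F v" "?F1 r" "v - frag_lift f r \<in> tensor_subgroup R A L0" unfolding H_def by blast
        have "u + v - frag_lift f (s + r) \<in> tensor_subgroup R A L0"
          using T0(3)[OF s(3) r(3)] by (simp add: frag_extend_add algebra_simps)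
        moreover have "?F (u + v)" "?F1 (s + r)" using keys_add[of u v] keys_add[of s r] s r by blast+
        ultimately show "u \<otimes>\<^bsub>tensor_free A L0\<^esub> v \<in> H" unfolding H_def by auto
      qed
      obtain \<phi> where \<phi>: "\<phi> \<in> hom (tensor_free A L0) QZ" "\<forall>h\<in>H. \<phi> h = \<one>\<^bsub>QZ\<^esub>" "\<phi> t \<noteq> \<one>\<^bsub>QZ\<^esub>"
        using character_separates[OF abelian_free_Abelian_group H, of t] t neg unfolding H_def by auto
      have sub: "s \<in> H" if "s \<in> tensor_subgroup R A L0" for s
        unfolding H_def using that T0(1)[OF that] by (auto intro!: exI[of _ 0])
      have \<beta>: "(\<lambda>a x. \<phi> (frag_of (a, x))) \<in> balanced R A L0"
        by (rule balanced_of_character[OF acted(1,3) \<phi>(1)]) (use \<phi>(2) sub in blast)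
      have van: "\<phi> (frag_of (a, x)) = \<one>\<^bsub>QZ\<^esub>" if x: "x \<in> carrier L0" "p x = \<zero>\<^bsub>Z\<^esub>" and a: "a \<in> carrier A" for a x
      proof -
        obtain y where y: "y \<in> carrier L1" "x = f y" using ex x by blast
        have "frag_of (a, x) \<in> H"
          unfolding H_def using x a y T0(2) by (auto intro!: exI[of _ "frag_of (a, y)"])
        then show ?thesis using \<phi>(2) by blast
      qed
      obtain \<eta> where \<eta>: "\<eta> \<in> balanced R A Z"
        "\<And>x a. x \<in> carrier L0 \<Longrightarrow> a \<in> carrier A \<Longrightarrow> \<eta> a (p x) = \<phi> (frag_of (a, x))"
        by (rule balanced_descend_right[OF acted(3,5,1) p onto \<beta>]) (use van in auto)
      obtain \<gamma> where \<gamma>: "\<gamma> \<in> balanced R L' A"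
        "\<And>z a. z \<in> carrier Z \<Longrightarrow> a \<in> carrier A \<Longrightarrow> \<gamma> (i z) a = \<eta> a z"
        by (rule bal_extD[OF L balanced_swap[OF \<eta>(1)]]) blast
      obtain \<psi> where \<psi>: "\<psi> \<in> hom (tensor_free A L') QZ"
        "\<And>a x. a \<in> carrier A \<Longrightarrow> x \<in> carrier L' \<Longrightarrow> \<psi> (frag_of (a, x)) = \<gamma> x a"
        "\<And>s. s \<in> tensor_subgroup R A L' \<Longrightarrow> \<psi> s = \<one>\<^bsub>QZ\<^esub>"
        by (rule character_of_balanced[OF acted(1,4) balanced_swap[OF \<gamma>(1)]]) blast
      have "\<psi> \<circ> frag_lift g \<in> hom (tensor_free A L0) QZ"
        by (rule hom_compose[OF frag_lift_hom[OF gh] \<psi>(1)])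
      then have "(\<psi> \<circ> frag_lift g) t = \<phi> t"
        by (rule fag_hom_eq[OF _ \<phi>(1) _ t])
          (use \<psi>(2) \<gamma>(2) \<eta>(2) mod_homD(1)[OF p] mod_homD(1)[OF i] g in auto)
      then show False using \<psi>(3)[OF gt] \<phi>(3) by simp
    qed
    moreover have "frag_lift g t \<in> tensor_subgroup R A L'" if t: "?F t" and P: "?P t" for t
    proof -
      obtain s where s: "?F1 s" "t - frag_lift f s \<in> tensor_subgroup R A L0" using P by blast
      have "frag_lift g (t - frag_lift f s) + frag_lift g (frag_lift f s) \<in> tensor_subgroup R A L'"
        by (rule T'(3)[OF frag_lift_tensor_subgroup[OF acted(1,3,4) gh s(2)] gf[OF s(1)]])
      then show ?thesis by (simp add: frag_extend_diff)
    qed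
    ultimately show "\<forall>t. ?F t \<longrightarrow> (frag_lift g t \<in> tensor_subgroup R A L' \<longleftrightarrow> ?P t)" by blast
  qed
qed

section \<open>Free modules and projective resolutions\<close>

definition free_module :: "'r ring \<Rightarrow> 'i set \<Rightarrow> ('r, 'i \<Rightarrow> 'r) module" where
  "free_module S X = coprod_module X (\<lambda>_. regular_module S)"

definition free_unit :: "'r ring \<Rightarrow> 'i set \<Rightarrow> 'i \<Rightarrow> 'i \<Rightarrow> 'r" where
  "free_unit S X x = (\<lambda>y\<in>X. if y = x then \<one>\<^bsub>S\<^esub> else \<zero>\<^bsub>S\<^esub>)"

definition free_lift ::
  "'r ring \<Rightarrow> 'i set \<Rightarrow> ('r, 'a) module \<Rightarrow> ('i \<Rightarrow> 'a) \<Rightarrow> ('i \<Rightarrow> 'r) \<Rightarrow> 'a"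
where
  "free_lift S X M b f = finsum M (\<lambda>x. f x \<odot>\<^bsub>M\<^esub> b x) {x \<in> X. f x \<noteq> \<zero>\<^bsub>S\<^esub>}"

lemma free_module_simps:
  "carrier (free_module S X) = {f \<in> X \<rightarrow>\<^sub>E carrier S. finite {x \<in> X. f x \<noteq> \<zero>\<^bsub>S\<^esub>}}"
  "\<zero>\<^bsub>free_module S X\<^esub> = (\<lambda>x\<in>X. \<zero>\<^bsub>S\<^esub>)"
  "f \<oplus>\<^bsub>free_module S X\<^esub> g = (\<lambda>x\<in>X. f x \<oplus>\<^bsub>S\<^esub> g x)"
  "r \<odot>\<^bsub>free_module S X\<^esub> f = (\<lambda>x\<in>X. r \<otimes>\<^bsub>S\<^esub> f x)"
  unfolding free_module_def coprod_module_def prod_module_def regular_module_def by simp_all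

lemma free_carrierD:
  assumes "f \<in> carrier (free_module S X)"
  shows "\<And>x. x \<in> X \<Longrightarrow> f x \<in> carrier S" "f \<in> extensional X" "finite {x \<in> X. f x \<noteq> \<zero>\<^bsub>S\<^esub>}"
  using assms unfolding free_module_simps by (auto simp: PiE_def)

lemma free_carrierI:
  assumes "\<And>x. x \<in> X \<Longrightarrow> f x \<in> carrier S" "f \<in> extensional X" "finite A" "\<And>x. x \<in> X \<Longrightarrow> x \<notin> A \<Longrightarrow> f x = \<zero>\<^bsub>S\<^esub>"
  shows "f \<in> carrier (free_module S X)"
proof -
  have "finite {x \<in> X. f x \<noteq> \<zero>\<^bsub>S\<^esub>}" by (rule finite_subset[OF _ assms(3)]) (use assms(4) in auto)
  then show ?thesis unfolding free_module_simps using assms(1,2) by (auto simp: PiE_def)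
qed

lemma left_module_free:
  assumes "ring S"
  shows "left_module S (free_module S X)"
proof -
  interpret S: ring S by fact
  let ?F = "free_module S X"
  note C = free_carrierD
  have ext: "f = g" if "f \<in> extensional X" "g \<in> extensional X" "\<And>x. x \<in> X \<Longrightarrow> f x = g x" for f g
    using that by (rule extensionalityI)
  show ?thesis
  proof (rule left_moduleI)
    show "ring S" by fact
    show "\<zero>\<^bsub>?F\<^esub> \<in> carrier ?F"
      by (rule free_carrierI[of _ _ _ "{}"]) (auto simp: free_module_simps)
  next
    fix f g assume fg: "f \<in> carrier ?F" "g \<in> carrier ?F"
    show "f \<oplus>\<^bsub>?F\<^esub> g \<in> carrier ?F"
      by (rule free_carrierI[of _ _ _ "{x \<in> X. f x \<noteq> \<zero>\<^bsub>S\<^esub>} \<union> {x \<in> X. g x \<noteq> \<zero>\<^bsub>S\<^esub>}"])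
        (use C[OF fg(1)] C[OF fg(2)] in \<open>auto simp: free_module_simps(3)\<close>)
    show "f \<oplus>\<^bsub>?F\<^esub> g = g \<oplus>\<^bsub>?F\<^esub> f"
      by (rule ext) (use C(1)[OF fg(1)] C(1)[OF fg(2)] in \<open>auto simp: free_module_simps(3) S.a_comm\<close>)
  next
    fix f g h assume fg: "f \<in> carrier ?F" "g \<in> carrier ?F" "h \<in> carrier ?F"
    show "f \<oplus>\<^bsub>?F\<^esub> g \<oplus>\<^bsub>?F\<^esub> h = f \<oplus>\<^bsub>?F\<^esub> (g \<oplus>\<^bsub>?F\<^esub> h)"
      by (rule ext) (use C(1)[OF fg(1)] C(1)[OF fg(2)] C(1)[OF fg(3)] in \<open>auto simp: free_module_simps(3) S.a_assoc\<close>)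
  next
    fix f assume f: "f \<in> carrier ?F"
    show "\<zero>\<^bsub>?F\<^esub> \<oplus>\<^bsub>?F\<^esub> f = f"
      by (rule ext) (use C(1,2)[OF f] in \<open>auto simp: free_module_simps(2,3)\<close>)
    have "(\<lambda>x\<in>X. \<ominus>\<^bsub>S\<^esub> f x) \<in> carrier ?F"
      by (rule free_carrierI[OF _ _ C(3)[OF f]]) (use C[OF f] in auto)
    moreover have "(\<lambda>x\<in>X. \<ominus>\<^bsub>S\<^esub> f x) \<oplus>\<^bsub>?F\<^esub> f = \<zero>\<^bsub>?F\<^esub>"
      by (rule ext) (use C(1)[OF f] in \<open>auto simp: free_module_simps(2,3) S.l_neg\<close>)
    ultimately show "\<exists>g\<in>carrier ?F. g \<oplus>\<^bsub>?F\<^esub> f = \<zero>\<^bsub>?F\<^esub>" by blast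
    show "\<one>\<^bsub>S\<^esub> \<odot>\<^bsub>?F\<^esub> f = f"
      by (rule ext) (use C(1,2)[OF f] in \<open>auto simp: free_module_simps(4)\<close>)
  next
    fix a f assume a: "a \<in> carrier S" and f: "f \<in> carrier ?F"
    show "a \<odot>\<^bsub>?F\<^esub> f \<in> carrier ?F"
      by (rule free_carrierI[OF _ _ C(3)[OF f]]) (use a C[OF f] in \<open>auto simp: free_module_simps(4)\<close>)
  next
    fix a b f assume ab: "a \<in> carrier S" "b \<in> carrier S" and f: "f \<in> carrier ?F"
    show "(a \<oplus>\<^bsub>S\<^esub> b) \<odot>\<^bsub>?F\<^esub> f = a \<odot>\<^bsub>?F\<^esub> f \<oplus>\<^bsub>?F\<^esub> b \<odot>\<^bsub>?F\<^esub> f"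
      by (rule ext) (use ab C(1)[OF f] in \<open>auto simp: free_module_simps(3,4) S.l_distr\<close>)
    show "(a \<otimes>\<^bsub>S\<^esub> b) \<odot>\<^bsub>?F\<^esub> f = a \<odot>\<^bsub>?F\<^esub> (b \<odot>\<^bsub>?F\<^esub> f)"
      by (rule ext) (use ab C(1)[OF f] in \<open>auto simp: free_module_simps(4) S.m_assoc\<close>)
  next
    fix a f g assume a: "a \<in> carrier S" and fg: "f \<in> carrier ?F" "g \<in> carrier ?F"
    show "a \<odot>\<^bsub>?F\<^esub> (f \<oplus>\<^bsub>?F\<^esub> g) = a \<odot>\<^bsub>?F\<^esub> f \<oplus>\<^bsub>?F\<^esub> a \<odot>\<^bsub>?F\<^esub> g"
      by (rule ext) (use a C(1)[OF fg(1)] C(1)[OF fg(2)] in \<open>auto simp: free_module_simps(3,4) S.r_distr\<close>)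
  qed
qed

lemma free_unit_carrier: "ring S \<Longrightarrow> free_unit S X x \<in> carrier (free_module S X)"
  by (rule free_carrierI[of _ _ _ "{x}"]) (auto simp: free_unit_def ring.ring_simprules)

text \<open>Two elements and their sum have different supports, so additivity of
  \<open>free_lift\<close> needs the sum over a common finite superset.\<close>

lemma free_lift_eq:
  assumes "left_module S M" "f \<in> carrier (free_module S X)" "\<And>x. x \<in> X \<Longrightarrow> b x \<in> carrier M"
    "finite A" "A \<subseteq> X" "\<And>x. x \<in> X \<Longrightarrow> x \<notin> A \<Longrightarrow> f x = \<zero>\<^bsub>S\<^esub>"
  shows "free_lift S X M b f = finsum M (\<lambda>x. f x \<odot>\<^bsub>M\<^esub> b x) A"
proof -
  interpret M: left_module S M by fact
  note C = free_carrierD[OF assms(2)]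
  show ?thesis
    unfolding free_lift_def
    by (rule M.M.add.finprod_mono_neutral_cong_left)
      (use assms(3-6) C M.smult_closed zero_smult[OF assms(1)] in auto)
qed

lemma finsum_smult:
  assumes "left_module S M" "r \<in> carrier S" "finite A" "\<And>x. x \<in> A \<Longrightarrow> g x \<in> carrier M"
  shows "r \<odot>\<^bsub>M\<^esub> finsum M g A = finsum M (\<lambda>x. r \<odot>\<^bsub>M\<^esub> g x) A"
proof -
  interpret M: left_module S M by fact
  show ?thesis
    using assms(3,4)
    by (induction A rule: finite_induct)
      (simp_all add: smult_zero[OF assms(1,2)] Pi_iff M.smult_r_distr assms(2) M.smult_closed M.M.finsum_closed)
qed

lemma free_lift_hom:
  assumes "left_module S M" "\<And>x. x \<in> X \<Longrightarrow> b x \<in> carrier M"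
  shows "free_lift S X M b \<in> mod_hom S (free_module S X) M"
proof -
  interpret M: left_module S M by fact
  let ?F = "free_module S X"
  interpret F: left_module S ?F by (rule left_module_free[OF M.R.ring_axioms])
  note C = free_carrierD
  have trm: "f x \<odot>\<^bsub>M\<^esub> b x \<in> carrier M" if "f \<in> carrier ?F" "x \<in> X" for f x
    using C(1)[OF that] assms(2) that(2) M.smult_closed by blast
  show ?thesis
  proof (rule mod_homI)
    fix f assume f: "f \<in> carrier ?F"
    show "free_lift S X M b f \<in> carrier M"
      unfolding free_lift_def by (rule M.M.finsum_closed) (use trm[OF f] in auto)
  next
    fix f g assume fg: "f \<in> carrier ?F" "g \<in> carrier ?F"
    let ?A = "{x \<in> X. f x \<noteq> \<zero>\<^bsub>S\<^esub>} \<union> {x \<in> X. g x \<noteq> \<zero>\<^bsub>S\<^esub>}"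
    have A: "finite ?A" "?A \<subseteq> X" using C(3)[OF fg(1)] C(3)[OF fg(2)] by auto
    have "free_lift S X M b (f \<oplus>\<^bsub>?F\<^esub> g) = finsum M (\<lambda>x. (f \<oplus>\<^bsub>?F\<^esub> g) x \<odot>\<^bsub>M\<^esub> b x) ?A"
      by (rule free_lift_eq[OF assms(1) F.M.a_closed[OF fg] assms(2) A]) (auto simp: free_module_simps(3))
    also have "\<dots> = finsum M (\<lambda>x. f x \<odot>\<^bsub>M\<^esub> b x \<oplus>\<^bsub>M\<^esub> g x \<odot>\<^bsub>M\<^esub> b x) ?A"
      by (rule M.M.finsum_cong')
        (use A(2) C(1)[OF fg(1)] C(1)[OF fg(2)] assms(2) trm[OF fg(1)] trm[OF fg(2)]
          in \<open>auto simp: free_module_simps(3) M.smult_l_distr\<close>)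
    also have "\<dots> = finsum M (\<lambda>x. f x \<odot>\<^bsub>M\<^esub> b x) ?A \<oplus>\<^bsub>M\<^esub> finsum M (\<lambda>x. g x \<odot>\<^bsub>M\<^esub> b x) ?A"
      by (rule M.M.finsum_addf) (use trm[OF fg(1)] trm[OF fg(2)] in auto)
    also have "finsum M (\<lambda>x. f x \<odot>\<^bsub>M\<^esub> b x) ?A = free_lift S X M b f"
      by (rule free_lift_eq[OF assms(1) fg(1) assms(2) A, symmetric]) auto
    also have "finsum M (\<lambda>x. g x \<odot>\<^bsub>M\<^esub> b x) ?A = free_lift S X M b g"
      by (rule free_lift_eq[OF assms(1) fg(2) assms(2) A, symmetric]) auto
    finally show "free_lift S X M b (f \<oplus>\<^bsub>?F\<^esub> g) = free_lift S X M b f \<oplus>\<^bsub>M\<^esub> free_lift S X M b g" .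
  next
    fix r f assume r: "r \<in> carrier S" and f: "f \<in> carrier ?F"
    let ?A = "{x \<in> X. f x \<noteq> \<zero>\<^bsub>S\<^esub>}"
    have A: "finite ?A" "?A \<subseteq> X" using C(3)[OF f] by auto
    have "free_lift S X M b (r \<odot>\<^bsub>?F\<^esub> f) = finsum M (\<lambda>x. (r \<odot>\<^bsub>?F\<^esub> f) x \<odot>\<^bsub>M\<^esub> b x) ?A"
      by (rule free_lift_eq[OF assms(1) F.smult_closed[OF r f] assms(2) A])
        (use r in \<open>auto simp: free_module_simps(4)\<close>)
    also have "\<dots> = finsum M (\<lambda>x. r \<odot>\<^bsub>M\<^esub> (f x \<odot>\<^bsub>M\<^esub> b x)) ?A"
      by (rule M.M.finsum_cong')
        (use A(2) r C(1)[OF f] assms(2) trm[OF f] M.smult_closed in \<open>auto simp: free_module_simps(4) M.smult_assoc1\<close>)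
    also have "\<dots> = r \<odot>\<^bsub>M\<^esub> finsum M (\<lambda>x. f x \<odot>\<^bsub>M\<^esub> b x) ?A"
      by (rule finsum_smult[OF assms(1) r A(1), symmetric]) (use trm[OF f] in auto)
    finally show "free_lift S X M b (r \<odot>\<^bsub>?F\<^esub> f) = r \<odot>\<^bsub>M\<^esub> free_lift S X M b f"
      unfolding free_lift_def[of S X M b f] .
  qed
qed

lemma free_lift_unit:
  assumes "left_module S M" "\<And>x. x \<in> X \<Longrightarrow> b x \<in> carrier M" "x \<in> X"
  shows "free_lift S X M b (free_unit S X x) = b x"
proof -
  interpret M: left_module S M by fact
  have "free_lift S X M b (free_unit S X x) = finsum M (\<lambda>y. free_unit S X x y \<odot>\<^bsub>M\<^esub> b y) {x}"
    by (rule free_lift_eq[OF assms(1) free_unit_carrier[OF M.R.ring_axioms] assms(2)])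
      (use assms(3) in \<open>auto simp: free_unit_def\<close>)
  also have "\<dots> = b x"
    using assms(2,3) by (simp add: free_unit_def M.smult_one M.smult_closed)
  finally show ?thesis .
qed

text \<open>Induction on a finite set containing the support; one coordinate at a time is split off
  as a multiple of a unit vector.\<close>

lemma free_hom_eq:
  assumes "left_module S M" "u \<in> mod_hom S (free_module S X) M" "v \<in> mod_hom S (free_module S X) M"
    and unit: "\<And>x. x \<in> X \<Longrightarrow> u (free_unit S X x) = v (free_unit S X x)" and f: "f \<in> carrier (free_module S X)"
  shows "u f = v f"
proof -
  interpret M: left_module S M by fact
  let ?F = "free_module S X"
  interpret F: left_module S ?F by (rule left_module_free[OF M.R.ring_axioms])
  have "\<forall>f. f \<in> carrier ?F \<longrightarrow> (\<forall>x\<in>X. x \<notin> A \<longrightarrow> f x = \<zero>\<^bsub>S\<^esub>) \<longrightarrow> u f = v f" if "finite A" for A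
    using that
  proof (induction A rule: finite_induct)
    case empty
    show ?case
    proof (intro allI impI)
      fix f assume f: "f \<in> carrier ?F" "\<forall>x\<in>X. x \<notin> {} \<longrightarrow> f x = \<zero>\<^bsub>S\<^esub>"
      have "f = \<zero>\<^bsub>?F\<^esub>"
        by (rule extensionalityI[of _ X]) (use f free_carrierD(2)[OF f(1)] in \<open>auto simp: free_module_simps(2)\<close>)
      then show "u f = v f"
        using mod_hom_zero[OF assms(2) F.abelian_group_axioms M.abelian_group_axioms]
          mod_hom_zero[OF assms(3) F.abelian_group_axioms M.abelian_group_axioms] by simp
    qed
  next
    case (insert x A)
    show ?case
    proof (intro allI impI)
      fix f assume f: "f \<in> carrier ?F" "\<forall>y\<in>X. y \<notin> insert x A \<longrightarrow> f y = \<zero>\<^bsub>S\<^esub>"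
      note C = free_carrierD[OF f(1)]
      show "u f = v f"
      proof (cases "x \<in> X")
        case False
        then show ?thesis using insert.IH f by auto
      next
        case True
        let ?g = "\<lambda>y\<in>X. if y = x then \<zero>\<^bsub>S\<^esub> else f y"
        let ?e = "free_unit S X x"
        have e: "?e \<in> carrier ?F" by (rule free_unit_carrier[OF M.R.ring_axioms])
        have g: "?g \<in> carrier ?F" by (rule free_carrierI[OF _ _ C(3)]) (use C in auto)
        have eq: "u ?g = v ?g" using insert.IH g f(2) by auto
        have "f = ?g \<oplus>\<^bsub>?F\<^esub> f x \<odot>\<^bsub>?F\<^esub> ?e"
          by (rule extensionalityI[of _ X]) (use C C(1)[OF True] in \<open>auto simp: free_module_simps(3,4) free_unit_def\<close>)
        moreover have "u (?g \<oplus>\<^bsub>?F\<^esub> f x \<odot>\<^bsub>?F\<^esub> ?e) = v (?g \<oplus>\<^bsub>?F\<^esub> f x \<odot>\<^bsub>?F\<^esub> ?e)"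
          using eq unit[OF True] C(1)[OF True] e g F.smult_closed
          by (simp add: mod_homD(2,3)[OF assms(2)] mod_homD(2,3)[OF assms(3)])
        ultimately show ?thesis by simp
      qed
    qed
  qed
  from this[OF free_carrierD(3)[OF f]] show ?thesis using f by auto
qed

text \<open>Enough projectives: P is a copy of the free module on the underlying set of N, small
  because the ring is. No minimality is meant by the name.\<close>

lemma projective_cover_exists:
  fixes S :: "'u ring"
  assumes U: "universe TYPE('u)" and S: "ring S" "small (carrier S)" and N: "N \<in> modules S"
  obtains P \<pi> K where "projective S P" "K \<in> modules S" "short_exact S K id P \<pi> N"
proof -
  let ?X = "carrier N"
  let ?F = "free_module S ?X"
  have F: "left_module S ?F" by (rule left_module_free[OF S(1)])
  have "carrier ?F \<subseteq> ?X \<rightarrow>\<^sub>E carrier S" unfolding free_module_simps by auto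
  moreover have "?X \<rightarrow>\<^sub>E carrier S \<prec> (UNIV :: 'u set)"
    using lesspoll_PiE[OF U] modulesD(3)[OF N] S(2) unfolding small_def by blast
  ultimately have "carrier ?F \<prec> (UNIV :: 'u set)" by (meson lesspoll_trans1 subset_imp_lepoll)
  then obtain P \<phi> where P: "P \<in> modules S" "\<phi> \<in> mod_hom S ?F P" "bij_betw \<phi> (carrier ?F) (carrier P)"
    by (rule copy_exists[OF F])
  obtain \<psi> where \<psi>: "\<psi> \<in> mod_hom S P ?F" and \<psi>\<phi>: "\<And>x. x \<in> carrier ?F \<Longrightarrow> \<psi> (\<phi> x) = x"
      and \<phi>\<psi>: "\<And>x. x \<in> carrier P \<Longrightarrow> \<phi> (\<psi> x) = x"
    by (rule inverse_mod_homE[OF F modulesD(1)[OF P(1)] P(2,3)]) (simp | blast)+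
  have "projective S P"
    unfolding projective_def
  proof (intro conjI ballI impI)
    show "P \<in> modules S" by (rule P(1))
    fix B C g h assume BC: "B \<in> modules S" "C \<in> modules S" and g: "g \<in> mod_hom S B C"
      and h: "h \<in> mod_hom S P C" and onto: "g ` carrier B = carrier C"
    have h\<phi>: "h \<circ> \<phi> \<in> mod_hom S ?F C" by (rule mod_hom_comp[OF P(2) h])
    have "\<exists>b. b \<in> carrier B \<and> g b = (h \<circ> \<phi>) (free_unit S ?X x)" for x
      using mod_homD(1)[OF h\<phi> free_unit_carrier[OF S(1)]] onto by (metis imageE)
    then obtain b where b: "\<And>x. b x \<in> carrier B" "\<And>x. g (b x) = (h \<circ> \<phi>) (free_unit S ?X x)" by metis
    have k: "free_lift S ?X B b \<in> mod_hom S ?F B" by (rule free_lift_hom[OF modulesD(1)[OF BC(1)] b(1)])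
    have "(g \<circ> free_lift S ?X B b) f = (h \<circ> \<phi>) f" if "f \<in> carrier ?F" for f
      by (rule free_hom_eq[OF modulesD(1)[OF BC(2)] mod_hom_comp[OF k g] h\<phi> _ that])
        (simp add: free_lift_unit[OF modulesD(1)[OF BC(1)]] b)
    then have "g ((free_lift S ?X B b \<circ> \<psi>) x) = h x" if "x \<in> carrier P" for x
      using mod_homD(1)[OF \<psi> that] \<phi>\<psi>[OF that] by simp
    then show "\<exists>k\<in>mod_hom S P B. \<forall>x\<in>carrier P. g (k x) = h x"
      using mod_hom_comp[OF \<psi> k] by blast
  qed
  let ?\<pi> = "free_lift S ?X N id \<circ> \<psi>"
  have l: "free_lift S ?X N id \<in> mod_hom S ?F N" by (rule free_lift_hom[OF modulesD(1)[OF N]]) simp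
  have \<pi>: "?\<pi> \<in> mod_hom S P N" by (rule mod_hom_comp[OF \<psi> l])
  have "?\<pi> (\<phi> (free_unit S ?X x)) = x" if "x \<in> ?X" for x
    using that \<psi>\<phi>[OF free_unit_carrier[OF S(1)]] free_lift_unit[OF modulesD(1)[OF N], of ?X id x] by simp
  then have "?\<pi> ` carrier P = carrier N"
    using mod_homD(1)[OF \<pi>] mod_homD(1)[OF P(2) free_unit_carrier[OF S(1)]]
    by (intro subset_antisym image_subsetI subsetI) (assumption | metis image_eqI)+
  then obtain K where "K \<in> modules S" "short_exact S K id P ?\<pi> N"
    by (rule kernel_exists[OF P(1) N \<pi>])
  then show ?thesis using that \<open>projective S P\<close> by blast
qed

text \<open>A projective resolution cut into short exact sequences, \<open>A i\<close> being the \<open>i\<close>-th syzygy of \<open>A 0\<close>.\<close>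

definition proj_chain ::
  "'u ring \<Rightarrow> (nat \<Rightarrow> ('u, 'u) module) \<Rightarrow> (nat \<Rightarrow> ('u, 'u) module) \<Rightarrow> (nat \<Rightarrow> 'u \<Rightarrow> 'u) \<Rightarrow> (nat \<Rightarrow> 'u \<Rightarrow> 'u) \<Rightarrow> bool"
where
  "proj_chain S A P \<iota> \<pi> \<longleftrightarrow> (\<forall>i. A i \<in> modules S \<and> projective S (P i) \<and>
     short_exact S (A (Suc i)) (\<iota> i) (P i) (\<pi> i) (A i))"

lemma proj_chainD:
  assumes "proj_chain S A P \<iota> \<pi>"
  shows "A i \<in> modules S" "projective S (P i)" "P i \<in> modules S"
    "short_exact S (A (Suc i)) (\<iota> i) (P i) (\<pi> i) (A i)"
  using assms unfolding proj_chain_def projective_def by auto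

lemma proj_chain_exists:
  fixes S :: "'u ring"
  assumes U: "universe TYPE('u)" and S: "ring S" "small (carrier S)" and N: "N \<in> modules S"
  obtains A P \<iota> \<pi> where "proj_chain S A P \<iota> \<pi>" "A 0 = N"
proof -
  have "\<forall>N\<in>modules S. \<exists>P \<pi> K. projective S P \<and> K \<in> modules S \<and> short_exact S K id P \<pi> N"
    using projective_cover_exists[OF U S] by metis
  then obtain p q k where pqk: "\<And>N. N \<in> modules S \<Longrightarrow>
      projective S (p N) \<and> k N \<in> modules S \<and> short_exact S (k N) id (p N) (q N) N"
    by metis
  define A where "A i = (k ^^ i) N" for i
  have A: "A i \<in> modules S" for i
    by (induction i) (use N pqk in \<open>auto simp: A_def\<close>)
  have "proj_chain S A (\<lambda>i. p (A i)) (\<lambda>_. id) (\<lambda>i. q (A i))"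
    unfolding proj_chain_def using A pqk[OF A] by (auto simp: A_def)
  then show ?thesis using that by (simp add: A_def)
qed

text \<open>Splicing: since \<open>\<iota>\<close> is injective, the kernel of a differential is the
  kernel of its \<open>\<pi>\<close>, which is the image of the next differential.\<close>

lemma proj_chain_resolution:
  assumes "proj_chain S A P \<iota> \<pi>"
  shows "projective_resolution S P (\<lambda>i. case i of 0 \<Rightarrow> \<pi> 0 | Suc k \<Rightarrow> \<iota> k \<circ> \<pi> (Suc k)) (A 0)"
proof -
  let ?d = "\<lambda>i. case i of 0 \<Rightarrow> \<pi> 0 | Suc k \<Rightarrow> \<iota> k \<circ> \<pi> (Suc k)"
  note D = proj_chainD[OF assms]
  note E = short_exactD[OF D(4)]
  have z: "\<iota> k \<zero>\<^bsub>A (Suc k)\<^esub> = \<zero>\<^bsub>P k\<^esub>" for k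
    by (rule mod_hom_zero[OF E(1) modulesD(2)[OF D(1)] modulesD(2)[OF D(3)]])
  have ker: "a_kernel (P k) (if k = 0 then A 0 else P (k - 1)) (?d k) = {x \<in> carrier (P k). \<pi> k x = \<zero>\<^bsub>A k\<^esub>}" for k
  proof (cases k)
    case 0
    then show ?thesis by (simp add: a_kernel_def')
  next
    case (Suc j)
    have "\<iota> j y = \<zero>\<^bsub>P j\<^esub> \<longleftrightarrow> y = \<zero>\<^bsub>A (Suc j)\<^esub>" if "y \<in> carrier (A (Suc j))" for y
      using E(9)[OF that abelian_groupE(2)[OF modulesD(2)[OF D(1)]]] z by metis
    then show ?thesis using Suc E(5)[of _ "Suc j"] by (auto simp: a_kernel_def')
  qed
  have im: "\<pi> k ` carrier (P k) = carrier (A k)" "\<iota> k ` carrier (A (Suc k)) = {x \<in> carrier (P k). \<pi> k x = \<zero>\<^bsub>A k\<^esub>}" for k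
    using D(4)[of k] unfolding short_exact_def a_kernel_def' by auto
  show ?thesis
    unfolding projective_resolution_def exact_augmented_def
  proof (intro conjI allI impI)
    show "projective S (P k)" for k by (rule D(2))
    show "?d 0 \<in> mod_hom S (P 0) (A 0)" "?d 0 ` carrier (P 0) = carrier (A 0)" using E(2)[of 0] im(1)[of 0] by auto
    show "?d (Suc k) \<in> mod_hom S (P (Suc k)) (P k)" for k
      using mod_hom_comp[OF E(2)[of "Suc k"] E(1)[of k]] by simp
    show "?d (Suc k) ` carrier (P (Suc k)) = a_kernel (P k) (if k = 0 then A 0 else P (k - 1)) (?d k)" for k
      unfolding ker im(2)[symmetric] im(1)[symmetric] by (simp add: image_image)
  qed auto
qed

section \<open>Vanishing of Ext as extension of homomorphisms\<close>

lemma mod_hom_cong: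
  assumes "f \<in> mod_hom S M N" "left_module S M" "\<And>x. x \<in> carrier M \<Longrightarrow> f x = g x"
  shows "g \<in> mod_hom S M N"
proof -
  interpret M: left_module S M by fact
  show ?thesis
    using mod_homD[OF assms(1)] assms(3) M.smult_closed by (intro mod_homI) (metis, metis M.M.a_closed, metis)
qed

lemma comm_group_hom_group:
  assumes "left_module S M" "left_module S N"
  shows "comm_group (hom_group S M N)"
proof -
  interpret M: left_module S M by fact
  interpret N: left_module S N by fact
  let ?H = "hom_group S M N"
  have simps: "carrier ?H = mod_hom S M N \<inter> extensional (carrier M)"
    "\<And>f g. f \<otimes>\<^bsub>?H\<^esub> g = (\<lambda>x\<in>carrier M. f x \<oplus>\<^bsub>N\<^esub> g x)" "\<one>\<^bsub>?H\<^esub> = (\<lambda>x\<in>carrier M. \<zero>\<^bsub>N\<^esub>)"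
    unfolding hom_group_def by simp_all
  have ext: "f = g" if "f \<in> extensional (carrier M)" "g \<in> extensional (carrier M)"
    "\<And>x. x \<in> carrier M \<Longrightarrow> f x = g x" for f g
    using that by (rule extensionalityI)
  show ?thesis
  proof (rule comm_groupI)
    fix f g assume "f \<in> carrier ?H" "g \<in> carrier ?H"
    then have f: "f \<in> mod_hom S M N" and g: "g \<in> mod_hom S M N" by (auto simp: simps)
    note F = mod_homD[OF f] and G = mod_homD[OF g]
    have "(\<lambda>x\<in>carrier M. f x \<oplus>\<^bsub>N\<^esub> g x) \<in> mod_hom S M N"
      by (rule mod_homI) (simp_all add: F G N.smult_r_distr M.smult_closed N.M.a_ac)
    then show "f \<otimes>\<^bsub>?H\<^esub> g \<in> carrier ?H" by (simp add: simps)
    show "f \<otimes>\<^bsub>?H\<^esub> g = g \<otimes>\<^bsub>?H\<^esub> f" unfolding simps by (rule ext) (simp_all add: F(1) G(1) N.M.a_comm)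
  next
    show "\<one>\<^bsub>?H\<^esub> \<in> carrier ?H"
      unfolding simps by (auto intro!: mod_homI simp: M.smult_closed smult_zero[OF assms(2)])
  next
    fix f g h assume "f \<in> carrier ?H" "g \<in> carrier ?H" "h \<in> carrier ?H"
    then show "f \<otimes>\<^bsub>?H\<^esub> g \<otimes>\<^bsub>?H\<^esub> h = f \<otimes>\<^bsub>?H\<^esub> (g \<otimes>\<^bsub>?H\<^esub> h)"
      unfolding simps by (intro ext) (auto simp: mod_homD(1) N.M.a_assoc)
  next
    fix f assume "f \<in> carrier ?H"
    then have f: "f \<in> mod_hom S M N" and fe: "f \<in> extensional (carrier M)" by (auto simp: simps)
    note F = mod_homD[OF f]
    show "\<one>\<^bsub>?H\<^esub> \<otimes>\<^bsub>?H\<^esub> f = f" unfolding simps by (rule ext) (use fe in \<open>auto simp: F(1)\<close>)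
    have um: "\<ominus>\<^bsub>N\<^esub> (r \<odot>\<^bsub>N\<^esub> y) = r \<odot>\<^bsub>N\<^esub> (\<ominus>\<^bsub>N\<^esub> y)" if "r \<in> carrier S" "y \<in> carrier N" for r y
      using smult_minus[OF assms(2) that(1), of "\<zero>\<^bsub>N\<^esub>" y] that smult_zero[OF assms(2)]
      by (simp add: a_minus_def N.smult_closed)
    have "(\<lambda>x\<in>carrier M. \<ominus>\<^bsub>N\<^esub> f x) \<in> mod_hom S M N"
      by (rule mod_homI) (simp_all add: F um M.smult_closed N.M.minus_add)
    then show "\<exists>g\<in>carrier ?H. g \<otimes>\<^bsub>?H\<^esub> f = \<one>\<^bsub>?H\<^esub>"
      by (intro bexI[of _ "\<lambda>x\<in>carrier M. \<ominus>\<^bsub>N\<^esub> f x"] ) (auto simp: simps F(1) N.M.l_neg intro!: ext)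
  qed
qed

text \<open>A trivial cohomology group means that every cocycle is a coboundary. Members of
  \<open>hom_group\<close> are extensional, so f enters through its restriction to the
  carrier.\<close>

lemma ext_zero_cocycle:
  assumes "ext_zero S i N B" "projective_resolution S P d N" "i \<ge> 1" "B \<in> modules S"
    and f: "f \<in> mod_hom S (P i) B" "\<And>x. x \<in> carrier (P (Suc i)) \<Longrightarrow> f (d (Suc i) x) = \<zero>\<^bsub>B\<^esub>"
  shows "\<exists>g\<in>mod_hom S (P (i - 1)) B. \<forall>x\<in>carrier (P i). g (d i x) = f x"
proof -
  let ?G = "(hom_group S (P i) B)\<lparr>carrier := ext_cocycles S P d i B\<rparr>"
  let ?H = "ext_coboundaries S P d i B"
  have P: "P k \<in> modules S" for k using assms(2) unfolding projective_resolution_def projective_def by auto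
  interpret Pi: left_module S "P i" using modulesD(1)[OF P] .
  interpret Pj: left_module S "P (i - 1)" using modulesD(1)[OF P] .
  interpret B: left_module S B using modulesD(1)[OF assms(4)] .
  have dk: "d (Suc k) \<in> mod_hom S (P (Suc k)) (P k)" for k
    using assms(2) unfolding projective_resolution_def exact_augmented_def by auto
  have di: "d i \<in> mod_hom S (P i) (P (i - 1))" using dk[of "i - 1"] assms(3) by simp
  note dc = mod_homD(1)[OF dk]
  let ?f = "restrict f (carrier (P i))"
  have fH: "?f \<in> carrier (hom_group S (P i) B)"
    unfolding hom_group_def using mod_hom_restrict[OF Pi.left_module_axioms f(1)] by simp
  have fZ: "?f \<in> ext_cocycles S P d i B"
    using fH f(2) dc unfolding ext_cocycles_def by (auto simp: hom_group_def compose_def intro!: restrict_ext)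
  have z: "\<one>\<^bsub>hom_group S (P i) B\<^esub> \<in> ?H"
  proof -
    have "(\<lambda>x\<in>carrier (P (i - 1)). \<zero>\<^bsub>B\<^esub>) \<in> carrier (hom_group S (P (i - 1)) B)"
      unfolding hom_group_def by (auto intro!: mod_homI simp: Pj.smult_closed[simplified] smult_zero[OF B.left_module_axioms]
        Pj.M.a_closed[simplified])
    moreover have "compose (carrier (P i)) (\<lambda>x\<in>carrier (P (i - 1)). \<zero>\<^bsub>B\<^esub>) (d i) = \<one>\<^bsub>hom_group S (P i) B\<^esub>"
      using mod_homD(1)[OF di] unfolding compose_def hom_group_def by (auto intro!: restrict_ext)
    ultimately show ?thesis using assms(3) unfolding ext_coboundaries_def by force
  qed
  have "trivial_group (?G Mod ?H)" using assms(1,2) unfolding ext_zero_def ext_group_def by blast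
  then have "?H #>\<^bsub>?G\<^esub> ?f = ?H"
    using fZ unfolding trivial_group_def carrier_FactGroup by auto
  \<comment> \<open>f lies in its own coset, as the translate of the zero coboundary.\<close>
  moreover have "\<one>\<^bsub>hom_group S (P i) B\<^esub> \<otimes>\<^bsub>hom_group S (P i) B\<^esub> ?f \<in> ?H #>\<^bsub>?G\<^esub> ?f"
    using z unfolding r_coset_def by auto
  moreover have "\<one>\<^bsub>hom_group S (P i) B\<^esub> \<otimes>\<^bsub>hom_group S (P i) B\<^esub> ?f = ?f"
    using mod_homD(1)[OF f(1)] unfolding hom_group_def by (auto intro!: restrict_ext)
  ultimately have "?f \<in> ?H" by simp
  then obtain g where g: "g \<in> mod_hom S (P (i - 1)) B" "?f = compose (carrier (P i)) g (d i)"
    using assms(3) unfolding ext_coboundaries_def hom_group_def by auto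
  have "g (d i x) = f x" if "x \<in> carrier (P i)" for x
    using fun_cong[OF g(2), of x] that by (simp add: compose_def)
  then show ?thesis using g(1) by blast
qed

text \<open>Dimension shifting. The composite of h with the surjection \<open>\<pi> (Suc i)\<close>
  is a cocycle in degree \<open>Suc i\<close>; written as a coboundary it factors through the
  differential, and the surjection can be cancelled.\<close>

lemma ext_zero_proj_chain:
  assumes "proj_chain S A P \<iota> \<pi>" "ext_zero S (Suc i) (A 0) B" "B \<in> modules S"
  shows "hom_ext S (\<iota> i) (A (Suc i)) (P i) B"
  unfolding hom_ext_def
proof
  let ?d = "\<lambda>i. case i of 0 \<Rightarrow> \<pi> 0 | Suc k \<Rightarrow> \<iota> k \<circ> \<pi> (Suc k)"
  note D = proj_chainD[OF assms(1)]
  note E = short_exactD[OF D(4)]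
  fix h assume h: "h \<in> mod_hom S (A (Suc i)) B"
  have h0: "h \<zero>\<^bsub>A (Suc i)\<^esub> = \<zero>\<^bsub>B\<^esub>"
    by (rule mod_hom_zero[OF h modulesD(2)[OF D(1)] modulesD(2)[OF assms(3)]])
  have "\<exists>g\<in>mod_hom S (P (Suc i - 1)) B. \<forall>x\<in>carrier (P (Suc i)). g (?d (Suc i) x) = (h \<circ> \<pi> (Suc i)) x"
  proof (rule ext_zero_cocycle[OF assms(2) proj_chain_resolution[OF assms(1)] _ assms(3)])
    show "h \<circ> \<pi> (Suc i) \<in> mod_hom S (P (Suc i)) B" by (rule mod_hom_comp[OF E(2) h])
    fix x assume "x \<in> carrier (P (Suc (Suc i)))"
    then show "(h \<circ> \<pi> (Suc i)) (?d (Suc (Suc i)) x) = \<zero>\<^bsub>B\<^esub>"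
      using E(6)[of _ "Suc i"] E(5)[of x "Suc (Suc i)"] h0 by simp
  qed simp
  then obtain g where g: "g \<in> mod_hom S (P i) B" "\<And>x. x \<in> carrier (P (Suc i)) \<Longrightarrow> g (\<iota> i (\<pi> (Suc i) x)) = h (\<pi> (Suc i) x)"
    by auto
  have "g (\<iota> i y) = h y" if "y \<in> carrier (A (Suc i))" for y
    using E(8)[OF that] g(2) by blast
  then show "\<exists>k\<in>mod_hom S (P i) B. \<forall>x\<in>carrier (A (Suc i)). k (\<iota> i x) = h x" using g(1) by blast
qed

text \<open>\<open>ext_zero\<close> ranges over all projective resolutions, but of each only the
  first syzygy K matters. A cocycle on \<open>P 1\<close> kills the image of \<open>P 2\<close> and
  descends to K; extending it from K to \<open>P 0\<close> exhibits it as a coboundary.\<close>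

lemma ext_zero_oneI:
  assumes NB: "N \<in> modules S" "B \<in> modules S"
    and ext: "\<And>K P \<pi>. projective S P \<Longrightarrow> K \<in> modules S \<Longrightarrow> short_exact S K id P \<pi> N \<Longrightarrow> hom_ext S id K P B"
  shows "ext_zero S 1 N B"
  unfolding ext_zero_def
proof (intro allI impI)
  fix P d assume PR: "projective_resolution S P d N"
  have P: "P k \<in> modules S" "projective S (P k)" for k
    using PR unfolding projective_resolution_def projective_def by auto
  have ex: "exact_augmented S P d N \<infinity>" using PR unfolding projective_resolution_def by simp
  have d0: "d 0 \<in> mod_hom S (P 0) N" "d 0 ` carrier (P 0) = carrier N"
    using ex unfolding exact_augmented_def by auto
  have d1: "d 1 \<in> mod_hom S (P 1) (P 0)" "d 1 ` carrier (P 1) = a_kernel (P 0) N (d 0)"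
    and d2: "d 2 \<in> mod_hom S (P 2) (P 1)" "d 2 ` carrier (P 2) = a_kernel (P 1) (P 0) (d 1)"
    using ex unfolding exact_augmented_def
    by (force dest: spec[of _ 0] spec[of _ 1] simp: numeral_2_eq_2)+
  obtain K where K: "K \<in> modules S" "short_exact S K id (P 0) (d 0) N"
    by (rule kernel_exists[OF P(1) NB(1) d0])
  note E = short_exactD[OF K(2)]
  interpret P0: left_module S "P 0" using modulesD(1)[OF P(1)] .
  interpret P1: left_module S "P 1" using modulesD(1)[OF P(1)] .
  interpret B: left_module S B using modulesD(1)[OF NB(2)] .
  have d1': "d 1 \<in> mod_hom S (P 1) K" and K0: "\<zero>\<^bsub>K\<^esub> = \<zero>\<^bsub>P 0\<^esub>" and ontoK: "\<And>z. z \<in> carrier K \<Longrightarrow> \<exists>y\<in>carrier (P 1). z = d 1 y"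
  proof -
    have "\<exists>k\<in>mod_hom S (P 1) K. \<forall>x\<in>carrier (P 1). id (k x) = d 1 x"
      by (rule short_exact_factor[OF K(2) modulesD(1)[OF K(1)] P0.left_module_axioms P1.left_module_axioms d1(1)])
        (use d1(2) in \<open>auto simp: a_kernel_def'\<close>)
    then obtain k where k: "k \<in> mod_hom S (P 1) K" "\<And>x. x \<in> carrier (P 1) \<Longrightarrow> k x = d 1 x" by auto
    show "d 1 \<in> mod_hom S (P 1) K"
      by (rule mod_hom_cong[OF k(1) P1.left_module_axioms k(2)])
    show "\<zero>\<^bsub>K\<^esub> = \<zero>\<^bsub>P 0\<^esub>"
      using mod_hom_zero[OF E(1) modulesD(2)[OF K(1)] P0.abelian_group_axioms] by simp
    show "\<exists>y\<in>carrier (P 1). z = d 1 y" if "z \<in> carrier K" for z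
      using E(4)[OF that] E(6)[OF that] d1(2) that by (auto simp: a_kernel_def' image_iff)
  qed
  let ?Z = "ext_cocycles S P d 1 B" and ?H = "ext_coboundaries S P d 1 B"
  have HZ: "?Z \<subseteq> ?H"
  proof
    fix f assume f: "f \<in> ?Z"
    then have fh: "f \<in> mod_hom S (P 1) B" "f \<in> extensional (carrier (P 1))"
      unfolding ext_cocycles_def hom_group_def by auto
    have f0: "f (d 2 x) = \<zero>\<^bsub>B\<^esub>" if "x \<in> carrier (P 2)" for x
    proof -
      have "compose (carrier (P 2)) f (d 2) = \<one>\<^bsub>hom_group S (P 2) B\<^esub>"
        using f unfolding ext_cocycles_def by (simp add: numeral_2_eq_2)
      from fun_cong[OF this, of x] show ?thesis using that by (simp add: compose_def hom_group_def)
    qed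
    have "\<exists>k\<in>mod_hom S K B. \<forall>y\<in>carrier (P 1). k (d 1 y) = f y"
    proof (rule mod_hom_descend[OF P1.left_module_axioms modulesD(1)[OF K(1)] B.left_module_axioms d1' ontoK fh(1)])
      fix y assume "y \<in> carrier (P 1)" "d 1 y = \<zero>\<^bsub>K\<^esub>"
      then have "y \<in> d 2 ` carrier (P 2)" unfolding d2(2) K0 by (simp add: a_kernel_def')
      then show "f y = \<zero>\<^bsub>B\<^esub>" using f0 by blast
    qed
    then obtain k where k: "k \<in> mod_hom S K B" "\<And>y. y \<in> carrier (P 1) \<Longrightarrow> k (d 1 y) = f y" by blast
    obtain g where g: "g \<in> mod_hom S (P 0) B" "\<And>x. x \<in> carrier K \<Longrightarrow> g x = k x"
      using ext[OF P(2) K] k(1) unfolding hom_ext_def by auto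
    have "f = compose (carrier (P 1)) (restrict g (carrier (P 0))) (d 1)"
      by (rule extensionalityI[OF fh(2)])
        (use g(2) k(2) mod_homD(1)[OF d1(1)] mod_homD(1)[OF d1'] in \<open>auto simp: compose_def\<close>)
    moreover have "restrict g (carrier (P 0)) \<in> carrier (hom_group S (P 0) B)"
      unfolding hom_group_def using mod_hom_restrict[OF P0.left_module_axioms g(1)] by simp
    ultimately show "f \<in> ?H" unfolding ext_coboundaries_def by auto
  qed
  have ZH: "?H \<subseteq> ?Z"
  proof
    fix f assume "f \<in> ?H"
    then obtain g where g: "g \<in> mod_hom S (P 0) B" "f = compose (carrier (P 1)) g (d 1)"
      unfolding ext_coboundaries_def hom_group_def by auto
    have c: "compose (carrier (P 1)) g (d 1) \<in> mod_hom S (P 1) B"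
      using mod_hom_restrict[OF P1.left_module_axioms mod_hom_comp[OF d1(1) g(1)]] by (simp add: compose_def comp_def)
    have "d 1 (d 2 x) = \<zero>\<^bsub>P 0\<^esub>" "d 2 x \<in> carrier (P 1)" if "x \<in> carrier (P 2)" for x
      using d2(2) that by (auto simp: a_kernel_def')
    then show "f \<in> ?Z"
      using c g mod_hom_zero[OF g(1) P0.abelian_group_axioms B.abelian_group_axioms]
      unfolding ext_cocycles_def
      by (auto simp: hom_group_def compose_def numeral_2_eq_2[symmetric] intro!: restrict_ext)
  qed
  \<comment> \<open>What remains is the quotient of the cocycles by themselves;
    \<open>trivial_group\<close> also asks that this be a group.\<close>
  have eq: "?H = ?Z" using HZ ZH by blast
  interpret H: comm_group "hom_group S (P 1) B"
    by (rule comm_group_hom_group[OF P1.left_module_axioms B.left_module_axioms])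
  have simps: "\<And>f g. f \<otimes>\<^bsub>hom_group S (P 1) B\<^esub> g = (\<lambda>x\<in>carrier (P 1). f x \<oplus>\<^bsub>B\<^esub> g x)"
    unfolding hom_group_def by simp
  have sgZ: "subgroup ?Z (hom_group S (P 1) B)"
  proof (rule H.subgroupI)
    show "?Z \<subseteq> carrier (hom_group S (P 1) B)" unfolding ext_cocycles_def by auto
    have d2c: "d 2 x \<in> carrier (P 1)" if "x \<in> carrier (P 2)" for x using mod_homD(1)[OF d2(1) that] .
    have Zi: "f \<in> ?Z \<longleftrightarrow> f \<in> carrier (hom_group S (P 1) B) \<and> (\<forall>x\<in>carrier (P 2). f (d 2 x) = \<zero>\<^bsub>B\<^esub>)" for f
      unfolding ext_cocycles_def numeral_2_eq_2
      by (auto simp: hom_group_def compose_def fun_eq_iff restrict_def)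
    have one: "\<one>\<^bsub>hom_group S (P 1) B\<^esub> x = \<zero>\<^bsub>B\<^esub>" if "x \<in> carrier (P 1)" for x
      using that by (simp add: hom_group_def)
    show "?Z \<noteq> {}" using Zi[of "\<one>\<^bsub>hom_group S (P 1) B\<^esub>"] one d2c H.one_closed by blast
    fix f assume f: "f \<in> ?Z"
    have fc: "f \<in> carrier (hom_group S (P 1) B)" using f Zi by blast
    have "(inv\<^bsub>hom_group S (P 1) B\<^esub> f) (d 2 x) = \<zero>\<^bsub>B\<^esub>" if x: "x \<in> carrier (P 2)" for x
    proof -
      have "(inv\<^bsub>hom_group S (P 1) B\<^esub> f \<otimes>\<^bsub>hom_group S (P 1) B\<^esub> f) (d 2 x) = \<zero>\<^bsub>B\<^esub>"
        using H.l_inv[OF fc] one[OF d2c[OF x]] by metis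
      moreover have "(inv\<^bsub>hom_group S (P 1) B\<^esub> f) (d 2 x) \<in> carrier B"
        using H.inv_closed[OF fc] d2c[OF x] by (auto simp: hom_group_def dest: mod_homD(1))
      ultimately show ?thesis using f x d2c[OF x] Zi by (simp add: simps[simplified])
    qed
    then show "inv\<^bsub>hom_group S (P 1) B\<^esub> f \<in> ?Z" using H.inv_closed[OF fc] Zi by blast
    fix g assume "g \<in> ?Z"
    then have g: "g \<in> carrier (hom_group S (P 1) B)" "\<forall>x\<in>carrier (P 2). g (d 2 x) = \<zero>\<^bsub>B\<^esub>" using Zi by blast+
    have "\<forall>x\<in>carrier (P 2). (f \<otimes>\<^bsub>hom_group S (P 1) B\<^esub> g) (d 2 x) = \<zero>\<^bsub>B\<^esub>"
      using f g(2) Zi d2c by (simp add: simps[simplified])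
    then show "f \<otimes>\<^bsub>hom_group S (P 1) B\<^esub> g \<in> ?Z" using H.m_closed[OF fc g(1)] Zi by blast
  qed
  interpret Z: comm_group "(hom_group S (P 1) B)\<lparr>carrier := ?Z\<rparr>"
    by (rule group.group_comm_groupI[OF subgroup.subgroup_is_group[OF sgZ H.group_axioms]])
      (use subgroup.mem_carrier[OF sgZ] H.m_comm in auto)
  let ?G = "(hom_group S (P 1) B)\<lparr>carrier := ?Z\<rparr>"
  have sg: "subgroup ?Z ?G" using Z.subgroup_self by simp
  have "group (?G Mod ?Z)" using Z.abelian_FactGroup[OF sg] comm_group.axioms(2) by blast
  moreover have "carrier (?G Mod ?Z) = {\<one>\<^bsub>?G Mod ?Z\<^esub>}"
  proof -
    have "?Z #>\<^bsub>?G\<^esub> f = ?Z" if "f \<in> ?Z" for f using Z.coset_join2[OF _ sg] that by simp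
    moreover have "?Z \<noteq> {}" using subgroup.one_closed[OF sg] by blast
    ultimately show ?thesis unfolding carrier_FactGroup by auto
  qed
  ultimately show "trivial_group (ext_group S P d 1 B)"
    unfolding ext_group_def eq trivial_group_def by blast
qed

text \<open>For projective \<open>P\<close> the hypothesis \<open>ext\<close> says \<open>Ext\<^sup>1(N, B) = 0\<close>.\<close>

lemma hom_ext_presentation:
  assumes P: "projective S P" and mods: "K \<in> modules S" "N \<in> modules S" "X \<in> modules S" "Y \<in> modules S"
    and Bm: "B \<in> modules S" and ex: "short_exact S K \<iota> P \<pi> N" "short_exact S X u Y v N"
    and ext: "hom_ext S \<iota> K P B"
  shows "hom_ext S u X Y B"
  unfolding hom_ext_def
proof
  note E = short_exactD[OF ex(1)] and F = short_exactD[OF ex(2)]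
  have Pm: "P \<in> modules S" using P unfolding projective_def by simp
  interpret P: left_module S P using modulesD(1)[OF Pm] .
  interpret N: left_module S N using modulesD(1)[OF mods(2)] .
  interpret X: left_module S X using modulesD(1)[OF mods(3)] .
  interpret Y: left_module S Y using modulesD(1)[OF mods(4)] .
  interpret B: left_module S B using modulesD(1)[OF Bm] .
  have onto: "v ` carrier Y = carrier N" using ex(2) unfolding short_exact_def by simp
  have "\<forall>B\<in>modules S. \<forall>C\<in>modules S. \<forall>g\<in>mod_hom S B C. \<forall>f\<in>mod_hom S P C.
      g ` carrier B = carrier C \<longrightarrow> (\<exists>k\<in>mod_hom S P B. \<forall>p\<in>carrier P. g (k p) = f p)"
    using P unfolding projective_def by simp
  note lift = mp[OF bspec[OF bspec[OF bspec[OF bspec[OF this mods(4)] mods(2)] F(2)] E(2)] onto]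
  obtain s where s: "s \<in> mod_hom S P Y" "\<And>p. p \<in> carrier P \<Longrightarrow> v (s p) = \<pi> p" using lift by auto
  have "\<exists>t\<in>mod_hom S K X. \<forall>k\<in>carrier K. u (t k) = (s \<circ> \<iota>) k"
    by (rule short_exact_factor[OF ex(2) X.left_module_axioms Y.left_module_axioms modulesD(1)[OF mods(1)]
          mod_hom_comp[OF E(1) s(1)]]) (use s(2) E(4,6) in auto)
  then obtain t where t: "t \<in> mod_hom S K X" "\<And>k. k \<in> carrier K \<Longrightarrow> u (t k) = s (\<iota> k)" by auto
  fix h assume h: "h \<in> mod_hom S X B"
  obtain \<delta> where \<delta>: "\<delta> \<in> mod_hom S P B" "\<And>k. k \<in> carrier K \<Longrightarrow> \<delta> (\<iota> k) = h (t k)"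
    using ext mod_hom_comp[OF t(1) h] unfolding hom_ext_def by force
  note H = mod_homD[OF h] and D = mod_homD[OF \<delta>(1)]
  let ?D = "dirsum X P"
  \<comment> \<open>Y is the quotient of the direct sum of X and P by the pairs
    \<open>(- t k, \<iota> k)\<close>, which make up the kernel of \<open>?e\<close>. The maps h and
    \<open>\<delta>\<close> together vanish on these pairs because \<open>\<delta>\<close> extends
    \<open>h \<circ> t\<close> along \<open>\<iota>\<close>.\<close>
  let ?e = "\<lambda>(x, p). u x \<oplus>\<^bsub>Y\<^esub> s p"
  have Dm: "left_module S ?D" by (rule left_module_dirsum[OF X.left_module_axioms P.left_module_axioms])
  have e: "?e \<in> mod_hom S ?D Y"
    by (rule mod_homI) (auto simp: dirsum_def mod_homD[OF F(1)] mod_homD[OF s(1)] Y.M.a_ac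
        Y.smult_r_distr Y.smult_closed)
  have e_onto: "\<exists>z\<in>carrier ?D. y = ?e z" if y: "y \<in> carrier Y" for y
  proof -
    obtain p where p: "p \<in> carrier P" "v y = \<pi> p" using E(8)[OF F(5)[OF y]] by blast
    have sp: "s p \<in> carrier Y" by (rule mod_homD(1)[OF s(1) p(1)])
    have "v (y \<ominus>\<^bsub>Y\<^esub> s p) = \<zero>\<^bsub>N\<^esub>"
      using mod_hom_minus[OF F(2) Y.abelian_group_axioms N.abelian_group_axioms y sp] s(2)[OF p(1)] p
        minus_eq_zero_iff[OF N.abelian_group_axioms F(5)[OF y] E(5)[OF p(1)]] by simp
    then obtain x where x: "x \<in> carrier X" "y \<ominus>\<^bsub>Y\<^esub> s p = u x" using F(7) y sp by blast
    have "y = u x \<oplus>\<^bsub>Y\<^esub> s p"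
      using y sp by (simp add: x(2)[symmetric] a_minus_def Y.M.a_assoc Y.M.l_neg)
    then show ?thesis using x(1) p(1) by (intro bexI[of _ "(x, p)"]) (auto simp: dirsum_def)
  qed
  let ?\<theta> = "\<lambda>(x, p). h x \<oplus>\<^bsub>B\<^esub> \<delta> p"
  have \<theta>: "?\<theta> \<in> mod_hom S ?D B"
    by (rule mod_homI) (auto simp: dirsum_def H D B.M.a_ac B.smult_r_distr B.smult_closed)
  have van: "?\<theta> z = \<zero>\<^bsub>B\<^esub>" if z: "z \<in> carrier ?D" "?e z = \<zero>\<^bsub>Y\<^esub>" for z
  proof -
    obtain x p where xp: "z = (x, p)" "x \<in> carrier X" "p \<in> carrier P" "u x \<oplus>\<^bsub>Y\<^esub> s p = \<zero>\<^bsub>Y\<^esub>"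
      using z by (cases z) (auto simp: dirsum_def)
    have sp: "s p \<in> carrier Y" by (rule mod_homD(1)[OF s(1) xp(3)])
    have "v (u x \<oplus>\<^bsub>Y\<^esub> s p) = \<pi> p"
      using mod_homD(2)[OF F(2) F(4)[OF xp(2)] sp] F(6)[OF xp(2)] s(2)[OF xp(3)] E(5)[OF xp(3)] by simp
    then have "\<pi> p = \<zero>\<^bsub>N\<^esub>" using xp(4) mod_hom_zero[OF F(2) Y.abelian_group_axioms N.abelian_group_axioms] by simp
    then obtain k where k: "k \<in> carrier K" "p = \<iota> k" using E(7)[OF xp(3)] by blast
    have tk: "t k \<in> carrier X" by (rule mod_homD(1)[OF t(1) k(1)])
    have "u (x \<oplus>\<^bsub>X\<^esub> t k) = u \<zero>\<^bsub>X\<^esub>"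
      using mod_homD(2)[OF F(1) xp(2) tk] t(2)[OF k(1)] k(2) xp(4)
        mod_hom_zero[OF F(1) X.abelian_group_axioms Y.abelian_group_axioms] by simp
    then have "x \<oplus>\<^bsub>X\<^esub> t k = \<zero>\<^bsub>X\<^esub>" using F(9) xp(2) tk by blast
    then have "h x \<oplus>\<^bsub>B\<^esub> h (t k) = \<zero>\<^bsub>B\<^esub>"
      using H(2)[OF xp(2) tk] mod_hom_zero[OF h X.abelian_group_axioms B.abelian_group_axioms] by simp
    then show ?thesis using xp(1) k \<delta>(2)[OF k(1)] by simp
  qed
  have "\<exists>\<eta>\<in>mod_hom S Y B. \<forall>z\<in>carrier ?D. \<eta> (?e z) = ?\<theta> z"
    by (rule mod_hom_descend[OF Dm Y.left_module_axioms B.left_module_axioms e e_onto \<theta>]) (use van in blast)+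
  then obtain \<eta> where \<eta>: "\<eta> \<in> mod_hom S Y B" "\<And>z. z \<in> carrier ?D \<Longrightarrow> \<eta> (?e z) = ?\<theta> z" by blast
  have "\<eta> (u x) = h x" if x: "x \<in> carrier X" for x
    using \<eta>(2)[of "(x, \<zero>\<^bsub>P\<^esub>)"] x F(4)[OF x] H(1)[OF x]
      mod_hom_zero[OF s(1) P.abelian_group_axioms Y.abelian_group_axioms]
      mod_hom_zero[OF \<delta>(1) P.abelian_group_axioms B.abelian_group_axioms] by (simp add: dirsum_def)
  then show "\<exists>k\<in>mod_hom S Y B. \<forall>x\<in>carrier X. k (u x) = h x"
    using \<eta>(1) by blast
qed

section \<open>Resolution dimension by induction\<close>

text \<open>The length is exactly n, as in the sequences counted by \<open>resdim\<close>: a class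
  without the zero module does not allow prolongation by zeros, so monotonicity in n takes an
  argument (\<open>resolved_le\<close>).\<close>

fun resolved :: "'u ring \<Rightarrow> ('u, 'u) module set \<Rightarrow> nat \<Rightarrow> ('u, 'u) module \<Rightarrow> bool" where
  "resolved S \<X> 0 M \<longleftrightarrow> M \<in> \<X>"
| "resolved S \<X> (Suc n) M \<longleftrightarrow> (\<exists>K\<in>modules S. \<exists>X\<in>\<X>. \<exists>f g. short_exact S K f X g M \<and> resolved S \<X> n K)"

lemma module_classD:
  assumes "module_class S \<X>"
  shows "\<And>M. M \<in> \<X> \<Longrightarrow> M \<in> modules S"
    "\<And>M N. M \<in> \<X> \<Longrightarrow> N \<in> modules S \<Longrightarrow> isomorphic S M N \<Longrightarrow> N \<in> \<X>"
  using assms unfolding module_class_def by auto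

lemma resolved_imp_exact_augmented:
  assumes "module_class S \<X>" "M \<in> modules S" "resolved S \<X> n M"
  shows "\<exists>Y d. (\<forall>k\<le>n. Y k \<in> \<X>) \<and> exact_augmented S Y d M (enat n)"
  using assms(2,3)
proof (induction n arbitrary: M)
  case 0
  then have "M \<in> \<X>" by simp
  then show ?case
    by (intro exI[of _ "\<lambda>_. M"] exI[of _ "\<lambda>_. id"])
      (auto simp: exact_augmented_def mod_hom_id[unfolded id_def] enat_0_iff)
next
  case (Suc n)
  then obtain K X f g where K: "K \<in> modules S" "X \<in> \<X>" "short_exact S K f X g M" "resolved S \<X> n K" by auto
  obtain Y d where Y: "\<forall>k\<le>n. Y k \<in> \<X>" "exact_augmented S Y d K (enat n)" using Suc.IH[OF K(1,4)] by blast
  note E = short_exactD[OF K(3)]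
  have d0: "d 0 \<in> mod_hom S (Y 0) K" "d 0 ` carrier (Y 0) = carrier K"
    and dS: "\<And>k. Suc k \<le> n \<Longrightarrow> d (Suc k) \<in> mod_hom S (Y (Suc k)) (Y k)"
      "\<And>k. Suc k \<le> n \<Longrightarrow> d (Suc k) ` carrier (Y (Suc k)) = a_kernel (Y k) (if k = 0 then K else Y (k - 1)) (d k)"
    and inj: "inj_on (d n) (carrier (Y n))"
    using Y(2) unfolding exact_augmented_def by auto
  let ?Y = "\<lambda>k. case k of 0 \<Rightarrow> X | Suc j \<Rightarrow> Y j"
  let ?d = "\<lambda>k. case k of 0 \<Rightarrow> g | Suc 0 \<Rightarrow> f \<circ> d 0 | Suc (Suc j) \<Rightarrow> d (Suc j)"
  have f0: "f \<zero>\<^bsub>K\<^esub> = \<zero>\<^bsub>X\<^esub>"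
    by (rule mod_hom_zero[OF E(1) modulesD(2)[OF K(1)] modulesD(2)[OF module_classD(1)[OF assms(1) K(2)]]])
  have fz: "f y = \<zero>\<^bsub>X\<^esub> \<longleftrightarrow> y = \<zero>\<^bsub>K\<^esub>" if "y \<in> carrier K" for y
    using E(9)[OF that abelian_groupE(2)[OF modulesD(2)[OF K(1)]]] f0 by auto
  have "exact_augmented S ?Y ?d M (enat (Suc n))"
    unfolding exact_augmented_def
  proof (intro conjI allI impI)
    show "?d 0 \<in> mod_hom S (?Y 0) M" "?d 0 ` carrier (?Y 0) = carrier M"
      using K(3) unfolding short_exact_def by auto
  next
    fix k assume k: "enat (Suc k) \<le> enat (Suc n)"
    show "?d (Suc k) \<in> mod_hom S (?Y (Suc k)) (?Y k)"
      using k mod_hom_comp[OF d0(1) E(1)] dS(1) by (auto split: nat.splits)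
    show "?d (Suc k) ` carrier (?Y (Suc k)) = a_kernel (?Y k) (if k = 0 then M else ?Y (k - 1)) (?d k)"
    proof (cases k)
      case 0
      have "f ` carrier K = a_kernel X M g" using K(3) unfolding short_exact_def by simp
      then show ?thesis using 0 by (simp add: d0(2)[symmetric] image_image)
    next
      case (Suc j)
      have "a_kernel (Y 0) X (f \<circ> d 0) = a_kernel (Y 0) K (d 0)"
        using fz mod_homD(1)[OF d0(1)] by (auto simp: a_kernel_def')
      then show ?thesis using k Suc dS(2)[of j] by (auto split: nat.splits)
    qed
  next
    fix k assume "enat (Suc n) = enat k"
    then show "inj_on (?d k) (carrier (?Y k))"
      using inj d0 E(3) by (auto split: nat.splits intro!: comp_inj_on)
  qed
  moreover have "\<forall>k\<le>Suc n. ?Y k \<in> \<X>" using K(2) Y(1) by (auto split: nat.splits)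
  ultimately show ?case by blast
qed

lemma exact_augmented_imp_resolved:
  assumes "module_class S \<X>" "M \<in> modules S" "\<forall>k\<le>n. Y k \<in> \<X>" "exact_augmented S Y d M (enat n)"
  shows "resolved S \<X> n M"
  using assms(2-)
proof (induction n arbitrary: M Y d)
  case 0
  then have "d 0 \<in> mod_hom S (Y 0) M" "bij_betw (d 0) (carrier (Y 0)) (carrier M)" "Y 0 \<in> \<X>"
    unfolding exact_augmented_def bij_betw_def by (auto simp: zero_enat_def)
  then have "isomorphic S (Y 0) M" unfolding isomorphic_def by blast
  then show ?case using module_classD(2)[OF assms(1) \<open>Y 0 \<in> \<X>\<close> 0(1)] by simp
next
  case (Suc n)
  have d0: "d 0 \<in> mod_hom S (Y 0) M" "d 0 ` carrier (Y 0) = carrier M"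
    and dS: "\<And>k. Suc k \<le> Suc n \<Longrightarrow> d (Suc k) \<in> mod_hom S (Y (Suc k)) (Y k)"
      "\<And>k. Suc k \<le> Suc n \<Longrightarrow> d (Suc k) ` carrier (Y (Suc k)) = a_kernel (Y k) (if k = 0 then M else Y (k - 1)) (d k)"
    and inj: "inj_on (d (Suc n)) (carrier (Y (Suc n)))"
    using Suc.prems(3) unfolding exact_augmented_def by auto
  have Ym: "Y k \<in> modules S" if "k \<le> Suc n" for k using Suc.prems(2) module_classD(1)[OF assms(1)] that by blast
  have Y0: "Y 0 \<in> modules S" and Y1: "Y 1 \<in> modules S" using Ym by auto
  obtain K where K: "K \<in> modules S" "short_exact S K id (Y 0) (d 0) M"
    by (rule kernel_exists[OF Y0 Suc.prems(1) d0])
  note E = short_exactD[OF K(2)]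
  have d1: "d 1 \<in> mod_hom S (Y 1) (Y 0)" "d 1 ` carrier (Y 1) = a_kernel (Y 0) M (d 0)"
    using dS[of 0] by simp_all
  have cK: "carrier K = a_kernel (Y 0) M (d 0)" using K(2) unfolding short_exact_def by simp
  have "\<exists>k\<in>mod_hom S (Y 1) K. \<forall>x\<in>carrier (Y 1). id (k x) = d 1 x"
    by (rule short_exact_factor[OF K(2) modulesD(1)[OF K(1)] modulesD(1)[OF Y0] modulesD(1)[OF Y1] d1(1)])
      (use d1(2) in \<open>auto simp: a_kernel_def'\<close>)
  then obtain k where "k \<in> mod_hom S (Y 1) K" "\<And>x. x \<in> carrier (Y 1) \<Longrightarrow> k x = d 1 x" by auto
  then have d1K: "d 1 \<in> mod_hom S (Y 1) K" by (rule mod_hom_cong[OF _ modulesD(1)[OF Y1]])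
  have K0: "\<zero>\<^bsub>K\<^esub> = \<zero>\<^bsub>Y 0\<^esub>" using mod_hom_zero[OF E(1) modulesD(2)[OF K(1)] modulesD(2)[OF Y0]] by simp
  have "exact_augmented S (\<lambda>k. Y (Suc k)) (\<lambda>k. d (Suc k)) K (enat n)"
    unfolding exact_augmented_def
  proof (intro conjI allI impI)
    show "d (Suc 0) \<in> mod_hom S (Y (Suc 0)) K" "d (Suc 0) ` carrier (Y (Suc 0)) = carrier K"
      using d1K d1(2) cK by simp_all
  next
    fix k assume k: "enat (Suc k) \<le> enat n"
    show "d (Suc (Suc k)) \<in> mod_hom S (Y (Suc (Suc k))) (Y (Suc k))" using dS(1)[of "Suc k"] k by simp
    show "d (Suc (Suc k)) ` carrier (Y (Suc (Suc k))) =
        a_kernel (Y (Suc k)) (if k = 0 then K else Y (Suc (k - 1))) (d (Suc k))"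
      using dS(2)[of "Suc k"] k by (cases k) (auto simp: a_kernel_def' K0)
  qed (use inj in auto)
  then have "resolved S \<X> n K"
    using Suc.IH[OF K(1), of "\<lambda>k. Y (Suc k)" "\<lambda>k. d (Suc k)"] Suc.prems(2) by simp
  then show ?case using K Suc.prems(2) by auto
qed

lemma resdim_eq:
  assumes "module_class S \<X>" "M \<in> modules S"
  shows "resdim S \<X> M = Inf {enat m | m. resolved S \<X> m M}"
proof -
  have "(\<exists>Y d. (\<forall>k\<le>m. Y k \<in> \<X>) \<and> exact_augmented S Y d M (enat m)) \<longleftrightarrow> resolved S \<X> m M" for m
    using resolved_imp_exact_augmented[OF assms, of m] exact_augmented_imp_resolved[OF assms, of m] by blast
  then show ?thesis unfolding resdim_def by simp
qed

lemma resdim_le: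
  assumes "module_class S \<X>" "M \<in> modules S" "resolved S \<X> n M"
  shows "resdim S \<X> M \<le> enat n"
  unfolding resdim_eq[OF assms(1,2)] by (rule Inf_lower) (use assms(3) in auto)

lemma resdim_finiteE:
  assumes "module_class S \<X>" "M \<in> finite_resdim_class S \<X>"
  obtains n where "M \<in> modules S" "resdim S \<X> M = enat n" "resolved S \<X> n M"
proof -
  have M: "M \<in> modules S" "resdim S \<X> M < \<infinity>" using assms(2) unfolding finite_resdim_class_def by auto
  then have "{enat m | m. resolved S \<X> m M} \<noteq> {}"
    unfolding resdim_eq[OF assms(1) M(1)] by (auto simp: Inf_enat_def split: if_splits)
  then have "Inf {enat m | m. resolved S \<X> m M} \<in> {enat m | m. resolved S \<X> m M}"
    unfolding Inf_enat_def using LeastI_ex[of "\<lambda>x. x \<in> {enat m | m. resolved S \<X> m M}"] by auto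
  then show ?thesis using that M(1) resdim_eq[OF assms(1) M(1)] by auto
qed

lemma finite_resdim_classI:
  assumes "module_class S \<X>" "M \<in> modules S" "resolved S \<X> n M"
  shows "M \<in> finite_resdim_class S \<X>"
  using resdim_le[OF assms] assms(2) unfolding finite_resdim_class_def
  by (cases "resdim S \<X> M") auto

text \<open>Every \<open>\<Y>\<close>-length of Q is an \<open>\<X>\<close>-length of M and so is at
  least the \<open>\<X>\<close>-dimension n. Taken for a shortest resolution of Q, this bounds n by
  the \<open>\<Y>\<close>-dimension of Q, which is finite and hence counted in the second
  supremum.\<close>

lemma findim_le_findim:
  assumes "module_class S \<X>" "module_class S \<Y>"
    and "\<And>M n. M \<in> modules S \<Longrightarrow> resolved S \<X> n M \<Longrightarrow> (\<And>k. resolved S \<X> k M \<Longrightarrow> n \<le> k) \<Longrightarrow>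
      n = 0 \<or> (\<exists>Q\<in>modules S. (\<exists>m. resolved S \<Y> m Q) \<and> (\<forall>k. resolved S \<Y> k Q \<longrightarrow> resolved S \<X> k M))"
  shows "findim S \<X> \<le> findim S \<Y>"
  unfolding findim_def
proof (rule SUP_least)
  fix M assume "M \<in> finite_resdim_class S \<X>"
  then obtain n where n: "M \<in> modules S" "resdim S \<X> M = enat n" "resolved S \<X> n M"
    by (rule resdim_finiteE[OF assms(1)])
  have min: "n \<le> k" if "resolved S \<X> k M" for k using resdim_le[OF assms(1) n(1) that] n(2) by simp
  show "resdim S \<X> M \<le> (SUP M\<in>finite_resdim_class S \<Y>. resdim S \<Y> M)"
    using assms(3)[OF n(1,3) min]
  proof
    assume "n = 0"
    then show ?thesis using n(2) by (simp add: zero_enat_def[symmetric])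
  next
    assume "\<exists>Q\<in>modules S. (\<exists>m. resolved S \<Y> m Q) \<and> (\<forall>k. resolved S \<Y> k Q \<longrightarrow> resolved S \<X> k M)"
    then obtain Q where Q1: "Q \<in> modules S" "\<exists>m. resolved S \<Y> m Q" "\<forall>k. resolved S \<Y> k Q \<longrightarrow> resolved S \<X> k M"
      by (elim bexE conjE) simp
    then obtain m where Q: "Q \<in> modules S" "resolved S \<Y> m Q" "\<And>k. resolved S \<Y> k Q \<Longrightarrow> resolved S \<X> k M"
      by (elim exE) simp
    have QF: "Q \<in> finite_resdim_class S \<Y>" by (rule finite_resdim_classI[OF assms(2) Q(1,2)])
    obtain k where k: "resdim S \<Y> Q = enat k" "resolved S \<Y> k Q" by (rule resdim_finiteE[OF assms(2) QF])
    have "resdim S \<X> M \<le> resdim S \<Y> Q" using min[OF Q(3)[OF k(2)]] k(1) n(2) by simp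
    also have "\<dots> \<le> (SUP M\<in>finite_resdim_class S \<Y>. resdim S \<Y> M)" by (rule SUP_upper[OF QF])
    finally show ?thesis .
  qed
qed

lemma resolved_mono: "resolved S \<X> n M \<Longrightarrow> \<X> \<subseteq> \<Y> \<Longrightarrow> resolved S \<Y> n M"
proof (induction n arbitrary: M)
  case (Suc n)
  then obtain K X f g where K: "K \<in> modules S" "X \<in> \<X>" "short_exact S K f X g M" "resolved S \<X> n K" by auto
  from Suc.IH[OF K(4) Suc.prems(2)] show ?case using K(1-3) Suc.prems(2) by auto
qed auto

section \<open>Comparison of resolutions by pullbacks, without Ext\<close>

lemma closed_extensionsD:
  "closed_extensions S \<X> \<Longrightarrow> short_exact S A f B g C \<Longrightarrow> A \<in> \<X> \<Longrightarrow> C \<in> \<X> \<Longrightarrow> B \<in> modules S \<Longrightarrow> B \<in> \<X>"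
  unfolding closed_extensions_def by blast

lemma closed_epikernelsD:
  "closed_epikernels S \<X> \<Longrightarrow> short_exact S A f B g C \<Longrightarrow> B \<in> \<X> \<Longrightarrow> C \<in> \<X> \<Longrightarrow> A \<in> modules S \<Longrightarrow> A \<in> \<X>"
  unfolding closed_epikernels_def by blast

lemma relative_generatorE:
  assumes "relative_generator S \<X>" "module_class S \<X>" "M \<in> modules S"
  obtains X K g where "X \<in> \<X>" "K \<in> modules S" "short_exact S K id X g M"
proof -
  obtain X g where X: "X \<in> \<X>" "g \<in> mod_hom S X M" "g ` carrier X = carrier M"
    using assms(1,3) unfolding relative_generator_def by blast
  obtain K where "K \<in> modules S" "short_exact S K id X g M"
    by (rule kernel_exists[OF module_classD(1)[OF assms(2) X(1)] assms(3) X(2,3)])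
  then show ?thesis using that X(1) by blast
qed

text \<open>The resolution is prolonged at its far end: M in the class is a quotient of a copy of
  the direct sum of M with itself, which is in the class by extension closure, and the kernel is M
  again.\<close>

lemma resolved_Suc:
  assumes U: "universe TYPE('u)" and "module_class (S :: 'u ring) \<X>" "closed_extensions S \<X>" "resolved S \<X> n M"
  shows "resolved S \<X> (Suc n) M"
  using assms(4)
proof (induction n arbitrary: M)
  case 0
  then have M: "M \<in> \<X>" "M \<in> modules S" using module_classD(1)[OF assms(2)] by auto
  obtain Q i p r where Q: "Q \<in> modules S" "short_exact S M i Q p M" "r \<in> mod_hom S Q M"
      "\<And>x. x \<in> carrier M \<Longrightarrow> r (i x) = x"
    by (rule dirsum_copy_exists[OF U M(2,2)]) blast
  have "Q \<in> \<X>" by (rule closed_extensionsD[OF assms(3) Q(2) M(1,1) Q(1)])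
  then show ?case using M Q by auto
next
  case (Suc n)
  then obtain K X f g where K: "K \<in> modules S" "X \<in> \<X>" "short_exact S K f X g M" "resolved S \<X> n K" by auto
  from Suc.IH[OF K(4)] have "resolved S \<X> (Suc n) K" .
  then show ?case using K(1-3) by (subst resolved.simps) blast
qed

lemma resolved_le:
  assumes "universe TYPE('u)" "module_class (S :: 'u ring) \<X>" "closed_extensions S \<X>" "resolved S \<X> n M" "n \<le> m"
  shows "resolved S \<X> m M"
  using assms(5,4) by (induction rule: dec_induct) (blast intro: resolved_Suc[OF assms(1-3)])+

text \<open>Only the top term X of a resolution of Q changes: it is replaced by the kernel W of
  \<open>X \<rightarrow> C\<close>, which covers K and has the same syzygy N.\<close>

lemma resolved_epikernel:
  assumes "module_class S \<X>" "closed_epikernels S \<X>" "C \<in> \<X>"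
    and "K \<in> modules S" "Q \<in> modules S" "short_exact S K f Q g C" "resolved S \<X> m Q"
  shows "resolved S \<X> m K"
proof (cases m)
  case 0
  then show ?thesis using closed_epikernelsD[OF assms(2,6) _ assms(3,4)] assms(7) by simp
next
  case (Suc j)
  then obtain N X a b where N: "N \<in> modules S" "X \<in> \<X>" "short_exact S N a X b Q" "resolved S \<X> j N"
    using assms(7) by auto
  obtain W n v where W: "W \<in> modules S" "short_exact S W id X (g \<circ> b) C" "short_exact S N n W v K"
    by (rule kernel_comp_exists[OF N(1) module_classD(1)[OF assms(1) N(2)] assms(5,4)
          module_classD(1)[OF assms(1,3)] N(3) assms(6)]) blast
  have "W \<in> \<X>" by (rule closed_epikernelsD[OF assms(2) W(2) N(2) assms(3) W(1)])
  then show ?thesis using Suc N(1,4) W(3) by auto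
qed

text \<open>Schanuel's comparison: the pullback Q of the two covers of M is an extension of Y by the
  good syzygy K', and also has K as the kernel of its map to Z. Closure under extensions is a
  hypothesis for the single length m, so that the induction proving it can call this step.\<close>

lemma resolved_syzygy_step:
  assumes U: "universe TYPE('u)" and X: "module_class (S :: 'u ring) \<X>" "closed_epikernels S \<X>"
    and ext: "\<And>K Q C f g. K \<in> modules S \<Longrightarrow> Q \<in> modules S \<Longrightarrow> C \<in> \<X> \<Longrightarrow> short_exact S K f Q g C \<Longrightarrow>
      resolved S \<X> m K \<Longrightarrow> resolved S \<X> m Q"
    and K: "K \<in> modules S" "Y \<in> \<X>" "M \<in> modules S" "short_exact S K f Y g M" "resolved S \<X> (Suc m) M"
  shows "resolved S \<X> m K"
proof -
  note mc = module_classD(1)[OF X(1)]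
  obtain K' Z f' g' where K': "K' \<in> modules S" "Z \<in> \<X>" "short_exact S K' f' Z g' M" "resolved S \<X> m K'"
    using K(5) by auto
  obtain Q i i' p p' where Q: "Q \<in> modules S" "short_exact S K i Q p' Z" "short_exact S K' i' Q p Y"
    by (rule pullback_exists[OF U K(1) mc[OF K(2)] K'(1) mc[OF K'(2)] K(3,4) K'(3)]) blast
  have "resolved S \<X> m Q" by (rule ext[OF K'(1) Q(1) K(2) Q(3) K'(4)])
  then show ?thesis by (rule resolved_epikernel[OF X(1,2) K'(2) K(1) Q(1,2)])
qed

text \<open>For a cover Z of Q with kernel N, the kernel W of \<open>Z \<rightarrow> C\<close> is in
  the class and covers K with the same kernel N. So N is a syzygy of K, and the comparison step, fed
  with the induction hypothesis, bounds its length by m.\<close>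

lemma resolved_extension:
  assumes U: "universe TYPE('u)" and X: "module_class (S :: 'u ring) \<X>" "closed_extensions S \<X>"
    "closed_epikernels S \<X>" "relative_generator S \<X>"
    and KQ: "K \<in> modules S" "Q \<in> modules S" "C \<in> \<X>" "short_exact S K f Q g C" "resolved S \<X> m K"
  shows "resolved S \<X> m Q"
  using KQ
proof (induction m arbitrary: K Q C f g)
  case 0
  then show ?case using closed_extensionsD[OF X(2)] by simp
next
  case (Suc m)
  note mc = module_classD(1)[OF X(1)]
  obtain Z N b where N: "Z \<in> \<X>" "N \<in> modules S" "short_exact S N id Z b Q"
    by (rule relative_generatorE[OF X(4,1) Suc.prems(2)])
  obtain W n v where W: "W \<in> modules S" "short_exact S W id Z (g \<circ> b) C" "short_exact S N n W v K"
    by (rule kernel_comp_exists[OF N(2) mc[OF N(1)] Suc.prems(2,1) mc[OF Suc.prems(3)] N(3) Suc.prems(4)]) blast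
  have WX: "W \<in> \<X>" by (rule closed_epikernelsD[OF X(3) W(2) N(1) Suc.prems(3) W(1)])
  have "resolved S \<X> m N"
    by (rule resolved_syzygy_step[OF U X(1,3) Suc.IH N(2) WX Suc.prems(1) W(3) Suc.prems(5)])
  then show ?case using N by auto
qed

lemma resolved_syzygy:
  assumes U: "universe TYPE('u)" and X: "module_class (S :: 'u ring) \<X>" "closed_extensions S \<X>"
    "closed_epikernels S \<X>" "relative_generator S \<X>"
    and K: "K \<in> modules S" "Y \<in> \<X>" "M \<in> modules S" "short_exact S K f Y g M" "resolved S \<X> (Suc m) M"
  shows "resolved S \<X> m K"
  by (rule resolved_syzygy_step[OF U X(1,3) resolved_extension[OF U X] K])

section \<open>Gluing and cutting complexes\<close>

text \<open>\<open>A \<otimes> X \<rightarrow> A \<otimes> Y\<close> is injective for every \<open>A \<in> \<nu>\<close>.\<close>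

definition pure_in :: "'u ring \<Rightarrow> ('u, 'u) module set \<Rightarrow> ('u \<Rightarrow> 'u) \<Rightarrow> ('u, 'u) module \<Rightarrow> ('u, 'u) module \<Rightarrow> bool" where
  "pure_in R \<nu> f X Y \<longleftrightarrow> (\<forall>A\<in>\<nu>. bal_ext R f X Y A)"

lemma GF_subset_modules: "GF R \<L> \<nu> \<subseteq> modules R"
  unfolding GF_def by auto

lemma module_class_GF: "module_class R (GF R \<L> \<nu>)"
  unfolding module_class_def
proof (intro conjI ballI impI)
  fix M N assume M: "M \<in> GF R \<L> \<nu>" and N: "N \<in> modules R" and iso: "isomorphic R M N"
  have "isomorphic R N M" using isomorphic_sym[OF modulesD(1) modulesD(1) iso] M N GF_subset_modules by blast
  then show "N \<in> GF R \<L> \<nu>" using M N isomorphic_trans unfolding GF_def by blast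
qed (rule GF_subset_modules)

text \<open>Membership in \<open>GF\<close> becomes a one-step property: \<open>\<G>l\<close> and
  \<open>\<G>r\<close> are invariants whose members can be cut once more to the left or right
  without leaving the class. Choice and iteration then give a complex infinite in both
  directions.\<close>

lemma GF_glue:
  assumes \<L>: "module_class R \<L>" and \<nu>: "\<nu> \<subseteq> modules (op_ring R)"
    and sub: "\<G>l \<subseteq> modules R" "\<G>r \<subseteq> modules R"
    and left: "\<And>M. M \<in> \<G>l \<Longrightarrow> \<exists>N\<in>\<G>l. \<exists>L\<in>\<L>. \<exists>f g. short_exact R N f L g M \<and> pure_in R \<nu> f N L"
    and right: "\<And>M. M \<in> \<G>r \<Longrightarrow> \<exists>N\<in>\<G>r. \<exists>L\<in>\<L>. \<exists>f g. short_exact R M f L g N \<and> pure_in R \<nu> f M L"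
    and M: "M \<in> \<G>l" "M \<in> \<G>r"
  shows "M \<in> GF R \<L> \<nu>"
proof -
  have "\<forall>M. \<exists>N L f g. M \<in> \<G>l \<longrightarrow> N \<in> \<G>l \<and> L \<in> \<L> \<and> short_exact R N f L g M \<and> pure_in R \<nu> f N L"
    using left by blast
  then obtain nl ll fl gl where l: "\<And>M. M \<in> \<G>l \<Longrightarrow> nl M \<in> \<G>l" "\<And>M. M \<in> \<G>l \<Longrightarrow> ll M \<in> \<L>"
      "\<And>M. M \<in> \<G>l \<Longrightarrow> short_exact R (nl M) (fl M) (ll M) (gl M) M"
      "\<And>M. M \<in> \<G>l \<Longrightarrow> pure_in R \<nu> (fl M) (nl M) (ll M)"
    by metis
  have "\<forall>M. \<exists>N L f g. M \<in> \<G>r \<longrightarrow> N \<in> \<G>r \<and> L \<in> \<L> \<and> short_exact R M f L g N \<and> pure_in R \<nu> f M L"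
    using right by blast
  then obtain nr lr fr gr where r: "\<And>M. M \<in> \<G>r \<Longrightarrow> nr M \<in> \<G>r" "\<And>M. M \<in> \<G>r \<Longrightarrow> lr M \<in> \<L>"
      "\<And>M. M \<in> \<G>r \<Longrightarrow> short_exact R M (fr M) (lr M) (gr M) (nr M)"
      "\<And>M. M \<in> \<G>r \<Longrightarrow> pure_in R \<nu> (fr M) M (lr M)"
    by metis
  have nl: "(nl ^^ k) M \<in> \<G>l" for k by (induction k) (use l(1) M in auto)
  have nr: "(nr ^^ k) M \<in> \<G>r" for k by (induction k) (use r(1) M in auto)
  \<comment> \<open>The cycles, with M in degree 0. \<open>L n\<close> contains \<open>Z n\<close>
    with quotient \<open>Z (n - 1)\<close>; for \<open>n \<ge> 1\<close> it is the left cut of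
    \<open>Z (n - 1)\<close>, otherwise the right cut of \<open>Z n\<close>.\<close>
  define Z where "Z n = (if n \<ge> 0 then (nl ^^ nat n) M else (nr ^^ nat (- n)) M)" for n :: int
  define L where "L n = (if n \<ge> 1 then ll (Z (n - 1)) else lr (Z n))" for n
  define i where "i n = (if n \<ge> 1 then fl (Z (n - 1)) else fr (Z n))" for n
  define p where "p n = (if n \<ge> 1 then gl (Z (n - 1)) else gr (Z n))" for n
  have Zl: "Z n \<in> \<G>l" if "n \<ge> 0" for n using that nl unfolding Z_def by simp
  have Zr: "Z n \<in> \<G>r" if "n \<le> 0" for n using that nr M unfolding Z_def by simp
  have Zl': "Z n = nl (Z (n - 1))" if "n \<ge> 1" for n
  proof -
    have "nat n = Suc (nat (n - 1))" using that by simp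
    then show ?thesis using that unfolding Z_def by simp
  qed
  have Zr': "Z (n - 1) = nr (Z n)" if "n \<le> 0" for n
  proof -
    have "nat (- (n - 1)) = Suc (nat (- n))" using that by simp
    then show ?thesis using that unfolding Z_def by auto
  qed
  have Zm: "Z n \<in> modules R" for n using Zl[of n] Zr[of n] sub by (cases "n \<ge> 0") auto
  have LL: "L n \<in> \<L>" for n
    unfolding L_def using l(2)[OF Zl, of "n - 1"] r(2)[OF Zr, of n] by auto
  have Lm: "L n \<in> modules R" for n using module_classD(1)[OF \<L> LL] .
  have ses: "short_exact R (Z n) (i n) (L n) (p n) (Z (n - 1))" for n
    using l(3)[OF Zl, of "n - 1"] r(3)[OF Zr, of n] Zl'[of n] Zr'[of n] unfolding L_def i_def p_def by auto
  have pure: "pure_in R \<nu> (i n) (Z n) (L n)" for n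
    using l(4)[OF Zl, of "n - 1"] r(4)[OF Zr, of n] Zl'[of n] unfolding L_def i_def by auto
  note E = short_exactD[OF ses]
  define d where "d n = i (n - 1) \<circ> p n" for n
  have d: "d n \<in> mod_hom R (L n) (L (n - 1))" for n
    unfolding d_def by (rule mod_hom_comp[OF E(2) E(1)])
  have i0: "i n z = \<zero>\<^bsub>L n\<^esub> \<longleftrightarrow> z = \<zero>\<^bsub>Z n\<^esub>" if "z \<in> carrier (Z n)" for n z
    using E(9)[OF that abelian_groupE(2)[OF modulesD(2)[OF Zm]]]
      mod_hom_zero[OF E(1) modulesD(2)[OF Zm] modulesD(2)[OF Lm]] by auto
  have ker: "a_kernel (L n) (L (n - 1)) (d n) = {x \<in> carrier (L n). p n x = \<zero>\<^bsub>Z (n - 1)\<^esub>}" for n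
    using i0 E(5) by (auto simp: a_kernel_def' d_def)
  have im_i: "i n ` carrier (Z n) = {x \<in> carrier (L n). p n x = \<zero>\<^bsub>Z (n - 1)\<^esub>}"
    and im_p: "p n ` carrier (L n) = carrier (Z (n - 1))" for n
    using ses[of n] unfolding short_exact_def a_kernel_def' by auto
  have im: "d (n + 1) ` carrier (L (n + 1)) = {x \<in> carrier (L n). p n x = \<zero>\<^bsub>Z (n - 1)\<^esub>}" for n
  proof -
    have "d (n + 1) ` carrier (L (n + 1)) = i n ` (p (n + 1) ` carrier (L (n + 1)))"
      by (simp add: d_def image_image)
    then show ?thesis using im_p[of "n + 1"] im_i[of n] by simp
  qed
  have "exact_complex R L d"
    unfolding exact_complex_def using d im ker by simp
  moreover have "tensor_exact R A L d" if A: "A \<in> \<nu>" for A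
    unfolding tensor_exact_def
  proof
    fix n
    note ac = modules_acted(1)[OF Lm] modules_acted(1)[OF Zm]
    have Aa: "acted R A" using A \<nu> modules_acted(2) by blast
    have f: "d (n + 1) \<in> mod_hom R (L (n + 1)) (L n)" using d[of "n + 1"] by simp
    \<comment> \<open>The differential factors as
      \<open>L n \<rightarrow> Z (n - 1) \<rightarrow> L (n - 1)\<close>, so exactness in degree n
      after tensoring is purity of the second map.\<close>
    have "bal_ext R (i (n - 1)) (Z (n - 1)) (L (n - 1)) A" using pure A unfolding pure_in_def by blast
    then show "tensor_map R A (L n) (d (n + 1)) ` carrier (tensor R A (L (n + 1))) =
        kernel (tensor R A (L n)) (tensor R A (L (n - 1))) (tensor_map R A (L (n - 1)) (d n))"
      by (subst tensor_exact_at_iff_bal_ext[OF Aa ac(1) ac(1) ac(1) ac(2)[of "n - 1"] f E(2) E(1) _ E(3) E(8) im])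
        (simp_all add: d_def)
  qed
  moreover have "isomorphic R M ((L 0)\<lparr>carrier := a_kernel (L 0) (L (- 1)) (d 0)\<rparr>)"
    unfolding isomorphic_def
  proof
    have M0: "Z 0 = M" unfolding Z_def by simp
    have k: "a_kernel (L 0) (L (- 1)) (d 0) = i 0 ` carrier M" using ker[of 0] im_i[of 0] M0 by simp
    show "bij_betw (i 0) (carrier M) (carrier ((L 0)\<lparr>carrier := a_kernel (L 0) (L (- 1)) (d 0)\<rparr>))"
      unfolding k using E(3)[of 0] M0 by (simp add: bij_betw_def)
    show "i 0 \<in> mod_hom R M ((L 0)\<lparr>carrier := a_kernel (L 0) (L (- 1)) (d 0)\<rparr>)"
      unfolding k using mod_homD[OF E(1)[of 0]] M0 by (intro mod_homI) auto
  qed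
  moreover have "M \<in> modules R" using M sub by blast
  ultimately show ?thesis unfolding GF_def using LL by blast
qed

section \<open>Cutting a complex at its cycles\<close>

definition cycles :: "(int \<Rightarrow> ('r, 'a) module) \<Rightarrow> (int \<Rightarrow> 'a \<Rightarrow> 'a) \<Rightarrow> int \<Rightarrow> ('r, 'a) module" where
  "cycles L d n = (L n)\<lparr>carrier := a_kernel (L n) (L (n - 1)) (d n)\<rparr>"

text \<open>Cycles in any degree are in \<open>GF\<close> because the complex can be shifted. Their
  purity in \<open>L n\<close> is read off from tensor-exactness in degree n + 1, where the
  differential is a surjection onto these cycles followed by the inclusion.\<close>

lemma cycles_facts:
  assumes \<L>: "module_class R \<L>" and \<nu>: "\<nu> \<subseteq> modules (op_ring R)"
    and L: "\<And>n. L n \<in> \<L>" "exact_complex R L d" "\<And>A. A \<in> \<nu> \<Longrightarrow> tensor_exact R A L d"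
  shows "cycles L d n \<in> modules R" "short_exact R (cycles L d n) id (L n) (d n) (cycles L d (n - 1))"
    "pure_in R \<nu> id (cycles L d n) (L n)" "cycles L d n \<in> GF R \<L> \<nu>"
proof -
  have Lm: "L n \<in> modules R" for n using module_classD(1)[OF \<L> L(1)] .
  have d: "d n \<in> mod_hom R (L n) (L (n - 1))" for n using L(2) unfolding exact_complex_def by blast
  have im: "d (n + 1) ` carrier (L (n + 1)) = a_kernel (L n) (L (n - 1)) (d n)" for n
    using L(2) unfolding exact_complex_def by blast
  have Zm: "cycles L d n \<in> modules R" for n
    unfolding cycles_def by (rule submod_modules[OF Lm submod_kernel[OF modulesD(1)[OF Lm] modulesD(1)[OF Lm] d]])
  then show "cycles L d n \<in> modules R" .
  have c: "carrier (cycles L d n) = d (n + 1) ` carrier (L (n + 1))" for n unfolding cycles_def im by simp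
  have c': "carrier (cycles L d n) = {x \<in> carrier (L n). d n x = \<zero>\<^bsub>L (n - 1)\<^esub>}" for n
    unfolding cycles_def a_kernel_def' by simp
  have dZ: "d n \<in> mod_hom R (L n) (cycles L d (n - 1))" for n
  proof (rule mod_homI)
    show "d n x \<in> carrier (cycles L d (n - 1))" if "x \<in> carrier (L n)" for x
      using c[of "n - 1"] that by simp
  qed (simp_all add: cycles_def mod_homD[OF d])
  have z: "\<zero>\<^bsub>cycles L d n\<^esub> = \<zero>\<^bsub>L n\<^esub>" for n by (simp add: cycles_def)
  have id: "id \<in> mod_hom R (cycles L d n) (L n)" for n
    by (rule mod_homI) (auto simp: cycles_def a_kernel_def')
  show "short_exact R (cycles L d n) id (L n) (d n) (cycles L d (n - 1))"
    by (rule short_exactI[OF id dZ]) (use c[of "n - 1"] in \<open>auto simp: z c'\<close>)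
  show "pure_in R \<nu> id (cycles L d n) (L n)"
    unfolding pure_in_def
  proof
    fix A assume A: "A \<in> \<nu>"
    have Aa: "acted R A" using A \<nu> modules_acted(2) by blast
    note ac = modules_acted(1)[OF Lm] modules_acted(1)[OF Zm]
    have dZ': "d (n + 1) \<in> mod_hom R (L (n + 1)) (cycles L d n)" using dZ[of "n + 1"] by simp
    have "tensor_map R A (L (n + 1)) (d (n + 1 + 1)) ` carrier (tensor R A (L (n + 1 + 1))) =
        kernel (tensor R A (L (n + 1))) (tensor R A (L (n + 1 - 1))) (tensor_map R A (L (n + 1 - 1)) (d (n + 1)))"
      using L(3)[OF A] unfolding tensor_exact_def by blast
    then have te: "tensor_map R A (L (n + 1)) (d (n + 1 + 1)) ` carrier (tensor R A (L (n + 1 + 1))) =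
        kernel (tensor R A (L (n + 1))) (tensor R A (L n)) (tensor_map R A (L n) (d (n + 1)))"
      by simp
    have f: "d (n + 1 + 1) \<in> mod_hom R (L (n + 1 + 1)) (L (n + 1))" using d[of "n + 1 + 1"] by (simp only: add_diff_cancel_right')
    have ker: "d (n + 1 + 1) ` carrier (L (n + 1 + 1)) = {x \<in> carrier (L (n + 1)). d (n + 1) x = \<zero>\<^bsub>cycles L d n\<^esub>}"
      unfolding im z by (simp add: a_kernel_def')
    show "bal_ext R id (cycles L d n) (L n) A"
      by (rule tensor_exact_at_iff_bal_ext[OF Aa ac(1) ac(1) ac(1) ac(2) f dZ' id _ _ _ ker, THEN iffD1, OF _ _ _ te])
        (use c in auto)
  qed
  let ?L = "\<lambda>k. L (k + n)" and ?d = "\<lambda>k. d (k + n)"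
  have sh: "k - 1 + n = k + n - 1" "k + 1 + n = k + n + 1" for k by simp_all
  have "exact_complex R ?L ?d" unfolding exact_complex_def sh using d im by blast
  moreover have "tensor_exact R A ?L ?d" if "A \<in> \<nu>" for A
    using L(3)[OF that] unfolding tensor_exact_def sh by blast
  moreover have "isomorphic R (cycles L d n) ((?L 0)\<lparr>carrier := a_kernel (?L 0) (?L (- 1)) (?d 0)\<rparr>)"
  proof -
    have "(?L 0)\<lparr>carrier := a_kernel (?L 0) (?L (- 1)) (?d 0)\<rparr> = cycles L d n" by (simp add: cycles_def)
    then show ?thesis unfolding isomorphic_def by (intro bexI[of _ id]) (auto simp: mod_hom_id)
  qed
  ultimately show "cycles L d n \<in> GF R \<L> \<nu>"
    unfolding GF_def using Zm[of n] L(1)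
    by (intro CollectI conjI exI[of _ ?L] exI[of _ ?d]) auto
qed

text \<open>The converse of \<open>GF_glue\<close>: M is identified with the cycles in degree 0,
  which \<open>L 1\<close> covers and \<open>L 0\<close> contains.\<close>

lemma GF_cut:
  assumes \<L>: "module_class R \<L>" and \<nu>: "\<nu> \<subseteq> modules (op_ring R)" and M: "M \<in> GF R \<L> \<nu>"
  shows "\<exists>N\<in>GF R \<L> \<nu>. \<exists>L\<in>\<L>. \<exists>f g. short_exact R N f L g M \<and> pure_in R \<nu> f N L"
    and "\<exists>N\<in>GF R \<L> \<nu>. \<exists>L\<in>\<L>. \<exists>f g. short_exact R M f L g N \<and> pure_in R \<nu> f M L"
proof -
  obtain L d where Ld: "\<And>n. L n \<in> \<L>" "exact_complex R L d" "\<And>A. A \<in> \<nu> \<Longrightarrow> tensor_exact R A L d"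
    and iso: "isomorphic R M (cycles L d 0)" and Mm: "M \<in> modules R"
    using M unfolding GF_def by (auto simp: cycles_def)
  note C = cycles_facts[OF \<L> \<nu> Ld]
  obtain \<phi> where \<phi>: "\<phi> \<in> mod_hom R M (cycles L d 0)" "bij_betw \<phi> (carrier M) (carrier (cycles L d 0))"
    using iso unfolding isomorphic_def by blast
  obtain \<psi> where \<psi>: "\<psi> \<in> mod_hom R (cycles L d 0) M" and \<psi>\<phi>: "\<And>x. x \<in> carrier M \<Longrightarrow> \<psi> (\<phi> x) = x"
      and \<phi>\<psi>: "\<And>x. x \<in> carrier (cycles L d 0) \<Longrightarrow> \<phi> (\<psi> x) = x"
    by (rule inverse_mod_homE[OF modulesD(1)[OF Mm] modulesD(1)[OF C(1)] \<phi>]) (simp | blast)+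
  have z: "\<phi> \<zero>\<^bsub>M\<^esub> = \<zero>\<^bsub>cycles L d 0\<^esub>" "\<psi> \<zero>\<^bsub>cycles L d 0\<^esub> = \<zero>\<^bsub>M\<^esub>"
    using mod_hom_zero[OF \<phi>(1) modulesD(2)[OF Mm] modulesD(2)[OF C(1)]]
      mod_hom_zero[OF \<psi> modulesD(2)[OF C(1)] modulesD(2)[OF Mm]] by auto
  have "short_exact R (cycles L d 1) id (L 1) (d 1) (cycles L d 0)" using C(2)[of 1] by simp
  note E = short_exactD[OF this]
  have "short_exact R (cycles L d 1) id (L 1) (\<psi> \<circ> d 1) M"
  proof (rule short_exactI)
    fix y assume y: "y \<in> carrier (L 1)" "(\<psi> \<circ> d 1) y = \<zero>\<^bsub>M\<^esub>"
    then have "d 1 y = \<zero>\<^bsub>cycles L d 0\<^esub>" using \<phi>\<psi>[OF E(5)[OF y(1)]] z by simp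
    then show "\<exists>x\<in>carrier (cycles L d 1). y = id x" using E(7) y by blast
  next
    fix x assume x: "x \<in> carrier M"
    then obtain y where "y \<in> carrier (L 1)" "\<phi> x = d 1 y" using E(8)[OF mod_homD(1)[OF \<phi>(1) x]] by blast
    then show "\<exists>y\<in>carrier (L 1). x = (\<psi> \<circ> d 1) y"
      using \<psi>\<phi>[OF x] by (intro bexI[of _ y]) simp_all
  qed (use E(1,3,6) mod_hom_comp[OF E(2) \<psi>] z in auto)
  then show "\<exists>N\<in>GF R \<L> \<nu>. \<exists>L\<in>\<L>. \<exists>f g. short_exact R N f L g M \<and> pure_in R \<nu> f N L"
    using C(3,4)[of 1] Ld(1)[of 1] by blast
  note F = short_exactD[OF C(2)[of 0]]
  have ses: "short_exact R M \<phi> (L 0) (d 0) (cycles L d (0 - 1))"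
  proof (rule short_exactI)
    show "\<phi> \<in> mod_hom R M (L 0)" using mod_hom_comp[OF \<phi>(1) F(1)] by simp
    show "inj_on \<phi> (carrier M)" using \<phi>(2) by (rule bij_betw_imp_inj_on)
    fix y assume y: "y \<in> carrier (L 0)" "d 0 y = \<zero>\<^bsub>cycles L d (0 - 1)\<^esub>"
    then have "y \<in> carrier (cycles L d 0)" using F(7) by auto
    then show "\<exists>x\<in>carrier M. y = \<phi> x" using \<phi>\<psi> mod_homD(1)[OF \<psi>] by metis
  qed (use F(2,6,8) mod_homD(1)[OF \<phi>(1)] in auto)
  have "pure_in R \<nu> \<phi> M (L 0)"
    unfolding pure_in_def
  proof
    fix A assume "A \<in> \<nu>"
    then have "bal_ext R id (cycles L d 0) (L 0) A" using C(3) unfolding pure_in_def by blast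
    moreover have "bal_ext R id M M A" unfolding bal_ext_def by auto
    then have "bal_ext R \<phi> M (cycles L d 0) A"
      by (rule bal_ext_factor[OF _ \<psi>]) (simp add: \<psi>\<phi>)
    ultimately show "bal_ext R \<phi> M (L 0) A" using bal_ext_comp[OF _ _ \<phi>(1), of A id "L 0"] by simp
  qed
  then show "\<exists>N\<in>GF R \<L> \<nu>. \<exists>L\<in>\<L>. \<exists>f g. short_exact R M f L g N \<and> pure_in R \<nu> f M L"
    using ses C(4) Ld(1) by blast
qed

section \<open>Approximations of modules of finite Gorenstein dimension\<close>

locale gorenstein_classes =
  fixes R :: "'u ring" and \<L> \<A> \<nu> :: "('u, 'u) module set"
  assumes U: "universe TYPE('u)" and ring: "ring R" and small: "small (carrier R)"
    and class_L: "module_class R \<L>" and class_A: "module_class (op_ring R) \<A>"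
    and \<nu>: "\<nu> = left_perp (op_ring R) \<A> \<inter> \<A>"
    and gen_L: "relative_generator R \<L>" and ext_L: "closed_extensions R \<L>"
    and ext_GF: "closed_extensions R (GF R \<L> \<nu>)"
begin

abbreviation "\<G> \<equiv> GF R \<L> \<nu>"
abbreviation "pure \<equiv> pure_in R \<nu>"

lemma \<nu>_modules: "\<nu> \<subseteq> modules (op_ring R)"
  unfolding \<nu> left_perp_def by auto

lemma L_modules: "L \<in> \<L> \<Longrightarrow> L \<in> modules R"
  by (rule module_classD(1)[OF class_L])

lemma G_modules: "G \<in> \<G> \<Longrightarrow> G \<in> modules R"
  using GF_subset_modules by blast

lemmas class_G = module_class_GF[of R \<L> \<nu>]

lemma cut_left:
  assumes "M \<in> \<G>"
  obtains N L f g where "N \<in> \<G>" "L \<in> \<L>" "short_exact R N f L g M" "pure f N L"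
  using GF_cut(1)[OF class_L \<nu>_modules assms] by blast

lemma cut_right:
  assumes "M \<in> \<G>"
  obtains N L f g where "N \<in> \<G>" "L \<in> \<L>" "short_exact R M f L g N" "pure f M L"
  using GF_cut(2)[OF class_L \<nu>_modules assms] by blast

text \<open>The complex \<open>0 \<rightarrow> L \<rightarrow> L \<rightarrow> 0\<close> is not available, since \<open>\<L>\<close> need not contain the zero module.\<close>

lemma split_pure:
  assumes "L \<in> \<L>"
  shows "\<exists>N\<in>\<L>. \<exists>f g. short_exact R L f N g L \<and> pure f L N"
proof -
  note Lm = L_modules[OF assms]
  obtain Q i p r where Q: "Q \<in> modules R" "short_exact R L i Q p L" "r \<in> mod_hom R Q L"
      "\<And>x. x \<in> carrier L \<Longrightarrow> r (i x) = x"
    by (rule dirsum_copy_exists[OF U Lm Lm]) blast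
  have "Q \<in> \<L>" by (rule closed_extensionsD[OF ext_L Q(2) assms assms Q(1)])
  moreover have "pure i L Q"
    unfolding pure_in_def
  proof
    fix A
    have "bal_ext R id L L A" unfolding bal_ext_def by auto
    then show "bal_ext R i L Q A" by (rule bal_ext_factor[OF _ Q(3)]) (simp add: Q(4))
  qed
  ultimately show ?thesis using Q(2) by blast
qed

text \<open>\<open>\<L>\<close> itself is an invariant for gluing on both sides, the cuts being the
  split sequences.\<close>

lemma L_subset_G: "\<L> \<subseteq> \<G>"
proof
  fix M assume M: "M \<in> \<L>"
  have sub: "\<L> \<subseteq> modules R" using L_modules by blast
  have left: "\<exists>N\<in>\<L>. \<exists>X\<in>\<L>. \<exists>f g. short_exact R N f X g L \<and> pure f N X" if "L \<in> \<L>" for L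
    using split_pure[OF that] that by blast
  have right: "\<exists>N\<in>\<L>. \<exists>X\<in>\<L>. \<exists>f g. short_exact R L f X g N \<and> pure f L X" if "L \<in> \<L>" for L
    using split_pure[OF that] that by blast
  show "M \<in> \<G>"
    by (rule GF_glue[OF class_L \<nu>_modules sub sub left right M M])
qed

lemma gen_G: "relative_generator R \<G>"
  using gen_L L_subset_G unfolding relative_generator_def by blast

text \<open>Applied to a syzygy inside the induction of \<open>special_precover\<close>, and to M
  itself afterwards. Purity holds because m is the pushout of the pure embedding j along g.\<close>

lemma approximation_step:
  assumes M: "M \<in> modules R" and K: "K \<in> modules R" "G \<in> \<G>" "short_exact R K f G g M" "resolved R \<L> n K"
  obtains L j r Q m s H where "L \<in> \<L>" "Q \<in> modules R" "H \<in> \<G>" "short_exact R K (j \<circ> f) L r Q"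
    "short_exact R M m Q s H" "pure m M Q" "resolved R \<L> (Suc n) Q"
proof -
  obtain H L j q where H: "H \<in> \<G>" "L \<in> \<L>" "short_exact R G j L q H" "pure j G L"
    by (rule cut_right[OF K(2)])
  note Gm = G_modules[OF K(2)] and Lm = L_modules[OF H(2)] and Hm = G_modules[OF H(1)]
  obtain Q r m s where Q: "Q \<in> modules R" "short_exact R K (j \<circ> f) L r Q" "short_exact R M m Q s H"
      "\<And>x. x \<in> carrier G \<Longrightarrow> m (g x) = r (j x)"
    by (rule cokernel_comp_exists[OF K(1) Gm M Lm Hm K(3) H(3)]) blast
  have "pure m M Q"
    unfolding pure_in_def
  proof
    fix A assume A: "A \<in> \<nu>"
    then have a: "acted R A" using modules_acted(2) \<nu>_modules by blast
    have j: "bal_ext R j G L A" using H(4) A unfolding pure_in_def by blast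
    show "bal_ext R m M Q A"
      by (rule bal_ext_pushout[OF modules_acted(1)[OF Gm] modules_acted(1)[OF M] modules_acted(1)[OF Lm]
            modules_acted(1)[OF Q(1)] a short_exactD(1)[OF H(3)] K(3) Q(2) j Q(4)])
  qed
  moreover have "resolved R \<L> (Suc n) Q" using K(1,4) H(2) Q(2) by auto
  ultimately show ?thesis using that H(1,2) Q(1-3) by blast
qed

text \<open>The sequence for M is pushed out along an embedding of its syzygy N into a module Q of
  bounded \<open>\<L>\<close>-length with cokernel in \<open>\<G>\<close>. The new middle term is an
  extension of that cokernel by G, hence in \<open>\<G>\<close>, and the kernel over M is now Q. For
  n = 0 a right cut of N supplies an object of \<open>\<L>\<close> as Q.\<close>

lemma special_precover:
  assumes "M \<in> modules R" "resolved R \<G> (Suc n) M"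
  obtains K G f g where "K \<in> modules R" "G \<in> \<G>" "short_exact R K f G g M" "resolved R \<L> n K"
proof -
  have "\<exists>K\<in>modules R. \<exists>G\<in>\<G>. \<exists>f g. short_exact R K f G g M \<and> resolved R \<L> n K"
    using assms
  proof (induction n arbitrary: M)
    case 0
    then obtain N G f g where N: "N \<in> modules R" "G \<in> \<G>" "short_exact R N f G g M" "N \<in> \<G>" by auto
    obtain H L j q where H: "H \<in> \<G>" "L \<in> \<L>" "short_exact R N j L q H" by (rule cut_right[OF N(4)])
    obtain P i i' p p' where P: "P \<in> modules R" "short_exact R L i P p M" "short_exact R G i' P p' H"
      by (rule pushout_exists[OF U N(1) G_modules[OF N(2)] 0(1) L_modules[OF H(2)] G_modules[OF H(1)] N(3) H(3)])
    have "P \<in> \<G>" by (rule closed_extensionsD[OF ext_GF P(3) N(2) H(1) P(1)])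
    then show ?case using P(2) H(2) L_modules by auto
  next
    case (Suc n)
    then obtain N G f g where N: "N \<in> modules R" "G \<in> \<G>" "short_exact R N f G g M" "resolved R \<G> (Suc n) N"
      by (subst (asm) (2) resolved.simps) blast
    obtain K0 G0 f0 g0 where K0: "K0 \<in> modules R" "G0 \<in> \<G>" "short_exact R K0 f0 G0 g0 N" "resolved R \<L> n K0"
      using Suc.IH[OF N(1,4)] by blast
    obtain L j r Q m s H where Q: "L \<in> \<L>" "Q \<in> modules R" "H \<in> \<G>" "short_exact R K0 (j \<circ> f0) L r Q"
      "short_exact R N m Q s H" "pure m N Q" "resolved R \<L> (Suc n) Q"
      by (rule approximation_step[OF N(1) K0])
    obtain P i i' p p' where P: "P \<in> modules R" "short_exact R Q i P p M" "short_exact R G i' P p' H"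
      by (rule pushout_exists[OF U N(1) G_modules[OF N(2)] Suc.prems(1) Q(2) G_modules[OF Q(3)] N(3) Q(5)])
    have "P \<in> \<G>" by (rule closed_extensionsD[OF ext_GF P(3) N(2) Q(3) P(1)])
    then show ?case using P(2) Q(2,7) by blast
  qed
  then show ?thesis using that by blast
qed

subsection \<open>The case of a class closed under epikernels\<close>

text \<open>The right cut of M is given; a left cut has to be found. Pull
  \<open>Q \<rightarrow> H\<close> back along a cover L1 of H: the result P is an extension of Q by
  H1, hence in \<open>\<G>\<close>, and M is the kernel of \<open>P \<rightarrow> L1\<close>. In a
  left cut of P with middle term L', the kernel W of \<open>L' \<rightarrow> L1\<close> is in
  \<open>\<L>\<close> and covers M with kernel P1, which is pure in W since it is pure in the larger
  L'.\<close>

lemma pure_submodule_in_G: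
  assumes epi: "closed_epikernels R \<L>"
    and M: "M \<in> modules R" "Q \<in> \<L>" "H \<in> \<G>" "short_exact R M m Q s H" "pure m M Q"
  shows "M \<in> \<G>"
proof -
  note Qm = L_modules[OF M(2)] and Hm = G_modules[OF M(3)]
  obtain H1 L1 f1 g1 where H1: "H1 \<in> \<G>" "L1 \<in> \<L>" "short_exact R H1 f1 L1 g1 H"
    by (rule cut_left[OF M(3)])
  obtain P i i' p p' where P: "P \<in> modules R" "short_exact R M i P p' L1" "short_exact R H1 i' P p Q"
    by (rule pullback_exists[OF U M(1) Qm G_modules[OF H1(1)] L_modules[OF H1(2)] Hm M(4) H1(3)]) blast
  have "P \<in> \<G>" by (rule closed_extensionsD[OF ext_GF P(3) H1(1) _ P(1)]) (use M(2) L_subset_G in blast)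
  then obtain P1 L' f' g' where P1: "P1 \<in> \<G>" "L' \<in> \<L>" "short_exact R P1 f' L' g' P" "pure f' P1 L'"
    by (rule cut_left)
  obtain W n v where W: "W \<in> modules R" "short_exact R W id L' (p' \<circ> g') L1" "short_exact R P1 n W v M"
    "\<And>x. x \<in> carrier P1 \<Longrightarrow> n x = f' x"
    by (rule kernel_comp_exists[OF G_modules[OF P1(1)] L_modules[OF P1(2)] P(1) M(1) L_modules[OF H1(2)] P1(3) P(2)])
      blast
  have WL: "W \<in> \<L>" by (rule closed_epikernelsD[OF epi W(2) P1(2) H1(2) W(1)])
  have "pure n P1 W"
    unfolding pure_in_def
  proof
    fix A assume "A \<in> \<nu>"
    then have "bal_ext R f' P1 L' A" using P1(4) unfolding pure_in_def by blast
    then show "bal_ext R n P1 W A"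
      by (rule bal_ext_factor[OF _ short_exactD(1)[OF W(2)]]) (simp add: W(4))
  qed
  \<comment> \<open>The other end of both cuts of M lies in \<open>\<G>\<close>, so adding the
    single module M already gives an invariant for gluing.\<close>
  then have left: "\<exists>N\<in>insert M \<G>. \<exists>L\<in>\<L>. \<exists>f g. short_exact R N f L g M \<and> pure f N L"
    using P1(1) WL W(3) by blast
  have right: "\<exists>N\<in>insert M \<G>. \<exists>L\<in>\<L>. \<exists>f g. short_exact R M f L g N \<and> pure f M L"
    using M by blast
  have sub: "insert M \<G> \<subseteq> modules R" using M(1) G_modules by blast
  show ?thesis
  proof (rule GF_glue[OF class_L \<nu>_modules sub sub])
    fix X assume "X \<in> insert M \<G>"
    then show "\<exists>N\<in>insert M \<G>. \<exists>L\<in>\<L>. \<exists>f g. short_exact R N f L g X \<and> pure f N L"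
      using left GF_cut(1)[OF class_L \<nu>_modules, of X] by blast
  next
    fix X assume "X \<in> insert M \<G>"
    then show "\<exists>N\<in>insert M \<G>. \<exists>L\<in>\<L>. \<exists>f g. short_exact R X f L g N \<and> pure f X L"
      using right GF_cut(2)[OF class_L \<nu>_modules, of X] by blast
  qed simp_all
qed

lemma approximation_epikernels:
  assumes epi: "closed_epikernels R \<L>" and M: "M \<in> modules R" "resolved R \<G> (Suc n) M"
  shows "\<exists>Q\<in>modules R. (\<exists>m. resolved R \<L> m Q) \<and> (\<forall>k. resolved R \<L> k Q \<longrightarrow> resolved R \<G> k M)"
proof -
  obtain K G f g where K: "K \<in> modules R" "G \<in> \<G>" "short_exact R K f G g M" "resolved R \<L> n K"
    by (rule special_precover[OF M])
  obtain L j r Q m s H where Q: "L \<in> \<L>" "Q \<in> modules R" "H \<in> \<G>" "short_exact R K (j \<circ> f) L r Q"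
    "short_exact R M m Q s H" "pure m M Q" "resolved R \<L> (Suc n) Q"
    by (rule approximation_step[OF M(1) K])
  have "resolved R \<G> k M" if k: "resolved R \<L> k Q" for k
  proof (cases k)
    case 0
    then have "Q \<in> \<L>" using k by simp
    then have "M \<in> \<G>" by (rule pure_submodule_in_G[OF epi M(1) _ Q(3,5,6)])
    then show ?thesis using 0 by simp
  next
    case (Suc i)
    \<comment> \<open>K is a syzygy of Q over an object of \<open>\<L>\<close>, and the length of a
      syzygy does not depend on the chosen cover.\<close>
    have "resolved R \<L> i K"
      by (rule resolved_syzygy[OF U class_L ext_L epi gen_L K(1) Q(1,2,4)]) (use k Suc in simp)
    then have "resolved R \<G> i K" using L_subset_G by (rule resolved_mono)
    then show ?thesis using Suc K(1-3) by auto
  qed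
  then show ?thesis using Q(2,7) by blast
qed

subsection \<open>The case of a class with characters in \<open>\<A>\<close>\<close>

definition char_in :: "('u, 'u) module \<Rightarrow> bool" where
  "char_in M \<longleftrightarrow> belongs (op_ring R) (char_module R M) \<A>"

text \<open>Ext^1(X, B) = 0 in the form used below, with an arbitrary Y in place of a
  projective.\<close>

lemma perp_hom_ext:
  assumes "X \<in> left_perp (op_ring R) \<A>" "B \<in> \<A>" "V \<in> modules (op_ring R)" "Y \<in> modules (op_ring R)"
    and "short_exact (op_ring R) V u Y v X"
  shows "hom_ext (op_ring R) u V Y B"
proof -
  have Xm: "X \<in> modules (op_ring R)" using assms(1) unfolding left_perp_def by auto
  have sR: "small (carrier (op_ring R))" using small by simp
  obtain A P \<iota> \<pi> where C: "proj_chain (op_ring R) A P \<iota> \<pi>" "A 0 = X"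
    by (rule proj_chain_exists[OF U ring_op_ring[OF ring] sR Xm])
  note D = proj_chainD[OF C(1)]
  have Bm: "B \<in> modules (op_ring R)" by (rule module_classD(1)[OF class_A assms(2)])
  have "ext_zero (op_ring R) (Suc 0) (A 0) B" using assms(1,2) C(2) unfolding left_perp_def by simp
  then have h: "hom_ext (op_ring R) (\<iota> 0) (A (Suc 0)) (P 0) B" by (rule ext_zero_proj_chain[OF C(1) _ Bm])
  have "short_exact (op_ring R) (A (Suc 0)) (\<iota> 0) (P 0) (\<pi> 0) X" using D(4)[of 0] unfolding C(2) .
  then show ?thesis by (rule hom_ext_presentation[OF D(2) D(1) Xm assms(3,4) Bm _ assms(5) h])
qed

text \<open>By adjunction, Tor_1(X, M) = 0 follows from Ext^1(X, \<open>M^+\<close>) = 0.\<close>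

lemma perp_bal_ext:
  assumes "X \<in> left_perp (op_ring R) \<A>" "M \<in> modules R" "char_in M" "V \<in> modules (op_ring R)" "Y \<in> modules (op_ring R)"
    and "short_exact R V u Y v X"
  shows "bal_ext R u V Y M"
proof -
  obtain B where B: "B \<in> \<A>" "isomorphic R (char_module R M) B"
    using assms(3) unfolding char_in_def belongs_def by auto
  have "hom_ext R u V Y B" using perp_hom_ext[OF assms(1) B(1) assms(4,5)] assms(6) by simp
  then show ?thesis
    using hom_ext_char_iff[OF modulesD(1)[OF assms(2)] modulesD(1)[OF module_classD(1)[OF class_A B(1)]] B(2)
        short_exactD(1)[OF assms(6)]] by blast
qed

text \<open>\<open>Tor\<^sub>i(A, M) = 0\<close> for all \<open>A \<in> \<nu>\<close> and \<open>i \<ge> 1\<close>.\<close>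

definition tor_acyclic :: "('u, 'u) module \<Rightarrow> bool" where
  "tor_acyclic M \<longleftrightarrow> (\<forall>A P \<iota> \<pi>. proj_chain (op_ring R) A P \<iota> \<pi> \<and> A 0 \<in> \<nu> \<longrightarrow>
     (\<forall>i. bal_ext R (\<iota> i) (A (Suc i)) (P i) M))"

lemma tor_acyclicD:
  "tor_acyclic M \<Longrightarrow> proj_chain (op_ring R) A P \<iota> \<pi> \<Longrightarrow> A 0 \<in> \<nu> \<Longrightarrow> bal_ext R (\<iota> i) (A (Suc i)) (P i) M"
  unfolding tor_acyclic_def by blast

lemma proj_chain_acted:
  assumes "proj_chain (op_ring R) A P \<iota> \<pi>"
  shows "acted R (A i)" "acted R (P i)" "short_exact R (A (Suc i)) (\<iota> i) (P i) (\<pi> i) (A i)"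
  using proj_chainD[OF assms, of i] modules_acted(2) by simp_all

text \<open>The character group of Tor_i(A, M) is Ext^i(A, \<open>M^+\<close>), and
  \<open>A \<in> \<nu>\<close> is orthogonal to \<open>\<A>\<close> in all positive degrees.\<close>

lemma tor_acyclic_char_in:
  assumes "M \<in> modules R" "char_in M"
  shows "tor_acyclic M"
  unfolding tor_acyclic_def
proof (intro allI impI)
  fix A P \<iota> \<pi> i assume "proj_chain (op_ring R) A P \<iota> \<pi> \<and> A 0 \<in> \<nu>"
  then have C: "proj_chain (op_ring R) A P \<iota> \<pi>" "A 0 \<in> left_perp (op_ring R) \<A>" unfolding \<nu> by auto
  note D = proj_chainD[OF C(1)]
  obtain B where B: "B \<in> \<A>" "isomorphic R (char_module R M) B"
    using assms(2) unfolding char_in_def belongs_def by auto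
  have Bm: "B \<in> modules (op_ring R)" by (rule module_classD(1)[OF class_A B(1)])
  have "ext_zero (op_ring R) (Suc i) (A 0) B" using C(2) B(1) unfolding left_perp_def by simp
  from ext_zero_proj_chain[OF C(1) this Bm] have "hom_ext R (\<iota> i) (A (Suc i)) (P i) B" by simp
  then show "bal_ext R (\<iota> i) (A (Suc i)) (P i) M"
    using hom_ext_char_iff[OF modulesD(1)[OF assms(1)] modulesD(1)[OF Bm] B(2)
        short_exactD(1)[OF proj_chain_acted(3)[OF C(1)]]] by blast
qed

lemma projective_bal_ext':
  assumes "proj_chain (op_ring R) A P \<iota> \<pi>" "M' \<in> modules R" "M \<in> modules R" "short_exact R M' f M g M''"
  shows "bal_ext R f M' M (P i)"
  by (rule projective_bal_ext[OF U proj_chainD(2)[OF assms(1)] assms(2,3) short_exactD(1,3)[OF assms(4)]])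

text \<open>Tor_1 of M'' against the syzygy \<open>A i\<close> vanishes, being Tor_{i+1} against
  \<open>A 0\<close>. Having this for all syzygies, not only for \<open>A 0\<close>, is what lets
  acyclicity pass to M'.\<close>

lemma tor_acyclic_bal_ext:
  assumes mods: "M' \<in> modules R" "M \<in> modules R" "M'' \<in> modules R" and ex: "short_exact R M' f M g M''"
    and ac: "tor_acyclic M''" and C: "proj_chain (op_ring R) A P \<iota> \<pi>" "A 0 \<in> \<nu>"
  shows "bal_ext R f M' M (A i)"
  by (rule bal_ext_connect[OF proj_chain_acted(1,2,1)[OF C(1)] modules_acted(1)[OF mods(1)] modules_acted(1)[OF mods(2)]
        modules_acted(1)[OF mods(3)] proj_chain_acted(3)[OF C(1)] ex tor_acyclicD[OF ac C] projective_bal_ext'[OF C(1) mods(1,2) ex]])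

lemma tor_acyclic_pure:
  assumes mods: "M' \<in> modules R" "M \<in> modules R" "M'' \<in> modules R" and ex: "short_exact R M' f M g M''"
    and ac: "tor_acyclic M''"
  shows "pure f M' M"
  unfolding pure_in_def
proof
  fix A assume A: "A \<in> \<nu>"
  have sR: "small (carrier (op_ring R))" using small by simp
  obtain As P \<iota> \<pi> where C: "proj_chain (op_ring R) As P \<iota> \<pi>" "As 0 = A"
    by (rule proj_chain_exists[OF U ring_op_ring[OF ring] sR]) (use A \<nu>_modules in blast)+
  show "bal_ext R f M' M A" using tor_acyclic_bal_ext[OF mods ex ac C(1), of 0] C(2) A by simp
qed

text \<open>The long exact sequence places Tor_i(A, M') between Tor_{i+1}(A, M'') and Tor_i(A,
  M).\<close>

lemma tor_acyclic_kernel: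
  assumes mods: "M' \<in> modules R" "M \<in> modules R" "M'' \<in> modules R" and ex: "short_exact R M' f M g M''"
    and ac: "tor_acyclic M" "tor_acyclic M''"
  shows "tor_acyclic M'"
  unfolding tor_acyclic_def
proof (intro allI impI)
  fix A P \<iota> \<pi> i assume "proj_chain (op_ring R) A P \<iota> \<pi> \<and> A 0 \<in> \<nu>"
  then have C: "proj_chain (op_ring R) A P \<iota> \<pi>" "A 0 \<in> \<nu>" by auto
  show "bal_ext R (\<iota> i) (A (Suc i)) (P i) M'"
    by (rule bal_ext_restrict[OF short_exactD(1)[OF ex] tor_acyclic_bal_ext[OF mods ex ac(2) C]
          tor_acyclicD[OF ac(1) C] short_exactD(1)[OF proj_chain_acted(3)[OF C(1)]]])
qed

context
  assumes char_L: "\<forall>L\<in>\<L>. belongs (op_ring R) (char_module R L) \<A>"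
begin

lemma tor_acyclic_L: "L \<in> \<L> \<Longrightarrow> tor_acyclic L"
  using tor_acyclic_char_in[OF L_modules] char_L unfolding char_in_def by blast

text \<open>Induction on the degree, for all members of \<open>\<G>\<close> at once. A left cut
  \<open>N \<rightarrow> L \<rightarrow> M\<close> with L acyclic reduces the claim to injectivity
  of \<open>A i \<otimes> N \<rightarrow> A i \<otimes> L\<close>. For i = 0 this is the purity of
  the cut; beyond, it follows from the induction hypothesis for N, which is again in
  \<open>\<G>\<close>.\<close>

lemma tor_acyclic_G:
  assumes "M \<in> \<G>"
  shows "tor_acyclic M"
  unfolding tor_acyclic_def
proof (intro allI impI)
  fix A P \<iota> \<pi> i assume "proj_chain (op_ring R) A P \<iota> \<pi> \<and> A 0 \<in> \<nu>"
  then have C: "proj_chain (op_ring R) A P \<iota> \<pi>" "A 0 \<in> \<nu>" by auto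
  note a = proj_chain_acted[OF C(1)]
  show "bal_ext R (\<iota> i) (A (Suc i)) (P i) M"
    using assms
  proof (induction i arbitrary: M)
    case 0
    then obtain N L f g where N: "N \<in> \<G>" "L \<in> \<L>" "short_exact R N f L g M" "pure f N L"
      by (rule cut_left)
    have "bal_ext R f N L (A 0)" using N(4) C(2) unfolding pure_in_def by blast
    then show ?case
      by (rule bal_ext_cokernel[OF a(1,2,1) modules_acted(1)[OF G_modules[OF N(1)]] modules_acted(1)[OF L_modules[OF N(2)]]
            modules_acted(1)[OF G_modules[OF 0]] a(3) N(3) _ tor_acyclicD[OF tor_acyclic_L[OF N(2)] C]])
  next
    case (Suc i)
    from Suc.prems obtain N L f g where N: "N \<in> \<G>" "L \<in> \<L>" "short_exact R N f L g M" "pure f N L"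
      by (rule cut_left)
    note E = short_exactD[OF N(3)]
    \<comment> \<open>Here \<open>bal_ext_restrict\<close> is used with its sides exchanged: the
      syzygy embeds in \<open>P i\<close> after tensoring with N, and f stays injective over the
      flat module \<open>P i\<close>.\<close>
    have "bal_ext R f N L (A (Suc i))"
      by (rule bal_ext_restrict[OF short_exactD(1)[OF a(3)] Suc.IH[OF N(1)]
            projective_bal_ext'[OF C(1) G_modules[OF N(1)] L_modules[OF N(2)] N(3)] E(1)])
    then show ?case
      by (rule bal_ext_cokernel[OF a(1,2,1) modules_acted(1)[OF G_modules[OF N(1)]] modules_acted(1)[OF L_modules[OF N(2)]]
            modules_acted(1)[OF G_modules[OF Suc.prems]] a(3) N(3) _ tor_acyclicD[OF tor_acyclic_L[OF N(2)] C]])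
  qed
qed

text \<open>On the right, M embeds into the object L of a right cut of B. The cokernel Q is an
  extension of H by C, so it is in \<open>\<G>\<close> and acyclic, which makes the embedding pure.
  On the left every cover by \<open>\<L>\<close> works: its kernel is acyclic again and
  pure.\<close>

lemma epikernels_G: "closed_epikernels R \<G>"
  unfolding closed_epikernels_def
proof (intro ballI allI impI)
  fix B C M f g assume BC: "B \<in> \<G>" "C \<in> \<G>" and M: "M \<in> modules R" and ex: "short_exact R M f B g C"
  note Bm = G_modules[OF BC(1)] and Cm = G_modules[OF BC(2)]
  have acM: "tor_acyclic M" by (rule tor_acyclic_kernel[OF M Bm Cm ex tor_acyclic_G[OF BC(1)] tor_acyclic_G[OF BC(2)]])
  obtain H L j q where H: "H \<in> \<G>" "L \<in> \<L>" "short_exact R B j L q H" by (rule cut_right[OF BC(1)])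
  obtain Q r m s where Q: "Q \<in> modules R" "short_exact R M (j \<circ> f) L r Q" "short_exact R C m Q s H"
    by (rule cokernel_comp_exists[OF M Bm Cm L_modules[OF H(2)] G_modules[OF H(1)] ex H(3)])
  have QG: "Q \<in> \<G>" by (rule closed_extensionsD[OF ext_GF Q(3) BC(2) H(1) Q(1)])
  have pM: "pure (j \<circ> f) M L"
    by (rule tor_acyclic_pure[OF M L_modules[OF H(2)] Q(1,2) tor_acyclic_G[OF QG]])
  \<comment> \<open>Kernels of covers are not known to be in \<open>\<G>\<close>, so the left
    invariant is the larger class of acyclic modules.\<close>
  let ?l = "{N \<in> modules R. tor_acyclic N}"
  show "M \<in> \<G>"
  proof (rule GF_glue[OF class_L \<nu>_modules, of ?l "insert M \<G>"])
    fix N assume N: "N \<in> ?l"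
    obtain X K g where X: "X \<in> \<L>" "K \<in> modules R" "short_exact R K id X g N"
      by (rule relative_generatorE[OF gen_L class_L]) (use N in blast)+
    have N': "N \<in> modules R" "tor_acyclic N" using N by auto
    have "K \<in> ?l"
      using X(2) tor_acyclic_kernel[OF X(2) L_modules[OF X(1)] N'(1) X(3) tor_acyclic_L[OF X(1)] N'(2)] by simp
    moreover have "pure id K X" by (rule tor_acyclic_pure[OF X(2) L_modules[OF X(1)] N'(1) X(3) N'(2)])
    ultimately show "\<exists>K\<in>?l. \<exists>L\<in>\<L>. \<exists>f g. short_exact R K f L g N \<and> pure f K L" using X by blast
  next
    fix N assume "N \<in> insert M \<G>"
    then show "\<exists>K\<in>insert M \<G>. \<exists>L\<in>\<L>. \<exists>f g. short_exact R N f L g K \<and> pure f N L"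
      using GF_cut(2)[OF class_L \<nu>_modules, of N] QG Q(2) pM H(2) by blast
  qed (use M acM G_modules in auto)
qed

lemma approximation_char:
  assumes M: "M \<in> modules R" "resolved R \<G> (Suc n) M"
  shows "\<exists>Q\<in>modules R. (\<exists>m. resolved R \<L> m Q) \<and> (\<forall>k. resolved R \<L> k Q \<longrightarrow> resolved R \<G> k M)"
proof -
  obtain K G f g where K: "K \<in> modules R" "G \<in> \<G>" "short_exact R K f G g M" "resolved R \<L> n K"
    by (rule special_precover[OF M])
  obtain L j r Q m s H where Q: "L \<in> \<L>" "Q \<in> modules R" "H \<in> \<G>" "short_exact R K (j \<circ> f) L r Q"
    "short_exact R M m Q s H" "pure m M Q" "resolved R \<L> (Suc n) Q"
    by (rule approximation_step[OF M(1) K])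
  have "resolved R \<G> k M" if "resolved R \<L> k Q" for k
    by (rule resolved_epikernel[OF class_G epikernels_G Q(3) M(1) Q(2,5) resolved_mono[OF that L_subset_G]])
  then show ?thesis using Q(2,7) by blast
qed

subsection \<open>Bicomplete duality pairs\<close>

text \<open>By the cotorsion pair, \<open>M^+\<close> is in \<open>\<A>\<close> once Ext^1(X,
  \<open>M^+\<close>) = 0 for every X orthogonal to \<open>\<A>\<close>, whereas acyclicity of M
  tests only against \<open>\<nu>\<close>. Completeness of the pair closes the gap by embedding X in
  a module Y of \<open>\<nu>\<close>.\<close>

lemma cokernel_in_L:
  assumes dual: "\<And>M. M \<in> modules R \<Longrightarrow> char_in M \<Longrightarrow> M \<in> \<L>"
    and pair: "cotorsion_pair (op_ring R) (left_perp (op_ring R) \<A>) \<A>"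
      "complete_pair (op_ring R) (left_perp (op_ring R) \<A>) \<A>"
    and L: "L1 \<in> \<L>" "L0 \<in> \<L>" "M \<in> modules R" "short_exact R L1 f L0 g M" "tor_acyclic M"
  shows "M \<in> \<L>"
proof (rule dual[OF L(3)])
  let ?perp = "left_perp (op_ring R) \<A>"
  note Lm = L_modules[OF L(1)] L_modules[OF L(2)]
  have cL: "char_in L" if "L \<in> \<L>" for L using char_L that unfolding char_in_def by blast
  obtain B where B: "B \<in> modules (op_ring R)" "isomorphic R (char_module R M) B"
    by (rule char_copy_exists[OF U L(3)])
  have "ext_zero (op_ring R) 1 X B" if X: "X \<in> ?perp" for X
  proof -
    have Xm: "X \<in> modules (op_ring R)" using X unfolding left_perp_def by auto
    show ?thesis
    proof (rule ext_zero_oneI[OF Xm B(1)])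
      fix K P \<pi> assume P: "projective (op_ring R) P" and K: "K \<in> modules (op_ring R)"
        and exK: "short_exact (op_ring R) K id P \<pi> X"
      have Pm: "P \<in> modules (op_ring R)" using P unfolding projective_def by simp
      have exK': "short_exact R K id P \<pi> X" using exK by simp
      obtain X' Y a b where Y: "X' \<in> ?perp" "Y \<in> \<A>" "short_exact R X a Y b X'"
        using pair(2) Xm unfolding complete_pair_def by auto
      have Ym: "Y \<in> modules (op_ring R)" by (rule module_classD(1)[OF class_A Y(2)])
      have X'm: "X' \<in> modules (op_ring R)" using Y(1) unfolding left_perp_def by auto
      \<comment> \<open>Y is an extension of X' by X, both orthogonal to \<open>\<A>\<close>. Degree
        one suffices here, because the cotorsion pair identifies the class so described with
        \<open>left_perp\<close>.\<close>
      have "Y \<in> {N \<in> modules (op_ring R). \<forall>A\<in>\<A>. ext_zero (op_ring R) 1 N A}"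
      proof (intro CollectI conjI ballI Ym)
        fix A assume A: "A \<in> \<A>"
        show "ext_zero (op_ring R) 1 Y A"
        proof (rule ext_zero_oneI[OF Ym module_classD(1)[OF class_A A]])
          fix K' P' \<pi>' assume P': "projective (op_ring R) P'" and K': "K' \<in> modules (op_ring R)"
            and exY: "short_exact (op_ring R) K' id P' \<pi>' Y"
          have P'm: "P' \<in> modules (op_ring R)" using P' unfolding projective_def by simp
          have exX: "short_exact (op_ring R) X a Y b X'" using Y(3) by simp
          obtain W n v where W: "W \<in> modules (op_ring R)" "short_exact (op_ring R) W id P' (b \<circ> \<pi>') X'"
            "short_exact (op_ring R) K' n W v X" "\<And>x. x \<in> carrier K' \<Longrightarrow> n x = id x"
            by (rule kernel_comp_exists[OF K' P'm Ym Xm X'm exY exX]) blast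
          \<comment> \<open>W is the preimage of X in P'. A map on K' is extended in two steps,
            through the quotients X of W by K' and X' of P' by W.\<close>
          have h1: "hom_ext (op_ring R) n K' W A" by (rule perp_hom_ext[OF X A K' W(1,3)])
          have h2: "hom_ext (op_ring R) id W P' A" by (rule perp_hom_ext[OF Y(1) A W(1) P'm W(2)])
          show "hom_ext (op_ring R) id K' P' A"
            unfolding hom_ext_def
          proof
            fix h assume "h \<in> mod_hom (op_ring R) K' A"
            then obtain k where k: "k \<in> mod_hom (op_ring R) W A" "\<And>x. x \<in> carrier K' \<Longrightarrow> k (n x) = h x"
              using h1 unfolding hom_ext_def by blast
            then obtain l where l: "l \<in> mod_hom (op_ring R) P' A" "\<And>x. x \<in> carrier W \<Longrightarrow> l (id x) = k x"
              using h2 unfolding hom_ext_def by blast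
            have "l (id x) = h x" if "x \<in> carrier K'" for x
              using l(2)[OF short_exactD(4)[OF W(3) that]] k(2)[OF that] W(4)[OF that] by simp
            then show "\<exists>k\<in>mod_hom (op_ring R) P' A. \<forall>x\<in>carrier K'. k (id x) = h x" using l(1) by blast
          qed
        qed
      qed
      then have "Y \<in> ?perp" using pair(1) unfolding cotorsion_pair_def by blast
      then have "Y \<in> \<nu>" using Y(2) unfolding \<nu> by blast
      then have fY: "bal_ext R f L1 L0 Y"
        using tor_acyclic_pure[OF Lm L(3,4,5)] unfolding pure_in_def by blast
      \<comment> \<open>Tor_1(X', L1) = 0, so \<open>X \<otimes> L1\<close> embeds in
        \<open>Y \<otimes> L1\<close>, and from there into \<open>Y \<otimes> L0\<close> by purity
        against Y. Hence f stays injective after tensoring with X.\<close>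
      have aX: "bal_ext R a X Y L1" by (rule perp_bal_ext[OF Y(1) Lm(1) cL[OF L(1)] Xm Ym Y(3)])
      have fX: "bal_ext R f L1 L0 X"
        by (rule bal_ext_restrict[OF short_exactD(1)[OF Y(3)] aX fY short_exactD(1)[OF L(4)]])
      have KP: "bal_ext R id K P L0" by (rule perp_bal_ext[OF X Lm(2) cL[OF L(2)] K Pm exK'])
      have "bal_ext R id K P M"
        by (rule bal_ext_cokernel[OF modules_acted(2)[OF K] modules_acted(2)[OF Pm] modules_acted(2)[OF Xm]
              modules_acted(1)[OF Lm(1)] modules_acted(1)[OF Lm(2)] modules_acted(1)[OF L(3)] exK' L(4) fX KP])
      then show "hom_ext (op_ring R) id K P B"
        using hom_ext_char_iff[OF modulesD(1)[OF L(3)] modulesD(1)[OF B(1)] B(2) short_exactD(1)[OF exK']]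
        by simp
    qed
  qed
  then have "B \<in> \<A>" using pair(1) B(1) unfolding cotorsion_pair_def by blast
  then show "char_in M" using B(2) unfolding char_in_def belongs_def by auto
qed

context
  assumes dual: "\<And>M. M \<in> modules R \<Longrightarrow> char_in M \<Longrightarrow> M \<in> \<L>"
    and pair: "cotorsion_pair (op_ring R) (left_perp (op_ring R) \<A>) \<A>"
      "complete_pair (op_ring R) (left_perp (op_ring R) \<A>) \<A>"
begin

text \<open>Since \<open>\<G>\<close> is closed under epikernels, the first syzygy of an
  \<open>\<L>\<close>-resolution of M stays in \<open>\<G>\<close>. By induction it is in
  \<open>\<L>\<close>, and M becomes the cokernel of a monomorphism in \<open>\<L>\<close>.\<close>

lemma G_resolved_in_L:
  assumes "M \<in> \<G>" "resolved R \<L> n M"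
  shows "M \<in> \<L>"
  using assms
proof (induction n arbitrary: M)
  case (Suc n)
  then obtain K X f g where K: "K \<in> modules R" "X \<in> \<L>" "short_exact R K f X g M" "resolved R \<L> n K" by auto
  have "X \<in> \<G>" using K(2) L_subset_G by blast
  then have "K \<in> \<G>" by (rule closed_epikernelsD[OF epikernels_G K(3) _ Suc.prems(1) K(1)])
  then have KL: "K \<in> \<L>" using Suc.IH K(4) by blast
  show ?case
    by (rule cokernel_in_L[OF dual pair KL K(2) G_modules[OF Suc.prems(1)] K(3) tor_acyclic_G[OF Suc.prems(1)]])
qed simp

text \<open>Finite \<open>\<L>\<close>-dimension is all that is required of n. The first syzygy K of
  an \<open>\<L>\<close>-resolution has \<open>\<G>\<close>-length m by the comparison of syzygies
  in \<open>\<G>\<close>, so the induction on m continues with K, and the case m = 0 is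
  \<open>G_resolved_in_L\<close>.\<close>

lemma resolved_L_of_G:
  assumes "M \<in> modules R" "resolved R \<L> n M" "resolved R \<G> m M"
  shows "resolved R \<L> m M"
  using assms
proof (induction m arbitrary: M n)
  case 0
  then show ?case using G_resolved_in_L by auto
next
  case (Suc m)
  show ?case
  proof (cases n)
    case 0
    then show ?thesis using Suc.prems(2) resolved_le[OF U class_L ext_L] by blast
  next
    case (Suc n')
    then obtain K X f g where K: "K \<in> modules R" "X \<in> \<L>" "short_exact R K f X g M" "resolved R \<L> n' K"
      using Suc.prems(2) by auto
    have "X \<in> \<G>" using K(2) L_subset_G by blast
    then have "resolved R \<G> m K"
      by (rule resolved_syzygy[OF U class_G ext_GF epikernels_G gen_G K(1) _ Suc.prems(1) K(3) Suc.prems(3)])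
    then have "resolved R \<L> m K" using Suc.IH K(1,4) by blast
    then show ?thesis using K(1-3) by auto
  qed
qed

end

end

end

theorem proposition4p14:
  fixes R :: "'u ring" and \<L> \<A> \<nu> :: "('u, 'u) module set"
  assumes "universe TYPE('u)"
    and "ring R" and "small (carrier R)"
    and "module_class R \<L>" and "module_class (op_ring R) \<A>"
    and "\<nu> = left_perp (op_ring R) \<A> \<inter> \<A>"
    and "relative_generator R \<L>" and "closed_extensions R \<L>"
    and "closed_epikernels R \<L> \<or> (\<forall>L\<in>\<L>. belongs (op_ring R) (char_module R L) \<A>)"
    and "closed_extensions R (GF R \<L> \<nu>)"
  shows "findim R (GF R \<L> \<nu>) \<le> findim R \<L> \<and>
    (product_closed_duality_pair R \<L> \<A> \<and> bicomplete_duality_pair R \<L> \<A> \<longrightarrow>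
      findim R (GF R \<L> \<nu>) = findim R \<L>)"
proof -
  interpret gorenstein_classes R \<L> \<A> \<nu> by (rule gorenstein_classes.intro) (fact assms)+
  have le: "findim R \<G> \<le> findim R \<L>"
  proof (rule findim_le_findim[OF class_G class_L])
    fix M n assume M: "M \<in> modules R" "resolved R \<G> n M"
    show "n = 0 \<or> (\<exists>Q\<in>modules R. (\<exists>m. resolved R \<L> m Q) \<and> (\<forall>k. resolved R \<L> k Q \<longrightarrow> resolved R \<G> k M))"
    proof (cases n)
      case (Suc k)
      then show ?thesis
        using assms(9) approximation_epikernels[OF _ M(1), of k] approximation_char[OF _ M(1), of k] M(2) by blast
    qed simp
  qed
  moreover have "findim R \<L> \<le> findim R \<G>" if "bicomplete_duality_pair R \<L> \<A>"
  proof -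
    have dp: "duality_pair R \<L> \<A>"
      using that unfolding bicomplete_duality_pair_def complete_duality_pair_def symmetric_duality_pair_def by blast
    have char: "\<forall>L\<in>\<L>. belongs (op_ring R) (char_module R L) \<A>"
      using dp L_modules unfolding duality_pair_def by blast
    have dual: "\<And>M. M \<in> modules R \<Longrightarrow> char_in M \<Longrightarrow> M \<in> \<L>"
      using dp unfolding duality_pair_def char_in_def by blast
    have pair: "cotorsion_pair (op_ring R) (left_perp (op_ring R) \<A>) \<A>"
      "complete_pair (op_ring R) (left_perp (op_ring R) \<A>) \<A>"
      using that unfolding bicomplete_duality_pair_def by auto
    show ?thesis
    proof (rule findim_le_findim[OF class_L class_G])
      fix M n assume M: "M \<in> modules R" "resolved R \<L> n M"
      \<comment> \<open>M serves as its own Q: on modules of finite \<open>\<L>\<close>-dimension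
        the two dimensions agree.\<close>
      have "resolved R \<G> n M" using M(2) L_subset_G by (rule resolved_mono)
      moreover have "\<forall>k. resolved R \<G> k M \<longrightarrow> resolved R \<L> k M"
        using resolved_L_of_G[OF char dual pair M] by blast
      ultimately show "n = 0 \<or> (\<exists>Q\<in>modules R. (\<exists>m. resolved R \<G> m Q) \<and> (\<forall>k. resolved R \<G> k Q \<longrightarrow> resolved R \<L> k M))"
        using M(1) by blast
    qed
  qed
  ultimately show ?thesis by (auto intro: antisym)
qed

end
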